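(* Let $S$ be a simplicial $d$-sphere ($d\ge3$). Then the following are equivalent: 1. $S$ is LC (locally constructible); 2. for some spanning tree $T$ of the dual graph of $S$, $K^T$ collapses onto some $(d-2)$-dimensional (contractible) complex $C$; 3. there exists a $(d-2)$-dimensional (contractible) complex $C$ such that for every facet $\Delta$ of $S$, $S-\Delta\searrow C$; 4. for some facet $\Delta$ of $S$, $S-\Delta$ collapses onto a $(d-2)$-dimensional contractible complex $C$.
   Context: All complexes are finite. A simplicial $d$-sphere is a simplicial complex whose underlying space is homeomorphic to the $d$-sphere; facets are its $d$-faces. For a facet $\Delta$, $S-\Delta$ is the complex obtained by deleting only the face $\Delta$ (keeping its proper faces). The dual graph of $S$ has the facets as nodes, two nodes joined by an arc iff the facets share a $(d-1)$-face. For a spanning tree $T$ of the dual graph, $K^T$ is the subcomplex of $S$ formed by all $(d-1)$-faces of $S$ (with their faces) that are not intersected by $T$, i.e. that do not correspond to arcs of $T$. The parenthetical "(contractible)" indicates that contractibility of $C$ is automatic there, since $K^T$ and $S-\Delta$ are contractible and collapses preserve the homotopy type. Collapse: an elementary collapse removes from a complex a pair of faces $(\sigma,\Sigma)$ with $\dim\Sigma=\dim\sigma+1$, $\sigma$ a proper face of $\Sigma$ and of no other face. $C\searrow D$ ($C$ collapses onto $D$) if $D$ is obtained from $C$ by a finite sequence of elementary collapses. LC: A regular CW complex is simplicial if every lower interval $[0,F]$ in its face poset is boolean. A $d$-pseudomanifold is a finite, pure $d$-dimensional, simplicial regular CW complex in which each $(d-1)$-cell belongs to at most two $d$-cells; its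 boundary is the smallest subcomplex containing all $(d-1)$-cells that lie in exactly one $d$-cell. For $d\ge2$, a local construction for a pure $d$-dimensional simplicial complex $C$ with $N$ facets is a sequence $T_1,\dots,T_N,\dots,T_k$ ($k\ge N$) of $d$-pseudomanifolds such that: (1) $T_1$ is a $d$-simplex; (2) for $i\le N-1$, $T_{i+1}$ is obtained from $T_i$ by gluing a new $d$-simplex to $T_i$ along one of the $(d-1)$-cells of $\partial T_i$; (3) for $i\ge N$, $T_{i+1}$ is obtained from $T_i$ by identifying a pair of $(d-1)$-cells $\sigma,\tau$ in $\partial T_i$ whose intersection contains a $(d-2)$-cell $F$ (the identification being the simplicial one that fixes $F$ pointwise); (4) $T_k=C$. $C$ is LC if a local construction for $C$ exists. *)

theory Defs
  imports "HOL-Analysis.Analysis"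
begin

section \<open>Simplicial spheres, dual graphs and collapses\<close>

text \<open>
  Complexes are geometric simplicial complexes in the sense of \<^const>\<open>simplicial_complex\<close>. These
  are finite and contain the empty set as a face of dimension -1.
\<close>

definition simplicial_sphere :: "nat \<Rightarrow> 'a::euclidean_space set set \<Rightarrow> bool" where
  "simplicial_sphere d S \<longleftrightarrow>
     simplicial_complex S \<and> top_of_set (\<Union>S) homeomorphic_space nsphere d"

definition faces_of_dim :: "'a::euclidean_space set set \<Rightarrow> int \<Rightarrow> 'a set set" where
  "faces_of_dim S n = {F \<in> S. aff_dim F = n}"

definition has_dim :: "'a::euclidean_space set set \<Rightarrow> int \<Rightarrow> bool" where
  "has_dim C n \<longleftrightarrow> (\<exists>F\<in>C. aff_dim F = n) \<and> (\<forall>F\<in>C. aff_dim F \<le> n)"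

abbreviation facets :: "nat \<Rightarrow> 'a::euclidean_space set set \<Rightarrow> 'a set set" where
  "facets d S \<equiv> faces_of_dim S (int d)"

definition dual_arcs :: "nat \<Rightarrow> 'a::euclidean_space set set \<Rightarrow> 'a set set set" where
  "dual_arcs d S = {{A, B} |A B. A \<in> facets d S \<and> B \<in> facets d S \<and> A \<noteq> B \<and>
     (\<exists>G\<in>faces_of_dim S (int d - 1). G face_of A \<and> G face_of B)}"

text \<open>A finite simple graph is given by its node set and its set of two-element arcs.\<close>

definition spanning_tree :: "'v set \<Rightarrow> 'v set set \<Rightarrow> 'v set set \<Rightarrow> bool" where
  "spanning_tree V E T \<longleftrightarrow>
     T \<subseteq> E \<and>
     (\<forall>u\<in>V. \<forall>v\<in>V. (u, v) \<in> {(x, y). {x, y} \<in> T}\<^sup>*) \<and>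
     \<not> (\<exists>p. length p \<ge> 3 \<and> distinct p \<and>
           (\<forall>i<length p. {p ! i, p ! (Suc i mod length p)} \<in> T))"

text \<open>The complex $K^T$.\<close>

definition cotree_complex :: "nat \<Rightarrow> 'a::euclidean_space set set \<Rightarrow> 'a set set set \<Rightarrow> 'a set set" where
  "cotree_complex d S T =
     {F \<in> S. \<exists>G\<in>faces_of_dim S (int d - 1). F face_of G \<and>
        \<not> (\<exists>A B. {A, B} \<in> T \<and> G face_of A \<and> G face_of B)}"

text \<open>The empty face is never removed: in the literature it does not count as a face here.\<close>

definition elementary_collapse :: "'a::euclidean_space set set \<Rightarrow> 'a set set \<Rightarrow> bool" where
  "elementary_collapse C D \<longleftrightarrow>
     (\<exists>\<sigma>\<in>C. \<exists>\<Sigma>\<in>C. \<sigma> \<noteq> {} \<and> aff_dim \<Sigma> = aff_dim \<sigma> + 1 \<and>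
        \<sigma> face_of \<Sigma> \<and> \<sigma> \<noteq> \<Sigma> \<and>
        (\<forall>G\<in>C. \<sigma> face_of G \<and> G \<noteq> \<sigma> \<longrightarrow> G = \<Sigma>) \<and>
        D = C - {\<sigma>, \<Sigma>})"

definition collapses_onto :: "'a::euclidean_space set set \<Rightarrow> 'a set set \<Rightarrow> bool" where
  "collapses_onto = elementary_collapse\<^sup>*\<^sup>*"

section \<open>Simplicial regular CW complexes and local constructions\<close>

text \<open>
  A finite regular CW complex is a Hausdorff space with a finite set of closed cells (nonempty, each
  homeomorphic to a closed ball) such that the interiors of the cells partition the space and the
  boundary of every cell is a union of cells (this is the definition of a regular cell complex in
  Bjorner, Las Vergnas, Sturmfels, White, Ziegler, Oriented Matroids, Section 4.7). Its face poset is
  the set of closed cells ordered by inclusion, with \<^term>\<open>{}\<close> added as bottom element.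
\<close>

type_synonym 'p cell_complex = "'p topology \<times> 'p set set"

definition disk :: "nat \<Rightarrow> (nat \<Rightarrow> real) topology" where
  "disk n = subtopology (Euclidean_space n) {x. (\<Sum>i<n. x i ^ 2) \<le> 1}"

text \<open>\<open>is_cell X n c B\<close>: \<open>c\<close> is a closed \<open>n\<close>-ball in \<open>X\<close> with boundary sphere \<open>B\<close> (empty if \<open>n = 0\<close>).\<close>

definition is_cell :: "'p topology \<Rightarrow> nat \<Rightarrow> 'p set \<Rightarrow> 'p set \<Rightarrow> bool" where
  "is_cell X n c B \<longleftrightarrow>
     c \<subseteq> topspace X \<and>
     (\<exists>f. homeomorphic_map (disk n) (subtopology X c) f \<and>
          B = f ` {x \<in> topspace (disk n). (\<Sum>i<n. x i ^ 2) = 1})"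

definition regular_CW_complex :: "'p cell_complex \<Rightarrow> bool" where
  "regular_CW_complex = (\<lambda>(X, K).
     Hausdorff_space X \<and> finite K \<and>
     (\<exists>bd. (\<forall>c\<in>K. (\<exists>n. is_cell X n c (bd c)) \<and> (\<exists>L\<subseteq>K. bd c = \<Union>L)) \<and>
           (\<Union>c\<in>K. c - bd c) = topspace X \<and>
           (\<forall>c\<in>K. \<forall>c'\<in>K. c \<noteq> c' \<longrightarrow> (c - bd c) \<inter> (c' - bd c') = {})))"

definition n_cells :: "'p cell_complex \<Rightarrow> nat \<Rightarrow> 'p set set" where
  "n_cells = (\<lambda>(X, K) n. {c \<in> K. \<exists>B. is_cell X n c B})"

definition boolean_poset :: "'p set set \<Rightarrow> bool" where
  "boolean_poset P \<longleftrightarrow>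
     (\<exists>(A :: nat set) \<phi>. finite A \<and> bij_betw \<phi> (Pow A) P \<and>
        (\<forall>B\<in>Pow A. \<forall>C\<in>Pow A. \<phi> B \<subseteq> \<phi> C \<longleftrightarrow> B \<subseteq> C))"

definition simplicial_CW_complex :: "'p cell_complex \<Rightarrow> bool" where
  "simplicial_CW_complex = (\<lambda>(X, K).
     regular_CW_complex (X, K) \<and> (\<forall>F\<in>K. boolean_poset {c \<in> insert {} K. c \<subseteq> F}))"

definition pseudomanifold :: "nat \<Rightarrow> 'p cell_complex \<Rightarrow> bool" where
  "pseudomanifold d = (\<lambda>(X, K).
     simplicial_CW_complex (X, K) \<and>
     K \<noteq> {} \<and> (\<forall>c\<in>K. \<exists>D\<in>n_cells (X, K) d. c \<subseteq> D) \<and>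
     (\<forall>\<sigma>\<in>n_cells (X, K) (d - 1). card {D \<in> n_cells (X, K) d. \<sigma> \<subseteq> D} \<le> 2))"

definition pm_boundary :: "nat \<Rightarrow> 'p cell_complex \<Rightarrow> 'p set set" where
  "pm_boundary d = (\<lambda>(X, K).
     {c \<in> K. \<exists>\<sigma>\<in>n_cells (X, K) (d - 1).
        card {D \<in> n_cells (X, K) d. \<sigma> \<subseteq> D} = 1 \<and> c \<subseteq> \<sigma>})"

text \<open>
  A simplicial CW complex all of whose cells are faces of one \<open>d\<close>-cell \<open>D\<close> is a \<open>d\<close>-simplex: the
  lower interval of \<open>D\<close> is then the boolean lattice of rank \<open>d + 1\<close>.
\<close>

definition is_single_simplex :: "nat \<Rightarrow> 'p cell_complex \<Rightarrow> bool" where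
  "is_single_simplex d = (\<lambda>(X, K).
     simplicial_CW_complex (X, K) \<and> (\<exists>D\<in>n_cells (X, K) d. \<forall>c\<in>K. c \<subseteq> D))"

text \<open>
  \<open>glue_simplex d T T'\<close>: the complex \<open>T\<close> is a subcomplex of \<open>T'\<close>, and \<open>T'\<close> consists of \<open>T\<close> and one
  further \<open>d\<close>-simplex \<open>D\<close> with its faces, which meets the space of \<open>T\<close> exactly in a boundary
  \<open>(d - 1)\<close>-cell. As all spaces involved are compact Hausdorff, this determines the topology of \<open>T'\<close>.
\<close>

definition glue_simplex :: "nat \<Rightarrow> 'p cell_complex \<Rightarrow> 'p cell_complex \<Rightarrow> bool" where
  "glue_simplex d = (\<lambda>(X, K) (Y, L).
     K \<subseteq> L \<and> topspace X \<subseteq> topspace Y \<and> X = subtopology Y (topspace X) \<and>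
     (\<exists>\<sigma>\<in>n_cells (X, K) (d - 1) \<inter> pm_boundary d (X, K). \<exists>D\<in>n_cells (Y, L) d.
        D \<notin> K \<and> L = K \<union> {c \<in> L. c \<subseteq> D} \<and> D \<inter> topspace X = \<sigma>))"

text \<open>
  \<open>identify_facets d T T'\<close>: \<open>T'\<close> is the quotient of \<open>T\<close> by a homeomorphism \<open>h\<close> between two boundary
  \<open>(d - 1)\<close>-cells \<open>\<sigma>\<close> and \<open>\<tau>\<close> sharing a \<open>(d - 2)\<close>-cell \<open>F\<close>, where \<open>h\<close> maps faces to faces and
  fixes \<open>F\<close> pointwise. A cell of \<open>\<sigma> \<inter> \<tau>\<close> is spanned by vertices of \<open>F\<close> and possibly the vertex
  opposite to \<open>F\<close>, when \<open>\<sigma>\<close> and \<open>\<tau>\<close> share it; a simplicial \<open>h\<close> fixing \<open>F\<close> fixes all of these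
  vertices, hence all of \<open>\<sigma> \<inter> \<tau>\<close> pointwise. The cells carry no linear structure here, so this is
  stated for \<open>\<sigma> \<inter> \<tau>\<close>.
\<close>

definition identify_facets :: "nat \<Rightarrow> 'p cell_complex \<Rightarrow> 'p cell_complex \<Rightarrow> bool" where
  "identify_facets d = (\<lambda>(X, K) (Y, L).
     (\<exists>\<sigma>\<in>n_cells (X, K) (d - 1) \<inter> pm_boundary d (X, K).
      \<exists>\<tau>\<in>n_cells (X, K) (d - 1) \<inter> pm_boundary d (X, K).
      \<exists>F\<in>n_cells (X, K) (d - 2). \<exists>h q.
        \<sigma> \<noteq> \<tau> \<and> F \<subseteq> \<sigma> \<inter> \<tau> \<and>
        homeomorphic_map (subtopology X \<sigma>) (subtopology X \<tau>) h \<and>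
        (\<lambda>c. h ` c) ` {c \<in> K. c \<subseteq> \<sigma>} = {c \<in> K. c \<subseteq> \<tau>} \<and>
        (\<forall>x\<in>\<sigma> \<inter> \<tau>. h x = x) \<and>
        quotient_map X Y q \<and>
        (\<forall>x\<in>topspace X. \<forall>y\<in>topspace X.
           q x = q y \<longleftrightarrow> x = y \<or> (x \<in> \<sigma> \<and> y = h x) \<or> (y \<in> \<sigma> \<and> x = h y)) \<and>
        L = (\<lambda>c. q ` c) ` K))"

text \<open>
  The sequence \<open>T 1, ..., T N, ..., T k\<close> ends literally in the simplicial complex \<open>C\<close>, regarded as
  a CW complex. The spaces of the other \<open>T i\<close> use elements of the type \<^typ>\<open>'a\<close> merely as names of
  points, with an arbitrary topology: this is no restriction, since for \<open>d > 0\<close> the points of any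
  finite CW complex can be renamed to elements of a set of the cardinality of the continuum.
  The notion is meant for \<open>d \<ge> 2\<close>.
\<close>

definition LC :: "nat \<Rightarrow> 'a::euclidean_space set set \<Rightarrow> bool" where
  "LC d C \<longleftrightarrow>
     (\<exists>(T :: nat \<Rightarrow> 'a cell_complex) k. let N = card (facets d C) in
        1 \<le> N \<and> N \<le> k \<and>
        (\<forall>i\<in>{1..k}. pseudomanifold d (T i)) \<and>
        is_single_simplex d (T 1) \<and>
        (\<forall>i\<in>{1..<N}. glue_simplex d (T i) (T (Suc i))) \<and>
        (\<forall>i\<in>{N..<k}. identify_facets d (T i) (T (Suc i))) \<and>
        T k = (top_of_set (\<Union>C), C - {{}}))"

end

theory Submission
  imports Defs "HOL-Homology.Homology"
begin

text \<open>
  Let \<open>\<Delta>\<close> be a facet. Collapsing \<open>S - \<Delta>\<close> through all facets amounts to choosing a spanning tree \<open>T\<close>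
  of the dual graph rooted at \<open>\<Delta>\<close>, and what remains is \<open>K\<^sup>T\<close>; collapses can be sorted by dimension.
  This gives the equivalence of the last three conditions, as \<open>S - \<Delta>\<close> is contractible.

  In a local construction, the gluings of the first phase form such a tree. A ridge of \<open>K\<^sup>T\<close> comes from
  a pair of boundary ridges that are identified along a shared \<open>(d - 2)\<close>-cell \<open>F\<close>. Every
  \<open>(d - 2)\<close>-cell lies in at most two boundary ridges, an invariant of all steps, so \<open>F\<close> becomes interior
  and is in no ridge identified later. Hence the ridges of \<open>K\<^sup>T\<close> collapse away from the faces \<open>F\<close> in
  the order of the identifications.

  Conversely, for a set \<open>E\<close> of ridges let \<open>T\<^sub>E\<close> be obtained from the disjoint union of all facets by
  gluing along the ridges in \<open>E\<close>. Starting with the tree and adding the other ridges \<open>\<rho>\<close> in the order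
  in which they collapse gives a local construction: all ridges around the free face \<open>F\<close> of \<open>\<rho>\<close> other
  than \<open>\<rho>\<close> have been glued already, so the two copies of \<open>\<rho>\<close> share \<open>F\<close>. If \<open>E\<close> contains all ridges then
  \<open>T\<^sub>E = S\<close>, because the facets around each point of a sphere are connected through ridges.
\<close>

section \<open>Simplicial complexes and collapses\<close>

text \<open>The definition of LC speaks of regular CW complexes whose cells are bare topological
  balls, so the combinatorics of a construction step has to be recovered from topology. Invariance
  of domain makes dimension and boundary of a cell well defined, ties the dimension to the rank in
  the boolean intervals, and shows that an identification maps the faces of each cell bijectively.
  In the converse direction the intermediate complexes have to be realised by points named in
  \<open>'a\<close> such that the last one is literally \<open>S\<close>. The points of a glued
  complex over \<open>x\<close> are the classes of facets at \<open>x\<close> linked by ridges glued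
  so far; they are named by translates of \<open>x\<close>.

  The connection of the facets at a point cannot be obtained by induction over links, because the
  sphere need not be piecewise linear and links of faces need not be spheres. It is proved by an
  obstruction argument: a field of directions on a small sphere would extend over the ball, contrary
  to Brouwer's theorem. Sorting of collapses rests on the remark that a collapse in lower dimension
  never frees a face for a collapse in higher dimension.\<close>

lemma simplex_faces_boolean:
  fixes D :: "'a::euclidean_space set"
  assumes "n simplex D"
  obtains C where "finite C" "int (card C) = n + 1"
    "bij_betw (\<lambda>A. convex hull A) (Pow C) {F. F face_of D}"
    "\<And>A B. \<lbrakk>A \<subseteq> C; B \<subseteq> C\<rbrakk> \<Longrightarrow> convex hull A \<subseteq> convex hull B \<longleftrightarrow> A \<subseteq> B"
    "\<And>A. A \<subseteq> C \<Longrightarrow> aff_dim (convex hull A) = int (card A) - 1"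
proof -
  obtain C where C: "finite C" "\<not> affine_dependent C" "int (card C) = n + 1" "D = convex hull C"
    using assms unfolding simplex by blast
  have sub: "A \<subseteq> B" if "A \<subseteq> C" "B \<subseteq> C" "convex hull A \<subseteq> convex hull B" for A B
  proof
    fix x assume "x \<in> A"
    then have "x \<in> affine hull B"
      using that convex_hull_subset_affine_hull hull_inc by fastforce
    show "x \<in> B"
    proof (rule ccontr)
      assume "x \<notin> B"
      then have "B \<subseteq> C - {x}" using that by auto
      then have "x \<in> affine hull (C - {x})"
        using \<open>x \<in> affine hull B\<close> hull_mono by blast
      then show False
        using C(2) \<open>x \<in> A\<close> that(1) unfolding affine_dependent_def by blast
    qed
  qed
  show thesis
  proof
    show "finite C" "int (card C) = n + 1" using C by auto
    have "inj_on (\<lambda>A. convex hull A) (Pow C)"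
      by (rule inj_onI) (metis PowD sub subset_antisym order_refl)
    moreover have "(\<lambda>A. convex hull A) ` Pow C = {F. F face_of D}"
      using face_of_convex_hull_affine_independent [OF C(2)] C(4) by auto
    ultimately show "bij_betw (\<lambda>A. convex hull A) (Pow C) {F. F face_of D}"
      by (simp add: bij_betw_def)
    show "convex hull A \<subseteq> convex hull B \<longleftrightarrow> A \<subseteq> B" if "A \<subseteq> C" "B \<subseteq> C" for A B
      using sub [OF that] hull_mono by blast
    show "aff_dim (convex hull A) = int (card A) - 1" if "A \<subseteq> C" for A
    proof -
      have "\<not> affine_dependent A" using C(2) affine_dependent_subset that by blast
      then show ?thesis
        by (simp add: aff_dim_convex_hull aff_dim_affine_independent)
    qed
  qed
qed

locale simpl_complex =
  fixes S :: "'a::euclidean_space set set"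
  assumes sc: "simplicial_complex S"
begin

lemma fin: "finite S"
  using sc by (simp add: simplicial_complex_def)

lemma simplexS: "F \<in> S \<Longrightarrow> \<exists>n. n simplex F"
  using sc by (simp add: simplicial_complex_def)

lemma face_in: "\<lbrakk>G \<in> S; F face_of G\<rbrakk> \<Longrightarrow> F \<in> S"
  using sc unfolding simplicial_complex_def by blast

lemma inter_face: "\<lbrakk>F \<in> S; G \<in> S\<rbrakk> \<Longrightarrow> F \<inter> G face_of F"
  using sc unfolding simplicial_complex_def by blast

lemma inter_in: "\<lbrakk>F \<in> S; G \<in> S\<rbrakk> \<Longrightarrow> F \<inter> G \<in> S"
  using inter_face face_in by blast

lemma face_iff: "\<lbrakk>F \<in> S; G \<in> S\<rbrakk> \<Longrightarrow> F face_of G \<longleftrightarrow> F \<subseteq> G"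
  by (metis inf.absorb_iff2 inter_face face_of_imp_subset)

lemma convexS: "F \<in> S \<Longrightarrow> convex F"
  using simplexS convex_simplex by blast

lemma compactS: "F \<in> S \<Longrightarrow> compact F"
  using simplexS compact_simplex by blast

lemma polytopeS: "F \<in> S \<Longrightarrow> polytope F"
  using simplexS simplex_imp_polytope by blast

lemma dim_less: "\<lbrakk>F \<in> S; G \<in> S; F \<subset> G\<rbrakk> \<Longrightarrow> aff_dim F < aff_dim G"
  by (simp add: convexS face_iff face_of_aff_dim_lt psubset_imp_subset psubset_eq)

lemma dim_eq: "\<lbrakk>F \<in> S; G \<in> S; F \<subseteq> G; aff_dim F = aff_dim G\<rbrakk> \<Longrightarrow> F = G"
  using dim_less by fastforce

lemma dim_mono: "F \<subseteq> G \<Longrightarrow> aff_dim F \<le> aff_dim (G::'a set)"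
  by (rule aff_dim_subset)

lemma face_below:
  assumes "F \<in> S" "D \<in> S" "F \<subset> D"
  obtains G where "G \<in> S" "F \<subseteq> G" "G \<subseteq> D" "aff_dim G = aff_dim D - 1"
proof -
  obtain n where "n simplex D" using simplexS[OF assms(2)] by blast
  obtain C where C: "finite C" "int (card C) = n + 1"
    "bij_betw (\<lambda>A. convex hull A) (Pow C) {F. F face_of D}"
    "\<And>A B. \<lbrakk>A \<subseteq> C; B \<subseteq> C\<rbrakk> \<Longrightarrow> convex hull A \<subseteq> convex hull B \<longleftrightarrow> A \<subseteq> B"
    "\<And>A. A \<subseteq> C \<Longrightarrow> aff_dim (convex hull A) = int (card A) - 1"
    by (rule simplex_faces_boolean[OF \<open>n simplex D\<close>]) (rule that)
  have "F \<in> (\<lambda>A. convex hull A) ` Pow C" "D \<in> (\<lambda>A. convex hull A) ` Pow C"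
    using C(3) assms face_iff [of F D] face_of_refl [OF convexS] by (auto simp: bij_betw_def)
  then obtain A B where A: "A \<subseteq> C" "F = convex hull A" and B: "B \<subseteq> C" "D = convex hull B" by auto
  then have "A \<subset> B" using assms C(4) [of A B] by auto
  then obtain x where x: "x \<in> B - A" by auto
  let ?G = "convex hull (B - {x})"
  have sub: "B - {x} \<subseteq> C" using B by auto
  have "finite B" using B C(1) finite_subset by blast
  show thesis
  proof
    have "?G face_of D" using C(3) sub by (auto simp: bij_betw_def)
    then show "?G \<in> S" "?G \<subseteq> D" using face_in face_of_imp_subset assms by blast+
    show "F \<subseteq> ?G" using A(2) x \<open>A \<subset> B\<close> by (auto intro!: hull_mono)
    have "card B = Suc (card (B - {x}))"
      using x \<open>finite B\<close> card.remove[of B x] by simp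
    then show "aff_dim ?G = aff_dim D - 1"
      using C(5)[OF sub] C(5)[OF B(1)] B(2) by simp
  qed
qed

text \<open>\<open>D\<close> has two vertices that \<open>F\<close> lacks, and a face in between
  arises by adding one of them to \<open>F\<close>. This makes facets and ridges alternate in cycles
  around a face of codimension two.\<close>

lemma diamond:
  assumes "F \<in> S" "D \<in> S" "F \<subseteq> D" "aff_dim D = aff_dim F + 2"
  shows "card {G \<in> S. F \<subseteq> G \<and> G \<subseteq> D \<and> aff_dim G = aff_dim F + 1} = 2"
proof -
  obtain n where "n simplex D" using simplexS[OF assms(2)] by blast
  obtain C where C: "finite C" "int (card C) = n + 1"
    "bij_betw (\<lambda>A. convex hull A) (Pow C) {F. F face_of D}"
    "\<And>A B. \<lbrakk>A \<subseteq> C; B \<subseteq> C\<rbrakk> \<Longrightarrow> convex hull A \<subseteq> convex hull B \<longleftrightarrow> A \<subseteq> B"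
    "\<And>A. A \<subseteq> C \<Longrightarrow> aff_dim (convex hull A) = int (card A) - 1"
    by (rule simplex_faces_boolean[OF \<open>n simplex D\<close>]) (rule that)
  have face: "G \<in> S \<and> G \<subseteq> D \<longleftrightarrow> G \<in> (\<lambda>A. convex hull A) ` Pow C" for G
    using C(3) assms face_iff [of G D] face_in [of D G] face_of_imp_subset [of G D]
    by (auto simp: bij_betw_def)
  then have "F \<in> (\<lambda>A. convex hull A) ` Pow C" "D \<in> (\<lambda>A. convex hull A) ` Pow C"
    using assms by auto
  then obtain A B where A: "A \<subseteq> C" "F = convex hull A" and B: "B \<subseteq> C" "D = convex hull B" by auto
  have finAB: "finite A" "finite B" using A B C(1) finite_subset by auto
  have "A \<subseteq> B" using assms C(4) [of A B] A B by auto
  have "int (card B) = int (card A) + 2" using assms(4) A B C(5) by auto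
  then have "card (B - A) = 2"
    using \<open>A \<subseteq> B\<close> finAB card_Diff_subset by fastforce
  have "{G \<in> S. F \<subseteq> G \<and> G \<subseteq> D \<and> aff_dim G = aff_dim F + 1} = (\<lambda>x. convex hull (insert x A)) ` (B - A)"
    (is "?L = ?R")
  proof
    show "?R \<subseteq> ?L"
    proof clarify
      fix x assume x: "x \<in> B" "x \<notin> A"
      then have sub: "insert x A \<subseteq> C" using A B by auto
      have "convex hull (insert x A) \<in> S" using face sub by blast
      moreover have "F \<subseteq> convex hull (insert x A)"
        unfolding A by (intro hull_mono subset_insertI)
      moreover have "convex hull (insert x A) \<subseteq> D" using B x \<open>A \<subseteq> B\<close> by (auto intro!: hull_mono)
      moreover have "aff_dim (convex hull (insert x A)) = aff_dim F + 1"
        using C(5)[OF sub] C(5)[OF A(1)] A(2) x finAB by simp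
      ultimately show "convex hull (insert x A) \<in> S \<and> F \<subseteq> convex hull (insert x A) \<and>
          convex hull (insert x A) \<subseteq> D \<and> aff_dim (convex hull (insert x A)) = aff_dim F + 1" by blast
    qed
    show "?L \<subseteq> ?R"
    proof clarify
      fix G assume G: "G \<in> S" "F \<subseteq> G" "G \<subseteq> D" "aff_dim G = aff_dim F + 1"
      then obtain E where E: "E \<subseteq> C" "G = convex hull E" using face[of G] by blast
      have "A \<subseteq> E" using G A E C(4) by auto
      moreover have "E \<subseteq> B" using G B E C(4) by auto
      moreover have "finite E" using E C(1) finite_subset by blast
      moreover have "int (card E) = int (card A) + 1" using G(4) A E C(5) by auto
      ultimately have "card (E - A) = 1" by (simp add: card_Diff_subset finAB)
      then obtain x where "E - A = {x}" by (auto simp: card_1_singleton_iff)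
      then have "E = insert x A" "x \<in> B - A" using \<open>A \<subseteq> E\<close> \<open>E \<subseteq> B\<close> by auto
      then show "G \<in> ?R" using E by blast
    qed
  qed
  moreover have "inj_on (\<lambda>x. convex hull (insert x A)) (B - A)"
  proof (rule inj_onI)
    fix x y assume xy: "x \<in> B - A" "y \<in> B - A" "convex hull (insert x A) = convex hull (insert y A)"
    then have "insert x A = insert y A"
      using C(4)[of "insert x A" "insert y A"] C(4)[of "insert y A" "insert x A"] A B by auto
    then show "x = y" using xy by auto
  qed
  ultimately show ?thesis using \<open>card (B - A) = 2\<close> by (simp add: card_image)
qed

end

text \<open>An elementary collapse with the dimension of the larger face recorded, so that collapses
  can be sorted by it. Inside a simplicial complex \<open>face_of\<close> is inclusion, which gives
  the simpler form used here.\<close>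

definition collapse_dim :: "int \<Rightarrow> 'a::euclidean_space set set \<Rightarrow> 'a set set \<Rightarrow> bool" where
  "collapse_dim k C D \<longleftrightarrow>
     (\<exists>\<sigma>\<in>C. \<exists>\<Sigma>\<in>C. \<sigma> \<noteq> {} \<and> aff_dim \<Sigma> = k \<and> aff_dim \<sigma> = k - 1 \<and> \<sigma> \<subseteq> \<Sigma> \<and>
        (\<forall>G\<in>C. \<sigma> \<subseteq> G \<longrightarrow> G = \<sigma> \<or> G = \<Sigma>) \<and> D = C - {\<sigma>, \<Sigma>})"

lemma collapse_dimI:
  assumes "\<sigma> \<in> C" "\<Sigma> \<in> C" "\<sigma> \<noteq> {}" "aff_dim \<Sigma> = k" "aff_dim \<sigma> = k - 1" "\<sigma> \<subseteq> \<Sigma>"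
    "\<And>G. \<lbrakk>G \<in> C; \<sigma> \<subseteq> G\<rbrakk> \<Longrightarrow> G = \<sigma> \<or> G = \<Sigma>" "D = C - {\<sigma>, \<Sigma>}"
  shows "collapse_dim k C D"
  using assms unfolding collapse_dim_def by blast

definition collapse_below :: "int \<Rightarrow> 'a::euclidean_space set set \<Rightarrow> 'a set set \<Rightarrow> bool" where
  "collapse_below k C D \<longleftrightarrow> (\<exists>j<k. collapse_dim j C D)"

lemma collapse_dim_subset: "collapse_dim k C D \<Longrightarrow> D \<subseteq> C"
  by (auto simp: collapse_dim_def)

lemma collapse_dim_sub_faces:
  "\<lbrakk>collapse_dim k C D; F \<in> C; aff_dim F > k\<rbrakk> \<Longrightarrow> F \<in> D"
  by (auto simp: collapse_dim_def)

lemma collapse_below_faces: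
  assumes "(collapse_below k)\<^sup>*\<^sup>* C D" "F \<in> C" "aff_dim F \<ge> k" shows "F \<in> D"
  using assms
proof (induction rule: rtranclp_induct)
  case (step y z)
  then show ?case unfolding collapse_below_def using collapse_dim_sub_faces by force
qed auto

context simpl_complex
begin

lemma elementary_collapse_iff:
  assumes "C \<subseteq> S"
  shows "elementary_collapse C D \<longleftrightarrow> (\<exists>k. collapse_dim k C D)"
proof
  assume "elementary_collapse C D"
  then obtain \<sigma> \<Sigma> where "\<sigma> \<in> C" "\<Sigma> \<in> C" "\<sigma> \<noteq> {}" "aff_dim \<Sigma> = aff_dim \<sigma> + 1" "\<sigma> face_of \<Sigma>"
    "\<And>G. \<lbrakk>G \<in> C; \<sigma> face_of G; G \<noteq> \<sigma>\<rbrakk> \<Longrightarrow> G = \<Sigma>" "D = C - {\<sigma>, \<Sigma>}"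
    unfolding elementary_collapse_def by blast
  then have "collapse_dim (aff_dim \<Sigma>) C D"
    unfolding collapse_dim_def using assms face_iff face_of_imp_subset
    by (smt (verit, best) subset_iff)
  then show "\<exists>k. collapse_dim k C D" by blast
next
  assume "\<exists>k. collapse_dim k C D"
  then obtain k \<sigma> \<Sigma> where 0: "\<sigma> \<in> C" "\<Sigma> \<in> C" "\<sigma> \<noteq> {}" "aff_dim \<Sigma> = k" "aff_dim \<sigma> = k - 1" "\<sigma> \<subseteq> \<Sigma>"
    "\<And>G. \<lbrakk>G \<in> C; \<sigma> \<subseteq> G\<rbrakk> \<Longrightarrow> G = \<sigma> \<or> G = \<Sigma>" "D = C - {\<sigma>, \<Sigma>}"
    unfolding collapse_dim_def by blast
  have "\<sigma> face_of \<Sigma>" using 0(1,2,6) face_iff assms by blast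
  moreover have "\<sigma> \<noteq> \<Sigma>" using 0(4,5) by auto
  moreover have "\<forall>G\<in>C. \<sigma> face_of G \<and> G \<noteq> \<sigma> \<longrightarrow> G = \<Sigma>"
    using 0(7) face_of_imp_subset by metis
  moreover have "aff_dim \<Sigma> = aff_dim \<sigma> + 1" using 0(4,5) by simp
  ultimately show "elementary_collapse C D"
    unfolding elementary_collapse_def using 0(1,2,3,8) by metis
qed

text \<open>The lower collapse removes faces of dimension below \<open>k\<close>, and none of them
  contains \<open>\<sigma>'\<close>: a candidate of dimension \<open>k - 1\<close> would have to
  equal \<open>\<sigma>'\<close>, which is still present afterwards. So the higher pair was free
  before. The lower pair stays free, as deleting further faces only helps.\<close>

lemma collapse_swap:
  assumes "C \<subseteq> S" "collapse_below k C C1" "collapse_dim k C1 C2"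
  shows "\<exists>C'. collapse_dim k C C' \<and> collapse_below k C' C2"
proof -
  obtain j \<sigma> \<Sigma> where 1: "j < k" "\<sigma> \<in> C" "\<Sigma> \<in> C" "\<sigma> \<noteq> {}" "aff_dim \<Sigma> = j" "aff_dim \<sigma> = j - 1" "\<sigma> \<subseteq> \<Sigma>"
    "\<And>G. \<lbrakk>G \<in> C; \<sigma> \<subseteq> G\<rbrakk> \<Longrightarrow> G = \<sigma> \<or> G = \<Sigma>" "C1 = C - {\<sigma>, \<Sigma>}"
    using assms(2) unfolding collapse_dim_def collapse_below_def by blast
  obtain \<sigma>' \<Sigma>' where 2: "\<sigma>' \<in> C1" "\<Sigma>' \<in> C1" "\<sigma>' \<noteq> {}" "aff_dim \<Sigma>' = k" "aff_dim \<sigma>' = k - 1" "\<sigma>' \<subseteq> \<Sigma>'"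
    "\<And>G. \<lbrakk>G \<in> C1; \<sigma>' \<subseteq> G\<rbrakk> \<Longrightarrow> G = \<sigma>' \<or> G = \<Sigma>'" "C2 = C1 - {\<sigma>', \<Sigma>'}"
    using assms(3) unfolding collapse_dim_def by blast
  have inS: "\<sigma> \<in> S" "\<Sigma> \<in> S" "\<sigma>' \<in> S" "\<Sigma>' \<in> S" using 1(2,3,9) 2(1,2) assms(1) by auto
  have ne: "\<not> \<sigma>' \<subseteq> \<sigma>" "\<not> \<sigma>' \<subseteq> \<Sigma>"
  proof -
    show "\<not> \<sigma>' \<subseteq> \<sigma>" using dim_mono[of \<sigma>' \<sigma>] 1(1,5,6) 2(4,5) by auto
    show "\<not> \<sigma>' \<subseteq> \<Sigma>"
    proof
      assume "\<sigma>' \<subseteq> \<Sigma>"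
      then have "\<sigma>' = \<Sigma>" using dim_mono[of \<sigma>' \<Sigma>] dim_eq[OF inS(3,2)] 1(1,5,6) 2(4,5) by auto
      then show False using 1(9) 2(1) by auto
    qed
  qed
  let ?C' = "C - {\<sigma>', \<Sigma>'}"
  have "collapse_dim k C ?C'"
  proof (rule collapse_dimI[of "\<sigma>'" _ "\<Sigma>'"])
    fix G assume "G \<in> C" "\<sigma>' \<subseteq> G"
    then show "G = \<sigma>' \<or> G = \<Sigma>'" using 2(7)[of G] ne 1(9) by blast
  qed (use 1(9) 2(1-6) in auto)
  moreover have "collapse_dim j ?C' C2"
  proof (rule collapse_dimI[of "\<sigma>" _ "\<Sigma>"])
    fix G assume "G \<in> ?C'" "\<sigma> \<subseteq> G"
    then show "G = \<sigma> \<or> G = \<Sigma>" using 1(8)[of G] by blast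
  qed (use 1(2-7,9) 2(1-2,8) in auto)
  ultimately show ?thesis using 1(1) collapse_below_def by blast
qed

lemma collapse_swap_star:
  assumes "(collapse_dim k)\<^sup>*\<^sup>* C1 C2" "C \<subseteq> S" "collapse_below k C C1"
  shows "\<exists>C'. (collapse_dim k)\<^sup>*\<^sup>* C C' \<and> collapse_below k C' C2"
  using assms(1)
proof (induction rule: rtranclp_induct)
  case base
  then show ?case using assms(3) by blast
next
  case (step y z)
  then obtain C' where C': "(collapse_dim k)\<^sup>*\<^sup>* C C'" "collapse_below k C' y" by blast
  have "C' \<subseteq> S" using C'(1)
  proof (induction rule: rtranclp_induct)
    case base then show ?case by (rule assms(2))
  next
    case (step a b) then show ?case using collapse_dim_subset by blast
  qed
  then obtain C'' where "collapse_dim k C' C''" "collapse_below k C'' z"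
    using collapse_swap[OF _ C'(2) step(2)] by auto
  then show ?case using rtranclp.rtrancl_into_rtrancl[OF C'(1)] by blast
qed

text \<open>The first collapse of the sequence either has top dimension and stays in front, or it is
  pushed behind the collapses of dimension \<open>k\<close> among the already sorted rest.\<close>

lemma collapse_sort_aux:
  assumes "elementary_collapse\<^sup>*\<^sup>* C D" "C \<subseteq> S" "\<And>F. F \<in> C \<Longrightarrow> aff_dim F \<le> k"
  shows "\<exists>C'. (collapse_dim k)\<^sup>*\<^sup>* C C' \<and> (collapse_below k)\<^sup>*\<^sup>* C' D"
  using assms
proof (induction rule: converse_rtranclp_induct)
  case base
  show ?case by (intro exI[of _ D] conjI rtranclp.rtrancl_refl)
next
  case (step C C1)
  then obtain j where j: "collapse_dim j C C1" using elementary_collapse_iff by blast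
  have "C1 \<subseteq> C" using j collapse_dim_subset by blast
  then obtain C' where C': "(collapse_dim k)\<^sup>*\<^sup>* C1 C'" "(collapse_below k)\<^sup>*\<^sup>* C' D"
    using step(3) step(4,5) by blast
  have "j \<le> k" using j step(5) unfolding collapse_dim_def by blast
  show ?case
  proof (cases "j = k")
    case True
    then have "(collapse_dim k)\<^sup>*\<^sup>* C C'"
      using converse_rtranclp_into_rtranclp[of "collapse_dim k", OF _ C'(1)] j by simp
    then show ?thesis using C'(2) by blast
  next
    case False
    then have "collapse_below k C C1" using j \<open>j \<le> k\<close> unfolding collapse_below_def by force
    then obtain C2 where "(collapse_dim k)\<^sup>*\<^sup>* C C2" "collapse_below k C2 C'"
      using collapse_swap_star[OF C'(1) step(4)] by blast
    then show ?thesis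
      using converse_rtranclp_into_rtranclp[of "collapse_below k", OF _ C'(2)] by blast
  qed
qed

lemma collapse_dim_star_subset: "(collapse_dim k)\<^sup>*\<^sup>* C D \<Longrightarrow> D \<subseteq> C"
  by (induction rule: rtranclp_induct) (auto dest: collapse_dim_subset)

lemma collapse_below_star_onto:
  assumes "(collapse_below k)\<^sup>*\<^sup>* C D" "C \<subseteq> S" shows "collapses_onto C D"
  using assms unfolding collapses_onto_def
proof (induction rule: converse_rtranclp_induct)
  case (step y z)
  then obtain j where j: "collapse_dim j y z" unfolding collapse_below_def by blast
  then have "elementary_collapse y z" using elementary_collapse_iff step(4) by blast
  moreover have "elementary_collapse\<^sup>*\<^sup>* z D"
    using step(3,4) collapse_dim_subset[OF j] by blast
  ultimately show ?case by (rule converse_rtranclp_into_rtranclp)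
qed auto

lemma collapse_dim_star_onto:
  assumes "(collapse_dim k)\<^sup>*\<^sup>* C D" "C \<subseteq> S" shows "collapses_onto C D"
  using assms unfolding collapses_onto_def
proof (induction rule: converse_rtranclp_induct)
  case (step y z)
  then have "elementary_collapse y z" using elementary_collapse_iff by blast
  moreover have "elementary_collapse\<^sup>*\<^sup>* z D"
    using step(3,4) collapse_dim_subset[OF step(1)] by blast
  ultimately show ?case by (rule converse_rtranclp_into_rtranclp)
qed auto

text \<open>Collapses below dimension \<open>k\<close> never remove a face of dimension
  \<open>k\<close>; as \<open>D\<close> has none, the intermediate complex has none either.\<close>

lemma collapse_sort:
  assumes "collapses_onto C D" "C \<subseteq> S" "\<And>F. F \<in> C \<Longrightarrow> aff_dim F \<le> k" "\<And>F. F \<in> D \<Longrightarrow> aff_dim F < k"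
  obtains C' where "(collapse_dim k)\<^sup>*\<^sup>* C C'" "collapses_onto C' D" "\<And>F. F \<in> C' \<Longrightarrow> aff_dim F < k"
proof -
  obtain C' where C': "(collapse_dim k)\<^sup>*\<^sup>* C C'" "(collapse_below k)\<^sup>*\<^sup>* C' D"
    using collapse_sort_aux assms unfolding collapses_onto_def by blast
  then have "C' \<subseteq> C" using collapse_dim_star_subset by blast
  then show thesis
    using that[OF C'(1)] C'(2) collapse_below_star_onto assms collapse_below_faces[OF C'(2)]
    by (metis linorder_not_less subset_trans)
qed

end

text \<open>Freeness of the \<open>i\<close>-th pair is expressed in the initial complex \<open>C\<close> of dimension at most \<open>k\<close>: the
  faces above \<open>\<sigma> i\<close> other than \<open>\<Sigma> i\<close> have been removed by the earlier collapses.\<close>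

definition collapse_seq ::
    "int \<Rightarrow> 'a::euclidean_space set set \<Rightarrow> nat \<Rightarrow> (nat \<Rightarrow> 'a set) \<Rightarrow> (nat \<Rightarrow> 'a set) \<Rightarrow> bool" where
  "collapse_seq k C n \<sigma> \<Sigma> \<longleftrightarrow>
     (\<forall>i<n. \<sigma> i \<in> C \<and> \<Sigma> i \<in> C \<and> \<sigma> i \<noteq> {} \<and> aff_dim (\<Sigma> i) = k \<and> aff_dim (\<sigma> i) = k - 1 \<and>
        \<sigma> i \<subseteq> \<Sigma> i \<and> \<sigma> i \<notin> \<sigma> ` {..<i} \<and> \<Sigma> i \<notin> \<Sigma> ` {..<i} \<and>
        (\<forall>G\<in>C. \<sigma> i \<subseteq> G \<longrightarrow> G = \<sigma> i \<or> G \<in> \<Sigma> ` {..i}))"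

lemma collapse_seq_collapse_dim:
  assumes "collapse_seq k C n \<sigma> \<Sigma>"
  shows "(collapse_dim k)\<^sup>*\<^sup>* C (C - \<sigma> ` {..<n} - \<Sigma> ` {..<n})"
  using assms
proof (induction n)
  case (Suc n)
  let ?R = "\<lambda>n. C - \<sigma> ` {..<n} - \<Sigma> ` {..<n}"
  have IH: "(collapse_dim k)\<^sup>*\<^sup>* C (?R n)"
    using Suc by (auto simp: collapse_seq_def)
  have n: "\<sigma> n \<in> C" "\<Sigma> n \<in> C" "\<sigma> n \<noteq> {}" "aff_dim (\<Sigma> n) = k" "aff_dim (\<sigma> n) = k - 1"
        "\<sigma> n \<subseteq> \<Sigma> n" "\<sigma> n \<notin> \<sigma> ` {..<n}" "\<Sigma> n \<notin> \<Sigma> ` {..<n}"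
        "\<And>G. \<lbrakk>G\<in>C; \<sigma> n \<subseteq> G\<rbrakk> \<Longrightarrow> G = \<sigma> n \<or> G \<in> \<Sigma> ` {..n}"
    using Suc.prems lessI[of n] unfolding collapse_seq_def by blast+
  have dims: "aff_dim (\<Sigma> i) = k" "aff_dim (\<sigma> i) = k - 1" if "i < n" for i
    using Suc.prems that less_SucI[OF that] unfolding collapse_seq_def by blast+
  have ne: "\<sigma> n \<noteq> \<Sigma> i" "\<Sigma> n \<noteq> \<sigma> i" if "i < n" for i
    using dims[OF that] n(4,5) by auto
  have "collapse_dim k (?R n) (?R (Suc n))"
  proof (rule collapse_dimI[of "\<sigma> n" _ "\<Sigma> n"])
    show "\<sigma> n \<in> ?R n" "\<Sigma> n \<in> ?R n" using n(1,2,7,8) ne by auto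
    show "?R (Suc n) = ?R n - {\<sigma> n, \<Sigma> n}" by (auto simp: lessThan_Suc)
    show "G = \<sigma> n \<or> G = \<Sigma> n" if "G \<in> ?R n" "\<sigma> n \<subseteq> G" for G
      using that n(9)[of G] by (auto simp: le_less)
  qed (use n(3-6) in auto)
  with IH show ?case by auto
qed auto

lemma collapse_seq_snoc:
  assumes "collapse_seq k C n \<sigma> \<Sigma>" "s \<in> C" "t \<in> C" "s \<noteq> {}" "aff_dim t = k" "aff_dim s = k - 1"
    "s \<subseteq> t" "s \<notin> \<sigma> ` {..<n}" "t \<notin> \<Sigma> ` {..<n}"
    "\<And>G. \<lbrakk>G \<in> C; s \<subseteq> G\<rbrakk> \<Longrightarrow> G = s \<or> G = t \<or> G \<in> \<Sigma> ` {..<n}"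
  shows "collapse_seq k C (Suc n) (\<sigma>(n := s)) (\<Sigma>(n := t))"
  unfolding collapse_seq_def
proof (intro allI impI)
  let ?s = "\<sigma>(n := s)" and ?t = "\<Sigma>(n := t)"
  have im: "i \<le> n \<Longrightarrow> ?s ` {..<i} = \<sigma> ` {..<i}" "i \<le> n \<Longrightarrow> ?t ` {..<i} = \<Sigma> ` {..<i}"
    "i < n \<Longrightarrow> ?t ` {..i} = \<Sigma> ` {..i}" for i
    by (auto simp: image_iff)
  have imn: "?t ` {..n} = insert t (\<Sigma> ` {..<n})"
    using im[of n] by (auto simp: lessThan_Suc lessThan_Suc_atMost[symmetric])
  fix i assume "i < Suc n"
  then consider "i < n" | "i = n" by linarith
  then show "?s i \<in> C \<and> ?t i \<in> C \<and> ?s i \<noteq> {} \<and> aff_dim (?t i) = k \<and> aff_dim (?s i) = k - 1 \<and>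
    ?s i \<subseteq> ?t i \<and> ?s i \<notin> ?s ` {..<i} \<and> ?t i \<notin> ?t ` {..<i} \<and>
    (\<forall>G\<in>C. ?s i \<subseteq> G \<longrightarrow> G = ?s i \<or> G \<in> ?t ` {..i})"
  proof cases
    case 1
    then show ?thesis using \<open>collapse_seq k C n \<sigma> \<Sigma>\<close> im[of i]
      unfolding collapse_seq_def by simp
  next
    case i: 2
    then show ?thesis using assms(2-9) imn im[of n] assms(10) by auto
  qed
qed

lemma (in simpl_complex) collapse_dim_collapse_seq:
  assumes "(collapse_dim k)\<^sup>*\<^sup>* C D" "C \<subseteq> S"
  obtains n \<sigma> \<Sigma> where "collapse_seq k C n \<sigma> \<Sigma>" "D = C - \<sigma> ` {..<n} - \<Sigma> ` {..<n}"
proof -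
  have "\<exists>n \<sigma> \<Sigma>. collapse_seq k C n \<sigma> \<Sigma> \<and> D = C - \<sigma> ` {..<n} - \<Sigma> ` {..<n}"
    using assms(1)
  proof (induction rule: rtranclp_induct)
    case base
    then show ?case by (intro exI[of _ 0]) (auto simp: collapse_seq_def)
  next
    case (step D E)
    then obtain n \<sigma> \<Sigma> where 1: "collapse_seq k C n \<sigma> \<Sigma>" "D = C - \<sigma> ` {..<n} - \<Sigma> ` {..<n}" by blast
    obtain s t where 2: "s \<in> D" "t \<in> D" "s \<noteq> {}" "aff_dim t = k" "aff_dim s = k - 1" "s \<subseteq> t"
      "\<And>G. \<lbrakk>G \<in> D; s \<subseteq> G\<rbrakk> \<Longrightarrow> G = s \<or> G = t" "E = D - {s, t}"
      using step(2) unfolding collapse_dim_def by blast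
    let ?s = "\<sigma>(n := s)" and ?t = "\<Sigma>(n := t)"
    have D_C: "D \<subseteq> C" using 1(2) by auto
    \<comment> \<open>A face above \<open>s\<close> that is gone already was removed as a
      \<open>\<Sigma>\<close> or as a \<open>\<sigma>\<close>; in the latter case it has the
      dimension of \<open>s\<close> and so equals \<open>s\<close>.\<close>
    have ss: "G = s \<or> G = t \<or> G \<in> \<Sigma> ` {..<n}" if "G \<in> C" "s \<subseteq> G" for G
    proof (cases "G \<in> D \<or> G \<in> \<Sigma> ` {..<n}")
      case True
      then show ?thesis using 2(7)[of G] that by auto
    next
      case False
      then have "G \<in> \<sigma> ` {..<n}" using that 1(2) by auto
      then have "aff_dim G = k - 1" using 1(1) by (auto simp: collapse_seq_def)
      then have "s = G" using dim_eq[of s G] 2(1,5) D_C that assms(2) by auto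
      then show ?thesis by simp
    qed
    have "collapse_seq k C (Suc n) ?s ?t"
      by (rule collapse_seq_snoc) (use 1 2(1-6) D_C ss in auto)
    moreover have "E = C - ?s ` {..<Suc n} - ?t ` {..<Suc n}"
      using 2(8) 1(2) by (auto simp: lessThan_Suc)
    ultimately show ?case by blast
  qed
  then show thesis using that by blast
qed

section \<open>Collapses along the dual graph\<close>

lemma simple_path_rtrancl:
  assumes "(u, v) \<in> R\<^sup>*"
  obtains p where "distinct p" "p \<noteq> []" "hd p = u" "last p = v"
    "\<And>i. Suc i < length p \<Longrightarrow> (p ! i, p ! Suc i) \<in> R"
proof -
  have "\<exists>p. distinct p \<and> p \<noteq> [] \<and> hd p = u \<and> last p = v \<and> (\<forall>i. Suc i < length p \<longrightarrow> (p ! i, p ! Suc i) \<in> R)"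
    using assms
  proof (induction rule: rtrancl_induct)
    case base
    show ?case by (intro exI[of _ "[u]"]) auto
  next
    case (step y z)
    then obtain p where p: "distinct p" "p \<noteq> []" "hd p = u" "last p = y"
      "\<forall>i. Suc i < length p \<longrightarrow> (p ! i, p ! Suc i) \<in> R" by blast
    show ?case
    proof (cases "z \<in> set p")
      case True
      then obtain k where k: "k < length p" "p ! k = z" by (auto simp: in_set_conv_nth)
      \<comment> \<open>The walk returns to \<open>z\<close>: cut the loop off.\<close>
      let ?q = "take (Suc k) p"
      have "distinct ?q" "?q \<noteq> []" "hd ?q = u" using p by auto
      moreover have "last ?q = z" using k by (simp add: take_Suc_conv_app_nth)
      moreover have "\<forall>i. Suc i < length ?q \<longrightarrow> (?q ! i, ?q ! Suc i) \<in> R"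
        using p by auto
      ultimately show ?thesis by blast
    next
      case False
      let ?q = "p @ [z]"
      have "distinct ?q" "?q \<noteq> []" "hd ?q = u" "last ?q = z" using p False by auto
      moreover have "(?q ! i, ?q ! Suc i) \<in> R" if "Suc i < length ?q" for i
      proof (cases "Suc i < length p")
        case True
        then show ?thesis using p by (auto simp: nth_append)
      next
        case False
        then have "Suc i = length p" using that by auto
        then have i: "i = length p - 1" "Suc i = length p" by auto
        have "?q ! i = y" using p i by (simp add: nth_append last_conv_nth)
        moreover have "?q ! Suc i = z" using i(2) by simp
        ultimately have "?q ! i = y" "?q ! Suc i = z" by auto
        then show ?thesis using step by simp
      qed
      ultimately show ?thesis by blast
    qed
  qed
  then show thesis using that by blast
qed

lemma spanning_treeD:
  assumes "spanning_tree V E T"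
  shows "T \<subseteq> E" "\<lbrakk>u \<in> V; v \<in> V\<rbrakk> \<Longrightarrow> (u, v) \<in> {(x, y). {x, y} \<in> T}\<^sup>*"
  using assms by (auto simp only: spanning_tree_def)

text \<open>An arc of \<open>T\<close> missing from \<open>T'\<close> would close the simple path
  between its ends in \<open>T'\<close> to a cycle of \<open>T\<close>. The path has at least three
  nodes, because its ends differ and are not joined in \<open>T'\<close>.\<close>

lemma spanning_tree_minimal:
  assumes T: "spanning_tree V E T" and T': "T' \<subseteq> T"
    and conn: "\<And>u v. \<lbrakk>u \<in> V; v \<in> V\<rbrakk> \<Longrightarrow> (u, v) \<in> {(x, y). {x, y} \<in> T'}\<^sup>*"
    and uv: "{u, v} \<in> T" "u \<noteq> v" "u \<in> V" "v \<in> V"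
  shows "{u, v} \<in> T'"
proof (rule ccontr)
  assume not: "{u, v} \<notin> T'"
  obtain p where p: "distinct p" "p \<noteq> []" "hd p = u" "last p = v"
    "\<And>i. Suc i < length p \<Longrightarrow> (p ! i, p ! Suc i) \<in> {(x, y). {x, y} \<in> T'}"
    by (rule simple_path_rtrancl[OF conn[OF uv(3,4)]]) (rule that)
  have p0: "p ! 0 = u" using p(2,3) by (simp add: hd_conv_nth)
  have pl: "p ! (length p - 1) = v" using p(2,4) by (simp add: last_conv_nth)
  have "length p \<noteq> 1" using p0 pl uv(2) by auto
  moreover have "length p \<noteq> 2"
  proof
    assume "length p = 2"
    then have "(p ! 0, p ! Suc 0) \<in> {(x, y). {x, y} \<in> T'}" using p(5)[of 0] by simp
    then show False using p0 pl \<open>length p = 2\<close> not by simp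
  qed
  moreover have "length p \<noteq> 0" using p(2) by simp
  ultimately have len: "length p \<ge> 3" by linarith
  have "\<forall>i<length p. {p ! i, p ! (Suc i mod length p)} \<in> T"
  proof (intro allI impI)
    fix i assume i: "i < length p"
    show "{p ! i, p ! (Suc i mod length p)} \<in> T"
    proof (cases "Suc i < length p")
      case True
      then show ?thesis using p(5)[of i] T' by auto
    next
      case False
      then have "Suc i = length p" using i by simp
      then have "i = length p - 1" "Suc i mod length p = 0" by simp_all
      then show ?thesis using p0 pl uv(1) by (simp add: insert_commute)
    qed
  qed
  then show False using T len p(1) unfolding spanning_tree_def by blast
qed

text \<open>A closed pseudomanifold, not assumed to be connected. The combinatorial half of the
  argument is carried out here; the topology of spheres enters later through
  \<open>sphere_complex\<close> and, for LC, through the linkage of the facets at each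
  point.\<close>

locale pm_complex = simpl_complex S for S :: "'a::euclidean_space set set" +
  fixes d :: nat
  assumes d2: "d \<ge> 2"
    and facets_ne: "facets d S \<noteq> {}"
    and pure: "F \<in> S \<Longrightarrow> \<exists>D\<in>facets d S. F \<subseteq> D"
    and two: "G \<in> faces_of_dim S (int d - 1) \<Longrightarrow> card {D \<in> facets d S. G \<subseteq> D} = 2"
begin

abbreviation "ridges \<equiv> faces_of_dim S (int d - 1)"

lemma facetD: "D \<in> facets d S \<Longrightarrow> D \<in> S" "D \<in> facets d S \<Longrightarrow> aff_dim D = int d"
  by (auto simp: faces_of_dim_def)

lemma ridgeD: "G \<in> ridges \<Longrightarrow> G \<in> S" "G \<in> ridges \<Longrightarrow> aff_dim G = int d - 1"
  by (auto simp: faces_of_dim_def)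

lemma dim_le: "F \<in> S \<Longrightarrow> aff_dim F \<le> int d"
  using pure[of F] facetD(2) dim_mono[of F] by metis

lemma facet_max: "\<lbrakk>D \<in> facets d S; G \<in> S; D \<subseteq> G\<rbrakk> \<Longrightarrow> G = D"
  using dim_eq[of D G] dim_le[of G] dim_mono[of D G] facetD[of D] by auto

lemma fin_facets: "finite (facets d S)"
  using fin by (auto simp: faces_of_dim_def)

lemma ridge_other:
  assumes "G \<in> ridges" "D \<in> facets d S" "G \<subseteq> D"
  obtains D' where "D' \<in> facets d S" "D' \<noteq> D" "G \<subseteq> D'"
    "\<forall>E\<in>facets d S. G \<subseteq> E \<longrightarrow> E = D \<or> E = D'"
proof -
  obtain x y where xy: "{D \<in> facets d S. G \<subseteq> D} = {x, y}" "x \<noteq> y"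
    using two[OF assms(1)] by (auto simp: card_2_iff)
  then have "D = x \<or> D = y" using assms by blast
  then show thesis
  proof
    assume "D = x" then show thesis using that[of y] xy by blast
  next
    assume "D = y" then show thesis using that[of x] xy by blast
  qed
qed

lemma ridge_inter:
  assumes "A \<in> facets d S" "B \<in> facets d S" "A \<noteq> B" "G \<in> ridges" "G \<subseteq> A" "G \<subseteq> B"
  shows "A \<inter> B = G"
proof -
  have in_S: "A \<inter> B \<in> S" using inter_in facetD(1) assms(1,2) by blast
  have "A \<inter> B \<subset> A" using facet_max[OF assms(1), of B] facetD(1)[OF assms(2)] assms(3) by blast
  then have "aff_dim (A \<inter> B) < int d" using dim_less[OF in_S facetD(1)[OF assms(1)]] facetD(2)[OF assms(1)] by simp
  moreover have "aff_dim G \<le> aff_dim (A \<inter> B)" using dim_mono assms by simp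
  ultimately have "aff_dim G = aff_dim (A \<inter> B)" using ridgeD[OF assms(4)] by simp
  then show ?thesis using dim_eq[OF ridgeD(1)[OF assms(4)] in_S] assms by blast
qed

lemma two_facets_of_ridge:
  assumes "G \<in> ridges" "A \<in> facets d S" "B \<in> facets d S" "E \<in> facets d S"
    "G \<subseteq> A" "G \<subseteq> B" "G \<subseteq> E" "A \<noteq> B"
  shows "E = A \<or> E = B"
  by (rule ridge_other[OF assms(1,2,5)]) (use assms in metis)

lemma facet_ridges:
  assumes "F \<in> S" "aff_dim F = int d - 2" "D \<in> facets d S" "F \<subseteq> D"
  shows "card {G \<in> ridges. F \<subseteq> G \<and> G \<subseteq> D} = 2"
proof -
  have "{G \<in> ridges. F \<subseteq> G \<and> G \<subseteq> D} = {G \<in> S. F \<subseteq> G \<and> G \<subseteq> D \<and> aff_dim G = aff_dim F + 1}"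
    using assms by (auto simp: faces_of_dim_def)
  then show ?thesis using diamond[of F D] assms facetD[OF assms(3)] by simp
qed

lemma codim2_above:
  assumes "F \<in> S" "aff_dim F \<le> int d - 2"
  obtains F' where "F' \<in> S" "F \<subseteq> F'" "aff_dim F' = int d - 2"
proof -
  obtain D where D: "D \<in> facets d S" "F \<subseteq> D" using pure assms by blast
  have "F \<subset> D" using D facetD[OF D(1)] assms by auto
  then obtain G where G: "G \<in> S" "F \<subseteq> G" "G \<subseteq> D" "aff_dim G = aff_dim D - 1"
    using face_below[OF assms(1) facetD(1)[OF D(1)]] by metis
  then have "F \<subset> G" using facetD[OF D(1)] assms by auto
  then obtain F' where "F' \<in> S" "F \<subseteq> F'" "F' \<subseteq> G" "aff_dim F' = aff_dim G - 1"
    using face_below[OF assms(1) G(1)] by metis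
  then show thesis using that G facetD[OF D(1)] by auto
qed

lemma ridge_of_dual_arc:
  assumes "{A, B} \<in> dual_arcs d S"
  obtains G where "A \<in> facets d S" "B \<in> facets d S" "A \<noteq> B" "G \<in> ridges" "G \<subseteq> A" "G \<subseteq> B"
proof -
  have "\<exists>A' B'. {A, B} = {A', B'} \<and> A' \<in> facets d S \<and> B' \<in> facets d S \<and> A' \<noteq> B' \<and>
    (\<exists>G\<in>ridges. G face_of A' \<and> G face_of B')"
    using assms unfolding dual_arcs_def by (simp only: mem_Collect_eq)
  then obtain A' B' G where AB: "{A, B} = {A', B'}" "A' \<in> facets d S" "B' \<in> facets d S" "A' \<noteq> B'"
    "G \<in> ridges" "G face_of A'" "G face_of B'"
    by (elim exE conjE bexE) (rule that)
  have G: "G \<subseteq> A'" "G \<subseteq> B'" using AB(6,7) face_of_imp_subset by blast+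
  from AB(1) consider "A = A'" "B = B'" | "A = B'" "B = A'" by (auto simp: doubleton_eq_iff)
  then show thesis
  proof cases
    case 1
    show thesis by (rule that[of G]) (use AB(2-5) G 1 in simp_all)
  next
    case 2
    show thesis by (rule that[of G]) (use AB(2-5) G 2 in simp_all)
  qed
qed

text \<open>The rooted form of a spanning tree: freeness of the pairs says that
  \<open>\<sigma> i\<close> joins \<open>\<Sigma> i\<close> to a parent which is
  \<open>\<Delta>\<close> or has a smaller index.\<close>

definition facet_seq :: "'a set \<Rightarrow> nat \<Rightarrow> (nat \<Rightarrow> 'a set) \<Rightarrow> (nat \<Rightarrow> 'a set) \<Rightarrow> bool" where
  "facet_seq \<Delta> n \<sigma> \<Sigma> \<longleftrightarrow> \<Delta> \<in> facets d S \<and> collapse_seq (int d) (S - {\<Delta>}) n \<sigma> \<Sigma> \<and>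
     \<Sigma> ` {..<n} = facets d S - {\<Delta>}"

definition seq_tree :: "nat \<Rightarrow> (nat \<Rightarrow> 'a set) \<Rightarrow> 'a set set set" where
  "seq_tree n \<sigma> = {{A, B} |A B. A \<in> facets d S \<and> B \<in> facets d S \<and> A \<noteq> B \<and> (\<exists>i<n. \<sigma> i \<subseteq> A \<and> \<sigma> i \<subseteq> B)}"

lemma seq_tree_iff:
  "{A, B} \<in> seq_tree n \<sigma> \<longleftrightarrow> A \<in> facets d S \<and> B \<in> facets d S \<and> A \<noteq> B \<and> (\<exists>i<n. \<sigma> i \<subseteq> A \<and> \<sigma> i \<subseteq> B)"
    (is "?l \<longleftrightarrow> ?r")
proof
  assume ?l
  then obtain A' B' i where AB: "{A, B} = {A', B'}" "A' \<in> facets d S" "B' \<in> facets d S" "A' \<noteq> B'"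
    "i < n" "\<sigma> i \<subseteq> A'" "\<sigma> i \<subseteq> B'"
    unfolding seq_tree_def mem_Collect_eq by (elim exE conjE) (rule that)
  from AB(1) consider "A = A'" "B = B'" | "A = B'" "B = A'" by (auto simp: doubleton_eq_iff)
  then show ?r using AB(2-7) by cases metis+
next
  assume ?r
  then show ?l unfolding seq_tree_def mem_Collect_eq by metis
qed

lemma seq_treeE:
  assumes "e \<in> seq_tree n \<sigma>"
  obtains A B i where "e = {A, B}" "A \<in> facets d S" "B \<in> facets d S" "A \<noteq> B" "i < n"
      "\<sigma> i \<subseteq> A" "\<sigma> i \<subseteq> B"
  using assms unfolding seq_tree_def mem_Collect_eq by (elim exE conjE) (rule that)

context
  fixes \<Delta> n \<sigma> \<Sigma>
  assumes fs: "facet_seq \<Delta> n \<sigma> \<Sigma>"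
begin

lemma facet_seqD:
  assumes "i < n"
  shows "\<sigma> i \<in> ridges" "\<Sigma> i \<in> facets d S" "\<Sigma> i \<noteq> \<Delta>" "\<sigma> i \<subseteq> \<Sigma> i" "\<sigma> i \<notin> \<sigma> ` {..<i}" "\<Sigma> i \<notin> \<Sigma> ` {..<i}"
    "\<And>G. \<lbrakk>G \<in> facets d S; \<sigma> i \<subseteq> G\<rbrakk> \<Longrightarrow> G = \<Delta> \<or> G \<in> \<Sigma> ` {..i}"
proof -
  have *: "\<sigma> i \<in> S - {\<Delta>}" "\<Sigma> i \<in> S - {\<Delta>}" "aff_dim (\<Sigma> i) = int d" "aff_dim (\<sigma> i) = int d - 1"
    "\<sigma> i \<subseteq> \<Sigma> i" "\<sigma> i \<notin> \<sigma> ` {..<i}" "\<Sigma> i \<notin> \<Sigma> ` {..<i}"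
    "\<forall>G\<in>S - {\<Delta>}. \<sigma> i \<subseteq> G \<longrightarrow> G = \<sigma> i \<or> G \<in> \<Sigma> ` {..i}"
    using fs assms unfolding facet_seq_def collapse_seq_def by blast+
  then show "\<sigma> i \<in> ridges" "\<Sigma> i \<in> facets d S" "\<Sigma> i \<noteq> \<Delta>" "\<sigma> i \<subseteq> \<Sigma> i" "\<sigma> i \<notin> \<sigma> ` {..<i}" "\<Sigma> i \<notin> \<Sigma> ` {..<i}"
    by (auto simp: faces_of_dim_def)
  fix G assume G: "G \<in> facets d S" "\<sigma> i \<subseteq> G"
  then have "G \<noteq> \<sigma> i" using *(4) facetD(2)[OF G(1)] by auto
  then show "G = \<Delta> \<or> G \<in> \<Sigma> ` {..i}" using *(8) G facetD(1) by blast
qed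

lemma facet_seq_inj: "inj_on \<Sigma> {..<n}" "inj_on \<sigma> {..<n}"
proof -
  show "inj_on \<Sigma> {..<n}"
  proof (rule linorder_inj_onI')
    fix i j :: nat assume "i \<in> {..<n}" "j \<in> {..<n}" "i < j"
    then show "\<Sigma> i \<noteq> \<Sigma> j" using facet_seqD(6)[of j] by (metis image_eqI lessThan_iff)
  qed
  show "inj_on \<sigma> {..<n}"
  proof (rule linorder_inj_onI')
    fix i j :: nat assume "i \<in> {..<n}" "j \<in> {..<n}" "i < j"
    then show "\<sigma> i \<noteq> \<sigma> j" using facet_seqD(5)[of j] by (metis image_eqI lessThan_iff)
  qed
qed

text \<open>The order of removal, with \<open>\<Delta>\<close> as number 0; in the rooted tree a
  parent has smaller rank than its child.\<close>

definition facet_rank :: "'a set \<Rightarrow> nat" where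
  "facet_rank D = (if D = \<Delta> then 0 else Suc (the_inv_into {..<n} \<Sigma> D))"

lemma facet_rank [simp]: "facet_rank \<Delta> = 0" "i < n \<Longrightarrow> facet_rank (\<Sigma> i) = Suc i"
  using facet_seqD(3) the_inv_into_f_f[OF facet_seq_inj(1)] by (auto simp: facet_rank_def)

lemma facet_seq_cases:
  assumes "D \<in> facets d S" obtains "D = \<Delta>" | i where "i < n" "D = \<Sigma> i"
  using fs assms unfolding facet_seq_def by blast

lemma facet_seq_above:
  assumes "i < n" "D \<in> facets d S" "\<sigma> i \<subseteq> D"
  shows "D = \<Sigma> i \<or> facet_rank D < facet_rank (\<Sigma> i)"
proof -
  from facet_seqD(7)[OF assms] consider "D = \<Delta>" | j where "j \<le> i" "D = \<Sigma> j" by auto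
  then show ?thesis
  proof cases
    case 1
    then show ?thesis using facet_rank(2)[OF assms(1)] by simp
  next
    case 2
    then have "j < n" using assms(1) by simp
    then show ?thesis using facet_rank(2)[OF assms(1)] facet_rank(2)[OF \<open>j < n\<close>] 2
      by (cases "j = i") auto
  qed
qed

lemma seq_tree_arc:
  assumes "{A, B} \<in> seq_tree n \<sigma>" "facet_rank B \<le> facet_rank A"
  obtains i where "i < n" "A = \<Sigma> i" "\<sigma> i \<subseteq> B" "facet_rank B < facet_rank A"
proof -
  obtain i where i: "i < n" "\<sigma> i \<subseteq> A" "\<sigma> i \<subseteq> B" and AB: "A \<in> facets d S" "B \<in> facets d S" "A \<noteq> B"
    using assms(1) unfolding seq_tree_iff by blast
  have "\<Sigma> i = A \<or> \<Sigma> i = B"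
    using two_facets_of_ridge[OF facet_seqD(1)[OF i(1)] AB(1,2) facet_seqD(2)[OF i(1)] i(2,3) facet_seqD(4)[OF i(1)] AB(3)] .
  then have "A = \<Sigma> i" "facet_rank B < facet_rank A"
    using facet_seq_above[OF i(1) AB(1) i(2)] facet_seq_above[OF i(1) AB(2) i(3)] AB(3) assms(2)
    by auto
  then show thesis using that[OF i(1)] i(3) by simp
qed

text \<open>At a node of maximal rank on a cycle both arcs lead to facets of smaller rank, hence
  both use the one ridge that joins this node to its parent. A ridge lies in two facets only, so the
  two neighbours would coincide.\<close>

lemma seq_tree_acyclic:
  "\<not> (\<exists>p. length p \<ge> 3 \<and> distinct p \<and> (\<forall>i<length p. {p ! i, p ! (Suc i mod length p)} \<in> seq_tree n \<sigma>))"
proof clarify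
  fix p :: "'a set list"
  assume p: "3 \<le> length p" "distinct p" "\<forall>i<length p. {p ! i, p ! (Suc i mod length p)} \<in> seq_tree n \<sigma>"
  let ?M = "(\<lambda>i. facet_rank (p ! i)) ` {..<length p}"
  have "finite ?M" by simp
  have "0 < length p" using p(1) by linarith
  then have "?M \<noteq> {}" by blast
  then have "Max ?M \<in> ?M" using Max_in \<open>finite ?M\<close> by blast
  then obtain i where i: "i < length p" "facet_rank (p ! i) = Max ?M" by force
  then have max: "facet_rank (p ! j) \<le> facet_rank (p ! i)" if "j < length p" for j
    using that \<open>finite ?M\<close> unfolding i(2) by (intro Max_ge) auto
  define nx where "nx = Suc i mod length p"
  \<comment> \<open>The predecessor of \<open>i\<close> on the cycle, as \<open>nx\<close> is its
    successor.\<close>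
  define pv where "pv = (if i = 0 then length p - 1 else i - 1)"
  have nx: "nx < length p" unfolding nx_def using i by (intro mod_less_divisor) auto
  have pv: "pv < length p" "Suc pv mod length p = i" unfolding pv_def using i p(1) by auto
  have ne: "nx \<noteq> pv"
  proof (cases "Suc i < length p")
    case True then show ?thesis using p(1) unfolding nx_def pv_def by auto
  next
    case False
    then have "Suc i = length p" using i by auto
    then show ?thesis using p(1) unfolding nx_def pv_def by auto
  qed
  have 1: "{p ! i, p ! nx} \<in> seq_tree n \<sigma>" using p(3) i nx_def by auto
  have "{p ! pv, p ! i} \<in> seq_tree n \<sigma>" using p(3) pv by metis
  then have 2: "{p ! i, p ! pv} \<in> seq_tree n \<sigma>" by (simp add: insert_commute)
  obtain j where j: "j < n" "p ! i = \<Sigma> j" "\<sigma> j \<subseteq> p ! nx" by (rule seq_tree_arc[OF 1 max[OF nx]]) (rule that)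
  obtain k where k: "k < n" "p ! i = \<Sigma> k" "\<sigma> k \<subseteq> p ! pv" by (rule seq_tree_arc[OF 2 max[OF pv(1)]]) (rule that)
  have "j = k" using inj_onD[OF facet_seq_inj(1), of j k] j k by simp
  have fac: "p ! nx \<in> facets d S" "p ! pv \<in> facets d S" "p ! i \<in> facets d S" "p ! i \<noteq> p ! nx" "p ! i \<noteq> p ! pv"
    using 1 2 unfolding seq_tree_iff by auto
  have "\<sigma> j \<subseteq> p ! i" "\<sigma> j \<subseteq> p ! pv" using facet_seqD(4)[OF j(1)] j(2) k(3) \<open>j = k\<close> by simp_all
  then have "p ! pv = p ! i \<or> p ! pv = p ! nx"
    using two_facets_of_ridge[OF facet_seqD(1)[OF j(1)] fac(3,1,2) _ j(3) _ fac(4)] by blast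
  then have "p ! pv = p ! nx" using fac(5) by metis
  then have "pv = nx" by (rule iffD1[OF nth_eq_iff_index_eq[OF p(2) pv(1) nx]])
  then show False using ne by simp
qed

lemma seq_tree_spanning: "spanning_tree (facets d S) (dual_arcs d S) (seq_tree n \<sigma>)"
  unfolding spanning_tree_def
proof (intro conjI ballI seq_tree_acyclic)
  show "seq_tree n \<sigma> \<subseteq> dual_arcs d S"
  proof
    fix e assume "e \<in> seq_tree n \<sigma>"
    then obtain A B i where e: "e = {A, B}" "A \<in> facets d S" "B \<in> facets d S" "A \<noteq> B" "i < n"
      "\<sigma> i \<subseteq> A" "\<sigma> i \<subseteq> B"
      by (rule seq_treeE)
    have "\<sigma> i face_of A" "\<sigma> i face_of B"
      using e(6,7) face_iff[OF ridgeD(1)[OF facet_seqD(1)[OF e(5)]]] facetD(1)[OF e(2)] facetD(1)[OF e(3)] by auto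
    then show "e \<in> dual_arcs d S"
      unfolding dual_arcs_def mem_Collect_eq using e(1-4) facet_seqD(1)[OF e(5)] by metis
  qed
  let ?R = "{(x, y). {x, y} \<in> seq_tree n \<sigma>}"
  have sym: "sym ?R" by (auto simp: sym_def insert_commute)
  \<comment> \<open>Follow the parents: the other facet of \<open>\<sigma> i\<close> is
    \<open>\<Delta>\<close> or was removed earlier.\<close>
  have to\<Delta>: "(\<Sigma> i, \<Delta>) \<in> ?R\<^sup>*" if "i < n" for i
    using that
  proof (induction i rule: less_induct)
    case (less i)
    obtain B where B: "B \<in> facets d S" "B \<noteq> \<Sigma> i" "\<sigma> i \<subseteq> B"
      using ridge_other[OF facet_seqD(1,2,4)[OF less(2)]] by metis
    have 1: "(\<Sigma> i, B) \<in> ?R"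
      using B less(2) facet_seqD(2,4)[OF less(2)] unfolding seq_tree_iff by (auto simp: seq_tree_iff)
    have "(B, \<Delta>) \<in> ?R\<^sup>*"
      using B(1)
    proof (cases rule: facet_seq_cases)
      case (2 j)
      then have "facet_rank B < facet_rank (\<Sigma> i)" using facet_seq_above[OF less(2) B(1,3)] B(2) by auto
      then have "j < i" using 2 less(2) by simp
      then show ?thesis using less.IH 2 by auto
    qed auto
    then show ?case using 1 by (rule converse_rtrancl_into_rtrancl[rotated])
  qed
  fix u v assume uv: "u \<in> facets d S" "v \<in> facets d S"
  have *: "(w, \<Delta>) \<in> ?R\<^sup>*" if "w \<in> facets d S" for w
    using that
  proof (cases rule: facet_seq_cases)
    case (2 i)
    then show ?thesis using to\<Delta> by blast
  qed simp
  have "(\<Delta>, v) \<in> ?R\<^sup>*" by (rule symD[OF sym_rtrancl[OF sym] *[OF uv(2)]])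
  then show "(u, v) \<in> ?R\<^sup>*" using *[OF uv(1)] by (rule rtrancl_trans[rotated])
qed

text \<open>Two distinct facets share at most one ridge, so arcs of the tree and the ridges
  \<open>\<sigma> i\<close> determine each other.\<close>

lemma seq_tree_ridge:
  assumes "G \<in> ridges"
  shows "(\<exists>A B. {A, B} \<in> seq_tree n \<sigma> \<and> G face_of A \<and> G face_of B) \<longleftrightarrow> G \<in> \<sigma> ` {..<n}"
proof
  assume "\<exists>A B. {A, B} \<in> seq_tree n \<sigma> \<and> G face_of A \<and> G face_of B"
  then obtain A B i where e: "A \<in> facets d S" "B \<in> facets d S" "A \<noteq> B" "i < n"
      "\<sigma> i \<subseteq> A" "\<sigma> i \<subseteq> B" "G \<subseteq> A" "G \<subseteq> B"
    unfolding seq_tree_iff using face_of_imp_subset by blast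
  have "A \<inter> B = G" "A \<inter> B = \<sigma> i"
    using ridge_inter[OF e(1-3) assms e(7,8)] ridge_inter[OF e(1-3) facet_seqD(1)[OF e(4)] e(5,6)] by auto
  then show "G \<in> \<sigma> ` {..<n}" using e(4) by auto
next
  assume "G \<in> \<sigma> ` {..<n}"
  then obtain i where i: "i < n" "G = \<sigma> i" by auto
  obtain B where B: "B \<in> facets d S" "B \<noteq> \<Sigma> i" "\<sigma> i \<subseteq> B"
    using ridge_other[OF facet_seqD(1,2,4)[OF i(1)]] by metis
  have "{\<Sigma> i, B} \<in> seq_tree n \<sigma>"
    using B i(1) facet_seqD(2,4)[OF i(1)] unfolding seq_tree_iff by auto
  moreover have "\<sigma> i face_of B" "\<sigma> i face_of \<Sigma> i"
    using B(3) facet_seqD(4)[OF i(1)] face_iff[OF ridgeD(1)[OF facet_seqD(1)[OF i(1)]]]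
      facetD(1)[OF B(1)] facetD(1)[OF facet_seqD(2)[OF i(1)]] by auto
  ultimately show "\<exists>A B. {A, B} \<in> seq_tree n \<sigma> \<and> G face_of A \<and> G face_of B" using i by blast
qed

text \<open>The point is that every face of dimension at most \<open>d - 2\<close> lies in a ridge
  outside the tree. Otherwise enlarge it to a face \<open>F'\<close> of codimension two and take the
  facet of largest rank around \<open>F'\<close>: both of its ridges at \<open>F'\<close> would be
  the ridge to its parent, but the two ridges differ.\<close>

lemma cotree_seq_tree:
  "cotree_complex d S (seq_tree n \<sigma>) = S - {\<Delta>} - \<sigma> ` {..<n} - \<Sigma> ` {..<n}"
proof -
  have 1: "cotree_complex d S (seq_tree n \<sigma>) = {F \<in> S. \<exists>G\<in>ridges. F \<subseteq> G \<and> G \<notin> \<sigma> ` {..<n}}"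
  proof -
    have *: "F face_of G \<and> \<not> (\<exists>A B. {A, B} \<in> seq_tree n \<sigma> \<and> G face_of A \<and> G face_of B) \<longleftrightarrow>
        F \<subseteq> G \<and> G \<notin> \<sigma> ` {..<n}" if "F \<in> S" "G \<in> ridges" for F G
      using seq_tree_ridge[OF that(2)] face_iff[OF that(1) ridgeD(1)[OF that(2)]] by simp
    show ?thesis unfolding cotree_complex_def
      by (intro Collect_cong, rule conj_cong[OF refl], rule bex_cong[OF refl], rule *)
  qed
  have all: "insert \<Delta> (\<Sigma> ` {..<n}) = facets d S" using fs unfolding facet_seq_def by blast
  show ?thesis unfolding 1
  proof (intro equalityI subsetI)
    fix F assume "F \<in> {F \<in> S. \<exists>G\<in>ridges. F \<subseteq> G \<and> G \<notin> \<sigma> ` {..<n}}"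
    then obtain G where G: "F \<in> S" "G \<in> ridges" "F \<subseteq> G" "G \<notin> \<sigma> ` {..<n}"
      by (elim CollectE conjE bexE)
    have "aff_dim F < int d" using dim_mono[OF G(3)] ridgeD[OF G(2)] by simp
    then have "F \<notin> insert \<Delta> (\<Sigma> ` {..<n})" unfolding all using facetD(2)[of F] by auto
    moreover have "F \<notin> \<sigma> ` {..<n}"
    proof
      assume F: "F \<in> \<sigma> ` {..<n}"
      then have "aff_dim F = int d - 1" using facet_seqD(1) ridgeD(2) by blast
      then have "F = G" using dim_eq[OF G(1) ridgeD(1)[OF G(2)] G(3)] ridgeD[OF G(2)] by simp
      then show False using F G by simp
    qed
    ultimately show "F \<in> S - {\<Delta>} - \<sigma> ` {..<n} - \<Sigma> ` {..<n}" using G(1) by simp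
  next
    fix F assume F: "F \<in> S - {\<Delta>} - \<sigma> ` {..<n} - \<Sigma> ` {..<n}"
    then have "F \<notin> facets d S" unfolding all[symmetric] by simp
    then have lt: "aff_dim F \<le> int d - 1" using F dim_le[of F] by (simp add: faces_of_dim_def)
    show "F \<in> {F \<in> S. \<exists>G\<in>ridges. F \<subseteq> G \<and> G \<notin> \<sigma> ` {..<n}}"
    proof (cases "aff_dim F = int d - 1")
      case True
      then have "F \<in> ridges" using F by (auto simp: faces_of_dim_def)
      moreover have "F \<in> S" "F \<notin> \<sigma> ` {..<n}" using F by simp_all
      ultimately show ?thesis by (intro CollectI conjI bexI[of _ F] subset_refl)
    next
      case False
      then have "aff_dim F \<le> int d - 2" using lt by simp
      then obtain F' where F': "F' \<in> S" "F \<subseteq> F'" "aff_dim F' = int d - 2"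
        using codim2_above[of F] F by auto
      have "\<exists>G\<in>ridges. F' \<subseteq> G \<and> G \<notin> \<sigma> ` {..<n}"
      proof (rule ccontr)
        assume con: "\<not> (\<exists>G\<in>ridges. F' \<subseteq> G \<and> G \<notin> \<sigma> ` {..<n})"
        let ?V = "{D \<in> facets d S. F' \<subseteq> D}"
        have "finite ?V" "?V \<noteq> {}" using fin_facets pure[OF F'(1)] by auto
        then have "Max (facet_rank ` ?V) \<in> facet_rank ` ?V" by (intro Max_in) auto
        then obtain D where D: "D \<in> ?V" "facet_rank D = Max (facet_rank ` ?V)" by force
        have max: "facet_rank E \<le> facet_rank D" if "E \<in> ?V" for E
        proof -
          have fi: "finite (facet_rank ` ?V)" using \<open>finite ?V\<close> by (rule finite_imageI)
          have "facet_rank E \<in> facet_rank ` ?V" using that by (rule imageI)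
          from Max_ge[OF fi this] show ?thesis by (simp only: D(2))
        qed
        have uniq: "\<exists>i<n. G = \<sigma> i \<and> D = \<Sigma> i" if "G \<in> ridges" "F' \<subseteq> G" "G \<subseteq> D" for G
        proof -
          have "G \<in> \<sigma> ` {..<n}" using con that(1,2) by blast
          then obtain i where i: "i < n" "G = \<sigma> i" by auto
          have "facet_rank (\<Sigma> i) \<le> facet_rank D"
            using max[of "\<Sigma> i"] facet_seqD(2,4)[OF i(1)] i(2) that by auto
          then have "D = \<Sigma> i" using facet_seq_above[OF i(1), of D] that(3) i(2) D(1) by auto
          then show ?thesis using i by blast
        qed
        have "card {G \<in> ridges. F' \<subseteq> G \<and> G \<subseteq> D} = 2" using facet_ridges[OF F'(1,3)] D(1) by blast
        then obtain G1 G2 where G: "{G \<in> ridges. F' \<subseteq> G \<and> G \<subseteq> D} = {G1, G2}" "G1 \<noteq> G2"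
          by (auto simp: card_2_iff)
        then obtain i j where "i < n" "G1 = \<sigma> i" "D = \<Sigma> i" "j < n" "G2 = \<sigma> j" "D = \<Sigma> j"
          using uniq[of G1] uniq[of G2] G(1) by blast
        then show False using G(2) inj_onD[OF facet_seq_inj(1), of i j] by simp
      qed
      then obtain G where G: "G \<in> ridges" "F' \<subseteq> G" "G \<notin> \<sigma> ` {..<n}" by (elim bexE conjE)
      have "F \<in> S" using F by simp
      moreover have "F \<subseteq> G" using F'(2) G(2) by (rule subset_trans)
      ultimately show ?thesis using G(1,3) by (intro CollectI conjI bexI[of _ G])
    qed
  qed
qed

end

text \<open>The sequence is grown from the root. A path in \<open>T\<close> from
  \<open>\<Delta>\<close> to a facet not yet reached has an arc leaving the set of reached facets,
  and its ridge is free because the facet on the near side has been removed already.\<close>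

lemma facet_seq_exists:
  assumes T: "spanning_tree (facets d S) (dual_arcs d S) T" and \<Delta>: "\<Delta> \<in> facets d S"
  obtains n \<sigma> \<Sigma> where "facet_seq \<Delta> n \<sigma> \<Sigma>" "seq_tree n \<sigma> \<subseteq> T"
proof -
  let ?P = "\<lambda>m \<sigma> \<Sigma>. collapse_seq (int d) (S - {\<Delta>}) m \<sigma> \<Sigma> \<and>
     (\<forall>i<m. \<exists>A B. {A, B} \<in> T \<and> \<sigma> i \<subseteq> A \<and> \<sigma> i \<subseteq> B)"
  let ?R = "{(x, y). {x, y} \<in> T}"
  have Td: "T \<subseteq> dual_arcs d S" by (rule spanning_treeD(1)[OF T])
  have ex: "\<exists>\<sigma> \<Sigma>. ?P m \<sigma> \<Sigma>" if "m < card (facets d S)" for m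
    using that
  proof (induction m)
    case 0
    show ?case by (auto simp: collapse_seq_def)
  next
    case (Suc m)
    have "m < card (facets d S)" using Suc(2) by simp
    from Suc(1)[OF this] obtain \<sigma> \<Sigma> where P: "?P m \<sigma> \<Sigma>" by blast
    then have cs: "\<And>i. i < m \<Longrightarrow> \<sigma> i \<in> S - {\<Delta>} \<and> \<Sigma> i \<in> S - {\<Delta>} \<and> aff_dim (\<Sigma> i) = int d \<and>
        (\<forall>G\<in>S - {\<Delta>}. \<sigma> i \<subseteq> G \<longrightarrow> G = \<sigma> i \<or> G \<in> \<Sigma> ` {..i})"
      unfolding collapse_seq_def by blast
    let ?Q = "insert \<Delta> (\<Sigma> ` {..<m})"
    have Q: "?Q \<subseteq> facets d S" using \<Delta> cs by (auto simp: faces_of_dim_def)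
    have "card ?Q \<le> Suc m"
      by (metis card_image_le card_insert_le_m1 card_lessThan diff_Suc_1 finite_lessThan zero_less_Suc)
    then have "?Q \<noteq> facets d S" using Suc(2) by auto
    then obtain v where v: "v \<in> facets d S" "v \<notin> ?Q" using Q by blast
    have "(\<Delta>, v) \<in> ?R\<^sup>*" by (rule spanning_treeD(2)[OF T \<Delta> v(1)])
    then have "\<exists>A B. A \<in> ?Q \<and> B \<notin> ?Q \<and> {A, B} \<in> T"
      using v(2)
    proof (induction rule: rtrancl_induct)
      case (step y z)
      show ?case
      proof (cases "y \<in> ?Q")
        case True
        then show ?thesis using step(2,4) by blast
      next
        case False
        then show ?thesis using step(3) by blast
      qed
    qed (use \<open>v \<notin> ?Q\<close> in simp)
    then obtain A B where AB: "A \<in> ?Q" "B \<notin> ?Q" "{A, B} \<in> T" by blast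
    obtain G where G: "A \<in> facets d S" "B \<in> facets d S" "A \<noteq> B" "G \<in> ridges" "G \<subseteq> A" "G \<subseteq> B"
      by (rule ridge_of_dual_arc[of A B]) (use AB Td in blast)+
    have Gd: "G \<in> S" "aff_dim G = int d - 1" using ridgeD[OF G(4)] by auto
    have "G \<noteq> {}" using Gd(2) d2 by auto
    have "G \<notin> \<sigma> ` {..<m}"
    proof
      assume "G \<in> \<sigma> ` {..<m}"
      then obtain i where i: "i < m" "G = \<sigma> i" by auto
      have "B \<in> S - {\<Delta>}" "B \<noteq> G" using AB facetD[OF G(2)] Gd by auto
      then have "B \<in> \<Sigma> ` {..i}" using cs[OF i(1)] i(2) G(6) by blast
      then show False using AB(2) i(1) by auto
    qed
    have "collapse_seq (int d) (S - {\<Delta>}) (Suc m) (\<sigma>(m := G)) (\<Sigma>(m := B))"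
    proof (rule collapse_seq_snoc)
      show "H = G \<or> H = B \<or> H \<in> \<Sigma> ` {..<m}" if H: "H \<in> S - {\<Delta>}" "G \<subseteq> H" for H
      proof (cases "aff_dim H = int d")
        case True
        then have "H \<in> facets d S" using H by (auto simp: faces_of_dim_def)
        then have "H = A \<or> H = B" using two_facets_of_ridge[OF G(4,1,2) _ G(5,6) H(2) G(3)] by blast
        then show ?thesis using AB(1) H(1) by auto
      next
        case False
        then have "aff_dim G = aff_dim H" using dim_mono[OF H(2)] dim_le[of H] Gd H by auto
        then show ?thesis using dim_eq[OF Gd(1) _ H(2)] H(1) by auto
      qed
      show "G \<in> S - {\<Delta>}" using Gd facetD[OF \<Delta>] by auto
    qed (use P AB G Gd \<open>G \<noteq> {}\<close> \<open>G \<notin> \<sigma> ` {..<m}\<close> facetD[OF G(2)] in auto)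
    moreover have "\<forall>i<Suc m. \<exists>A B. {A, B} \<in> T \<and> (\<sigma>(m := G)) i \<subseteq> A \<and> (\<sigma>(m := G)) i \<subseteq> B"
      using P AB(3) G(5,6) by (auto simp: less_Suc_eq)
    ultimately show ?case by blast
  qed
  \<comment> \<open>One facet is the root, so a sequence of this length reaches all the
    others.\<close>
  let ?n = "card (facets d S) - 1"
  have "card (facets d S) > 0" using \<Delta> fin_facets card_gt_0_iff by blast
  then obtain \<sigma> \<Sigma> where P: "?P ?n \<sigma> \<Sigma>" using ex[of ?n] by auto
  then have cs: "\<And>i. i < ?n \<Longrightarrow> \<sigma> i \<in> S - {\<Delta>} \<and> \<Sigma> i \<in> S - {\<Delta>} \<and> aff_dim (\<Sigma> i) = int d \<and> \<Sigma> i \<notin> \<Sigma> ` {..<i}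
     \<and> aff_dim (\<sigma> i) = int d - 1"
    unfolding collapse_seq_def by blast
  have "inj_on \<Sigma> {..<?n}"
  proof (rule linorder_inj_onI')
    fix i j :: nat assume "i \<in> {..<?n}" "j \<in> {..<?n}" "i < j"
    then show "\<Sigma> i \<noteq> \<Sigma> j" using cs[of j] by (metis image_eqI lessThan_iff)
  qed
  then have "card (\<Sigma> ` {..<?n}) = card (facets d S - {\<Delta>})" using \<Delta> fin_facets by (simp add: card_image)
  moreover have "\<Sigma> ` {..<?n} \<subseteq> facets d S - {\<Delta>}" using cs by (auto simp: faces_of_dim_def)
  ultimately have "\<Sigma> ` {..<?n} = facets d S - {\<Delta>}" using fin_facets by (simp add: card_subset_eq)
  then have fs: "facet_seq \<Delta> ?n \<sigma> \<Sigma>" using P \<Delta> unfolding facet_seq_def by blast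
  moreover have "seq_tree ?n \<sigma> \<subseteq> T"
  proof
    fix e assume "e \<in> seq_tree ?n \<sigma>"
    then obtain A B i where e: "e = {A, B}" "A \<in> facets d S" "B \<in> facets d S" "A \<noteq> B" "i < ?n"
      "\<sigma> i \<subseteq> A" "\<sigma> i \<subseteq> B"
      by (rule seq_treeE)
    have ri: "\<sigma> i \<in> ridges" using cs[OF e(5)] by (auto simp: faces_of_dim_def)
    obtain A' B' where AB': "{A', B'} \<in> T" "\<sigma> i \<subseteq> A'" "\<sigma> i \<subseteq> B'" using P e(5) by blast
    have f: "A' \<in> facets d S" "B' \<in> facets d S" "A' \<noteq> B'"
      using ridge_of_dual_arc[of A' B'] AB'(1) Td by (metis subsetD)+
    have "A' = A \<or> A' = B" "B' = A \<or> B' = B"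
      using two_facets_of_ridge[OF ri e(2,3) f(1) e(6,7) AB'(2) e(4)]
        two_facets_of_ridge[OF ri e(2,3) f(2) e(6,7) AB'(3) e(4)] by auto
    then have "{A', B'} = {A, B}" using f(3) by auto
    then show "e \<in> T" using AB' e(1) by simp
  qed
  ultimately show thesis by (rule that)
qed

text \<open>The tree of a sequence grown inside \<open>T\<close> spans already, so by minimality of
  spanning trees it is all of \<open>T\<close>.\<close>

lemma collapses_onto_cotree:
  assumes T: "spanning_tree (facets d S) (dual_arcs d S) T" and \<Delta>: "\<Delta> \<in> facets d S"
  shows "collapses_onto (S - {\<Delta>}) (cotree_complex d S T)"
proof -
  obtain n \<sigma> \<Sigma> where fs: "facet_seq \<Delta> n \<sigma> \<Sigma>" "seq_tree n \<sigma> \<subseteq> T" by (rule facet_seq_exists[OF T \<Delta>])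
  have Td: "T \<subseteq> dual_arcs d S" by (rule spanning_treeD(1)[OF T])
  have "T \<subseteq> seq_tree n \<sigma>"
  proof
    fix e assume e: "e \<in> T"
    then have "e \<in> dual_arcs d S" using Td by blast
    then obtain A B where AB: "e = {A, B}" "A \<in> facets d S" "B \<in> facets d S" "A \<noteq> B"
      unfolding dual_arcs_def mem_Collect_eq by (elim exE conjE) (rule that)
    have "{A, B} \<in> T" using e AB(1) by simp
    have "{A, B} \<in> seq_tree n \<sigma>"
      by (rule spanning_tree_minimal[OF T fs(2) spanning_treeD(2)[OF seq_tree_spanning[OF fs(1)]]
        \<open>{A, B} \<in> T\<close> AB(4,2,3)])
    then show "e \<in> seq_tree n \<sigma>" using AB(1) by simp
  qed
  then have "T = seq_tree n \<sigma>" using fs(2) by blast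
  then have "cotree_complex d S T = S - {\<Delta>} - \<sigma> ` {..<n} - \<Sigma> ` {..<n}" using cotree_seq_tree[OF fs(1)] by simp
  moreover have "collapses_onto (S - {\<Delta>}) (S - {\<Delta>} - \<sigma> ` {..<n} - \<Sigma> ` {..<n})"
  proof (rule collapse_dim_star_onto[OF collapse_seq_collapse_dim])
    show "collapse_seq (int d) (S - {\<Delta>}) n \<sigma> \<Sigma>" using fs(1) by (simp only: facet_seq_def)
  qed blast
  ultimately show ?thesis by simp
qed

text \<open>After sorting, the collapses of dimension \<open>d\<close> come first, and they use up
  all facets but \<open>\<Delta>\<close> since \<open>C\<close> contains none.\<close>

lemma collapse_facet_seq:
  assumes \<Delta>: "\<Delta> \<in> facets d S" and C: "collapses_onto (S - {\<Delta>}) C" "has_dim C (int d - 2)"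
  obtains n \<sigma> \<Sigma> where "facet_seq \<Delta> n \<sigma> \<Sigma>" "collapses_onto (S - {\<Delta>} - \<sigma> ` {..<n} - \<Sigma> ` {..<n}) C"
proof -
  obtain C' where C': "(collapse_dim (int d))\<^sup>*\<^sup>* (S - {\<Delta>}) C'" "collapses_onto C' C" "\<And>F. F \<in> C' \<Longrightarrow> aff_dim F < int d"
  proof (rule collapse_sort[OF C(1), of "int d"])
    show "aff_dim F \<le> int d" if "F \<in> S - {\<Delta>}" for F using that dim_le[of F] by blast
    show "aff_dim F < int d" if "F \<in> C" for F using that C(2) unfolding has_dim_def by force
  qed (auto intro: that)
  obtain n \<sigma> \<Sigma> where cs: "collapse_seq (int d) (S - {\<Delta>}) n \<sigma> \<Sigma>" "C' = S - {\<Delta>} - \<sigma> ` {..<n} - \<Sigma> ` {..<n}"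
    by (rule collapse_dim_collapse_seq[OF C'(1)]) auto
  have dims: "\<And>i. i < n \<Longrightarrow> \<sigma> i \<in> S - {\<Delta>} \<and> \<Sigma> i \<in> S - {\<Delta>} \<and> aff_dim (\<Sigma> i) = int d \<and> aff_dim (\<sigma> i) = int d - 1"
    using cs(1) unfolding collapse_seq_def by blast
  have "facets d S - {\<Delta>} \<subseteq> \<Sigma> ` {..<n}"
  proof
    fix D assume D: "D \<in> facets d S - {\<Delta>}"
    then have "aff_dim D = int d" "D \<in> S" using facetD by blast+
    then have "D \<notin> C'" "D \<notin> \<sigma> ` {..<n}" using C'(3)[of D] dims by auto
    then show "D \<in> \<Sigma> ` {..<n}" using D cs(2) \<open>D \<in> S\<close> by blast
  qed
  moreover have "\<Sigma> ` {..<n} \<subseteq> facets d S - {\<Delta>}" using dims by (auto simp: faces_of_dim_def)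
  ultimately have "facet_seq \<Delta> n \<sigma> \<Sigma>" using cs(1) \<Delta> unfolding facet_seq_def by blast
  then show thesis using that C'(2) cs(2) by blast
qed

lemma collapse_spanning_tree:
  assumes \<Delta>: "\<Delta> \<in> facets d S" and C: "collapses_onto (S - {\<Delta>}) C" "has_dim C (int d - 2)"
  obtains T where "spanning_tree (facets d S) (dual_arcs d S) T" "collapses_onto (cotree_complex d S T) C"
proof -
  obtain n \<sigma> \<Sigma> where 1: "facet_seq \<Delta> n \<sigma> \<Sigma>" "collapses_onto (S - {\<Delta>} - \<sigma> ` {..<n} - \<Sigma> ` {..<n}) C"
    by (rule collapse_facet_seq[OF assms])
  then show thesis using that[OF seq_tree_spanning[OF 1(1)]] cotree_seq_tree[OF 1(1)] by simp
qed

lemma collapses_onto_trans: "\<lbrakk>collapses_onto A B; collapses_onto B C\<rbrakk> \<Longrightarrow> collapses_onto A C"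
  unfolding collapses_onto_def by simp

end

section \<open>Collapses and contractibility\<close>

context simpl_complex
begin

lemma closed_Union: "C \<subseteq> S \<Longrightarrow> closed (\<Union>C)"
  by (intro closed_Union) (use fin finite_subset compactS compact_imp_closed in blast)+

text \<open>\<open>F \<inter> G\<close> is a face of \<open>F\<close> that meets the relative
  interior of \<open>F\<close>, so it is \<open>F\<close>. Used throughout to pass from one point of
  \<open>F\<close> to all of it.\<close>

lemma rel_interior_meets:
  assumes "F \<in> S" "G \<in> S" "x \<in> rel_interior F" "x \<in> G" shows "F \<subseteq> G"
proof -
  have "F \<inter> G face_of F" using inter_face assms by blast
  then have "F \<subseteq> F \<inter> G"
    by (rule subset_of_face_of) (use assms rel_interior_subset in blast)+
  then show ?thesis by blast
qed

lemma carrier_exists: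
  assumes "x \<in> \<Union>S" obtains F where "F \<in> S" "x \<in> rel_interior F"
proof -
  have "finite {F \<in> S. x \<in> F}" "{F \<in> S. x \<in> F} \<noteq> {}" using fin assms by auto
  then obtain F where F: "F \<in> S" "x \<in> F" "\<And>G. \<lbrakk>G \<in> S; x \<in> G; G \<subseteq> F\<rbrakk> \<Longrightarrow> G = F"
    using finite_has_minimal[of "{F \<in> S. x \<in> F}"] by blast
  have "F \<noteq> {}" using F by blast
  have "x \<notin> rel_frontier F"
  proof
    assume "x \<in> rel_frontier F"
    then obtain G where "G face_of F" "G \<noteq> F" "x \<in> G"
      using rel_frontier_of_polyhedron_alt[OF polytope_imp_polyhedron[OF polytopeS[OF F(1)]]] by auto
    then show False using F face_in face_of_imp_subset by blast
  qed
  then have "x \<in> rel_interior F"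
    using F(2) closure_subset[of F] by (auto simp: rel_frontier_def)
  then show thesis using that F by blast
qed

lemma collapse_dim_faces:
  assumes "collapse_dim k C D" "C \<subseteq> S" "\<And>F G. \<lbrakk>F \<in> C; G \<in> S; G \<subseteq> F\<rbrakk> \<Longrightarrow> G \<in> C"
    "F \<in> D" "G \<in> S" "G \<subseteq> F"
  shows "G \<in> D"
proof -
  obtain s t where st: "s \<in> C" "t \<in> C" "s \<subseteq> t" "\<And>G. \<lbrakk>G \<in> C; s \<subseteq> G\<rbrakk> \<Longrightarrow> G = s \<or> G = t" "D = C - {s, t}"
    using assms(1) unfolding collapse_dim_def by metis
  have "F \<in> C" "F \<noteq> s" "F \<noteq> t" using st(5) assms(4) by auto
  then have "\<not> s \<subseteq> F" using st(4) by blast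
  then have "\<not> s \<subseteq> G" using assms(6) by blast
  then have "G \<noteq> s" "G \<noteq> t" using st(3) by auto
  then show ?thesis using assms(3)[OF \<open>F \<in> C\<close> assms(5,6)] st(5) by blast
qed

text \<open>The remaining proper faces form a horn. It is star-shaped from the vertex
  \<open>v\<close> of \<open>t\<close> opposite to \<open>s\<close>, hence contractible; being also
  a finite union of compact convex sets, it is an absolute retract.\<close>

lemma horn_retract:
  assumes "t \<in> S" "s \<in> S" "s \<noteq> {}" "s \<subseteq> t" "aff_dim t = aff_dim s + 1"
  shows "\<Union>{F \<in> S. F \<subseteq> t \<and> F \<noteq> t \<and> F \<noteq> s} retract_of t" (is "\<Union>?H retract_of t")
proof -
  obtain n where "n simplex t" using simplexS[OF assms(1)] by blast
  obtain C where C: "finite C" "int (card C) = n + 1"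
    "bij_betw (\<lambda>A. convex hull A) (Pow C) {F. F face_of t}"
    "\<And>A B. \<lbrakk>A \<subseteq> C; B \<subseteq> C\<rbrakk> \<Longrightarrow> convex hull A \<subseteq> convex hull B \<longleftrightarrow> A \<subseteq> B"
    "\<And>A. A \<subseteq> C \<Longrightarrow> aff_dim (convex hull A) = int (card A) - 1"
    by (rule simplex_faces_boolean[OF \<open>n simplex t\<close>]) (rule that)
  have face: "G \<in> S \<and> G \<subseteq> t \<longleftrightarrow> G \<in> (\<lambda>A. convex hull A) ` Pow C" for G
    using C(3) assms(1) face_iff[of G t] face_in[of t G] face_of_imp_subset[of G t]
    unfolding bij_betw_def by blast
  obtain c where c: "c \<subseteq> C" "s = convex hull c" using face[of s] assms by blast
  obtain e where e: "e \<subseteq> C" "t = convex hull e" using face[of t] assms by blast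
  have "C \<subseteq> e"
  proof -
    have "convex hull C \<subseteq> t" using face[of "convex hull C"] by blast
    then show ?thesis using C(4)[of C e] e by blast
  qed
  then have tC: "t = convex hull C" using e by (metis subset_antisym)
  have "int (card C) = int (card c) + 1" using C(5)[OF c(1)] C(5)[of C] assms(5) c tC by simp
  then have "card (C - c) = 1" using c(1) C(1) by (simp add: card_Diff_subset finite_subset)
  then obtain v where v: "C - c = {v}" by (auto simp: card_1_singleton_iff)
  have Cv: "C = insert v c" "v \<notin> c" using v c(1) by auto
  have "c \<noteq> {}" using c assms(3) by auto
  have HD: "F \<in> ?H \<longleftrightarrow> (\<exists>A\<subseteq>C. A \<noteq> C \<and> A \<noteq> c \<and> F = convex hull A)" for F
  proof
    assume "F \<in> ?H"
    then obtain A where "A \<subseteq> C" "F = convex hull A" using face[of F] by blast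
    moreover have "F \<noteq> t" "F \<noteq> s" using \<open>F \<in> ?H\<close> by simp_all
    then have "A \<noteq> C" "A \<noteq> c" using \<open>F = convex hull A\<close> c(2) tC by metis+
    ultimately show "\<exists>A\<subseteq>C. A \<noteq> C \<and> A \<noteq> c \<and> F = convex hull A" by blast
  next
    assume "\<exists>A\<subseteq>C. A \<noteq> C \<and> A \<noteq> c \<and> F = convex hull A"
    then obtain A where A: "A \<subseteq> C" "A \<noteq> C" "A \<noteq> c" "F = convex hull A" by blast
    have "F \<noteq> t" using A tC C(4)[of C A] by (metis subset_antisym order_refl)
    moreover have "F \<noteq> s" using A c C(4)[of c A] C(4)[of A c] by (metis subset_antisym order_refl)
    moreover have "F \<in> S" "F \<subseteq> t" using face[of F] A by blast+
    ultimately show "F \<in> ?H" by blast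
  qed
  have vH: "v \<in> \<Union>?H"
  proof -
    have "{v} \<noteq> C" "{v} \<noteq> c" using Cv \<open>c \<noteq> {}\<close> by auto
    then have "convex hull {v} \<in> ?H" unfolding HD
      by (intro exI[of _ "{v}"] conjI refl) (simp_all add: Cv(1))
    then show ?thesis by auto
  qed
  have star: "closed_segment v x \<subseteq> \<Union>?H" if x: "x \<in> \<Union>?H" for x
  proof -
    obtain F where F: "F \<in> ?H" "x \<in> F" using x by (rule UnionE)
    obtain A where A: "A \<subseteq> C" "A \<noteq> C" "A \<noteq> c" "x \<in> convex hull A"
      using F(1,2) unfolding HD by (elim exE conjE) simp
    \<comment> \<open>Adding the apex to \<open>A\<close> gives all of \<open>C\<close> only if
      \<open>A\<close> is \<open>C\<close> or \<open>c\<close>.\<close>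
    have "insert v A \<noteq> C" using A(2,3) Cv by (metis insert_absorb insert_ident)
    moreover have "insert v A \<noteq> c" using Cv(2) by (metis insertI1)
    moreover have "insert v A \<subseteq> C" using A(1) Cv(1) by (metis insert_subset insertI1)
    ultimately have vA: "convex hull (insert v A) \<in> ?H"
      unfolding HD by (intro exI[of _ "insert v A"] conjI refl)
    have "closed_segment v x \<subseteq> convex hull (insert v A)"
      using A(4) hull_mono[of A "insert v A" convex]
      by (intro closed_segment_subset) (auto simp: hull_inc)
    then show ?thesis using vA by (rule order_trans[OF _ Union_upper])
  qed
  have sub: "\<Union>?H \<subseteq> t" by blast
  have finH: "finite ?H" using fin by simp
  have "ANR (\<Union>?H)"
    by (rule ANR_finite_Union_convex_closed[OF finH]) (use convexS compactS compact_imp_closed in blast)+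
  moreover have "contractible (\<Union>?H)"
    by (rule starlike_imp_contractible) (use vH star in \<open>unfold starlike_def, blast\<close>)
  ultimately have "AR (\<Union>?H)" using vH by (auto simp: AR_ANR)
  moreover have "closed (\<Union>?H)" by (rule closed_Union) blast
  ultimately show ?thesis using sub by (intro AR_imp_retract) (auto intro: closed_subset)
qed

lemma retract_glue:
  fixes A B :: "'a set"
  assumes "H retract_of A" "closed A" "closed B" "A \<inter> B \<subseteq> H" "H \<subseteq> B"
  shows "B retract_of (A \<union> B)"
proof -
  obtain r where r: "continuous_on A r" "r \<in> A \<rightarrow> H" "\<And>x. x \<in> H \<Longrightarrow> r x = x" "H \<subseteq> A"
    using assms(1) unfolding retract_of_def retraction_def by blast
  let ?g = "\<lambda>x. if x \<in> A then r x else x"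
  have "continuous_on (A \<union> B) ?g"
  proof (rule continuous_on_cases[OF assms(2,3) r(1) continuous_on_id])
    show "\<forall>x. x \<in> A \<and> x \<notin> A \<or> x \<in> B \<and> x \<in> A \<longrightarrow> r x = x" using r(3) assms(4) by blast
  qed
  moreover have "?g \<in> A \<union> B \<rightarrow> B"
  proof (rule Pi_I)
    fix x assume "x \<in> A \<union> B"
    moreover have "r x \<in> B" if "x \<in> A" using that r(2) assms(5) by blast
    ultimately show "?g x \<in> B" by auto
  qed
  moreover have "?g x = x" if "x \<in> B" for x using that r(3) assms(4) by auto
  ultimately show ?thesis unfolding retract_of_def retraction_def by blast
qed

text \<open>The space changes only inside \<open>t\<close>, which retracts onto its horn. Extended
  by the identity this retracts the old space onto the new one, and retracts of contractible spaces
  are contractible.\<close>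

lemma collapse_dim_contractible:
  assumes "collapse_dim k C D" "C \<subseteq> S" "\<And>F G. \<lbrakk>F \<in> C; G \<in> S; G \<subseteq> F\<rbrakk> \<Longrightarrow> G \<in> C"
    "contractible (\<Union>C)"
  shows "contractible (\<Union>D)"
proof -
  obtain s t where st: "s \<in> C" "t \<in> C" "s \<noteq> {}" "aff_dim t = k" "aff_dim s = k - 1" "s \<subseteq> t"
    "\<And>G. \<lbrakk>G \<in> C; s \<subseteq> G\<rbrakk> \<Longrightarrow> G = s \<or> G = t" "D = C - {s, t}"
    using assms(1) unfolding collapse_dim_def by metis
  have inS: "s \<in> S" "t \<in> S" "D \<subseteq> S" using st(1,2,8) assms(2) by auto
  let ?H = "{F \<in> S. F \<subseteq> t \<and> F \<noteq> t \<and> F \<noteq> s}"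
  have R: "\<Union>?H retract_of t" using horn_retract[OF inS(2,1) st(3,6)] st(4,5) by simp
  have 1: "t \<inter> \<Union>D \<subseteq> \<Union>?H"
  proof (rule subsetI, elim IntE UnionE)
    fix x F assume x: "x \<in> t" "x \<in> F" "F \<in> D"
    have F: "F \<inter> t \<in> S" using inter_in x(3) inS by blast
    have "F \<inter> t \<in> D" by (rule collapse_dim_faces[OF assms(1,2) _ x(3) F]) (use assms(3) in blast)+
    then have "F \<inter> t \<in> ?H" using F st(8) by blast
    then show "x \<in> \<Union>?H" using x by blast
  qed
  have 2: "\<Union>?H \<subseteq> \<Union>D"
  proof (rule subsetI, elim UnionE CollectE conjE)
    fix x F assume F: "x \<in> F" "F \<in> S" "F \<subseteq> t" "F \<noteq> t" "F \<noteq> s"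
    then have "F \<in> D" using assms(3)[OF st(2), of F] st(8) by blast
    then show "x \<in> \<Union>D" using F by blast
  qed
  have "\<Union>D retract_of (t \<union> \<Union>D)"
    by (rule retract_glue[OF R compact_imp_closed[OF compactS[OF inS(2)]] closed_Union[OF inS(3)] 1 2])
  moreover have "t \<union> \<Union>D = \<Union>C"
  proof -
    have "C = insert t (insert s D)" using st(1,2,8) by auto
    then have "\<Union>C = t \<union> (s \<union> \<Union>D)" by simp
    then show ?thesis using st(6) by blast
  qed
  ultimately show ?thesis using retract_of_contractible assms(4) by metis
qed

lemma collapses_onto_contractible:
  assumes "collapses_onto C D" "C \<subseteq> S" "\<And>F G. \<lbrakk>F \<in> C; G \<in> S; G \<subseteq> F\<rbrakk> \<Longrightarrow> G \<in> C"
    "contractible (\<Union>C)"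
  shows "contractible (\<Union>D)"
proof -
  have "D \<subseteq> S \<and> (\<forall>F\<in>D. \<forall>G\<in>S. G \<subseteq> F \<longrightarrow> G \<in> D) \<and> contractible (\<Union>D)"
    using assms(1) unfolding collapses_onto_def
  proof (induction rule: rtranclp_induct)
    case base
    show ?case using assms(2-4) by simp
  next
    case (step D E)
    then have IH: "D \<subseteq> S" "contractible (\<Union>D)" "\<And>F G. \<lbrakk>F \<in> D; G \<in> S; G \<subseteq> F\<rbrakk> \<Longrightarrow> G \<in> D"
      by simp_all
    obtain k where k: "collapse_dim k D E" using step(2) unfolding elementary_collapse_iff[OF IH(1)] ..
    have "E \<subseteq> S" using IH(1) collapse_dim_subset[OF k] by (rule subset_trans[rotated])
    moreover have "\<forall>F\<in>E. \<forall>G\<in>S. G \<subseteq> F \<longrightarrow> G \<in> E"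
      by (intro ballI impI) (rule collapse_dim_faces[OF k IH(1,3)])
    moreover have "contractible (\<Union>E)"
      by (rule collapse_dim_contractible[OF k IH(1,3,2)])
    ultimately show ?case by simp
  qed
  then show ?thesis by (elim conjE)
qed

end

text \<open>\<open>U\<close> is the unit ball of a \<open>(d + 1)\<close>-dimensional subspace of
  \<open>'a\<close>, so the point is that \<open>'a\<close> has room for it. Otherwise the sphere of
  dimension \<open>DIM('a)\<close> would embed in the \<open>d\<close>-sphere and hence, through
  \<open>X\<close>, in \<open>'a\<close>, which is impossible.\<close>

lemma sphere_model:
  fixes X :: "'a::euclidean_space set"
  assumes "top_of_set X homeomorphic_space nsphere d"
  obtains U :: "'a set" where "convex U" "bounded U" "aff_dim U = int d + 1" "X homeomorphic rel_frontier U"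
proof -
  let ?n = "DIM('a)"
  have "d < ?n"
  proof (rule ccontr)
    assume "\<not> d < ?n"
    then have le: "?n \<le> d" by simp
    \<comment> \<open>The standard sphere of dimension \<open>?n\<close> is realised as the unit
      sphere of \<open>'a \<times> real\<close>.\<close>
    obtain f g where fg: "homeomorphic_maps (nsphere (DIM('a \<times> real) - 1)) (top_of_set (sphere 0 1 \<inter> span Basis)) (f :: _ \<Rightarrow> 'a \<times> real) g"
      by (rule homeomorphic_maps_nsphere_euclidean_sphere[of "Basis :: ('a \<times> real) set" "DIM('a \<times> real)"])
        (auto simp: independent_Basis orthogonal_Basis intro: that)
    then have fg: "homeomorphic_maps (nsphere ?n) (top_of_set (sphere 0 1)) f g" by simp
    obtain h k where hk: "homeomorphic_maps (top_of_set X) (nsphere d) h k"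
      using assms unfolding homeomorphic_space_def by blast
    have sub: "topspace (nsphere ?n) \<subseteq> topspace (nsphere d)"
    proof
      fix x :: "nat \<Rightarrow> real" assume x: "x \<in> topspace (nsphere ?n)"
      have "(\<Sum>i\<le>d. (x i)\<^sup>2) = (\<Sum>i\<le>?n. (x i)\<^sup>2)"
        by (rule sum.mono_neutral_right) (use x le in \<open>auto simp: nsphere\<close>)
      then show "x \<in> topspace (nsphere d)" using x le by (auto simp: nsphere)
    qed
    have "nsphere ?n = subtopology (nsphere d) (topspace (nsphere ?n))"
      using sub by (simp add: nsphere subtopology_subtopology inf.absorb_iff2)
    then have ck: "continuous_map (nsphere ?n) (top_of_set X) k"
      using hk continuous_map_from_subtopology unfolding homeomorphic_maps_def by metis
    have "continuous_map (top_of_set (sphere 0 1)) (top_of_set X) (k \<circ> g)"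
      by (rule continuous_map_compose[OF _ ck]) (use fg in \<open>auto simp: homeomorphic_maps_def\<close>)
    then have cont: "continuous_on (sphere 0 1) (k \<circ> g)" by (simp add: continuous_map_in_subtopology)
    have "inj_on g (sphere 0 1)"
      using fg unfolding homeomorphic_maps_def by (metis inj_on_inverseI topspace_euclidean_subtopology)
    moreover have "inj_on k (topspace (nsphere d))"
      using hk unfolding homeomorphic_maps_def by (metis inj_on_inverseI)
    moreover have "g ` sphere 0 1 \<subseteq> topspace (nsphere d)"
      using fg sub unfolding homeomorphic_maps_def continuous_map_def by auto
    ultimately have "inj_on (k \<circ> g) (sphere 0 1)" by (metis comp_inj_on inj_on_subset)
    then have "DIM('a \<times> real) \<le> DIM('a)" using no_embedding_sphere_lowdim[OF cont] by simp
    then show False by simp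
  qed
  then obtain B where B: "B \<subseteq> (Basis :: 'a set)" "card B = d + 1"
    using obtain_subset_with_card_n[of "d + 1" "Basis :: 'a set"] by (metis Suc_eq_plus1 Suc_leI)
  have iB: "independent B" "pairwise orthogonal B" "\<And>u. u \<in> B \<Longrightarrow> norm u = 1"
    using B independent_Basis independent_mono orthogonal_Basis pairwise_subset by auto
  obtain f g where "homeomorphic_maps (nsphere (d + 1 - 1)) (top_of_set (sphere 0 1 \<inter> span B)) f g"
    by (rule homeomorphic_maps_nsphere_euclidean_sphere[OF iB(1,2) B(2) _ iB(3)]) auto
  then have "nsphere d homeomorphic_space top_of_set (sphere 0 1 \<inter> span B)"
    unfolding homeomorphic_space_def by auto
  then have hom: "X homeomorphic sphere 0 1 \<inter> span B"
    using assms homeomorphic_space_trans homeomorphic_space_iff_homeomorphic by blast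
  let ?U = "cball 0 1 \<inter> span B"
  have "0 \<in> interior (cball (0::'a) 1) \<inter> span B" using span_zero[of B] by simp
  then have ne: "interior (cball 0 1) \<inter> span B \<noteq> {}" by blast
  show thesis
  proof
    show "convex ?U" by (simp add: convex_Int subspace_imp_convex)
    show "bounded ?U" by (simp add: bounded_Int)
    have "rel_frontier ?U = sphere 0 1 \<inter> span B"
      using convex_affine_rel_frontier_Int[OF convex_cball subspace_imp_affine[OF subspace_span] ne] by simp
    then show "X homeomorphic rel_frontier ?U" using hom by simp
    have "aff_dim ?U = aff_dim (span B)"
      using aff_dim_convex_Int_nonempty_interior[of "span B" "cball 0 1"] ne
      by (simp add: Int_commute subspace_imp_convex)
    also have "\<dots> = int (dim (span B))" by (simp add: aff_dim_subspace)
    also have "\<dots> = int d + 1" using B(2) iB(1) by (simp add: dim_eq_card_independent)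
    finally show "aff_dim ?U = int d + 1" .
  qed
qed

lemma homeomorphismD:
  assumes "homeomorphism A B f g"
  shows "continuous_on A f" "continuous_on B g" "f ` A = B" "g ` B = A"
    "x \<in> A \<Longrightarrow> g (f x) = x" "y \<in> B \<Longrightarrow> f (g y) = y" "inj_on f A" "inj_on g B"
    "x \<in> A \<Longrightarrow> f x \<in> B" "y \<in> B \<Longrightarrow> g y \<in> A"
  using assms unfolding homeomorphism_def by (blast, blast, blast, blast, blast, blast,
    metis inj_on_inverseI, metis inj_on_inverseI, blast, blast)

locale sphere_complex = simpl_complex S for S :: "'a::euclidean_space set set" +
  fixes d :: nat
  assumes sphere: "top_of_set (\<Union>S) homeomorphic_space nsphere d"
    and d2: "d \<ge> 2"
begin

text \<open>A punctured sphere is a linear space: this supplies the charts in which invariance of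
  domain is applied.\<close>

lemma model_space:
  obtains L :: "'a set" where "subspace L" "dim L = d" "\<And>p. p \<in> \<Union>S \<Longrightarrow> (\<Union>S - {p}) homeomorphic L"
proof -
  obtain U :: "'a set" where U: "convex U" "bounded U" "aff_dim U = int d + 1" "\<Union>S homeomorphic rel_frontier U"
    by (rule sphere_model[OF sphere])
  have "int d + 1 \<le> int DIM('a)" using U(3) aff_dim_le_DIM[of U] by simp
  then obtain L :: "'a set" where L: "subspace L" "dim L = d"
    using choose_subspace_of_subspace[of d "UNIV :: 'a set"] by (auto simp: dim_UNIV)
  have "(\<Union>S - {p}) homeomorphic L" if "p \<in> \<Union>S" for p
  proof -
    obtain f g where fg: "homeomorphism (\<Union>S) (rel_frontier U) f g" using U(4) unfolding homeomorphic_def by blast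
    have fp: "f p \<in> rel_frontier U" using fg that unfolding homeomorphism_def by blast
    have "homeomorphism (\<Union>S - {p}) (rel_frontier U - {f p}) f g"
    proof (rule homeomorphism_of_subsets[OF fg])
      have "inj_on f (\<Union>S)" using fg unfolding homeomorphism_def by (metis inj_on_inverseI)
      then have "f ` (\<Union>S - {p}) = f ` \<Union>S - f ` {p}" using that by (intro inj_on_image_set_diff[of f "\<Union>S"]) auto
      then show "f ` (\<Union>S - {p}) = rel_frontier U - {f p}" using fg by (auto simp: homeomorphism_def)
    qed auto
    then have "(\<Union>S - {p}) homeomorphic (rel_frontier U - {f p})" unfolding homeomorphic_def by blast
    also have "\<dots> homeomorphic L"
      by (rule homeomorphic_punctured_sphere_affine_gen[OF U(1,2) fp subspace_imp_affine[OF L(1)]])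
        (simp add: U(3) L aff_dim_subspace)
    finally show ?thesis .
  qed
  then show thesis using that L by blast
qed

lemma compact_U: "compact (\<Union>S)"
  using fin compactS by (intro compact_Union) auto

lemma other_point:
  obtains p where "p \<in> \<Union>S" "p \<noteq> x"
proof -
  obtain U :: "'a set" where U: "convex U" "bounded U" "aff_dim U = int d + 1" "\<Union>S homeomorphic rel_frontier U"
    by (rule sphere_model[OF sphere])
  obtain f g where fg: "homeomorphism (\<Union>S) (rel_frontier U) f g" using U(4) unfolding homeomorphic_def by blast
  have "\<Union>S \<noteq> {}"
  proof
    assume "\<Union>S = {}"
    then have "top_of_set (\<Union>S) = trivial_topology"
      using subtopology_empty_iff_trivial[of "euclidean :: 'a topology"] by metis
    then show False using homeomorphic_empty_space[OF sphere] nonempty_nsphere[of d] by blast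
  qed
  then have "rel_frontier U \<noteq> {}" using fg unfolding homeomorphism_def by blast
  then obtain y z where yz: "y \<in> rel_frontier U" "z \<in> rel_frontier U" "y \<noteq> z"
    using rel_frontier_not_sing[OF U(2)] by blast
  then have "g y \<in> \<Union>S" "g z \<in> \<Union>S" "g y \<noteq> g z" using fg unfolding homeomorphism_def by (blast, blast, metis)
  then show thesis using that by metis
qed

lemma chart:
  assumes "x \<in> \<Union>S"
  obtains p and L :: "'a set" and \<phi> \<psi> where "p \<in> \<Union>S" "p \<noteq> x" "subspace L" "dim L = d" "homeomorphism (\<Union>S - {p}) L \<phi> \<psi>"
proof -
  obtain p where p: "p \<in> \<Union>S" "p \<noteq> x" by (rule other_point)
  obtain L :: "'a set" where L: "subspace L" "dim L = d" "\<And>p. p \<in> \<Union>S \<Longrightarrow> (\<Union>S - {p}) homeomorphic L"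
    by (rule model_space) (rule that)
  show thesis using L(3)[OF p(1)] that[OF p L(1,2)] unfolding homeomorphic_def by blast
qed

lemma openin_minus: "openin (top_of_set (\<Union>S)) (\<Union>S - {p})"
  by (simp add: openin_delete)

text \<open>Invariance of domain with the sphere as target. An image that misses a point
  \<open>p\<close> is read in the chart on the complement of \<open>p\<close>; an image that misses
  none is the whole sphere.\<close>

lemma embedding_open:
  fixes h :: "'b::euclidean_space \<Rightarrow> 'a"
  assumes "openin (top_of_set V) O'" "affine V" "aff_dim V = int d" "continuous_on O' h" "inj_on h O'" "h ` O' \<subseteq> \<Union>S"
  shows "openin (top_of_set (\<Union>S)) (h ` O')"
proof (cases "h ` O' = \<Union>S")
  case False
  then obtain p where p: "p \<in> \<Union>S" "p \<notin> h ` O'" using assms by blast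
  obtain L :: "'a set" where L: "subspace L" "dim L = d" "\<And>p. p \<in> \<Union>S \<Longrightarrow> (\<Union>S - {p}) homeomorphic L"
    by (rule model_space) (rule that)
  obtain \<phi> \<psi> where h: "homeomorphism (\<Union>S - {p}) L \<phi> \<psi>"
    using L(3)[OF p(1)] unfolding homeomorphic_def by blast
  have im: "h ` O' \<subseteq> \<Union>S - {p}" using assms(6) p by blast
  have cont: "continuous_on O' (\<phi> \<circ> h)"
    by (intro continuous_on_compose assms(4) continuous_on_subset[OF homeomorphismD(1)[OF h] im])
  have into: "(\<phi> \<circ> h) ` O' \<subseteq> L"
    unfolding comp_def by (rule image_subsetI) (use im homeomorphismD(9)[OF h] in blast)
  have inj: "inj_on (\<phi> \<circ> h) O'"
    by (intro comp_inj_on assms(5) inj_on_subset[OF homeomorphismD(7)[OF h] im])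
  have "aff_dim L \<le> aff_dim V" using assms(3) L by (simp add: aff_dim_subspace)
  then have "openin (top_of_set L) ((\<phi> \<circ> h) ` O')"
    by (rule invariance_of_domain_affine_sets[OF assms(1,2) subspace_imp_affine[OF L(1)] _ cont into inj])
  then have "openin (top_of_set (\<Union>S - {p})) (\<psi> ` (\<phi> \<circ> h) ` O')"
    using homeomorphism_imp_open_map[OF homeomorphism_symD[OF h]] by blast
  moreover have "\<psi> ` (\<phi> \<circ> h) ` O' = h ` O'"
  proof -
    have "\<psi> (\<phi> (h x)) = h x" if "x \<in> O'" for x using homeomorphismD(5)[OF h, of "h x"] im that by blast
    then show ?thesis by (simp add: image_image)
  qed
  ultimately have "openin (top_of_set (\<Union>S - {p})) (h ` O')" by simp
  then show ?thesis by (rule openin_trans[OF _ openin_minus])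
next
  case True
  show ?thesis unfolding True by (rule openin_subtopology_self)
qed

text \<open>Invariance of domain with a piece of the sphere as source: after removing one point it
  is read in a chart, and the inverse chart embeds an open subset of a \<open>d\<close>-dimensional
  space into \<open>V\<close>.\<close>

lemma open_embedding:
  fixes V :: "'a set"
  assumes "openin (top_of_set (\<Union>S)) W" "x \<in> W" "affine V" "W \<subseteq> V" "aff_dim V \<le> int d"
  obtains W' where "x \<in> W'" "W' \<subseteq> W" "openin (top_of_set V) W'"
proof -
  have xS: "x \<in> \<Union>S" using openin_imp_subset[OF assms(1)] assms(2) by blast
  obtain p and L :: "'a set" and \<phi> \<psi> where c: "p \<in> \<Union>S" "p \<noteq> x" "subspace L" "dim L = d" "homeomorphism (\<Union>S - {p}) L \<phi> \<psi>"
    by (rule chart[OF xS])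
  let ?W = "W - {p}"
  have "?W \<subseteq> \<Union>S - {p}" using openin_imp_subset[OF assms(1)] by blast
  have "openin (top_of_set (\<Union>S - {p})) ?W"
    by (rule openin_subset_trans[OF openin_delete[OF assms(1)] \<open>?W \<subseteq> \<Union>S - {p}\<close> Diff_subset])
  then have o: "openin (top_of_set L) (\<phi> ` ?W)" using homeomorphism_imp_open_map[OF c(5)] by blast
  have eq: "\<psi> ` \<phi> ` ?W = ?W"
  proof -
    have "\<psi> (\<phi> y) = y" if "y \<in> ?W" for y
      using homeomorphismD(5)[OF c(5), of y] \<open>?W \<subseteq> \<Union>S - {p}\<close> that by blast
    then show ?thesis by (simp add: image_image)
  qed
  have sub: "\<phi> ` ?W \<subseteq> L" by (rule openin_imp_subset[OF o])
  have "openin (top_of_set V) (\<psi> ` \<phi> ` ?W)"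
  proof (rule invariance_of_domain_affine_sets[OF o subspace_imp_affine[OF c(3)] assms(3)])
    show "aff_dim V \<le> aff_dim L" using assms(5) c by (simp add: aff_dim_subspace)
    show "continuous_on (\<phi> ` ?W) \<psi>" by (rule continuous_on_subset[OF homeomorphismD(2)[OF c(5)] sub])
    show "\<psi> ` \<phi> ` ?W \<subseteq> V" using eq assms(4) by blast
    show "inj_on \<psi> (\<phi> ` ?W)" by (rule inj_on_subset[OF homeomorphismD(8)[OF c(5)] sub])
  qed
  then have "openin (top_of_set V) ?W" using eq by simp
  moreover have "x \<in> ?W" using assms(2) c(2) by simp
  ultimately show thesis by (intro that[of ?W] Diff_subset)
qed

end

section \<open>Simplicial spheres are pseudomanifolds\<close>

lemma affine_Times_UNIV:
  fixes H :: "'a::euclidean_space set"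
  assumes "affine H" "H \<noteq> {}"
  shows "affine (H \<times> (UNIV :: real set))" "aff_dim (H \<times> (UNIV :: real set)) = aff_dim H + 1"
proof -
  obtain a where a: "a \<in> H" using assms(2) by blast
  let ?V = "(+) (- a) ` H"
  have V: "subspace ?V" using affine_diffs_subspace[OF assms(1) a] by simp
  have VU: "subspace (?V \<times> (UNIV :: real set))" by (intro subspace_Times V subspace_UNIV)
  have eq: "H \<times> (UNIV :: real set) = (+) (a, 0) ` (?V \<times> UNIV)"
  proof (rule Set.set_eqI)
    fix z :: "'a \<times> real"
    have "z \<in> H \<times> UNIV \<longleftrightarrow> fst z \<in> H" by (cases z) auto
    also have "\<dots> \<longleftrightarrow> (- a + fst z, snd z) \<in> ?V \<times> UNIV" by (auto simp: image_iff)
    also have "\<dots> \<longleftrightarrow> z \<in> (+) (a, 0) ` (?V \<times> UNIV)"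
    proof
      assume "(- a + fst z, snd z) \<in> ?V \<times> UNIV"
      then have "(a, 0) + (- a + fst z, snd z) \<in> (+) (a, 0) ` (?V \<times> UNIV)" by (rule imageI)
      then show "z \<in> (+) (a, 0) ` (?V \<times> UNIV)" by (cases z) simp
    next
      assume "z \<in> (+) (a, 0) ` (?V \<times> UNIV)"
      then show "(- a + fst z, snd z) \<in> ?V \<times> UNIV" by (cases z) auto
    qed
    finally show "z \<in> H \<times> UNIV \<longleftrightarrow> z \<in> (+) (a, 0) ` (?V \<times> UNIV)" .
  qed
  show "affine (H \<times> (UNIV :: real set))"
    unfolding eq using subspace_imp_affine[OF VU] affine_translation by blast
  have "aff_dim (H \<times> (UNIV :: real set)) = int (dim (?V \<times> (UNIV :: real set)))"
    unfolding eq using VU by (simp only: aff_dim_translation_eq aff_dim_subspace)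
  also have "dim (?V \<times> (UNIV :: real set)) = dim ?V + 1"
    using dim_Times[OF V subspace_UNIV[where 'a = real]] by (simp add: dim_UNIV)
  also have "int (dim ?V + 1) = aff_dim H + 1"
    using aff_dim_eq_dim[of a H] a by (simp add: hull_inc)
  finally show "aff_dim (H \<times> (UNIV :: real set)) = aff_dim H + 1" .
qed

lemma aff_dim_Times_interval:
  fixes F :: "'a::euclidean_space set"
  assumes "F \<noteq> {}"
  shows "aff_dim (F \<times> {0..1::real}) \<le> aff_dim F + 1"
proof -
  have "F \<times> {0..1::real} \<subseteq> (affine hull F) \<times> UNIV" using hull_subset[of F affine] by blast
  then have "aff_dim (F \<times> {0..1::real}) \<le> aff_dim ((affine hull F) \<times> (UNIV :: real set))" by (rule aff_dim_subset)
  also have "\<dots> = aff_dim F + 1" using affine_Times_UNIV(2)[OF affine_affine_hull, of F] assms by simp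
  finally show ?thesis .
qed

text \<open>The functional is the scalar product with the perpendicular dropped from
  \<open>a\<close> to the affine hull of \<open>G\<close>, scaled so that it rises by one. It serves
  as a height above a ridge.\<close>

lemma affine_functional:
  fixes a :: "'a::euclidean_space"
  assumes "a \<notin> affine hull G" "G \<noteq> {}"
  obtains \<alpha> \<beta> where "\<And>y. y \<in> G \<Longrightarrow> \<alpha> \<bullet> y = \<beta>" "\<alpha> \<bullet> a = \<beta> + 1"
proof -
  let ?H = "affine hull G"
  have H: "convex ?H" "closed ?H" "?H \<noteq> {}" using assms(2) by (auto simp: affine_imp_convex)
  define \<pi> where "\<pi> = closest_point ?H a"
  have \<pi>: "\<pi> \<in> ?H" unfolding \<pi>_def by (rule closest_point_in_set[OF H(2,3)])
  define w where "w = a - \<pi>"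
  have "w \<noteq> 0" using \<pi> assms(1) unfolding w_def by auto
  have perp: "w \<bullet> (y - \<pi>) = 0" if "y \<in> ?H" for y
  proof (rule antisym)
    show "w \<bullet> (y - \<pi>) \<le> 0" unfolding w_def \<pi>_def by (rule closest_point_dot[OF H(1,2) that])
    \<comment> \<open>The reflection of \<open>y\<close> in \<open>\<pi>\<close> also lies in the
      affine hull and gives the opposite inequality.\<close>
    have "2 *\<^sub>R \<pi> + (-1) *\<^sub>R y \<in> ?H" by (rule mem_affine[OF affine_affine_hull \<pi> that]) simp
    then have "w \<bullet> ((2 *\<^sub>R \<pi> + (-1) *\<^sub>R y) - \<pi>) \<le> 0"
      unfolding w_def \<pi>_def by (rule closest_point_dot[OF H(1,2)])
    then show "0 \<le> w \<bullet> (y - \<pi>)" by (simp add: inner_simps scaleR_2)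
  qed
  let ?\<alpha> = "(1 / (w \<bullet> w)) *\<^sub>R w"
  show thesis
  proof (rule that[of ?\<alpha> "?\<alpha> \<bullet> \<pi>"])
    show "?\<alpha> \<bullet> y = ?\<alpha> \<bullet> \<pi>" if "y \<in> G" for y
      using perp[OF hull_inc[OF that]] by (simp add: inner_diff_right)
    have "?\<alpha> \<bullet> (a - \<pi>) = 1" using \<open>w \<noteq> 0\<close> unfolding w_def[symmetric] by simp
    then show "?\<alpha> \<bullet> a = ?\<alpha> \<bullet> \<pi> + 1" by (simp only: inner_diff_right)
  qed
qed

context sphere_complex
begin

text \<open>If \<open>P F\<close> says that \<open>F\<close> contains a given point or face, this is
  its open star.\<close>

lemma star_openin:
  "openin (top_of_set (\<Union>S)) (\<Union>S - \<Union>{F \<in> S. \<not> P F})"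
proof -
  have "closed (\<Union>{F \<in> S. \<not> P F})" by (rule closed_Union) blast
  then have "openin (top_of_set (\<Union>S)) (\<Union>S \<inter> - \<Union>{F \<in> S. \<not> P F})" by (intro openin_open_Int) auto
  then show ?thesis by (simp only: Diff_eq)
qed

lemma in_starI: "\<lbrakk>x \<in> \<Union>S; \<And>F. \<lbrakk>F \<in> S; x \<in> F\<rbrakk> \<Longrightarrow> P F\<rbrakk> \<Longrightarrow> x \<in> \<Union>S - \<Union>{F \<in> S. \<not> P F}"
  by blast

lemma in_starD: "\<lbrakk>x \<in> \<Union>S - \<Union>{F \<in> S. \<not> P F}; F \<in> S; x \<in> F\<rbrakk> \<Longrightarrow> P F"
  by blast

text \<open>Points in the relative interior of a maximal face lie in no other face, so near them the
  sphere is contained in the affine hull of \<open>D\<close>, which gives one inequality by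
  invariance of dimension. The relative interior of \<open>D\<close> embeds in a chart, which gives
  the other.\<close>

lemma maximal_dim:
  assumes D: "D \<in> S" "D \<noteq> {}" and max: "\<And>G. \<lbrakk>G \<in> S; D \<subseteq> G\<rbrakk> \<Longrightarrow> G = D"
  shows "aff_dim D = int d"
proof (rule antisym)
  obtain x where x: "x \<in> rel_interior D" using D rel_interior_eq_empty[OF convexS[OF D(1)]] by blast
  have sub: "rel_interior D \<subseteq> D" by (rule rel_interior_subset)
  have xS: "x \<in> \<Union>S" using x sub D(1) by blast
  obtain p and L :: "'a set" and \<phi> \<psi> where c: "p \<in> \<Union>S" "p \<noteq> x" "subspace L" "dim L = d"
    "homeomorphism (\<Union>S - {p}) L \<phi> \<psi>"
    by (rule chart[OF xS])
  have dimL: "aff_dim L = int d" using c(3,4) by (simp add: aff_dim_subspace)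
  let ?W = "(\<Union>S - \<Union>{F \<in> S. \<not> F = D}) - {p}"
  have op: "openin (top_of_set (\<Union>S)) ?W" by (intro openin_delete star_openin)
  have WS: "?W \<subseteq> \<Union>S - {p}" by blast
  have WD: "?W \<subseteq> D" by blast
  have xW: "x \<in> ?W"
  proof -
    have "F = D" if "F \<in> S" "x \<in> F" for F using rel_interior_meets[OF D(1) that(1) x that(2)] max that by blast
    then show ?thesis using xS c(2) by blast
  qed
  have oL: "openin (top_of_set L) (\<phi> ` ?W)"
    by (rule homeomorphism_imp_open_map[OF c(5) openin_subset_trans[OF op WS Diff_subset]])
  have L: "\<phi> ` ?W \<subseteq> L" by (rule openin_imp_subset[OF oL])
  have backL: "\<psi> ` \<phi> ` ?W \<subseteq> affine hull D"
  proof (rule subsetI, elim imageE)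
    fix y z w assume "y = \<psi> z" "z = \<phi> w" "w \<in> ?W"
    then have "y \<in> D" using homeomorphismD(5)[OF c(5), of w] WS WD by auto
    then show "y \<in> affine hull D" by (rule hull_inc)
  qed
  have "aff_dim L \<le> aff_dim (affine hull D)"
  proof (rule invariance_of_dimension_affine_sets[OF oL subspace_imp_affine[OF c(3)] affine_affine_hull _ backL])
    show "continuous_on (\<phi> ` ?W) \<psi>" by (rule continuous_on_subset[OF homeomorphismD(2)[OF c(5)] L])
    show "inj_on \<psi> (\<phi> ` ?W)" by (rule inj_on_subset[OF homeomorphismD(8)[OF c(5)] L])
    show "\<phi> ` ?W \<noteq> {}" using xW by blast
  qed
  then show "int d \<le> aff_dim D" using dimL by simp
  let ?R = "rel_interior D - {p}"
  have RS: "?R \<subseteq> \<Union>S - {p}" using sub D(1) by blast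
  have "aff_dim (affine hull D) \<le> aff_dim L"
  proof (rule invariance_of_dimension_affine_sets[OF _ affine_affine_hull subspace_imp_affine[OF c(3)]])
    show "openin (top_of_set (affine hull D)) ?R" by (intro openin_delete openin_rel_interior)
    show "continuous_on ?R \<phi>" by (rule continuous_on_subset[OF homeomorphismD(1)[OF c(5)] RS])
    show "inj_on \<phi> ?R" by (rule inj_on_subset[OF homeomorphismD(7)[OF c(5)] RS])
    show "\<phi> ` ?R \<subseteq> L" using homeomorphismD(3)[OF c(5)] RS by blast
    show "?R \<noteq> {}" using x c(2) by blast
  qed
  then show "aff_dim D \<le> int d" using dimL by simp
qed

lemma S_nonempty: "\<exists>F\<in>S. F \<noteq> {}"
proof -
  obtain p where "p \<in> \<Union>S" by (rule other_point)
  then show ?thesis by blast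
qed

lemma face_in_facet: assumes "F \<in> S" shows "\<exists>D\<in>facets d S. F \<subseteq> D"
proof -
  obtain G where G: "G \<in> S" "G \<noteq> {}" "F \<subseteq> G"
    using S_nonempty assms by (cases "F = {}") auto
  have "finite {H \<in> S. G \<subseteq> H}" "{H \<in> S. G \<subseteq> H} \<noteq> {}" using fin G(1) by auto
  from finite_has_maximal[OF this] obtain D where D': "D \<in> {H \<in> S. G \<subseteq> H}"
    "\<forall>H\<in>{H \<in> S. G \<subseteq> H}. D \<subseteq> H \<longrightarrow> D = H" by (elim bexE)
  then have D: "D \<in> S" "G \<subseteq> D" by simp_all
  have Dmax: "H = D" if "H \<in> S" "G \<subseteq> H" "D \<subseteq> H" for H using bspec[OF D'(2), of H] that by simp
  have "aff_dim D = int d"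
  proof (rule maximal_dim[OF D(1)])
    show "D \<noteq> {}" using D(2) G(2) by blast
    show "H = D" if "H \<in> S" "D \<subseteq> H" for H using Dmax[OF that(1) subset_trans[OF D(2) that(2)] that(2)] .
  qed
  then show ?thesis using D(1,2) G(3) unfolding faces_of_dim_def by (intro bexI[of _ D]) auto
qed

lemma facet_maximal: "\<lbrakk>D \<in> facets d S; G \<in> S; D \<subseteq> G\<rbrakk> \<Longrightarrow> G = D"
proof -
  assume a: "D \<in> facets d S" "G \<in> S" "D \<subseteq> G"
  obtain E where E: "E \<in> facets d S" "G \<subseteq> E" using face_in_facet[OF a(2)] by blast
  have "aff_dim G \<le> int d" using dim_mono[OF E(2)] E(1) by (simp add: faces_of_dim_def)
  then have "aff_dim D = aff_dim G" using dim_mono[OF a(3)] a(1) by (simp add: faces_of_dim_def)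
  then show "G = D" using dim_eq[of D G] a by (simp add: faces_of_dim_def)
qed

text \<open>A point of a ridge \<open>G\<close> in a single facet would be interior to that facet by invariance of
  domain. Two facets contain a double pyramid over \<open>G\<close>, which is open in the sphere by invariance of
  domain and leaves no room for a third one.\<close>

lemma ridge_two_facets:
  assumes "G \<in> faces_of_dim S (int d - 1)"
  shows "card {D \<in> facets d S. G \<subseteq> D} = 2"
proof -
  let ?N = "{D \<in> facets d S. G \<subseteq> D}"
  have G: "G \<in> S" "aff_dim G = int d - 1" using assms by (auto simp: faces_of_dim_def)
  have "G \<noteq> {}" using G(2) d2 by auto
  then obtain x where x: "x \<in> rel_interior G" using rel_interior_eq_empty[OF convexS[OF G(1)]] by blast
  have xG: "x \<in> G" using x rel_interior_subset by blast
  have xS: "x \<in> \<Union>S" using xG G(1) by blast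
  have NS: "D \<in> S" "aff_dim D = int d" "G \<subseteq> D" if "D \<in> ?N" for D using that by (auto simp: faces_of_dim_def)
  have fN: "finite ?N" using fin by (simp add: faces_of_dim_def)
  obtain A where A: "A \<in> ?N" using face_in_facet[OF G(1)] by blast
  have "?N \<noteq> {A}"
  proof
    assume N: "?N = {A}"
    let ?W = "\<Union>S - \<Union>{F \<in> S. \<not> G \<subseteq> F}"
    have "x \<in> ?W" by (rule in_starI[OF xS]) (rule rel_interior_meets[OF G(1) _ x])
    moreover have WA: "?W \<subseteq> A"
    proof
      fix y assume y: "y \<in> ?W"
      then obtain F where "F \<in> S" "y \<in> F" by blast
      then obtain E where E: "E \<in> facets d S" "F \<subseteq> E" using face_in_facet by blast
      have "y \<in> E" "E \<in> S" using E \<open>y \<in> F\<close> by (auto simp: faces_of_dim_def)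
      then have "G \<subseteq> E" using in_starD[OF y] by blast
      then have "E \<in> ?N" using E(1) by simp
      then show "y \<in> A" using N \<open>y \<in> E\<close> by simp
    qed
    ultimately obtain W' where W': "x \<in> W'" "W' \<subseteq> ?W" "openin (top_of_set (affine hull A)) W'"
      using open_embedding[OF star_openin _ affine_affine_hull subset_trans[OF WA hull_subset], of x]
        NS(2)[OF A] by (metis aff_dim_affine_hull order_refl)
    have "W' \<subseteq> rel_interior A" by (rule rel_interior_maximal[OF subset_trans[OF W'(2) WA] W'(3)])
    then have "A \<subseteq> G" using rel_interior_meets[OF NS(1)[OF A] G(1) _ xG] W'(1) by blast
    then show False using dim_mono[of A G] G(2) NS(2)[OF A] by simp
  qed
  then obtain B where B: "B \<in> ?N" "B \<noteq> A" using A by blast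
  have apex: "\<exists>a \<alpha> \<beta>. a \<in> D \<and> (\<forall>y\<in>G. \<alpha> \<bullet> y = \<beta>) \<and> \<alpha> \<bullet> a = \<beta> + 1" if D: "D \<in> ?N" for D
  proof -
    have "\<not> D \<subseteq> affine hull G"
    proof
      assume "D \<subseteq> affine hull G"
      then have "aff_dim D \<le> aff_dim G" using dim_mono[of D "affine hull G"] by simp
      then show False using NS(2)[OF D] G(2) by simp
    qed
    then obtain a where a: "a \<in> D" "a \<notin> affine hull G" by blast
    obtain \<alpha> \<beta> where f: "\<And>y. y \<in> G \<Longrightarrow> \<alpha> \<bullet> y = \<beta>" "\<alpha> \<bullet> a = \<beta> + 1"
      by (rule affine_functional[OF a(2) \<open>G \<noteq> {}\<close>]) (rule that)
    show ?thesis by (intro exI[of _ a] exI[of _ \<alpha>] exI[of _ \<beta>] conjI ballI a(1) f)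
  qed
  obtain a \<alpha> \<beta> where a: "a \<in> A" "\<forall>y\<in>G. \<alpha> \<bullet> y = \<beta>" "\<alpha> \<bullet> a = \<beta> + 1" using apex[OF A] by blast
  obtain b \<gamma> \<delta> where b: "b \<in> B" "\<forall>y\<in>G. \<gamma> \<bullet> y = \<delta>" "\<gamma> \<bullet> b = \<delta> + 1" using apex[OF B(1)] by blast
  \<comment> \<open>The double pyramid over \<open>G\<close> with apexes \<open>a\<close> and
    \<open>b\<close>: a positive second coordinate moves a point of \<open>G\<close> by that
    fraction towards \<open>a\<close>, a negative one towards \<open>b\<close>. The functionals
    \<open>\<alpha>\<close> and \<open>\<gamma>\<close> recover this coordinate, which gives
    injectivity on each half.\<close>
  define h :: "'a \<times> real \<Rightarrow> 'a" where
    "h = (\<lambda>z. (1 - \<bar>snd z\<bar>) *\<^sub>R fst z + max (snd z) 0 *\<^sub>R a + max (- snd z) 0 *\<^sub>R b)"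
  let ?O = "rel_interior G \<times> {-1<..<1::real}"
  have hp: "h (z, t) = (1 - t) *\<^sub>R z + t *\<^sub>R a" if "t \<ge> 0" for z t
    using that by (simp add: h_def)
  have hn: "h (z, t) = (1 - (- t)) *\<^sub>R z + (- t) *\<^sub>R b" if "t \<le> 0" for z t
    using that by (simp add: h_def max_def)
  have inA: "h (z, t) \<in> A" if "z \<in> G" "t \<ge> 0" "t < 1" for z t
    unfolding hp[OF that(2)] using that a(1) NS(3)[OF A] convexD_alt[OF convexS[OF NS(1)[OF A]]] by auto
  have inB: "h (z, t) \<in> B" if "z \<in> G" "t \<le> 0" "- 1 < t" for z t
    unfolding hn[OF that(2)] using that b(1) NS(3)[OF B(1)] convexD_alt[OF convexS[OF NS(1)[OF B(1)]], of z b "- t"] by auto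
  have valA: "\<alpha> \<bullet> h (z, t) = \<beta> + t" if "z \<in> G" "t \<ge> 0" for z t
    unfolding hp[OF that(2)] using a that(1) by (simp add: inner_simps algebra_simps)
  have valB: "\<gamma> \<bullet> h (z, t) = \<delta> - t" if "z \<in> G" "t \<le> 0" for z t
    unfolding hn[OF that(2)] using b that(1) by (simp add: inner_simps algebra_simps)
  have AB: "A \<inter> B = G"
  proof -
    have i: "A \<inter> B \<in> S" by (rule inter_in[OF NS(1)[OF A] NS(1)[OF B(1)]])
    have "A \<inter> B \<noteq> A" using facet_maximal[of A B] A B NS(1)[OF B(1)] by blast
    then have "aff_dim (A \<inter> B) < aff_dim A" using dim_less[OF i NS(1)[OF A]] by blast
    moreover have "G \<subseteq> A \<inter> B" using NS(3)[OF A] NS(3)[OF B(1)] by blast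
    ultimately show ?thesis using dim_eq[OF G(1) i] dim_mono[of G "A \<inter> B"] G(2) NS(2)[OF A] by auto
  qed
  have mixed: False if "z \<in> G" "t \<ge> 0" "t < 1" "w \<in> G" "s < 0" "- 1 < s" "h (z, t) = h (w, s)" for z t w s
  proof -
    have "h (w, s) \<in> A \<inter> B" using inA[OF that(1-3)] inB[OF that(4) _ that(6)] that(5,7) by auto
    then have "h (w, s) \<in> G" using AB by simp
    then have "\<gamma> \<bullet> h (w, s) = \<delta>" using b(2) by blast
    then show False using valB[OF that(4), of s] that(5) by simp
  qed
  have inj: "inj_on h ?O"
  proof (rule inj_onI)
    fix u v assume u: "u \<in> ?O" and v: "v \<in> ?O" and eq: "h u = h v"
    obtain z t w s where zt: "u = (z, t)" "v = (w, s)" by (cases u, cases v)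
    have z: "z \<in> G" "- 1 < t" "t < 1" and w: "w \<in> G" "- 1 < s" "s < 1"
      using u v zt rel_interior_subset[of G] by auto
    consider "t \<ge> 0" "s \<ge> 0" | "t < 0" "s < 0" | "t \<ge> 0" "s < 0" | "t < 0" "s \<ge> 0" by linarith
    then show "u = v"
    proof cases
      case 1
      then have "t = s" using valA[OF z(1) 1(1)] valA[OF w(1) 1(2)] eq zt by simp
      then have "(1 - t) *\<^sub>R z = (1 - t) *\<^sub>R w" using eq hp 1 zt by simp
      then show ?thesis using zt \<open>t = s\<close> z(3) by simp
    next
      case 2
      then have "t = s" using valB[OF z(1), of t] valB[OF w(1), of s] eq zt by simp
      have "(1 - (- t)) *\<^sub>R z + (- t) *\<^sub>R b = (1 - (- t)) *\<^sub>R w + (- t) *\<^sub>R b"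
        using eq zt \<open>t = s\<close> hn[of t z] hn[of t w] 2(1) by (metis less_imp_le)
      then have "(1 - (- t)) *\<^sub>R z = (1 - (- t)) *\<^sub>R w" by (simp only: add_right_cancel)
      moreover have "1 - (- t) \<noteq> 0" using z(2) by simp
      ultimately have "z = w" by (metis scaleR_cancel_left)
      then show ?thesis using zt \<open>t = s\<close> by simp
    next
      case 3
      then show ?thesis using mixed[of z t w s] z w eq zt by simp
    next
      case 4
      then show ?thesis using mixed[of w s z t] z w eq zt by simp
    qed
  qed
  have hAB: "h ` ?O \<subseteq> A \<union> B"
  proof (rule image_subsetI)
    fix u assume "u \<in> ?O"
    then obtain z t where "u = (z, t)" "z \<in> G" "- 1 < t" "t < 1" using rel_interior_subset[of G] by auto
    then show "h u \<in> A \<union> B" using inA[of z t] inB[of z t] by (cases "t \<ge> 0") auto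
  qed
  have op: "openin (top_of_set (\<Union>S)) (h ` ?O)"
  proof (rule embedding_open[OF _ _ _ _ inj])
    show "openin (top_of_set ((affine hull G) \<times> UNIV)) ?O"
      by (intro openin_Times openin_rel_interior) (simp add: open_openin[symmetric])
    show "affine ((affine hull G) \<times> (UNIV :: real set))"
      using affine_Times_UNIV(1)[OF affine_affine_hull, of G] \<open>G \<noteq> {}\<close> by simp
    show "aff_dim ((affine hull G) \<times> (UNIV :: real set)) = int d"
      using affine_Times_UNIV(2)[OF affine_affine_hull, of G] \<open>G \<noteq> {}\<close> G(2) by simp
    show "continuous_on ?O h" unfolding h_def by (intro continuous_intros)
    show "h ` ?O \<subseteq> \<Union>S" using hAB NS(1)[OF A] NS(1)[OF B(1)] by blast
  qed
  have "E = A \<or> E = B" if E: "E \<in> ?N" for E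
  proof (rule ccontr)
    assume ne: "\<not> (E = A \<or> E = B)"
    have "h (x, 0) = x" by (simp add: h_def)
    moreover have "(x, 0) \<in> ?O" using x by simp
    ultimately have xO: "x \<in> h ` ?O" by (metis imageI)
    obtain U where U: "open U" "h ` ?O = \<Union>S \<inter> U" using op unfolding openin_open by blast
    have cE: "convex E" "closed E" using convexS compactS compact_imp_closed NS(1)[OF E] by blast+
    \<comment> \<open>Relative interior points of a third facet come arbitrarily close to
      \<open>x\<close>, hence enter the open double pyramid, which lies in the union of
      \<open>A\<close> and \<open>B\<close>.\<close>
    have "x \<in> closure (rel_interior E)"
      using convex_closure_rel_interior[OF cE(1)] closure_closed[OF cE(2)] xG NS(3)[OF E] by auto
    moreover have "x \<in> U" using xO unfolding U(2) by (rule IntD2)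
    ultimately have "U \<inter> closure (rel_interior E) \<noteq> {}" by blast
    then have "U \<inter> rel_interior E \<noteq> {}" using open_Int_closure_eq_empty[OF U(1)] by simp
    then obtain y where y: "y \<in> U" "y \<in> rel_interior E" by blast
    have "y \<in> \<Union>S" using y(2) rel_interior_subset[of E] NS(1)[OF E] by blast
    then have "y \<in> A \<union> B" using y(1) U(2) hAB by blast
    then have "E \<subseteq> A \<or> E \<subseteq> B"
      using rel_interior_meets[OF NS(1)[OF E] NS(1)[OF A] y(2)] rel_interior_meets[OF NS(1)[OF E] NS(1)[OF B(1)] y(2)] by blast
    then show False using facet_maximal[of E A] facet_maximal[of E B] E ne NS(1)[OF A] NS(1)[OF B(1)] by blast
  qed
  then have "?N = {A, B}" using A B(1) by blast
  then show ?thesis using B(2) by simp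
qed

text \<open>Instead of the open facet only one interior point \<open>q\<close> is removed: the
  punctured sphere is contractible, and pushing \<open>\<Delta>\<close> minus \<open>q\<close> out
  to its relative frontier retracts it onto the remaining complex.\<close>

lemma remove_facet_contractible:
  assumes "\<Delta> \<in> facets d S"
  shows "contractible (\<Union>(S - {\<Delta>}))"
proof -
  have D: "\<Delta> \<in> S" "aff_dim \<Delta> = int d" using assms by (auto simp: faces_of_dim_def)
  have "\<Delta> \<noteq> {}" using D(2) by auto
  then obtain q where q: "q \<in> rel_interior \<Delta>" using rel_interior_eq_empty[OF convexS[OF D(1)]] by blast
  have qD: "q \<in> \<Delta>" using q rel_interior_subset by blast
  have disj: "F \<inter> rel_interior \<Delta> = {}" if F: "F \<in> S - {\<Delta>}" for F
  proof (rule ccontr)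
    assume "F \<inter> rel_interior \<Delta> \<noteq> {}"
    then have "\<Delta> \<subseteq> F" using rel_interior_meets[OF D(1), of F] F by blast
    then show False using facet_maximal[OF assms, of F] F by blast
  qed
  obtain L :: "'a set" where L: "subspace L" "dim L = d" "\<And>p. p \<in> \<Union>S \<Longrightarrow> (\<Union>S - {p}) homeomorphic L"
    by (rule model_space) (rule that)
  have "contractible L" using L(1) by (simp add: convex_imp_contractible subspace_imp_convex)
  then have con: "contractible (\<Union>S - {q})"
    using homeomorphic_contractible_eq[OF L(3)[of q]] qD D(1) by blast
  have cl: "closed \<Delta>" "convex \<Delta>" "bounded \<Delta>" using compactS[OF D(1)] convexS[OF D(1)]
    by (auto simp: compact_imp_closed compact_imp_bounded)
  have rf: "rel_frontier \<Delta> = \<Delta> - rel_interior \<Delta>" using cl(1) by (simp add: rel_frontier_def)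
  obtain r where r: "retraction (\<Delta> - {q}) (rel_frontier \<Delta>) r"
    by (rule rel_frontier_deformation_retract_of_punctured_convex[OF cl(2,2,3) q])
      (use rf hull_subset[of \<Delta> affine] in auto)
  have "rel_frontier \<Delta> retract_of (\<Delta> - {q})" using r unfolding retract_of_def by blast
  let ?B = "\<Union>(S - {\<Delta>})"
  have rfB: "rel_frontier \<Delta> \<subseteq> ?B"
  proof
    fix y assume "y \<in> rel_frontier \<Delta>"
    then obtain G where "G face_of \<Delta>" "G \<noteq> \<Delta>" "y \<in> G"
      using rel_frontier_of_polyhedron_alt[OF polytope_imp_polyhedron[OF polytopeS[OF D(1)]]] by auto
    then show "y \<in> ?B" using face_in[OF D(1)] by blast
  qed
  have clB: "closed ?B" by (rule closed_Union) blast
  have qB: "q \<notin> ?B" using disj q by blast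
  have SB: "\<Union>S - {q} = (\<Delta> - {q}) \<union> ?B" using D(1) qB by blast
  have DB: "(\<Delta> - {q}) \<inter> ?B \<subseteq> rel_frontier \<Delta>" unfolding rf using disj by blast
  have rr: "continuous_on (\<Delta> - {q}) r" "r ` (\<Delta> - {q}) \<subseteq> rel_frontier \<Delta>" "\<And>x. x \<in> rel_frontier \<Delta> \<Longrightarrow> r x = x"
    using r unfolding retraction_def by auto
  let ?g = "\<lambda>x. if x \<in> \<Delta> - {q} then r x else x"
  have g1: "continuous_on ((\<Delta> - {q}) \<union> ?B) ?g"
  proof (rule continuous_on_cases_local)
    have "(\<Delta> - {q}) = ((\<Delta> - {q}) \<union> ?B) \<inter> \<Delta>" using DB rf qB by blast
    then show "closedin (top_of_set ((\<Delta> - {q}) \<union> ?B)) (\<Delta> - {q})" using cl(1) closedin_closed by metis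
    show "closedin (top_of_set ((\<Delta> - {q}) \<union> ?B)) ?B" using clB by (intro closed_subset) auto
    show "r x = x" if "x \<in> \<Delta> - {q} \<and> x \<notin> \<Delta> - {q} \<or> x \<in> ?B \<and> x \<in> \<Delta> - {q}" for x
      using that rr(3) DB by blast
  qed (use rr in auto)
  have g2: "?g \<in> (\<Delta> - {q}) \<union> ?B \<rightarrow> ?B"
  proof (rule Pi_I)
    fix x assume "x \<in> (\<Delta> - {q}) \<union> ?B"
    moreover have "r x \<in> ?B" if "x \<in> \<Delta> - {q}" using that rr(2) rfB by blast
    ultimately show "?g x \<in> ?B" by (metis UnE)
  qed
  have g3: "?g x = x" if "x \<in> ?B" for x
  proof (cases "x \<in> \<Delta> - {q}")
    case True
    then have "x \<in> rel_frontier \<Delta>" using that DB by blast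
    then show ?thesis using rr(3) by simp
  next
    case False
    then show ?thesis by (simp only: if_False)
  qed
  have "retraction ((\<Delta> - {q}) \<union> ?B) ?B ?g"
    unfolding retraction_def by (intro conjI ballI g1 g2 g3 Un_upper2)
  then have "?B retract_of ((\<Delta> - {q}) \<union> ?B)" unfolding retract_of_def by blast
  then show ?thesis using retract_of_contractible con SB by metis
qed

end

section \<open>Simplicial spheres are normal\<close>

text \<open>As \<open>t\<close> runs from \<open>0\<close> to \<open>1\<close>, this deforms the direction field away from \<open>b\<close> into the one away
  from \<open>a\<close>.\<close>

definition direction :: "'a::real_normed_vector \<Rightarrow> 'a \<Rightarrow> real \<Rightarrow> 'a \<Rightarrow> 'a" where
  "direction b a t w = sgn (w - ((1 - t) *\<^sub>R b + t *\<^sub>R a))"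

lemma direction_0 [simp]: "direction b a 0 w = sgn (w - b)"
  and direction_1 [simp]: "direction b a 1 w = sgn (w - a)"
  by (simp_all add: direction_def)

lemma inner_sgn_self: "sgn v \<bullet> v = norm (v :: 'a::real_inner)"
  using dot_square_norm[of v] by (cases "v = 0") (simp_all add: sgn_div_norm power2_eq_square)

text \<open>Brouwer's theorem for the map that steps from \<open>w\<close> to \<open>w - G w\<close>
  and projects back to the ball. At a fixed point \<open>w\<close> every \<open>x\<close> of the
  ball satisfies \<open>0 \<le> G w \<bullet> (x - w)\<close>. For \<open>w\<close> on the sphere
  this fails at \<open>x = b\<close>; for \<open>w\<close> inside it fails for \<open>x\<close> a
  little behind \<open>w\<close>, against the direction \<open>G w\<close>.\<close>

lemma no_extension_of_direction:
  fixes L :: "'a::euclidean_space set"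
  assumes L: "subspace L" and c: "c \<in> L" and b: "b \<in> L" "dist c b < r"
    and G: "continuous_on (cball c r \<inter> L) G" "\<And>w. w \<in> cball c r \<inter> L \<Longrightarrow> G w \<in> L \<and> norm (G w) = 1"
    and bd: "\<And>w. w \<in> sphere c r \<inter> L \<Longrightarrow> G w = sgn (w - b)"
  shows False
proof -
  let ?W = "cball c r \<inter> L"
  have "r > 0" using b(2) zero_le_dist[of c b] by linarith
  have W: "compact ?W" "convex ?W" "closed ?W"
    using closed_subspace[OF L] subspace_imp_convex[OF L]
    by (auto intro!: compact_Int_closed convex_Int closed_Int)
  have "c \<in> ?W" using c \<open>r > 0\<close> by simp
  then have W4: "?W \<noteq> {}" by blast
  let ?k = "\<lambda>w. closest_point ?W (w - G w)"
  have "continuous_on ?W ?k"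
    by (rule continuous_on_compose2[OF continuous_on_closest_point[OF W(2,3) W4, of UNIV]])
      (auto intro: continuous_on_diff G(1))
  moreover have "?k \<in> ?W \<rightarrow> ?W"
    by (rule Pi_I) (rule closest_point_in_set[OF W(3) W4])
  ultimately obtain w where w: "w \<in> ?W" "?k w = w"
    by (rule brouwer[OF W(1,2) W4])
  have nn: "0 \<le> G w \<bullet> (x - w)" if "x \<in> ?W" for x
    using closest_point_dot[OF W(2,3) that, of "w - G w"] unfolding w(2) by simp
  show False
  proof (cases "dist c w = r")
    case True
    then have "G w = sgn (w - b)" using w(1) by (intro bd) auto
    then have "0 \<le> sgn (w - b) \<bullet> (b - w)" using nn[of b] b by simp
    also have "\<dots> = - norm (w - b)"
    proof -
      have "sgn (w - b) \<bullet> (b - w) = - (sgn (w - b) \<bullet> (w - b))" by (simp add: inner_diff_right)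
      also have "sgn (w - b) \<bullet> (w - b) = norm (w - b)"
        by (rule inner_sgn_self)
      finally show ?thesis .
    qed
    finally have "w = b" by simp
    then show False using True b(2) by simp
  next
    case False
    then have lt: "dist c w < r" using w(1) by simp
    define e where "e = r - dist c w"
    have "e > 0" using lt by (simp add: e_def)
    have "w - e *\<^sub>R G w \<in> ?W"
    proof
      have "dist c (w - e *\<^sub>R G w) \<le> dist c w + dist w (w - e *\<^sub>R G w)" by (rule dist_triangle)
      also have "dist w (w - e *\<^sub>R G w) = e" using G(2)[OF w(1)] \<open>e > 0\<close> by (simp add: dist_norm)
      finally show "w - e *\<^sub>R G w \<in> cball c r" by (simp add: e_def)
      show "w - e *\<^sub>R G w \<in> L" using w(1) G(2)[OF w(1)] L by (auto intro: subspace_diff subspace_scale)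
    qed
    from nn[OF this] have "0 \<le> - (e * (G w \<bullet> G w))" by simp
    moreover have "G w \<bullet> G w = 1" using G(2)[OF w(1)] by (simp add: norm_eq_1)
    ultimately show False using \<open>e > 0\<close> by simp
  qed
qed

lemma continuous_map_prod_of_sets:
  assumes "continuous_on (A \<times> B) f" "f ` (A \<times> B) \<subseteq> C"
  shows "continuous_map (prod_topology (top_of_set A) (top_of_set B)) (top_of_set C) f"
  using assms by (simp add: continuous_map_in_subtopology image_subset_iff_funcset)

context sphere_complex
begin

text \<open>If the facets at \<open>x\<close> split into two families whose unions meet only in dimension at most
  \<open>d - 2\<close>, then the deformation between the direction fields away from a point \<open>a\<close> of the first
  union and a point \<open>b\<close> of the second one extends over this intersection, as the sphere of directions
  has dimension \<open>d - 1\<close>. The field away from \<open>b\<close> on the sphere around \<open>x\<close> then extends over the whole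
  ball: use a field away from \<open>b\<close> on the first union and one away from \<open>a\<close> on the second.\<close>

lemma facets_linked:
  assumes x: "x \<in> \<Union>S" and A: "A \<subseteq> {D \<in> facets d S. x \<in> D}" "A \<noteq> {}" "A \<noteq> {D \<in> facets d S. x \<in> D}"
  shows "\<exists>D\<in>A. \<exists>E\<in>{D \<in> facets d S. x \<in> D} - A. \<exists>G\<in>faces_of_dim S (int d - 1). x \<in> G \<and> G \<subseteq> D \<and> G \<subseteq> E"
proof (rule ccontr)
  assume con: "\<not> ?thesis"
  define B where "B = {D \<in> facets d S. x \<in> D} - A"
  have "B \<noteq> {}" using A unfolding B_def by auto
  have AS: "D \<in> S" "aff_dim D = int d" "x \<in> D" "D \<in> facets d S" if "D \<in> A \<or> D \<in> B" for D
    using that A(1) unfolding B_def by (auto simp: faces_of_dim_def)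

  \<comment> \<open>A ball around the point in a chart, inside its open star\<close>
  obtain p and L :: "'a set" and \<phi> \<psi> where c: "p \<in> \<Union>S" "p \<noteq> x" "subspace L" "dim L = d"
    "homeomorphism (\<Union>S - {p}) L \<phi> \<psi>"
    by (rule chart[OF x])
  note h = homeomorphismD[OF c(5)]
  have xp: "x \<in> \<Union>S - {p}" using x c(2) by blast
  define U where "U = (\<Union>S - \<Union>{F \<in> S. \<not> x \<in> F}) - {p}"
  have US: "U \<subseteq> \<Union>S - {p}" unfolding U_def by blast
  have Ux: "x \<in> F" if "y \<in> U" "F \<in> S" "y \<in> F" for y F using that unfolding U_def by blast
  have "openin (top_of_set (\<Union>S)) U" unfolding U_def by (intro openin_delete star_openin)
  then have oU: "openin (top_of_set (\<Union>S - {p})) U" by (rule openin_subset_trans[OF _ US Diff_subset])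
  have "openin (top_of_set L) (\<phi> ` U)" by (rule homeomorphism_imp_open_map[OF c(5) oU])
  moreover have "\<phi> x \<in> \<phi> ` U"
    unfolding U_def by (intro imageI DiffI[OF in_starI[OF x]]) (use c(2) in auto)
  ultimately obtain r where r: "r > 0" "cball (\<phi> x) r \<inter> L \<subseteq> \<phi> ` U"
    unfolding openin_contains_cball by blast
  define W where "W = cball (\<phi> x) r \<inter> L"
  have xL: "\<phi> x \<in> L" by (rule h(9)[OF xp])
  have cW: "compact W" using closed_subspace[OF c(3)] unfolding W_def by (intro compact_Int_closed) auto
  have WL: "W \<subseteq> L" unfolding W_def by blast
  have \<psi>U: "\<psi> w \<in> U" if "w \<in> W" for w
  proof -
    have "w \<in> \<phi> ` U" using r(2) that unfolding W_def by blast
    then obtain u where u: "u \<in> U" "w = \<phi> u" by blast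
    then have "\<psi> w = u" using h(5)[of u] US by blast
    then show ?thesis using u(1) by simp
  qed
  have c\<psi>: "continuous_on W \<psi>" by (rule continuous_on_subset[OF h(2) WL])
  let ?Sph = "sphere 0 1 \<inter> L"

  \<comment> \<open>The parts of the ball covered by the two families\<close>
  define WA where "WA = {w \<in> W. \<psi> w \<in> \<Union>A}"
  define WB where "WB = {w \<in> W. \<psi> w \<in> \<Union>B}"
  have clo: "closed (\<Union>A)" "closed (\<Union>B)" using AS(1) by (intro closed_Union, blast)+
  have cl: "closed WA" "closed WB"
  proof -
    have "closedin (top_of_set W) (W \<inter> \<psi> -` \<Union>A)" "closedin (top_of_set W) (W \<inter> \<psi> -` \<Union>B)"
      by (intro continuous_closedin_preimage c\<psi> clo)+
    moreover have "WA = W \<inter> \<psi> -` \<Union>A" "WB = W \<inter> \<psi> -` \<Union>B" unfolding WA_def WB_def by auto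
    ultimately have "closedin (top_of_set W) WA" "closedin (top_of_set W) WB" by simp_all
    from closedin_closed_trans[OF this(1) compact_imp_closed[OF cW]]
      closedin_closed_trans[OF this(2) compact_imp_closed[OF cW]]
    show "closed WA" "closed WB" .
  qed
  have cover: "W \<subseteq> WA \<union> WB"
  proof
    fix w assume w: "w \<in> W"
    obtain F where "F \<in> S" "\<psi> w \<in> F" using \<psi>U[OF w] US by blast
    then obtain D where D: "D \<in> facets d S" "\<psi> w \<in> D" using face_in_facet by blast
    then have "x \<in> D" using Ux[OF \<psi>U[OF w]] by (auto simp: faces_of_dim_def)
    then have "D \<in> A \<or> D \<in> B" using D unfolding B_def by blast
    then show "w \<in> WA \<union> WB" using w D unfolding WA_def WB_def by blast
  qed
  \<comment> \<open>By the assumption to be refuted no ridge through \<open>x\<close> lies in facets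
    of both families, so the two parts of the ball meet only over faces of codimension at least
    two.\<close>
  define K where "K = {F \<in> S. aff_dim F \<le> int d - 2}"
  have KS: "K \<subseteq> S" unfolding K_def by blast
  define Z where "Z = \<Union>K"
  have clZ: "closed Z" unfolding Z_def by (rule closed_Union[OF KS])
  have meet: "\<psi> w \<in> Z" if w: "w \<in> WA" "w \<in> WB" for w
  proof -
    obtain D E where D: "D \<in> A" "\<psi> w \<in> D" and E: "E \<in> B" "\<psi> w \<in> E" using w unfolding WA_def WB_def by blast
    have wW: "w \<in> W" using w unfolding WA_def by blast
    have DE: "D \<inter> E \<in> S" using inter_in AS(1) D E by blast
    have xDE: "x \<in> D \<inter> E" using AS(3) D E by blast
    have "D \<noteq> E" using D(1) E(1) unfolding B_def by blast
    then have "D \<inter> E \<noteq> D" using facet_maximal[of D E] AS(1,4) D(1) E(1) by blast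
    then have "D \<inter> E \<subset> D" by blast
    then have lt: "aff_dim (D \<inter> E) < int d" using dim_less[OF DE AS(1)[of D]] AS(2)[of D] D(1) by simp
    have "aff_dim (D \<inter> E) \<noteq> int d - 1"
    proof
      assume "aff_dim (D \<inter> E) = int d - 1"
      then have "D \<inter> E \<in> faces_of_dim S (int d - 1)" using DE by (simp add: faces_of_dim_def)
      moreover have "x \<in> D \<inter> E \<and> D \<inter> E \<subseteq> D \<and> D \<inter> E \<subseteq> E" using xDE by simp
      ultimately have ex: "\<exists>G\<in>faces_of_dim S (int d - 1). x \<in> G \<and> G \<subseteq> D \<and> G \<subseteq> E" by (rule bexI[rotated])
      have "E \<in> {D \<in> facets d S. x \<in> D} - A" using E(1) by (simp only: B_def)
      have "\<exists>D\<in>A. \<exists>E\<in>{D \<in> facets d S. x \<in> D} - A. \<exists>G\<in>faces_of_dim S (int d - 1). x \<in> G \<and> G \<subseteq> D \<and> G \<subseteq> E"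
        by (rule bexI[where x = D], rule bexI[where x = E], rule ex, rule \<open>E \<in> _ - A\<close>, rule D(1))
      with con show False by (rule notE)
    qed
    then have "D \<inter> E \<in> K" using lt DE unfolding K_def by simp
    then show ?thesis using D(2) E(2) unfolding Z_def by blast
  qed
  \<comment> \<open>Every facet at \<open>x\<close> has relative interior points arbitrarily close
    to \<open>x\<close>; these supply the centres \<open>a\<close> and \<open>b\<close>.\<close>
  have interior_point: "\<exists>q. q \<in> L \<and> dist (\<phi> x) q < r \<and> \<psi> q \<in> rel_interior D" if D: "D \<in> A \<or> D \<in> B" for D
  proof -
    have "openin (top_of_set L) (L \<inter> ball (\<phi> x) r)" by (intro openin_open_Int) simp
    then have "openin (top_of_set (\<Union>S - {p})) (\<psi> ` (L \<inter> ball (\<phi> x) r))"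
      by (rule homeomorphism_imp_open_map[OF homeomorphism_symD[OF c(5)]])
    then have "openin (top_of_set (\<Union>S)) (\<psi> ` (L \<inter> ball (\<phi> x) r))"
      by (rule openin_trans[OF _ openin_minus])
    then obtain V where V: "open V" "\<psi> ` (L \<inter> ball (\<phi> x) r) = \<Union>S \<inter> V" unfolding openin_open by blast
    have "\<psi> (\<phi> x) = x" by (rule h(5)[OF xp])
    moreover have "\<psi> (\<phi> x) \<in> \<psi> ` (L \<inter> ball (\<phi> x) r)" using xL r(1) by (intro imageI) simp
    ultimately have "x \<in> V" using V(2) by auto
    have cD: "convex D" "closed D" using convexS compactS compact_imp_closed AS(1)[OF D] by blast+
    have "x \<in> closure (rel_interior D)"
      using convex_closure_rel_interior[OF cD(1)] closure_closed[OF cD(2)] AS(3)[OF D] by simp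
    then have "V \<inter> closure (rel_interior D) \<noteq> {}" using \<open>x \<in> V\<close> by blast
    then have "V \<inter> rel_interior D \<noteq> {}" using open_Int_closure_eq_empty[OF V(1)] by simp
    then obtain y where y: "y \<in> V" "y \<in> rel_interior D" by blast
    have "y \<in> \<Union>S" using y(2) rel_interior_subset[of D] AS(1)[OF D] by blast
    then obtain q where "q \<in> L \<inter> ball (\<phi> x) r" "y = \<psi> q" using y(1) V(2) by blast
    then show ?thesis using y(2) by auto
  qed
  have only: "D = E" if "D \<in> A \<or> D \<in> B" "E \<in> S" "y \<in> rel_interior D" "y \<in> E" for D E y
    using rel_interior_meets[OF AS(1)[OF that(1)] that(2-4)] facet_maximal[OF AS(4)[OF that(1)] that(2)] by simp
  obtain DA DB where DA: "DA \<in> A" and DB: "DB \<in> B" using \<open>A \<noteq> {}\<close> \<open>B \<noteq> {}\<close> by blast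
  obtain a where a: "a \<in> L" "dist (\<phi> x) a < r" "\<psi> a \<in> rel_interior DA" using interior_point DA by blast
  obtain b where b: "b \<in> L" "dist (\<phi> x) b < r" "\<psi> b \<in> rel_interior DB" using interior_point DB by blast
  have aK: "\<psi> a \<notin> Z"
  proof
    assume "\<psi> a \<in> Z"
    then obtain F where F: "F \<in> K" "\<psi> a \<in> F" unfolding Z_def by blast
    then have "DA = F" using only[of DA F "\<psi> a"] DA a(3) KS by blast
    then show False using F(1) AS(2)[of DA] DA unfolding K_def by simp
  qed
  have bK: "\<psi> b \<notin> Z"
  proof
    assume "\<psi> b \<in> Z"
    then obtain F where F: "F \<in> K" "\<psi> b \<in> F" unfolding Z_def by blast
    then have "DB = F" using only[of DB F "\<psi> b"] DB b(3) KS by blast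
    then show False using F(1) AS(2)[of DB] DB unfolding K_def by simp
  qed
  have aWB: "a \<notin> WB"
  proof
    assume "a \<in> WB"
    then obtain E where E: "E \<in> B" "\<psi> a \<in> E" unfolding WB_def by blast
    then have "DA = E" using only[of DA E "\<psi> a"] DA a(3) AS(1) by blast
    then show False using E(1) DA unfolding B_def by blast
  qed
  have bWA: "b \<notin> WA"
  proof
    assume "b \<in> WA"
    then obtain E where E: "E \<in> A" "\<psi> b \<in> E" unfolding WA_def by blast
    then have "DB = E" using only[of DB E "\<psi> b"] DB b(3) AS(1) by blast
    then show False using E(1) DB unfolding B_def by blast
  qed
  let ?c = "\<lambda>t. (1 - t) *\<^sub>R b + t *\<^sub>R a"
  have ctL: "?c t \<in> L" for t using a(1) b(1) c(3) by (intro subspace_add subspace_scale)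
  have ctB: "dist (\<phi> x) (?c t) < r" if "t \<in> {0..1}" for t
  proof -
    have "?c t \<in> ball (\<phi> x) r"
      using convexD_alt[OF convex_ball, of b "\<phi> x" r a t] a(2) b(2) that by simp
    then show ?thesis by simp
  qed
  have dirL: "direction b a t w \<in> ?Sph" if "w \<in> L" "w \<noteq> ?c t" for w t
  proof -
    have "w - ?c t \<noteq> 0" using that(2) by auto
    then have "norm (direction b a t w) = 1" unfolding direction_def by (simp add: norm_sgn)
    moreover have "direction b a t w \<in> L"
      unfolding direction_def sgn_div_norm using that(1) ctL c(3) by (intro subspace_scale subspace_diff)
    ultimately show ?thesis by simp
  qed
  have rf: "rel_frontier (cball 0 1 \<inter> L) = ?Sph" "aff_dim (cball 0 1 \<inter> L) = int d"
  proof -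
    have "0 \<in> interior (cball (0::'a) 1) \<inter> L" using subspace_0[OF c(3)] by simp
    then have ne: "interior (cball (0::'a) 1) \<inter> L \<noteq> {}" by blast
    show "rel_frontier (cball 0 1 \<inter> L) = ?Sph"
      using convex_affine_rel_frontier_Int[OF convex_cball subspace_imp_affine[OF c(3)] ne] by simp
    show "aff_dim (cball 0 1 \<inter> L) = int d"
      using aff_dim_convex_Int_nonempty_interior[of L "cball 0 1"] ne subspace_imp_convex[OF c(3)] c(3,4)
      by (simp add: Int_commute aff_dim_subspace)
  qed

  \<comment> \<open>The deformation where it is prescribed\<close>
  let ?dW = "sphere (\<phi> x) r \<inter> L"
  have dWW: "?dW \<subseteq> W" unfolding W_def by auto
  have cldW: "closed ?dW" using closed_subspace[OF c(3)] by (intro closed_Int) auto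
  define XZ where "XZ = {w \<in> W. \<psi> w \<in> Z}"
  have XZD: "w \<in> W" "\<psi> w \<in> Z" if "w \<in> XZ" for w using that by (simp_all add: XZ_def)
  have clXZ: "closed XZ"
  proof -
    have "closedin (top_of_set W) (W \<inter> \<psi> -` Z)"
      by (rule continuous_closedin_preimage[OF c\<psi> clZ])
    moreover have "XZ = W \<inter> \<psi> -` Z" unfolding XZ_def by auto
    ultimately show ?thesis using closedin_closed_trans[OF _ compact_imp_closed[OF cW]] by metis
  qed
  have "W \<inter> XZ = XZ" unfolding XZ_def by blast
  then have cXZ: "compact XZ" using compact_Int_closed[OF cW clXZ] by simp
  have XZL: "XZ \<subseteq> L" unfolding XZ_def using WL by blast
  \<comment> \<open>Both ends are prescribed over all of \<open>XZ\<close>, since neither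
    \<open>a\<close> nor \<open>b\<close> lies there. Where \<open>XZ\<close> meets the boundary
    sphere all times are prescribed, as the moving centre \<open>?c t\<close> stays in the interior
    of the ball.\<close>
  define Y where "Y = (XZ \<times> {0, 1::real}) \<union> ((XZ \<inter> ?dW) \<times> {0..1})"
  have cY: "compact Y" unfolding Y_def
    by (intro compact_Un compact_Times cXZ compact_Int_closed cldW) auto
  have Ydir: "w \<noteq> ?c t \<and> w \<in> L \<and> t \<in> {0..1}" if "(w, t) \<in> Y" for w t
  proof -
    have wL: "w \<in> L" "t \<in> {0..1}" using that XZL unfolding Y_def by auto
    have "w \<noteq> ?c t"
    proof (cases "w \<in> ?dW")
      case True
      then show ?thesis using ctB[OF wL(2)] by auto
    next
      case False
      then have "w \<in> XZ" "t = 0 \<or> t = 1" using that unfolding Y_def by auto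
      then show ?thesis using aK bK XZD(2)[of w] by auto
    qed
    then show ?thesis using wL by blast
  qed
  \<comment> \<open>Back from the chart to \<open>S\<close>: there the domain lies in a complex of
    polytopes, as the extension of maps into a sphere requires.\<close>
  let ?m = "\<lambda>z. (\<psi> (fst z), snd z)"
  let ?Y' = "?m ` Y"
  have contm: "continuous_on Y ?m"
    by (intro continuous_on_Pair continuous_on_snd continuous_on_id continuous_on_compose2[OF h(2) continuous_on_fst[OF continuous_on_id]])
      (use Ydir in auto)
  have cY': "compact ?Y'" by (rule compact_continuous_image[OF contm cY])
  let ?f = "\<lambda>z. direction b a (snd z) (\<phi> (fst z))"
  have Y'S: "fst z \<in> \<Union>S - {p}" "\<phi> (fst z) \<in> L" "(\<phi> (fst z), snd z) \<in> Y" if "z \<in> ?Y'" for z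
  proof -
    from that obtain y where y: "z = ?m y" "y \<in> Y" by (rule imageE)
    obtain w t where wt': "y = (w, t)" by (cases y)
    have wt: "(w, t) \<in> Y" "z = (\<psi> w, t)" using y unfolding wt' by simp_all
    have "w \<in> L" using Ydir[OF wt(1)] by blast
    then show "fst z \<in> \<Union>S - {p}" "\<phi> (fst z) \<in> L" "(\<phi> (fst z), snd z) \<in> Y"
      using h(6)[of w] h(10)[of w] wt by auto
  qed
  have contf: "continuous_on ?Y' ?f"
    unfolding direction_def
  proof (intro continuous_on_sgn continuous_intros ballI)
    show "continuous_on ?Y' (\<lambda>z. \<phi> (fst z))"
      by (rule continuous_on_compose2[OF h(1) continuous_on_fst[OF continuous_on_id]]) (use Y'S(1) in blast)
    show "\<phi> (fst z) - ((1 - snd z) *\<^sub>R b + snd z *\<^sub>R a) \<noteq> 0" if "z \<in> ?Y'" for z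
      using Ydir[OF Y'S(3)[OF that]] by simp
  qed
  have fim: "?f \<in> ?Y' \<rightarrow> rel_frontier (cball 0 1 \<inter> L)"
    unfolding rf(1)
  proof (rule Pi_I)
    fix z assume "z \<in> ?Y'"
    then show "?f z \<in> ?Sph" using Ydir[OF Y'S(3)] by (intro dirL) auto
  qed

  \<comment> \<open>Extension of the deformation over prisms\<close>
  let ?F = "(\<lambda>F. F \<times> {0..1::real}) ` (K - {{}})"
  have UF: "\<Union>?F = Z \<times> {0..1}" unfolding Z_def by auto
  have fF: "finite ?F" using finite_subset[OF KS fin] by simp
  have poly: "polytope X" if "X \<in> ?F" for X
    using that polytopeS KS polytope_interval[of "0::real" 1] by (auto intro!: polytope_Times)
  \<comment> \<open>Prisms over faces of dimension at most \<open>d - 2\<close> have dimension below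
    \<open>d\<close>, so there is no obstruction to extending a map into the sphere of dimension
    \<open>d - 1\<close>.\<close>
  have aff: "aff_dim X < aff_dim (cball 0 1 \<inter> L)" if "X \<in> ?F" for X
  proof -
    from that obtain F where F': "X = F \<times> {0..1::real}" "F \<in> K - {{}}" by (rule imageE)
    then have F: "F \<in> K" "F \<noteq> {}" "X = F \<times> {0..1::real}" by simp_all
    have "aff_dim X \<le> aff_dim F + 1" unfolding F(3) by (rule aff_dim_Times_interval[OF F(2)])
    also have "\<dots> < int d" using F(1) unfolding K_def by simp
    finally show ?thesis unfolding rf(2) .
  qed
  have face: "X \<inter> X' face_of X" if X: "X \<in> ?F" "X' \<in> ?F" for X X'
  proof -
    obtain F F' where F: "F \<in> K" "X = F \<times> {0..1::real}" "F' \<in> K" "X' = F' \<times> {0..1::real}" using X by blast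
    have "F \<inter> F' face_of F" using inter_face F(1,3) KS by blast
    then have "(F \<inter> F') \<times> {0..1} face_of F \<times> {0..1::real}"
      by (intro face_of_Times face_of_refl convex_real_interval) auto
    moreover have "X \<inter> X' = (F \<inter> F') \<times> {0..1}" unfolding F by auto
    ultimately show ?thesis using F(2) by simp
  qed
  have Y'sub: "?Y' \<subseteq> \<Union>?F" unfolding UF
  proof (rule image_subsetI)
    fix z assume "z \<in> Y"
    then have "fst z \<in> XZ" "snd z \<in> {0..1}" unfolding Y_def by auto
    then show "?m z \<in> Z \<times> {0..1}" using XZD(2) by simp
  qed
  have cvT: "convex (cball 0 1 \<inter> L)" "bounded (cball 0 1 \<inter> L)"
    using subspace_imp_convex[OF c(3)] by (auto intro: convex_Int bounded_Int)
  obtain g where g: "continuous_on (\<Union>?F) g" "g \<in> \<Union>?F \<rightarrow> rel_frontier (cball 0 1 \<inter> L)"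
    "\<And>z. z \<in> ?Y' \<Longrightarrow> g z = ?f z"
    by (rule extend_map_cell_complex_to_sphere[OF fF Y'sub compact_imp_closed[OF cY'] cvT poly aff face contf fim])
      (assumption+, rule that)
  let ?X = "XZ \<union> ?dW"
  let ?H = "\<lambda>z. if snd z \<in> XZ then g (\<psi> (snd z), fst z) else direction b a (fst z) (snd z)"
  have HY: "g (\<psi> w, t) = direction b a t w" if "(w, t) \<in> Y" for w t
  proof -
    have "(\<psi> w, t) \<in> ?Y'" using that by force
    moreover have "\<phi> (\<psi> w) = w" using Ydir[OF that] h(6) by blast
    ultimately show ?thesis using g(3) by simp
  qed
  have contH: "continuous_on (({0..1} \<times> XZ) \<union> ({0..1} \<times> ?dW)) ?H"
  proof (rule continuous_on_cases_local)
    show "closedin (top_of_set (({0..1} \<times> XZ) \<union> ({0..1} \<times> ?dW))) ({0..1::real} \<times> XZ)"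
      "closedin (top_of_set (({0..1} \<times> XZ) \<union> ({0..1} \<times> ?dW))) ({0..1::real} \<times> ?dW)"
      by (intro closed_subset closed_Times clXZ cldW closed_real_atLeastAtMost; blast)+
    show "continuous_on ({0..1} \<times> XZ) (\<lambda>z. g (\<psi> (snd z), fst z))"
    proof (rule continuous_on_compose2[OF g(1)])
      show "continuous_on ({0..1} \<times> XZ) (\<lambda>z. (\<psi> (snd z), fst z))"
        by (intro continuous_on_Pair continuous_on_fst continuous_on_id continuous_on_compose2[OF h(2) continuous_on_snd[OF continuous_on_id]])
          (use XZL in auto)
      show "(\<lambda>z. (\<psi> (snd z), fst z)) ` ({0..1} \<times> XZ) \<subseteq> \<Union>?F" unfolding UF using XZD(2) by auto
    qed
    show "continuous_on ({0..1} \<times> ?dW) (\<lambda>z. direction b a (fst z) (snd z))"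
      unfolding direction_def
    proof (intro continuous_on_sgn continuous_intros ballI)
      show "snd z - ((1 - fst z) *\<^sub>R b + fst z *\<^sub>R a) \<noteq> 0" if "z \<in> {0..1} \<times> ?dW" for z
        using ctB[of "fst z"] that by auto
    qed
    show "g (\<psi> (snd z), fst z) = direction b a (fst z) (snd z)"
      if "z \<in> {0..1} \<times> XZ \<and> snd z \<notin> XZ \<or> z \<in> {0..1} \<times> ?dW \<and> snd z \<in> XZ" for z
    proof (rule HY)
      show "(snd z, fst z) \<in> Y" using that unfolding Y_def by (cases z) auto
    qed
  qed
  have Un: "({0..1} \<times> XZ) \<union> ({0..1} \<times> ?dW) = {0..1::real} \<times> ?X" by blast
  have Him: "?H ` ({0..1} \<times> ?X) \<subseteq> ?Sph"
  proof (rule image_subsetI)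
    fix z :: "real \<times> 'a" assume z: "z \<in> {0..1} \<times> ?X"
    show "?H z \<in> ?Sph"
    proof (cases "snd z \<in> XZ")
      case True
      then have "(\<psi> (snd z), fst z) \<in> \<Union>?F" unfolding UF using z XZD(2) by auto
      then have "g (\<psi> (snd z), fst z) \<in> ?Sph" using g(2) unfolding rf(1) by blast
      then show ?thesis using True by simp
    next
      case False
      then have "direction b a (fst z) (snd z) \<in> ?Sph" using z ctB[of "fst z"] by (intro dirL) auto
      then show ?thesis using False by simp
    qed
  qed
  have hom: "homotopic_with_canon (\<lambda>x. True) ?X ?Sph (\<lambda>w. sgn (w - a)) (\<lambda>w. sgn (w - b))"
  proof (rule homotopic_with_symD)
    have cm: "continuous_map (prod_topology (top_of_set {0..1}) (top_of_set ?X)) (top_of_set ?Sph) ?H"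
      by (rule continuous_map_prod_of_sets[OF contH[unfolded Un] Him])
    show "homotopic_with_canon (\<lambda>x. True) ?X ?Sph (\<lambda>w. sgn (w - b)) (\<lambda>w. sgn (w - a))"
      unfolding homotopic_with[where P = "\<lambda>x. True", simplified]
    proof (intro exI[of _ ?H] conjI ballI)
      show "continuous_map (prod_topology (top_of_set {0..1}) (top_of_set ?X)) (top_of_set ?Sph) ?H" by (rule cm)
      show "?H (0, w) = sgn (w - b)" "?H (1, w) = sgn (w - a)" if "w \<in> topspace (top_of_set ?X)" for w
        using HY[of w 0] HY[of w 1] unfolding Y_def by auto
    qed
  qed

  \<comment> \<open>Extension of the direction field over the whole ball\<close>
  let ?T = "WB" and ?X' = "?X \<inter> WB"
  have "homotopic_with_canon (\<lambda>x. True) ?X' ?Sph (\<lambda>w. sgn (w - a)) (\<lambda>w. sgn (w - b))"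
    by (rule homotopic_with_subset_left[OF hom]) blast
  moreover have "closedin (top_of_set WB) ?X'"
    by (intro closed_subset closed_Int closed_Un clXZ cldW cl) blast
  moreover have "ANR ?Sph" using ANR_rel_frontier_convex[OF cvT(2,1)] unfolding rf(1) .
  moreover have "continuous_on WB (\<lambda>w. sgn (w - a))"
    by (intro continuous_on_sgn continuous_intros) (use aWB in auto)
  moreover have "(\<lambda>w. sgn (w - a)) \<in> WB \<rightarrow> ?Sph"
  proof (rule Pi_I)
    fix w assume "w \<in> WB"
    then have "w \<in> L" "w \<noteq> a" using aWB WL unfolding WB_def by auto
    then show "sgn (w - a) \<in> ?Sph" using dirL[of w 1] by simp
  qed
  \<comment> \<open>The field away from \<open>a\<close> is defined on all of \<open>WB\<close>, as
    \<open>a\<close> lies outside. By the homotopy extension property it may be replaced by a field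
    that agrees with the one away from \<open>b\<close> over \<open>XZ\<close> and on the boundary
    sphere.\<close>
  ultimately obtain g' where g': "continuous_on WB g'" "g' ` WB \<subseteq> ?Sph" "\<And>w. w \<in> ?X' \<Longrightarrow> g' w = sgn (w - b)"
    using Borsuk_homotopy_extension_homotopic[of WB ?X' ?Sph "\<lambda>w. sgn (w - a)" "\<lambda>w. sgn (w - b)"] by metis
  let ?G = "\<lambda>w. if w \<in> WB then g' w else sgn (w - b)"
  have WAB: "WB \<union> WA = W" using cover unfolding WA_def WB_def by blast
  have "continuous_on (WB \<union> WA) ?G"
  proof (rule continuous_on_cases[OF cl(2,1) g'(1)])
    show "continuous_on WA (\<lambda>w. sgn (w - b))"
      by (intro continuous_on_sgn continuous_intros) (use bWA in auto)
    show "\<forall>w. w \<in> WB \<and> w \<notin> WB \<or> w \<in> WA \<and> w \<in> WB \<longrightarrow> g' w = sgn (w - b)"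
    proof (intro allI impI)
      fix w assume "w \<in> WB \<and> w \<notin> WB \<or> w \<in> WA \<and> w \<in> WB"
      then have "w \<in> WA" "w \<in> WB" by auto
      moreover have "w \<in> XZ" using meet[OF calculation] calculation(1) unfolding XZ_def WA_def by simp
      ultimately show "g' w = sgn (w - b)" by (intro g'(3)) simp
    qed
  qed
  then have "continuous_on (cball (\<phi> x) r \<inter> L) ?G" unfolding WAB W_def[symmetric] .
  then show False
  proof (rule no_extension_of_direction[OF c(3) xL b(1,2)])
    show "?G w \<in> L \<and> norm (?G w) = 1" if "w \<in> cball (\<phi> x) r \<inter> L" for w
    proof (cases "w \<in> WB")
      case True
      then have "g' w \<in> ?Sph" using g'(2) by blast
      then show ?thesis using True by simp
    next
      case False
      have "w \<in> W" using that unfolding W_def .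
      then have "w \<in> WA" using cover False by blast
      then have "w \<noteq> b" using bWA by blast
      then have "sgn (w - b) \<in> ?Sph" using dirL[of w 0] that by simp
      then show ?thesis using False by simp
    qed
    show "?G w = sgn (w - b)" if "w \<in> ?dW" for w using g'(3)[of w] that by auto
  qed
qed

end

section \<open>Cells\<close>

abbreviation sqnorm :: "nat \<Rightarrow> (nat \<Rightarrow> real) \<Rightarrow> real" where
  "sqnorm n x \<equiv> \<Sum>i<n. (x i)\<^sup>2"

abbreviation open_disk :: "nat \<Rightarrow> (nat \<Rightarrow> real) set" where
  "open_disk n \<equiv> {x \<in> topspace (Euclidean_space n). sqnorm n x < 1}"

lemma Euclidean_space_top_of_set: "Euclidean_space n = top_of_set {x. \<forall>i\<ge>n. x i = 0}"
  by (simp add: Euclidean_space_def euclidean_product_topology)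

lemma continuous_on_sqnorm: "continuous_on A (sqnorm n)"
  by (intro continuous_intros continuous_on_product_coordinates[THEN continuous_on_subset]) auto

lemma topspace_disk: "topspace (disk n) = {x \<in> topspace (Euclidean_space n). sqnorm n x \<le> 1}"
  by (auto simp: disk_def)

lemma openin_sqnorm:
  assumes "open U"
  shows "openin (Euclidean_space n) {x \<in> topspace (Euclidean_space n). sqnorm n x \<in> U}"
proof -
  have "open (sqnorm n -` U)" using open_vimage[OF assms continuous_on_sqnorm[of UNIV n]] .
  then have "openin (Euclidean_space n) (topspace (Euclidean_space n) \<inter> sqnorm n -` U)"
    unfolding Euclidean_space_top_of_set by (simp add: openin_open_Int)
  moreover have "topspace (Euclidean_space n) \<inter> sqnorm n -` U = {x \<in> topspace (Euclidean_space n). sqnorm n x \<in> U}"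
    by blast
  ultimately show ?thesis by simp
qed

lemma openin_open_disk: "openin (Euclidean_space n) (open_disk n)"
  using openin_sqnorm[of "{..<1}" n] by simp

lemma open_disk_subset: "open_disk n \<subseteq> topspace (disk n)"
  by (auto simp: disk_def)

lemma compact_space_disk: "compact_space (disk m)"
proof -
  have cb: "compact (PiE UNIV (\<lambda>i. if i < m then {-1..1} else {0::real}))"
    using compactin_PiE[of "\<lambda>i. euclideanreal" UNIV "\<lambda>i. if i < m then {-1..1} else {0::real}"]
    by (simp add: euclidean_product_topology)
  have cl: "closed {x :: nat \<Rightarrow> real. sqnorm m x \<le> 1}"
    by (rule closed_Collect_le[OF continuous_on_sqnorm continuous_on_const])
  have "{x \<in> topspace (Euclidean_space m). sqnorm m x \<le> 1} =
    (PiE UNIV (\<lambda>i. if i < m then {-1..1} else {0::real})) \<inter> {x. sqnorm m x \<le> 1}" (is "?L = ?R")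
  proof (intro equalityI subsetI)
    fix x assume x: "x \<in> ?L"
    have "\<bar>x i\<bar> \<le> 1" if "i < m" for i
    proof -
      have "(x i)\<^sup>2 \<le> sqnorm m x" using that by (intro member_le_sum) auto
      then show ?thesis using x abs_square_le_1[of "x i"] by simp
    qed
    then show "x \<in> ?R" using x by (auto simp: topspace_Euclidean_space PiE_iff abs_le_iff)
  next
    fix x assume x: "x \<in> ?R"
    have "x i = 0" if "i \<ge> m" for i
      using x that PiE_mem[of x UNIV "\<lambda>i. if i < m then {-1..1} else {0::real}" i] by simp
    then show "x \<in> ?L" using x by (simp add: topspace_Euclidean_space)
  qed
  then have "compact {x \<in> topspace (Euclidean_space m). sqnorm m x \<le> 1}"
    using compact_Int_closed[OF cb cl] by simp
  then have "compact_space (top_of_set {x \<in> topspace (Euclidean_space m). sqnorm m x \<le> 1})"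
    by (simp add: compact_space_subtopology)
  moreover have "disk m = top_of_set {x \<in> topspace (Euclidean_space m). sqnorm m x \<le> 1}"
    unfolding disk_def Euclidean_space_top_of_set subtopology_subtopology
    by (intro arg_cong[where f = top_of_set]) auto
  ultimately show ?thesis by simp
qed

lemma zero_in_open_disk: "(\<lambda>i. 0) \<in> open_disk n"
  by (simp add: topspace_Euclidean_space)

text \<open>If \<open>m < n\<close>, the space with \<open>m\<close> coordinates is a subspace of
  the one with \<open>n\<close>, and by invariance of domain the image would be open in the latter.
  But a small change of coordinate \<open>m\<close>, which is 0 on the image, leaves the
  image.\<close>

lemma Euclidean_space_dim_le:
  assumes U: "openin (Euclidean_space n) U" "U \<noteq> {}"
    and f: "continuous_map (subtopology (Euclidean_space n) U) (Euclidean_space m) f" "inj_on f U"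
  shows "n \<le> m"
proof (rule ccontr)
  assume "\<not> n \<le> m"
  then have mn: "m < n" by simp
  have UE: "U \<subseteq> topspace (Euclidean_space n)" using U(1) by (rule openin_subset)
  have im: "f ` U \<subseteq> topspace (Euclidean_space m)"
    using continuous_map_image_subset_topspace[OF f(1)] UE by (simp add: inf.absorb2)
  have sub: "topspace (Euclidean_space m) \<subseteq> topspace (Euclidean_space n)" using mn by simp
  have "continuous_map (subtopology (Euclidean_space n) U) (Euclidean_space n) f"
    using f(1) im sub unfolding cm_Euclidean_space_iff_continuous_on by blast
  then have "openin (Euclidean_space n) (f ` U)"
    by (rule invariance_of_domain_Euclidean_space[OF U(1) _ f(2)])
  then obtain V where V: "open V" "f ` U = {x. \<forall>i\<ge>n. x i = 0} \<inter> V"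
    unfolding Euclidean_space_top_of_set openin_open by blast
  obtain y where y: "y \<in> f ` U" using U(2) by blast
  then have ym: "\<forall>i\<ge>m. y i = 0" using im by (auto simp: topspace_Euclidean_space)
  let ?g = "\<lambda>t. y(m := t)"
  have "continuous_on UNIV ?g"
  proof (rule continuous_on_coordinatewise_then_product)
    fix i show "continuous_on UNIV (\<lambda>t. (y(m := t)) i)" by (cases "i = m") simp_all
  qed
  then have "open (?g -` V)" by (rule open_vimage[OF V(1)])
  moreover have "0 \<in> ?g -` V"
  proof -
    have "?g 0 = y" using ym by (auto simp: fun_eq_iff)
    then show ?thesis using y V(2) by simp
  qed
  ultimately obtain e where e: "e > 0" "ball 0 e \<subseteq> ?g -` V" unfolding open_contains_ball by blast
  have "e / 2 \<in> ball 0 e" using e(1) by simp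
  then have "?g (e / 2) \<in> V" using e(2) by blast
  moreover have "\<forall>i\<ge>n. ?g (e / 2) i = 0" using ym mn by simp
  ultimately have "?g (e / 2) \<in> f ` U" unfolding V(2) by simp
  then have "?g (e / 2) \<in> topspace (Euclidean_space m)" using im by (rule subsetD[rotated])
  then have "\<forall>i\<ge>m. ?g (e / 2) i = 0" unfolding topspace_Euclidean_space by (rule CollectD)
  then have "?g (e / 2) m = 0" by blast
  then show False using e(1) by simp
qed

text \<open>An open set that contains a point of the boundary sphere also contains points slightly
  further out on the same ray.\<close>

lemma open_subset_disk:
  assumes V: "openin (Euclidean_space n) V" "V \<subseteq> topspace (disk n)"
  shows "V \<subseteq> open_disk n"
proof
  fix y assume y: "y \<in> V"
  obtain W where W: "open W" "V = {x. \<forall>i\<ge>n. x i = 0} \<inter> W"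
    using V(1) unfolding Euclidean_space_top_of_set openin_open by blast
  let ?g = "\<lambda>t i. t * y i"
  have "continuous_on UNIV ?g"
    by (rule continuous_on_coordinatewise_then_product) (intro continuous_intros)
  then have "open (?g -` W)" by (rule open_vimage[OF W(1)])
  moreover have "1 \<in> ?g -` W" using y W(2) by simp
  ultimately obtain e where e: "e > 0" "ball 1 e \<subseteq> ?g -` W" unfolding open_contains_ball by blast
  have "1 + e / 2 \<in> ball 1 e" using e(1) by (simp add: dist_real_def)
  then have "?g (1 + e / 2) \<in> W" using e(2) by blast
  moreover have y0: "\<forall>i\<ge>n. y i = 0" "sqnorm n y \<le> 1" using y V(2) by (auto simp: topspace_disk topspace_Euclidean_space)
  ultimately have "?g (1 + e / 2) \<in> V" unfolding W(2) by simp
  then have "sqnorm n (?g (1 + e / 2)) \<le> 1" using V(2) by (auto simp: topspace_disk)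
  moreover have "sqnorm n (?g (1 + e / 2)) = (1 + e / 2)\<^sup>2 * sqnorm n y"
    by (simp add: power_mult_distrib sum_distrib_left)
  ultimately have le: "(1 + e / 2)\<^sup>2 * sqnorm n y \<le> 1" by simp
  have "(1 + e / 2)\<^sup>2 > 1" by (rule one_less_power) (use e(1) in simp_all)
  then have "sqnorm n y \<noteq> 1" using le by auto
  then show "y \<in> open_disk n" using y0 by (simp add: topspace_Euclidean_space)
qed

lemma is_cellE:
  assumes "is_cell X n c B"
  obtains f g where "homeomorphic_maps (disk n) (subtopology X c) f g" "c \<subseteq> topspace X"
    "f ` topspace (disk n) = c" "inj_on f (topspace (disk n))"
    "f ` open_disk n = c - B" "B = f ` (topspace (disk n) - open_disk n)"
    "\<And>x. x \<in> c \<Longrightarrow> g x \<in> topspace (disk n) \<and> f (g x) = x"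
    "continuous_map (disk n) X f" "continuous_map (subtopology X c) (Euclidean_space n) g" "inj_on g c"
proof -
  obtain f where c: "c \<subseteq> topspace X" and f: "homeomorphic_map (disk n) (subtopology X c) f"
    and B: "B = f ` {x \<in> topspace (disk n). (\<Sum>i<n. x i ^ 2) = 1}"
    using assms unfolding is_cell_def by blast
  obtain g where fg: "homeomorphic_maps (disk n) (subtopology X c) f g"
    using f homeomorphic_map_maps by blast
  have tc: "topspace (subtopology X c) = c" using c by (simp add: inf.absorb2)
  have im: "f ` topspace (disk n) = c" using homeomorphic_imp_surjective_map[OF f] tc by simp
  have inj: "inj_on f (topspace (disk n))" by (rule homeomorphic_imp_injective_map[OF f])
  have eq: "{x \<in> topspace (disk n). (\<Sum>i<n. x i ^ 2) = 1} = topspace (disk n) - open_disk n"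
    by (auto simp: topspace_disk)
  have "f ` open_disk n = c - B"
  proof -
    have "f ` (topspace (disk n) - (topspace (disk n) - open_disk n)) = f ` topspace (disk n) - f ` (topspace (disk n) - open_disk n)"
      by (rule inj_on_image_set_diff[OF inj]) auto
    then show ?thesis unfolding im B eq double_diff[OF open_disk_subset order_refl] .
  qed
  moreover have gx: "g x \<in> topspace (disk n) \<and> f (g x) = x" if "x \<in> c" for x
    using fg that tc unfolding homeomorphic_maps_def continuous_map_def by auto
  moreover have "continuous_map (disk n) X f"
    using fg unfolding homeomorphic_maps_def by (simp add: continuous_map_in_subtopology)
  moreover have "continuous_map (subtopology X c) (Euclidean_space n) g"
    using fg unfolding homeomorphic_maps_def disk_def by (simp add: continuous_map_in_subtopology)
  moreover have "inj_on g c" using gx by (metis inj_on_inverseI)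
  ultimately show thesis using that[OF fg c im inj] B unfolding eq by blast
qed

lemma continuous_map_open_disk:
  assumes "continuous_map (disk n) X f"
  shows "continuous_map (subtopology (Euclidean_space n) (open_disk n)) X f"
proof -
  have "subtopology (Euclidean_space n) (open_disk n) = subtopology (disk n) (open_disk n)"
    unfolding disk_def subtopology_subtopology by (intro arg_cong[where f = "subtopology _"]) auto
  then show ?thesis using continuous_map_from_subtopology[OF assms] by simp
qed

text \<open>Injectivity is asked on the open cell only, so that the bound applies to quotient maps
  that may fold the boundary.\<close>

lemma cell_interior_dim_le:
  assumes c: "is_cell X n c B" and c': "is_cell Y m c' B'"
    and h: "continuous_map (subtopology X c) Y h" "inj_on h (c - B)" "h ` (c - B) \<subseteq> c'"
  shows "n \<le> m"
proof -
  obtain f g where f: "homeomorphic_maps (disk n) (subtopology X c) f g" "c \<subseteq> topspace X"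
    "f ` topspace (disk n) = c" "inj_on f (topspace (disk n))"
    "f ` open_disk n = c - B" "continuous_map (disk n) X f"
    by (rule is_cellE[OF c]) (rule that)
  obtain f' g' where f': "continuous_map (subtopology Y c') (Euclidean_space m) g'" "inj_on g' c'"
    by (rule is_cellE[OF c']) (rule that)
  have "continuous_map (disk n) (subtopology X c) f" using f(1) unfolding homeomorphic_maps_def by blast
  then have "continuous_map (disk n) Y (h \<circ> f)" using h(1) by (rule continuous_map_compose)
  then have 1: "continuous_map (subtopology (Euclidean_space n) (open_disk n)) Y (h \<circ> f)"
    by (rule continuous_map_open_disk)
  have im: "(h \<circ> f) ` open_disk n \<subseteq> c'" unfolding image_comp[symmetric] f(5) by (rule h(3))
  have "continuous_map (subtopology (Euclidean_space n) (open_disk n)) (subtopology Y c') (h \<circ> f)"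
    using 1 im by (simp add: continuous_map_in_subtopology image_subset_iff_funcset[symmetric]) blast
  then have cont: "continuous_map (subtopology (Euclidean_space n) (open_disk n)) (Euclidean_space m) (g' \<circ> (h \<circ> f))"
    using f'(1) by (rule continuous_map_compose)
  have "inj_on f (open_disk n)" using f(4) open_disk_subset by (rule inj_on_subset)
  then have "inj_on (h \<circ> f) (open_disk n)" by (rule comp_inj_on) (simp add: f(5) h(2))
  then have inj: "inj_on (g' \<circ> (h \<circ> f)) (open_disk n)"
    by (rule comp_inj_on) (rule inj_on_subset[OF f'(2) im])
  have "open_disk n \<noteq> {}" using zero_in_open_disk by blast
  then show ?thesis by (rule Euclidean_space_dim_le[OF openin_open_disk _ cont inj])
qed

lemma cell_dim_le:
  assumes "is_cell X n c B" "is_cell X m c' B'" "c \<subseteq> c'" shows "n \<le> m"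
  by (rule cell_interior_dim_le[OF assms(1,2), of "\<lambda>x. x"])
    (use assms(3) in \<open>auto intro: continuous_map_from_subtopology continuous_map_id[unfolded id_def]\<close>)

lemma cell_dim_unique: "\<lbrakk>is_cell X n c B; is_cell X m c B'\<rbrakk> \<Longrightarrow> n = m"
  by (intro antisym cell_dim_le[of X _ c _ _ c]) auto

text \<open>In the coordinates of the larger cell the open smaller cell is open by invariance of
  domain, so it avoids the boundary sphere. Dimension and boundary of a cell are thereby independent
  of the chosen parametrisation.\<close>

lemma cell_embedding_interior:
  assumes c: "is_cell X n c B" and c': "is_cell X n c' B'" and sub: "c \<subseteq> c'"
  shows "c - B \<subseteq> c' - B'"
proof -
  obtain f g where f: "homeomorphic_maps (disk n) (subtopology X c) f g" "c \<subseteq> topspace X"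
    "f ` topspace (disk n) = c" "inj_on f (topspace (disk n))"
    "f ` open_disk n = c - B" "continuous_map (disk n) X f"
    by (rule is_cellE[OF c]) (rule that)
  obtain f' g' where f': "f' ` open_disk n = c' - B'"
    "\<And>x. x \<in> c' \<Longrightarrow> g' x \<in> topspace (disk n) \<and> f' (g' x) = x"
    "continuous_map (subtopology X c') (Euclidean_space n) g'" "inj_on g' c'"
    by (rule is_cellE[OF c']) (rule that)
  have 1: "continuous_map (subtopology (Euclidean_space n) (open_disk n)) X f"
    by (rule continuous_map_open_disk[OF f(6)])
  have im: "f ` open_disk n \<subseteq> c'" using f(5) sub by blast
  have "continuous_map (subtopology (Euclidean_space n) (open_disk n)) (subtopology X c') f"
    using 1 im by (simp add: continuous_map_in_subtopology image_subset_iff_funcset[symmetric]) blast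
  then have cont: "continuous_map (subtopology (Euclidean_space n) (open_disk n)) (Euclidean_space n) (g' \<circ> f)"
    using f'(3) by (rule continuous_map_compose)
  have "inj_on f (open_disk n)" using f(4) open_disk_subset by (rule inj_on_subset)
  then have inj: "inj_on (g' \<circ> f) (open_disk n)"
    by (rule comp_inj_on) (rule inj_on_subset[OF f'(4) im])
  have "openin (Euclidean_space n) ((g' \<circ> f) ` open_disk n)"
    by (rule invariance_of_domain_Euclidean_space[OF openin_open_disk cont inj])
  moreover have "(g' \<circ> f) ` open_disk n \<subseteq> topspace (disk n)" using f'(2) im by auto
  ultimately have od: "(g' \<circ> f) ` open_disk n \<subseteq> open_disk n" by (rule open_subset_disk)
  show ?thesis
  proof
    fix x assume "x \<in> c - B"
    then obtain y where y: "y \<in> open_disk n" "x = f y" unfolding f(5)[symmetric] by (rule imageE)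
    have "g' x \<in> open_disk n" using od y by (auto simp: image_subset_iff)
    moreover have "f' (g' x) = x" using f'(2)[of x] im y by blast
    ultimately show "x \<in> c' - B'" using imageI[of "g' x" "open_disk n" f'] unfolding f'(1) by (simp only:)
  qed
qed

lemma cell_boundary_subset: assumes "is_cell X n c B" shows "B \<subseteq> c"
  by (rule is_cellE[OF assms]) blast

lemma cell_boundary_unique:
  assumes "is_cell X n c B" "is_cell X n c B'" shows "B = B'"
  using cell_embedding_interior[OF assms order_refl] cell_embedding_interior[OF assms(2,1) order_refl]
    cell_boundary_subset[OF assms(1)] cell_boundary_subset[OF assms(2)] by blast

lemma cell_interior_nonempty: assumes "is_cell X n c B" shows "c - B \<noteq> {}"
proof (rule is_cellE[OF assms])
  fix f :: "(nat \<Rightarrow> real) \<Rightarrow> 'a" assume "f ` open_disk n = c - B"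
  then show ?thesis using zero_in_open_disk[of n] by blast
qed

lemma cell_boundary_dim_less:
  assumes c: "is_cell X n c B" and c': "is_cell X m c' B'" and sub: "c \<subseteq> B'"
  shows "n < m"
proof -
  have cc: "c \<subseteq> c'" using sub cell_boundary_subset[OF c'] by blast
  have "n \<le> m" by (rule cell_dim_le[OF c c' cc])
  moreover have "n \<noteq> m"
  proof
    assume "n = m"
    then have "c - B \<subseteq> c' - B'" using cell_embedding_interior[OF c _ cc] c' by blast
    then show False using cell_interior_nonempty[OF c] sub by blast
  qed
  ultimately show ?thesis by simp
qed

text \<open>A finite Baire argument: if \<open>U\<close> is not contained in one of the sets, the
  part of \<open>U\<close> outside it is open and nonempty and is covered by the others.\<close>

lemma finite_closed_cover_interior:
  assumes "finite I" "\<And>i. i \<in> I \<Longrightarrow> closedin X (A i)" "openin X U" "U \<noteq> {}" "U \<subseteq> (\<Union>i\<in>I. A i)"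
  shows "\<exists>i\<in>I. \<exists>V. openin X V \<and> V \<noteq> {} \<and> V \<subseteq> A i \<and> V \<subseteq> U"
  using assms
proof (induction I arbitrary: U rule: finite_induct)
  case (insert a I)
  show ?case
  proof (cases "U \<subseteq> A a")
    case True
    then show ?thesis using insert.prems by blast
  next
    case False
    have "openin X (U - A a)" using insert.prems(1,2) by (simp add: openin_diff)
    moreover have "U - A a \<noteq> {}" "U - A a \<subseteq> (\<Union>i\<in>I. A i)" using False insert.prems(4) by auto
    ultimately obtain i V where "i \<in> I" "openin X V" "V \<noteq> {}" "V \<subseteq> A i" "V \<subseteq> U - A a"
      using insert.IH[of "U - A a"] insert.prems(1) by auto
    then show ?thesis by blast
  qed
qed auto

text \<open>The punctured open disk projects radially to the boundary sphere. As finitely many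
  closed pieces cover it, some cell \<open>e\<close> contains the image of a nonempty open set
  \<open>V\<close>. The coordinates in \<open>e\<close> together with the radius embed
  \<open>V\<close> in dimension at most \<open>k + 1\<close>, which bounds \<open>n\<close>.\<close>

lemma boundary_cover_dim:
  assumes X: "Hausdorff_space X" and c: "is_cell X n c B" and n: "n \<noteq> 0"
    and I: "finite I" "\<And>e. e \<in> I \<Longrightarrow> \<exists>m b. is_cell X m e b \<and> m \<le> k" and cover: "B \<subseteq> \<Union>I"
  shows "n \<le> k + 1"
proof -
  obtain f g where f: "f ` topspace (disk n) = c" "inj_on f (topspace (disk n))"
    "B = f ` (topspace (disk n) - open_disk n)" "continuous_map (disk n) X f"
    by (rule is_cellE[OF c]) (rule that)
  let ?E = "Euclidean_space n"
  define U where "U = {x \<in> topspace ?E. sqnorm n x \<in> {0<..<1}}"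
  have oU: "openin ?E U" unfolding U_def by (rule openin_sqnorm) simp
  let ?p = "\<lambda>x i. x i / sqrt (sqnorm n x)"
  have UE: "U \<subseteq> topspace ?E" unfolding U_def by blast
  have pos: "sqnorm n x > 0" if "x \<in> U" for x using that unfolding U_def by simp
  have pn: "sqnorm n (?p x) = 1" if "x \<in> U" for x
  proof -
    have "sqnorm n (?p x) = (\<Sum>i<n. (x i)\<^sup>2 / sqnorm n x)"
      using pos[OF that] by (simp add: power_divide)
    also have "\<dots> = sqnorm n x / sqnorm n x" by (rule sum_divide_distrib[symmetric])
    finally show ?thesis using pos[OF that] by simp
  qed
  have pd: "?p x \<in> topspace (disk n) - open_disk n" if "x \<in> U" for x
    using pn[OF that] UE that unfolding topspace_disk by (auto simp: topspace_Euclidean_space)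
  have cp0: "continuous_on U ?p"
  proof (rule continuous_on_coordinatewise_then_product)
    fix i
    have "continuous_on U (\<lambda>x. x i)" by (rule continuous_on_subset[OF continuous_on_product_coordinates]) simp
    moreover have "continuous_on U (\<lambda>x. sqrt (sqnorm n x))" by (intro continuous_on_real_sqrt continuous_on_sqnorm)
    ultimately show "continuous_on U (\<lambda>x. x i / sqrt (sqnorm n x))"
      by (rule continuous_on_divide) (use pos in \<open>auto simp: less_le\<close>)
  qed
  have tU: "topspace (subtopology ?E U) = U" using UE by (simp add: inf.absorb2)
  have cp: "continuous_map (subtopology ?E U) (disk n) ?p"
  proof -
    have "continuous_map (subtopology ?E U) ?E ?p"
      unfolding cm_Euclidean_space_iff_continuous_on tU using cp0 pd by (auto simp: topspace_disk)
    then show ?thesis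
      unfolding disk_def using pn by (auto simp: continuous_map_in_subtopology tU)
  qed
  define h where "h = f \<circ> ?p"
  have ch: "continuous_map (subtopology ?E U) X h" unfolding h_def by (rule continuous_map_compose[OF cp f(4)])
  have hB: "h x \<in> B" if "x \<in> U" for x using pd[OF that] f(3) unfolding h_def by auto
  define A where "A = (\<lambda>e. {x \<in> U. h x \<in> e})"
  have clA: "closedin (subtopology ?E U) (A e)" if "e \<in> I" for e
  proof -
    obtain m b where e: "is_cell X m e b" using I(2)[OF \<open>e \<in> I\<close>] by blast
    have "compactin X e"
    proof -
      obtain f' g' where "f' ` topspace (disk m) = e" "continuous_map (disk m) X f'"
        by (rule is_cellE[OF e]) (rule that)
      then show ?thesis using image_compactin[of "disk m" "topspace (disk m)" X f'] compact_space_disk[of m]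
        by (simp add: compact_space_def)
    qed
    then have "closedin X e" using X by (rule compactin_imp_closedin[rotated])
    from closedin_continuous_map_preimage[OF ch this]
    show ?thesis unfolding A_def tU .
  qed
  have Uc: "U \<subseteq> (\<Union>e\<in>I. A e)" using hB cover unfolding A_def by blast
  have Uo: "openin (subtopology ?E U) U" using oU by (simp add: openin_open_subtopology)
  have "U \<noteq> {}"
  proof -
    let ?z = "\<lambda>i::nat. if i = 0 then 1 / 2 else 0 :: real"
    have "sqnorm n ?z = (\<Sum>i<n. if i = 0 then 1 / 4 else 0)"
      by (rule sum.cong) (auto simp: power2_eq_square)
    then have "sqnorm n ?z = 1 / 4" using n by simp
    moreover have "?z \<in> topspace (Euclidean_space n)" using n by (simp add: topspace_Euclidean_space)
    ultimately have "?z \<in> U" unfolding U_def by simp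
    then show ?thesis by blast
  qed
  have "\<exists>e\<in>I. \<exists>V. openin (subtopology ?E U) V \<and> V \<noteq> {} \<and> V \<subseteq> A e \<and> V \<subseteq> U"
    by (rule finite_closed_cover_interior[OF I(1) clA Uo \<open>U \<noteq> {}\<close> Uc])
  then obtain e V where e: "e \<in> I" and V: "openin (subtopology ?E U) V" "V \<noteq> {}" "V \<subseteq> A e" "V \<subseteq> U"
    by (elim bexE exE conjE)
  have oV: "openin ?E V" using V(1) oU by (simp add: openin_open_subtopology)
  obtain m b where em: "is_cell X m e b" "m \<le> k" using I(2)[OF e] by blast
  obtain f' g' where g': "continuous_map (subtopology X e) (Euclidean_space m) g'" "inj_on g' e"
    by (rule is_cellE[OF em(1)]) (rule that)
  have hV: "h ` V \<subseteq> e" using V(3) unfolding A_def by blast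
  have "continuous_map (subtopology ?E V) X h" by (rule continuous_map_from_subtopology_mono[OF ch V(4)])
  then have "continuous_map (subtopology ?E V) (subtopology X e) h"
    using hV by (auto simp: continuous_map_in_subtopology)
  then have cgh: "continuous_map (subtopology ?E V) (Euclidean_space m) (g' \<circ> h)"
    using g'(1) by (rule continuous_map_compose)
  have tV: "topspace (subtopology ?E V) = V" using V(4) UE by (auto simp: inf.absorb2)
  have cgh1: "continuous_on V (g' \<circ> h)" and ghE: "g' \<circ> h \<in> V \<rightarrow> topspace (Euclidean_space m)"
    using cgh unfolding cm_Euclidean_space_iff_continuous_on tV by simp_all
  have gh0: "g' (h x) i = 0" if "x \<in> V" "i \<ge> m" for x i
  proof -
    have "(g' \<circ> h) x \<in> topspace (Euclidean_space m)" using ghE that(1) by (rule funcset_mem)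
    then show ?thesis using that(2) by (simp add: topspace_Euclidean_space)
  qed
  \<comment> \<open>Slot \<open>m\<close> is free, since \<open>g'\<close> uses the coordinates
    below \<open>m\<close> only; it holds the radius, which the projection forgets.\<close>
  define H where "H = (\<lambda>x i. if i = m then sqrt (sqnorm n x) else g' (h x) i)"
  have "continuous_map (subtopology ?E V) (Euclidean_space (Suc m)) H"
    unfolding cm_Euclidean_space_iff_continuous_on tV
  proof
    show "continuous_on V H"
    proof (rule continuous_on_coordinatewise_then_product)
      fix i
      have "continuous_on V (\<lambda>x. (g' \<circ> h) x i)" by (rule continuous_on_product_then_coordinatewise[OF cgh1])
      moreover have "continuous_on V (\<lambda>x. sqrt (sqnorm n x))" by (intro continuous_on_real_sqrt continuous_on_sqnorm)
      ultimately show "continuous_on V (\<lambda>x. H x i)" unfolding H_def by (cases "i = m") simp_all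
    qed
    show "H \<in> V \<rightarrow> topspace (Euclidean_space (Suc m))"
      using gh0 unfolding H_def by (auto simp: topspace_Euclidean_space)
  qed
  moreover have "inj_on H V"
  proof (rule inj_onI)
    fix x y assume x: "x \<in> V" and y: "y \<in> V" and eq: "H x = H y"
    have xU: "x \<in> U" "y \<in> U" using x y V(4) by auto
    have s: "sqrt (sqnorm n x) = sqrt (sqnorm n y)" using fun_cong[OF eq, of m] unfolding H_def by simp
    have "g' (h x) i = g' (h y) i" for i
      using fun_cong[OF eq, of i] gh0[OF x, of m] gh0[OF y, of m] unfolding H_def by (cases "i = m") simp_all
    then have "h x = h y" using inj_onD[OF g'(2), of "h x" "h y"] hV x y by (auto simp: fun_eq_iff)
    then have "?p x = ?p y" using inj_onD[OF f(2), of "?p x" "?p y"] pd[OF xU(1)] pd[OF xU(2)] unfolding h_def by simp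
    then have "x i / sqrt (sqnorm n x) = y i / sqrt (sqnorm n x)" for i using s by (metis (no_types, lifting))
    then show "x = y" using pos[OF xU(1)] by (auto simp: fun_eq_iff)
  qed
  ultimately have "n \<le> Suc m" using Euclidean_space_dim_le[OF oV V(2)] by blast
  then show ?thesis using em(2) by simp
qed

section \<open>Simplicial CW complexes\<close>

locale simplicial_cw =
  fixes X :: "'p topology" and K :: "'p set set"
  assumes cw: "simplicial_CW_complex (X, K)"
begin

lemma hausdorff: "Hausdorff_space X" and finite_cells: "finite K"
  using cw by (auto simp: simplicial_CW_complex_def regular_CW_complex_def)

lemma boundary_exists:
  "\<exists>bd. (\<forall>c\<in>K. (\<exists>n. is_cell X n c (bd c)) \<and> (\<exists>L\<subseteq>K. bd c = \<Union>L)) \<and>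
        (\<Union>c\<in>K. c - bd c) = topspace X \<and>
        (\<forall>c\<in>K. \<forall>c'\<in>K. c \<noteq> c' \<longrightarrow> (c - bd c) \<inter> (c' - bd c') = {})"
  using cw by (simp add: simplicial_CW_complex_def regular_CW_complex_def)

text \<open>One fixed choice of boundaries, which \<open>regular_CW_complex\<close> only asserts to
  exist. The boundary of a closed ball is unique, so nothing depends on the choice.\<close>

definition bd :: "'p set \<Rightarrow> 'p set" where
  "bd = (SOME bd. (\<forall>c\<in>K. (\<exists>n. is_cell X n c (bd c)) \<and> (\<exists>L\<subseteq>K. bd c = \<Union>L)) \<and>
        (\<Union>c\<in>K. c - bd c) = topspace X \<and>
        (\<forall>c\<in>K. \<forall>c'\<in>K. c \<noteq> c' \<longrightarrow> (c - bd c) \<inter> (c' - bd c') = {}))"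

abbreviation "inner_part c \<equiv> c - bd c"

lemma bd_props:
  "(\<forall>c\<in>K. (\<exists>n. is_cell X n c (bd c)) \<and> (\<exists>L\<subseteq>K. bd c = \<Union>L)) \<and>
        (\<Union>c\<in>K. c - bd c) = topspace X \<and>
        (\<forall>c\<in>K. \<forall>c'\<in>K. c \<noteq> c' \<longrightarrow> (c - bd c) \<inter> (c' - bd c') = {})"
  unfolding bd_def by (rule someI_ex[OF boundary_exists])

definition cdim :: "'p set \<Rightarrow> nat" where "cdim c = (SOME n. is_cell X n c (bd c))"

lemma is_cell: "c \<in> K \<Longrightarrow> is_cell X (cdim c) c (bd c)"
  unfolding cdim_def using bd_props by (intro someI_ex[of "\<lambda>n. is_cell X n c (bd c)"]) (simp only: Ball_def)

lemma bd_cells: "c \<in> K \<Longrightarrow> \<exists>L\<subseteq>K. bd c = \<Union>L"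
  using bd_props by (simp only: Ball_def)

lemma covered: "x \<in> topspace X \<Longrightarrow> \<exists>c\<in>K. x \<in> inner_part c"
  using bd_props by (metis UN_E)

lemma disjoint_cells: "\<lbrakk>c \<in> K; e \<in> K; x \<in> inner_part c; x \<in> inner_part e\<rbrakk> \<Longrightarrow> c = e"
  using bd_props by (metis IntI empty_iff)

lemma cell_subset: "c \<in> K \<Longrightarrow> c \<subseteq> topspace X"
  using is_cell unfolding is_cell_def by blast

lemma inner_part_nonempty: "c \<in> K \<Longrightarrow> \<exists>x. x \<in> inner_part c"
  using cell_interior_nonempty[OF is_cell] by blast

lemma cell_nonempty: "c \<in> K \<Longrightarrow> c \<noteq> {}"
  using inner_part_nonempty by blast

lemma bd_subset: "c \<in> K \<Longrightarrow> bd c \<subseteq> c"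
  by (rule cell_boundary_subset[OF is_cell])

lemma n_cells_iff: "c \<in> n_cells (X, K) n \<longleftrightarrow> c \<in> K \<and> cdim c = n"
proof
  assume "c \<in> n_cells (X, K) n"
  then obtain B where "c \<in> K" "is_cell X n c B" by (auto simp: n_cells_def)
  then show "c \<in> K \<and> cdim c = n" using cell_dim_unique is_cell by metis
next
  assume "c \<in> K \<and> cdim c = n"
  then show "c \<in> n_cells (X, K) n" using is_cell[of c] by (auto simp: n_cells_def)
qed

text \<open>A point of \<open>bd c\<close> lies in a cell contained in \<open>bd c\<close>, which
  has fewer faces than \<open>c\<close> because it misses the interior of \<open>c\<close>. Descend
  until the point is an interior one.\<close>

lemma point_in_face:
  assumes "c \<in> K" "x \<in> c" shows "\<exists>e\<in>K. e \<subseteq> c \<and> x \<in> inner_part e"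
  using assms
proof (induction "card {e \<in> K. e \<subseteq> c}" arbitrary: c rule: less_induct)
  case less
  show ?case
  proof (cases "x \<in> bd c")
    case False
    then show ?thesis using less.prems by blast
  next
    case True
    obtain L where L: "L \<subseteq> K" "bd c = \<Union>L" using bd_cells[OF less.prems(1)] by (elim exE conjE)
    then obtain l where l: "l \<in> L" "x \<in> l" using True by blast
    have lK: "l \<in> K" using l L by blast
    have lb: "l \<subseteq> bd c" unfolding L(2) using l(1) by (rule Union_upper)
    have lc: "l \<subseteq> c" using lb bd_subset[OF less.prems(1)] by (rule subset_trans)
    have "\<not> c \<subseteq> l" using inner_part_nonempty[OF less.prems(1)] lb by blast
    then have "{e \<in> K. e \<subseteq> l} \<subset> {e \<in> K. e \<subseteq> c}" using lc less.prems(1) by blast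
    then have "card {e \<in> K. e \<subseteq> l} < card {e \<in> K. e \<subseteq> c}" using finite_cells by (intro psubset_card_mono) auto
    from less.hyps[OF this lK l(2)] obtain e where "e \<in> K" "e \<subseteq> l" "x \<in> inner_part e" by (elim bexE conjE)
    then show ?thesis using lc by (intro bexI[of _ e] conjI) auto
  qed
qed

lemma inner_point_face: "\<lbrakk>e \<in> K; c \<in> K; x \<in> inner_part e; x \<in> c\<rbrakk> \<Longrightarrow> e \<subseteq> c"
  using point_in_face[of c x] disjoint_cells by metis

lemma proper_face_bd:
  assumes "e \<in> K" "c \<in> K" "e \<subseteq> c" "e \<noteq> c" shows "e \<subseteq> bd c"
proof (rule subsetI, rule ccontr)
  fix x assume "x \<in> e" "x \<notin> bd c"
  then have "c \<subseteq> e" using inner_point_face[of c e x] assms by blast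
  then show False using assms(3,4) by simp
qed

lemma cdim_less: "\<lbrakk>e \<in> K; c \<in> K; e \<subseteq> c; e \<noteq> c\<rbrakk> \<Longrightarrow> cdim e < cdim c"
  by (rule cell_boundary_dim_less[OF is_cell is_cell proper_face_bd])

lemma cdim_eq: "\<lbrakk>e \<in> K; c \<in> K; e \<subseteq> c; cdim e = cdim c\<rbrakk> \<Longrightarrow> e = c"
  using cdim_less by force

text \<open>Relates the topological dimension to the rank in the lower interval. Each further vertex
  raises the dimension, since a proper face lies in the boundary; conversely the boundary is covered
  by faces of smaller rank, and \<open>boundary_cover_dim\<close> bounds the dimension from
  above.\<close>

lemma cell_faces:
  assumes c: "c \<in> K"
  obtains A :: "nat set" and \<phi> where "finite A" "card A = cdim c + 1"
    "bij_betw \<phi> (Pow A) {e \<in> insert {} K. e \<subseteq> c}"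
    "\<And>B C. \<lbrakk>B \<subseteq> A; C \<subseteq> A\<rbrakk> \<Longrightarrow> \<phi> B \<subseteq> \<phi> C \<longleftrightarrow> B \<subseteq> C"
    "\<phi> {} = {}" "\<phi> A = c" "\<And>B. \<lbrakk>B \<subseteq> A; B \<noteq> {}\<rbrakk> \<Longrightarrow> \<phi> B \<in> K \<and> cdim (\<phi> B) + 1 = card B"
proof -
  have "boolean_poset {e \<in> insert {} K. e \<subseteq> c}"
    using cw c by (simp add: simplicial_CW_complex_def)
  then obtain A :: "nat set" and \<phi> where A: "finite A" and bij: "bij_betw \<phi> (Pow A) {e \<in> insert {} K. e \<subseteq> c}"
    and ord': "\<forall>B\<in>Pow A. \<forall>C\<in>Pow A. \<phi> B \<subseteq> \<phi> C \<longleftrightarrow> B \<subseteq> C"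
    unfolding boolean_poset_def by blast
  have ord: "\<phi> B \<subseteq> \<phi> C \<longleftrightarrow> B \<subseteq> C" if "B \<subseteq> A" "C \<subseteq> A" for B C using ord' that by simp
  have im: "\<phi> ` Pow A = {e \<in> insert {} K. e \<subseteq> c}" using bij by (simp add: bij_betw_def)
  have onto: "\<exists>B\<subseteq>A. e = \<phi> B" if "e \<in> insert {} K" "e \<subseteq> c" for e
  proof -
    have "e \<in> \<phi> ` Pow A" unfolding im using that by simp
    then show ?thesis by blast
  qed
  have into: "\<phi> B \<in> insert {} K" "\<phi> B \<subseteq> c" if "B \<subseteq> A" for B
  proof -
    have "\<phi> B \<in> \<phi> ` Pow A" using that by (intro imageI) simp
    then show "\<phi> B \<in> insert {} K" "\<phi> B \<subseteq> c" unfolding im by simp_all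
  qed
  have e0: "\<phi> {} = {}"
  proof -
    obtain B where B: "B \<subseteq> A" "{} = \<phi> B" using onto[of "{}"] by blast
    have "\<phi> {} \<subseteq> \<phi> B" using ord[of "{}" B] B(1) by simp
    then show ?thesis using B(2) by simp
  qed
  have eA: "\<phi> A = c"
  proof -
    obtain B where B: "B \<subseteq> A" "c = \<phi> B" using onto[of c] c by blast
    have "\<phi> B \<subseteq> \<phi> A" using ord[of B A] B(1) by simp
    then show ?thesis using B(2) into(2)[of A] by simp
  qed
  have inK: "\<phi> B \<in> K" if "B \<subseteq> A" "B \<noteq> {}" for B
  proof -
    have "\<not> \<phi> B \<subseteq> \<phi> {}" using ord[of B "{}"] that by simp
    then show ?thesis using into(1)[OF that(1)] e0 by auto
  qed
  have inj: "\<phi> B = \<phi> C \<longleftrightarrow> B = C" if "B \<subseteq> A" "C \<subseteq> A" for B C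
    using ord[OF that] ord[OF that(2,1)] by auto
  have dim: "cdim (\<phi> B) + 1 = card B" if "B \<subseteq> A" "B \<noteq> {}" for B
    using that
  proof (induction "card B" arbitrary: B rule: less_induct)
    case less
    have fB: "finite B" using less.prems(1) A finite_subset by blast
    have \<phi>B: "\<phi> B \<in> K" by (rule inK[OF less.prems])
    obtain L where L: "L \<subseteq> K" "bd (\<phi> B) = \<Union>L" using bd_cells[OF \<phi>B] by (elim exE conjE)
    have low: "\<exists>C\<subset>B. C \<noteq> {} \<and> l = \<phi> C \<and> cdim l + 1 = card C" if l: "l \<in> L" for l
    proof -
      have lb: "l \<subseteq> bd (\<phi> B)" unfolding L(2) using l by (rule Union_upper)
      have lB: "l \<subseteq> \<phi> B" using lb bd_subset[OF \<phi>B] by (rule subset_trans)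
      have lK: "l \<in> K" using l L(1) by blast
      have "\<not> \<phi> B \<subseteq> l" using inner_part_nonempty[OF \<phi>B] lb by blast
      obtain C where C: "C \<subseteq> A" "l = \<phi> C"
        using onto[of l] lK subset_trans[OF lB into(2)[OF less.prems(1)]] by blast
      have CB: "C \<subseteq> B" using ord[OF C(1) less.prems(1)] lB C(2) by simp
      moreover have "C \<noteq> B" using \<open>\<not> \<phi> B \<subseteq> l\<close> C(2) by blast
      ultimately have CsB: "C \<subset> B" by (rule psubsetI)
      have "C \<noteq> {}" using cell_nonempty[OF lK] C(2) e0 by auto
      have "card C < card B" using CsB fB by (intro psubset_card_mono)
      from less.hyps[OF this C(1) \<open>C \<noteq> {}\<close>] have "cdim l + 1 = card C" unfolding C(2) .
      then show ?thesis using CsB \<open>C \<noteq> {}\<close> C(2) by (intro exI[of _ C] conjI)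
    qed
    have upper: "cdim (\<phi> B) + 1 \<le> card B"
    proof (cases "cdim (\<phi> B) = 0")
      case True
      then show ?thesis using less.prems(2) fB by (simp add: Suc_leI card_gt_0_iff)
    next
      case False
      have "cdim (\<phi> B) \<le> (card B - 2) + 1"
      proof (rule boundary_cover_dim[OF hausdorff is_cell[OF \<phi>B] False])
        show "finite L" using finite_cells L(1) finite_subset by blast
        show "\<exists>m b. is_cell X m e b \<and> m \<le> card B - 2" if "e \<in> L" for e
        proof -
          obtain C where C: "C \<subset> B" "cdim e + 1 = card C" using low[OF \<open>e \<in> L\<close>] by (elim exE conjE)
          have "card C < card B" using C(1) fB by (intro psubset_card_mono)
          then have "cdim e \<le> card B - 2" using C(2) by simp
          moreover have "is_cell X (cdim e) e (bd e)" using is_cell that L(1) by blast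
          ultimately show ?thesis by blast
        qed
        show "bd (\<phi> B) \<subseteq> \<Union>L" unfolding L(2) ..
      qed
      \<comment> \<open>Needed to trust the natural subtraction in \<open>card B - 2\<close>: the
        boundary sphere of a cell of positive dimension is nonempty, so there is a proper nonempty
        face.\<close>
      moreover have "card B \<ge> 2"
      proof -
        have "L \<noteq> {}"
        proof
          assume "L = {}"
          then have "bd (\<phi> B) = {}" using L(2) by simp
          obtain f where f: "bd (\<phi> B) = f ` (topspace (disk (cdim (\<phi> B))) - open_disk (cdim (\<phi> B)))"
            by (rule is_cellE[OF is_cell[OF \<phi>B]]) (rule that)
          let ?z = "\<lambda>i::nat. if i = 0 then 1 else 0 :: real"
          have "sqnorm (cdim (\<phi> B)) ?z = (\<Sum>i<cdim (\<phi> B). if i = 0 then 1 else 0)"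
            by (rule sum.cong) auto
          then have "sqnorm (cdim (\<phi> B)) ?z = 1" using False by simp
          moreover have "?z \<in> topspace (Euclidean_space (cdim (\<phi> B)))" using False by (simp add: topspace_Euclidean_space)
          ultimately have "?z \<in> topspace (disk (cdim (\<phi> B))) - open_disk (cdim (\<phi> B))"
            by (simp add: topspace_disk)
          then show False using f \<open>bd (\<phi> B) = {}\<close> by blast
        qed
        then obtain l where "l \<in> L" by blast
        from low[OF this] obtain C where C: "C \<subset> B" "C \<noteq> {}" "l = \<phi> C" "cdim l + 1 = card C"
          by (elim exE conjE)
        have "card C < card B" using C(1) fB by (intro psubset_card_mono)
        moreover have "card C > 0" using C fB finite_subset by (auto simp: card_gt_0_iff)
        ultimately show ?thesis by simp
      qed
      ultimately show ?thesis by simp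
    qed
    have lower: "card B \<le> cdim (\<phi> B) + 1"
    proof (cases "card B \<le> 1")
      case False
      obtain b where b: "b \<in> B" using less.prems(2) by blast
      let ?C = "B - {b}"
      have cC: "card ?C + 1 = card B" using card_Suc_Diff1[OF fB b] by simp
      then have "card ?C \<noteq> 0" using False by simp
      then have "?C \<noteq> {}" by (metis card.empty)
      moreover have "?C \<subseteq> A" using less.prems(1) by blast
      ultimately have C: "?C \<subseteq> A" "?C \<noteq> {}" "card ?C + 1 = card B" using cC by simp_all
      have "card ?C < card B" using C(3) by simp
      from less.hyps[OF this C(1,2)] have 1: "cdim (\<phi> ?C) + 1 = card ?C" .
      have "\<phi> ?C \<subseteq> \<phi> B" "\<phi> ?C \<noteq> \<phi> B" using ord[OF C(1) less.prems(1)] inj[OF C(1) less.prems(1)] b by auto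
      then have "cdim (\<phi> ?C) < cdim (\<phi> B)" by (intro cdim_less inK C less.prems)
      then show ?thesis using 1 C(3) by simp
    qed simp
    show ?case using upper lower by simp
  qed
  have Ane: "A \<noteq> {}" using eA e0 cell_nonempty[OF c] by auto
  have "cdim c + 1 = card A" using dim[of A] Ane unfolding eA by simp
  then show thesis using that[OF A _ bij ord e0 eA] inK dim by simp
qed

lemma card_faces:
  assumes "c \<in> K" shows "card {e \<in> K. e \<subseteq> c} + 1 = 2 ^ (cdim c + 1)"
proof -
  obtain A :: "nat set" and \<phi> where A: "finite A" "card A = cdim c + 1"
    "bij_betw \<phi> (Pow A) {e \<in> insert {} K. e \<subseteq> c}"
    by (rule cell_faces[OF assms]) (rule that)
  have "{e \<in> insert {} K. e \<subseteq> c} = insert {} {e \<in> K. e \<subseteq> c}" by auto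
  moreover have "{} \<notin> {e \<in> K. e \<subseteq> c}" using cell_nonempty by auto
  ultimately have "card {e \<in> insert {} K. e \<subseteq> c} = card {e \<in> K. e \<subseteq> c} + 1" using finite_cells by simp
  then show ?thesis using bij_betw_same_card[OF A(3)] card_Pow[OF A(1)] A(2) by simp
qed

lemma cell_diamond:
  assumes "F \<in> K" "D \<in> K" "F \<subseteq> D" "cdim D = cdim F + 2"
  shows "card {G \<in> K. F \<subseteq> G \<and> G \<subseteq> D \<and> cdim G = cdim F + 1} = 2"
proof -
  obtain A :: "nat set" and \<phi> where A: "finite A" "card A = cdim D + 1"
    "bij_betw \<phi> (Pow A) {e \<in> insert {} K. e \<subseteq> D}"
    "\<And>B C. \<lbrakk>B \<subseteq> A; C \<subseteq> A\<rbrakk> \<Longrightarrow> \<phi> B \<subseteq> \<phi> C \<longleftrightarrow> B \<subseteq> C"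
    "\<phi> {} = {}" "\<phi> A = D" "\<And>B. \<lbrakk>B \<subseteq> A; B \<noteq> {}\<rbrakk> \<Longrightarrow> \<phi> B \<in> K \<and> cdim (\<phi> B) + 1 = card B"
    by (rule cell_faces[OF assms(2)]) (rule that)
  have im: "\<phi> ` Pow A = {e \<in> insert {} K. e \<subseteq> D}" using A(3) by (simp add: bij_betw_def)
  have onto: "\<exists>B. B \<subseteq> A \<and> e = \<phi> B \<and> B \<noteq> {}" if "e \<in> K" "e \<subseteq> D" for e
  proof -
    have "e \<in> \<phi> ` Pow A" unfolding im using that by simp
    then obtain B where B: "e = \<phi> B" "B \<in> Pow A" by (rule imageE)
    then have "B \<noteq> {}" using A(5) cell_nonempty[OF that(1)] by auto
    then show ?thesis using B by (intro exI[of _ B] conjI) auto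
  qed
  obtain a where a: "a \<subseteq> A" "F = \<phi> a" "a \<noteq> {}" using onto[OF assms(1,3)] by (elim exE conjE)
  have "cdim F + 1 = card a" using A(7)[OF a(1,3)] a(2) by simp
  then have ca: "card A = card a + 2" using A(2) assms(4) by simp
  have fa: "finite a" using a(1) A(1) by (rule finite_subset)
  have "card (A - a) = 2" using card_Diff_subset[OF fa a(1)] ca by simp
  have "{G \<in> K. F \<subseteq> G \<and> G \<subseteq> D \<and> cdim G = cdim F + 1} = (\<lambda>x. \<phi> (insert x a)) ` (A - a)"
  proof (intro equalityI subsetI)
    fix G assume "G \<in> {G \<in> K. F \<subseteq> G \<and> G \<subseteq> D \<and> cdim G = cdim F + 1}"
    then have G: "G \<in> K" "F \<subseteq> G" "G \<subseteq> D" "cdim G = cdim F + 1" by simp_all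
    obtain e where e: "e \<subseteq> A" "G = \<phi> e" "e \<noteq> {}" using onto[OF G(1,3)] by (elim exE conjE)
    have ae: "a \<subseteq> e" using A(4)[OF a(1) e(1)] G(2) a(2) e(2) by simp
    have "card e = card a + 1" using A(7)[OF e(1,3)] G(4) \<open>cdim F + 1 = card a\<close> e(2) by simp
    then have "card (e - a) = 1" using card_Diff_subset[OF fa ae] by simp
    then obtain x where x: "e - a = {x}" by (auto simp: card_1_singleton_iff)
    have "e = insert x a" using x ae by auto
    moreover have "x \<in> A - a" using x e(1) by auto
    ultimately show "G \<in> (\<lambda>x. \<phi> (insert x a)) ` (A - a)" using e(2) by simp
  next
    fix G assume "G \<in> (\<lambda>x. \<phi> (insert x a)) ` (A - a)"
    then obtain x where x: "G = \<phi> (insert x a)" "x \<in> A - a" by (rule imageE)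
    have sub: "insert x a \<subseteq> A" using x(2) a(1) by auto
    have G: "G \<in> K" "cdim G + 1 = card (insert x a)" using A(7)[OF sub] x(1) by auto
    have "F \<subseteq> G" using A(4)[OF a(1) sub] a(2) x(1) by auto
    moreover have "G \<subseteq> D" using A(4)[OF sub order_refl] A(6) x(1) sub by simp
    moreover have "cdim G = cdim F + 1" using G(2) x(2) fa \<open>cdim F + 1 = card a\<close> by simp
    ultimately show "G \<in> {G \<in> K. F \<subseteq> G \<and> G \<subseteq> D \<and> cdim G = cdim F + 1}" using G(1) by simp
  qed
  moreover have "inj_on (\<lambda>x. \<phi> (insert x a)) (A - a)"
  proof (rule inj_onI)
    fix x y assume xy: "x \<in> A - a" "y \<in> A - a" "\<phi> (insert x a) = \<phi> (insert y a)"
    have "insert x a \<subseteq> A" "insert y a \<subseteq> A" using xy a(1) by auto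
    then have "insert x a \<subseteq> insert y a" using A(4)[of "insert x a" "insert y a"] xy(3) by simp
    then show "x = y" using xy(1) by auto
  qed
  ultimately show ?thesis using \<open>card (A - a) = 2\<close> by (simp add: card_image)
qed

end

text \<open>A folding of complexes: an isomorphism on the faces of each single cell, although
  distinct cells may have the same image. The combinatorial argument treats the quotient maps of the
  identifications as such foldings.\<close>

definition cell_map :: "('p set \<Rightarrow> 'q set) \<Rightarrow> 'p set set \<Rightarrow> 'q set set \<Rightarrow> bool" where
  "cell_map f K L \<longleftrightarrow> f ` K = L \<and>
     (\<forall>c\<in>K. bij_betw f {e \<in> K. e \<subseteq> c} {e \<in> L. e \<subseteq> f c})"

lemma cell_map_compose:
  assumes "cell_map f K L" "cell_map g L M" shows "cell_map (g \<circ> f) K M"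
  unfolding cell_map_def
proof (intro conjI ballI)
  show "(g \<circ> f) ` K = M" using assms unfolding cell_map_def by (metis image_comp)
  fix c assume c: "c \<in> K"
  have "f c \<in> L" using assms(1) c by (auto simp: cell_map_def)
  then have "bij_betw g {e \<in> L. e \<subseteq> f c} {e \<in> M. e \<subseteq> g (f c)}" using assms(2) by (simp add: cell_map_def)
  moreover have "bij_betw f {e \<in> K. e \<subseteq> c} {e \<in> L. e \<subseteq> f c}" using assms(1) c by (simp add: cell_map_def)
  ultimately show "bij_betw (g \<circ> f) {e \<in> K. e \<subseteq> c} {e \<in> M. e \<subseteq> (g \<circ> f) c}"
    using bij_betw_trans by (simp only: comp_apply) blast
qed

lemma cell_map_id: "cell_map (\<lambda>c. c) K K"
  by (simp add: cell_map_def bij_betw_def inj_on_def)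

lemma cell_mapD:
  assumes "cell_map f K L"
  shows "c \<in> K \<Longrightarrow> f c \<in> L"
    "\<lbrakk>c \<in> K; e \<in> K; e \<subseteq> c\<rbrakk> \<Longrightarrow> f e \<subseteq> f c"
    "e' \<in> L \<Longrightarrow> \<exists>c\<in>K. e' = f c"
    "\<lbrakk>c \<in> K; e' \<in> L; e' \<subseteq> f c\<rbrakk> \<Longrightarrow> \<exists>b\<in>K. b \<subseteq> c \<and> f b = e'"
    "\<lbrakk>c \<in> K; a \<in> K; b \<in> K; a \<subseteq> c; b \<subseteq> c; f a = f b\<rbrakk> \<Longrightarrow> a = b"
proof -
  have im: "f ` K = L" using assms by (simp add: cell_map_def)
  have bij: "bij_betw f {e \<in> K. e \<subseteq> c} {e \<in> L. e \<subseteq> f c}" if "c \<in> K" for c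
    using assms that by (simp add: cell_map_def)
  show "f c \<in> L" if "c \<in> K" using im that by blast
  show "f e \<subseteq> f c" if "c \<in> K" "e \<in> K" "e \<subseteq> c"
    using bij_betwE[OF bij[OF that(1)]] that(2,3) by simp
  show "\<exists>c\<in>K. e' = f c" if "e' \<in> L" using im that by blast
  show "\<exists>b\<in>K. b \<subseteq> c \<and> f b = e'" if "c \<in> K" "e' \<in> L" "e' \<subseteq> f c"
  proof -
    have "e' \<in> f ` {e \<in> K. e \<subseteq> c}" using bij[OF that(1)] that(2,3) by (simp add: bij_betw_def)
    then show ?thesis by blast
  qed
  show "a = b" if "c \<in> K" "a \<in> K" "b \<in> K" "a \<subseteq> c" "b \<subseteq> c" "f a = f b"
    using inj_onD[OF bij_betw_imp_inj_on[OF bij[OF that(1)]] that(6)] that(2-5) by simp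
qed

locale cw_identification = X: simplicial_cw X K + Y: simplicial_cw Y L
  for X :: "'p topology" and K and Y :: "'q topology" and L +
  fixes \<sigma> \<tau> :: "'p set" and h :: "'p \<Rightarrow> 'p" and q :: "'p \<Rightarrow> 'q"
  assumes \<sigma>: "\<sigma> \<in> K" and \<tau>: "\<tau> \<in> K" and ne: "\<sigma> \<noteq> \<tau>"
    and h: "homeomorphic_map (subtopology X \<sigma>) (subtopology X \<tau>) h"
    and h_faces: "(\<lambda>c. h ` c) ` {c \<in> K. c \<subseteq> \<sigma>} = {c \<in> K. c \<subseteq> \<tau>}"
    and h_fix: "\<And>x. x \<in> \<sigma> \<inter> \<tau> \<Longrightarrow> h x = x"
    and q: "quotient_map X Y q"
    and q_eq: "\<And>x y. \<lbrakk>x \<in> topspace X; y \<in> topspace X\<rbrakk> \<Longrightarrow>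
           q x = q y \<longleftrightarrow> x = y \<or> (x \<in> \<sigma> \<and> y = h x) \<or> (y \<in> \<sigma> \<and> x = h y)"
    and L: "L = (\<lambda>c. q ` c) ` K"
begin

lemma h_inj: "inj_on h \<sigma>" and h_im: "h ` \<sigma> = \<tau>"
  using homeomorphic_imp_injective_map[OF h] homeomorphic_imp_surjective_map[OF h]
    X.cell_subset[OF \<sigma>] X.cell_subset[OF \<tau>] by (simp_all add: inf.absorb2)

lemma h_face: "\<lbrakk>c \<in> K; c \<subseteq> \<sigma>\<rbrakk> \<Longrightarrow> h ` c \<in> K \<and> h ` c \<subseteq> \<tau>"
proof -
  assume "c \<in> K" "c \<subseteq> \<sigma>"
  then have "h ` c \<in> (\<lambda>c. h ` c) ` {c \<in> K. c \<subseteq> \<sigma>}" by (intro imageI) simp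
  then show ?thesis unfolding h_faces by simp
qed

text \<open>The relation on cells that corresponds to the relation on points in
  \<open>q_eq\<close>.\<close>

definition glued :: "'p set \<Rightarrow> 'p set \<Rightarrow> bool" where
  "glued c e \<longleftrightarrow> c = e \<or> (c \<subseteq> \<sigma> \<and> e = h ` c) \<or> (e \<subseteq> \<sigma> \<and> c = h ` e)"

lemma glued_inner_aux:
  assumes "c \<in> K" "e \<in> K" "x \<in> X.inner_part c" "h x \<in> X.inner_part e" "x \<in> \<sigma>"
  shows "c \<subseteq> \<sigma> \<and> e = h ` c"
proof -
  have c\<sigma>: "c \<subseteq> \<sigma>" by (rule X.inner_point_face[OF assms(1) \<sigma> assms(3,5)])
  have hc: "h ` c \<in> K" "h ` c \<subseteq> \<tau>" using h_face[OF assms(1) c\<sigma>] by auto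
  have e_hc: "e \<subseteq> h ` c" by (rule X.inner_point_face[OF assms(2) hc(1) assms(4)]) (use assms(3) in blast)
  then have "e \<in> {c \<in> K. c \<subseteq> \<tau>}" using hc(2) assms(2) by blast
  then obtain b where b: "e = h ` b" "b \<in> K" "b \<subseteq> \<sigma>" unfolding h_faces[symmetric] by (elim imageE CollectE conjE)
  have "h x \<in> h ` b" using assms(4) b(1) by blast
  then have "x \<in> b" using inj_on_image_mem_iff[OF h_inj assms(5) b(3)] by blast
  then have "c \<subseteq> b" by (rule X.inner_point_face[OF assms(1) b(2) assms(3)])
  then have "h ` c \<subseteq> e" unfolding b(1) by (rule image_mono)
  then show ?thesis using c\<sigma> e_hc by blast
qed

lemma glued_inner:
  assumes "c \<in> K" "e \<in> K" "x \<in> X.inner_part c" "y \<in> X.inner_part e" "q x = q y"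
  shows "glued c e"
proof -
  have "x \<in> topspace X" "y \<in> topspace X" using X.cell_subset assms(1-4) by blast+
  then consider "x = y" | "x \<in> \<sigma>" "y = h x" | "y \<in> \<sigma>" "x = h y" using q_eq assms(5) by blast
  then show ?thesis
  proof cases
    case 1
    then show ?thesis using X.disjoint_cells[OF assms(1,2,3)] assms(4) by (simp add: glued_def)
  next
    case 2
    then show ?thesis using glued_inner_aux[OF assms(1,2,3)] assms(4) by (simp add: glued_def)
  next
    case 3
    then show ?thesis using glued_inner_aux[OF assms(2,1,4)] assms(3) by (simp add: glued_def)
  qed
qed

lemma q_h: "x \<in> \<sigma> \<Longrightarrow> q (h x) = q x"
  using q_eq[of x "h x"] X.cell_subset[OF \<sigma>] X.cell_subset[OF \<tau>] h_im by (metis imageI subsetD)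

lemma glued_image: "glued c e \<Longrightarrow> q ` c = q ` e"
proof -
  have "q ` h ` c = q ` c" if "c \<subseteq> \<sigma>" for c
    using q_h that by (simp add: image_image subset_iff cong: image_cong)
  then show "glued c e \<Longrightarrow> q ` c = q ` e" unfolding glued_def by metis
qed

lemma q_in_L: "c \<in> K \<Longrightarrow> q ` c \<in> L"
  unfolding L by (rule imageI)

text \<open>\<open>q x\<close> is interior to some cell \<open>e'\<close> below the image of
  \<open>c\<close>, and \<open>e'\<close> is itself the image of a cell \<open>e\<close>. A preimage
  of \<open>q x\<close> in \<open>e\<close> is interior to a face \<open>b\<close> of
  \<open>e\<close> that is glued to \<open>c\<close>, so \<open>c\<close> and \<open>b\<close> have
  the same image and \<open>e'\<close> is no proper face.\<close>

lemma inner_image: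
  assumes c: "c \<in> K" and x: "x \<in> X.inner_part c"
  shows "q x \<in> Y.inner_part (q ` c)"
proof -
  have "q x \<in> q ` c" using x by blast
  from Y.point_in_face[OF q_in_L[OF c] this] obtain e' where e': "e' \<in> L" "e' \<subseteq> q ` c" "q x \<in> Y.inner_part e'"
    by (elim bexE conjE)
  then obtain e where e: "e \<in> K" "e' = q ` e" using L by blast
  have "q x \<in> q ` e" using e'(3) e(2) by blast
  then obtain y where y: "q x = q y" "y \<in> e" by (rule imageE)
  obtain b where b: "b \<in> K" "b \<subseteq> e" "y \<in> X.inner_part b" using X.point_in_face[OF e(1) y(2)] by (elim bexE conjE)
  have "q ` c = q ` b" by (rule glued_image[OF glued_inner[OF c b(1) x b(3) y(1)]])
  then have "q ` c \<subseteq> e'" using image_mono[OF b(2), of q] e(2) by simp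
  then show ?thesis using e' by auto
qed

lemma face_lift:
  assumes c: "c \<in> K" and e: "e \<in> L" "e \<subseteq> q ` c"
  shows "\<exists>b\<in>K. b \<subseteq> c \<and> q ` b = e"
proof -
  obtain z where z: "z \<in> Y.inner_part e" using Y.inner_part_nonempty[OF e(1)] by blast
  then have "z \<in> q ` c" using e(2) by blast
  then obtain x where x: "z = q x" "x \<in> c" by (rule imageE)
  obtain b where b: "b \<in> K" "b \<subseteq> c" "x \<in> X.inner_part b" using X.point_in_face[OF c x(2)] by (elim bexE conjE)
  have "z \<in> Y.inner_part (q ` b)" unfolding x(1) by (rule inner_image[OF b(1,3)])
  then have "e = q ` b" using Y.disjoint_cells[OF e(1) q_in_L[OF b(1)] z] by simp
  then show ?thesis using b by blast
qed

text \<open>Two interior points of \<open>c\<close> can be identified only if \<open>h\<close> maps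
  \<open>c\<close> to itself. Then \<open>c\<close> lies in \<open>\<sigma> \<inter> \<tau>\<close>,
  which \<open>h\<close> fixes pointwise.\<close>

lemma inj_inner:
  assumes c: "c \<in> K" shows "inj_on q (X.inner_part c)"
proof (rule inj_onI)
  fix x y assume x: "x \<in> X.inner_part c" and y: "y \<in> X.inner_part c" and eq: "q x = q y"
  have "x \<in> topspace X" "y \<in> topspace X" using X.cell_subset[OF c] x y by blast+
  have *: "y' = x'" if "x' \<in> X.inner_part c" "y' \<in> X.inner_part c" "x' \<in> \<sigma>" "y' = h x'" for x' y'
  proof -
    have "h x' \<in> X.inner_part c" using that(2,4) by simp
    then have "c \<subseteq> \<sigma> \<and> c = h ` c" by (rule glued_inner_aux[OF c c that(1) _ that(3)])
    then have "c \<subseteq> \<sigma>" "c \<subseteq> \<tau>" using h_face[OF c] by auto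
    then have "y' \<in> \<sigma> \<inter> \<tau>" "x' \<in> \<sigma> \<inter> \<tau>" using that(1,2) by blast+
    then show ?thesis using h_fix that(4) by simp
  qed
  consider "x = y" | "x \<in> \<sigma>" "y = h x" | "y \<in> \<sigma>" "x = h y"
    using q_eq[OF \<open>x \<in> topspace X\<close> \<open>y \<in> topspace X\<close>] eq by blast
  then show "x = y"
  proof cases
    case 2
    show ?thesis using *[OF x y 2] by simp
  next
    case 3
    show ?thesis using *[OF y x 3] by simp
  qed simp
qed

text \<open>The dimension does not drop because \<open>q\<close> is injective on the open cell. It
  does not rise because every face of the image lifts to a face of \<open>c\<close>, and the number
  of faces determines the dimension.\<close>

lemma q_dim: assumes c: "c \<in> K" shows "Y.cdim (q ` c) = X.cdim c"
proof (rule antisym)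
  have "continuous_map (subtopology X c) Y q"
    using quotient_imp_continuous_map[OF q] by (rule continuous_map_from_subtopology)
  then show "X.cdim c \<le> Y.cdim (q ` c)"
    by (rule cell_interior_dim_le[OF X.is_cell[OF c] Y.is_cell[OF q_in_L[OF c]] _ inj_inner[OF c]]) auto
  have "{e \<in> L. e \<subseteq> q ` c} \<subseteq> (\<lambda>b. q ` b) ` {e \<in> K. e \<subseteq> c}" using face_lift[OF c] by blast
  then have "card {e \<in> L. e \<subseteq> q ` c} \<le> card {e \<in> K. e \<subseteq> c}"
    using X.finite_cells by (intro surj_card_le) auto
  then have "(2::nat) ^ (Y.cdim (q ` c) + 1) \<le> 2 ^ (X.cdim c + 1)"
    using X.card_faces[OF c] Y.card_faces[OF q_in_L[OF c]] by linarith
  then have "Y.cdim (q ` c) + 1 \<le> X.cdim c + 1" by (rule power_le_imp_le_exp[rotated]) simp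
  then show "Y.cdim (q ` c) \<le> X.cdim c" by simp
qed

lemma cell_map: "cell_map (\<lambda>c. q ` c) K L"
  unfolding cell_map_def
proof (intro conjI ballI)
  show "(\<lambda>c. q ` c) ` K = L" by (rule L[symmetric])
  fix c assume c: "c \<in> K"
  have im: "(\<lambda>b. q ` b) ` {e \<in> K. e \<subseteq> c} = {e \<in> L. e \<subseteq> q ` c}"
  proof (intro equalityI subsetI)
    fix e assume "e \<in> (\<lambda>b. q ` b) ` {e \<in> K. e \<subseteq> c}"
    then obtain b where b: "e = q ` b" "b \<in> K" "b \<subseteq> c" by (elim imageE CollectE conjE)
    then show "e \<in> {e \<in> L. e \<subseteq> q ` c}" using q_in_L[OF b(2)] image_mono[OF b(3), of q] by simp
  next
    fix e assume "e \<in> {e \<in> L. e \<subseteq> q ` c}"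
    then obtain b where "b \<in> K" "b \<subseteq> c" "q ` b = e" using face_lift[OF c, of e] by (elim CollectE conjE) blast
    then show "e \<in> (\<lambda>b. q ` b) ` {e \<in> K. e \<subseteq> c}" by (intro image_eqI[of _ _ b]) auto
  qed
  have "card {e \<in> K. e \<subseteq> c} = card {e \<in> L. e \<subseteq> q ` c}"
    using X.card_faces[OF c] Y.card_faces[OF q_in_L[OF c]] q_dim[OF c] by simp
  then have "inj_on (\<lambda>b. q ` b) {e \<in> K. e \<subseteq> c}"
    using X.finite_cells unfolding im[symmetric] by (intro eq_card_imp_inj_on) auto
  then show "bij_betw (\<lambda>b. q ` b) {e \<in> K. e \<subseteq> c} {e \<in> L. e \<subseteq> q ` c}"
    using im by (simp add: bij_betw_def)
qed

lemma image_eq_glued: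
  assumes c: "c \<in> K" and e: "e \<in> K" and eq: "q ` c = q ` e"
  shows "glued c e"
proof -
  obtain x where x: "x \<in> X.inner_part c" using X.inner_part_nonempty[OF c] by blast
  have qx: "q x \<in> Y.inner_part (q ` e)" using inner_image[OF c x] eq by simp
  then have "q x \<in> q ` e" by blast
  then obtain y where y: "q x = q y" "y \<in> e" by (rule imageE)
  obtain b where b: "b \<in> K" "b \<subseteq> e" "y \<in> X.inner_part b" using X.point_in_face[OF e y(2)] by (elim bexE conjE)
  have "q y \<in> Y.inner_part (q ` b)" by (rule inner_image[OF b(1,3)])
  then have "q ` b = q ` e" using Y.disjoint_cells[OF q_in_L[OF b(1)] q_in_L[OF e]] qx y(1) by simp
  then have "b = e" using cell_mapD(5)[OF cell_map, of e b e] b(1,2) e by simp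
  then show ?thesis using glued_inner[OF c b(1) x b(3) y(1)] by simp
qed

end

section \<open>Boundary ridges in a local construction\<close>

lemma homeomorphism_rel_interior:
  fixes A B :: "'a::euclidean_space set"
  assumes h: "homeomorphism A B f g" and dim: "aff_dim A = aff_dim B"
  shows "f ` rel_interior A = rel_interior B"
proof -
  have 1: "f ` rel_interior A \<subseteq> rel_interior B"
    using continuous_image_subset_rel_interior[OF homeomorphismD(1)[OF h] homeomorphismD(7)[OF h], of B]
      homeomorphismD(3)[OF h] dim by simp
  have 2: "g ` rel_interior B \<subseteq> rel_interior A"
    using continuous_image_subset_rel_interior[OF homeomorphismD(2)[OF h] homeomorphismD(8)[OF h], of A]
      homeomorphismD(4)[OF h] dim by simp
  have "rel_interior B \<subseteq> f ` rel_interior A"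
  proof
    fix y assume y: "y \<in> rel_interior B"
    then have "f (g y) = y" using homeomorphismD(6)[OF h] rel_interior_subset by blast
    moreover have "g y \<in> rel_interior A" using 2 y by blast
    ultimately show "y \<in> f ` rel_interior A" by (metis imageI)
  qed
  then show ?thesis using 1 by blast
qed

text \<open>The standard disk is carried isometrically to the unit ball of a subspace of
  \<open>'a\<close>, and this to \<open>F\<close> by the homeomorphism of compact convex sets of
  equal dimension. Relative interiors correspond by invariance of domain, hence so do the
  boundaries.\<close>

lemma convex_is_cell:
  fixes F :: "'a::euclidean_space set"
  assumes F: "convex F" "compact F" "aff_dim F = int n"
  shows "is_cell (top_of_set F) n F (rel_frontier F)"
proof -
  have "int n \<le> int DIM('a)" using F(3) aff_dim_le_DIM[of F] by simp
  then obtain B where B: "B \<subseteq> (Basis :: 'a set)" "card B = n"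
    using obtain_subset_with_card_n[of n "Basis :: 'a set"] by (metis of_nat_le_iff)
  have iB: "independent B" "pairwise orthogonal B" "\<And>u. u \<in> B \<Longrightarrow> norm u = 1"
    using B independent_Basis independent_mono orthogonal_Basis pairwise_subset by auto
  obtain f g where fg: "homeomorphic_maps (Euclidean_space n) (top_of_set (span B)) f g"
    and nf: "\<And>x. x \<in> topspace (Euclidean_space n) \<Longrightarrow> (norm (f x))\<^sup>2 = sqnorm n x"
    by (rule homeomorphic_maps_Euclidean_space_euclidean_gen[OF iB(1,2) B(2) iB(3)]) (simp, rule that)
  let ?C = "cball 0 1 \<inter> span B"
  have fB: "f ` topspace (Euclidean_space n) = span B"
    using homeomorphic_imp_surjective_map[of "Euclidean_space n" "top_of_set (span B)" f] fg
    unfolding homeomorphic_maps_map by simp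
  have nle: "norm (f x) \<le> 1 \<longleftrightarrow> sqnorm n x \<le> 1" "norm (f x) < 1 \<longleftrightarrow> sqnorm n x < 1"
    if "x \<in> topspace (Euclidean_space n)" for x
  proof -
    show "norm (f x) \<le> 1 \<longleftrightarrow> sqnorm n x \<le> 1"
      using nf[OF that] abs_square_le_1[of "norm (f x)"] by simp
    show "norm (f x) < 1 \<longleftrightarrow> sqnorm n x < 1"
      using nf[OF that] abs_square_less_1[of "norm (f x)"] by simp
  qed
  have imC: "f ` (topspace (Euclidean_space n) \<inter> {x. sqnorm n x \<le> 1}) = topspace (top_of_set (span B)) \<inter> cball 0 1"
  proof (intro equalityI subsetI)
    fix y assume "y \<in> f ` (topspace (Euclidean_space n) \<inter> {x. sqnorm n x \<le> 1})"
    then obtain x where "y = f x" "x \<in> topspace (Euclidean_space n)" "sqnorm n x \<le> 1" by blast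
    then show "y \<in> topspace (top_of_set (span B)) \<inter> cball 0 1" using nle(1) fB by auto
  next
    fix y assume y: "y \<in> topspace (top_of_set (span B)) \<inter> cball 0 1"
    then have "y \<in> f ` topspace (Euclidean_space n)" using fB by simp
    then obtain x where "y = f x" "x \<in> topspace (Euclidean_space n)" by (rule imageE)
    then show "y \<in> f ` (topspace (Euclidean_space n) \<inter> {x. sqnorm n x \<le> 1})" using nle(1)[of x] y by auto
  qed
  have "homeomorphic_map (disk n) (subtopology (top_of_set (span B)) (cball 0 1)) f"
    unfolding disk_def
    by (rule homeomorphic_map_subtopologies[OF _ imC]) (use fg in \<open>simp add: homeomorphic_maps_map\<close>)
  then have hC: "homeomorphic_map (disk n) (top_of_set ?C) f" by (simp add: subtopology_subtopology Int_commute)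
  have "0 \<in> interior (cball (0::'a) 1) \<inter> span B" using span_zero[of B] by simp
  then have ne: "interior (cball (0::'a) 1) \<inter> span B \<noteq> {}" by blast
  have "aff_dim ?C = aff_dim (span B)"
    using aff_dim_convex_Int_nonempty_interior[of "span B" "cball 0 1"] ne
    by (simp add: Int_commute subspace_imp_convex)
  also have "\<dots> = int n" using B(2) iB(1) by (simp add: aff_dim_subspace dim_eq_card_independent)
  finally have dC: "aff_dim ?C = int n" .
  have rC: "rel_interior ?C = ball 0 1 \<inter> span B"
    using rel_interior_convex_Int_affine[OF convex_cball subspace_imp_affine[OF subspace_span] ne] by simp
  have "?C homeomorphic F"
    by (rule homeomorphic_convex_compact_sets)
      (use F dC in \<open>auto simp: convex_Int subspace_imp_convex compact_Int_closed closed_span\<close>)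
  then obtain k l where kl: "homeomorphism ?C F k l" unfolding homeomorphic_def by blast
  have "homeomorphic_map (top_of_set ?C) (top_of_set F) k"
    using kl homeomorphic_maps_iff_homeomorphism[of ?C F k l] unfolding homeomorphic_maps_map by blast
  then have hom: "homeomorphic_map (disk n) (top_of_set F) (k \<circ> f)" using hC homeomorphic_map_compose by blast
  let ?S = "{x \<in> topspace (disk n). (\<Sum>i<n. x i ^ 2) = 1}"
  have cell: "is_cell (top_of_set F) n F ((k \<circ> f) ` ?S)"
    unfolding is_cell_def using hom by (intro conjI exI[of _ "k \<circ> f"] refl) (simp_all add: subtopology_subtopology)
  have "(k \<circ> f) ` open_disk n = rel_interior F"
  proof -
    have "f ` open_disk n = ball 0 1 \<inter> span B"
    proof (intro equalityI subsetI)
      fix y assume "y \<in> f ` open_disk n"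
      then obtain x where "y = f x" "x \<in> topspace (Euclidean_space n)" "sqnorm n x < 1" by blast
      then show "y \<in> ball 0 1 \<inter> span B" using nle(2) fB by auto
    next
      fix y assume y: "y \<in> ball 0 1 \<inter> span B"
      then have "y \<in> f ` topspace (Euclidean_space n)" using fB by simp
      then obtain x where "y = f x" "x \<in> topspace (Euclidean_space n)" by (rule imageE)
      then show "y \<in> f ` open_disk n" using nle(2)[of x] y by auto
    qed
    moreover have "k ` (ball 0 1 \<inter> span B) = rel_interior F"
      using homeomorphism_rel_interior[OF kl] F(3) dC rC by simp
    ultimately show ?thesis by (simp only: image_comp[symmetric])
  qed
  moreover have "(k \<circ> f) ` open_disk n = F - (k \<circ> f) ` ?S"
  proof -
    have inj: "inj_on (k \<circ> f) (topspace (disk n))" by (rule homeomorphic_imp_injective_map[OF hom])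
    have im: "(k \<circ> f) ` topspace (disk n) = F" using homeomorphic_imp_surjective_map[OF hom] by simp
    have eq: "open_disk n = topspace (disk n) - ?S" by (auto simp: topspace_disk)
    have "(k \<circ> f) ` (topspace (disk n) - ?S) = (k \<circ> f) ` topspace (disk n) - (k \<circ> f) ` ?S"
      by (rule inj_on_image_set_diff[OF inj]) auto
    then show ?thesis unfolding im eq .
  qed
  moreover have "(k \<circ> f) ` ?S \<subseteq> F" by (rule cell_boundary_subset[OF cell])
  ultimately have "(k \<circ> f) ` ?S = F - rel_interior F" by (simp add: double_diff)
  moreover have "rel_frontier F = F - rel_interior F"
    using F(2) by (simp add: rel_frontier_def compact_imp_closed)
  ultimately show ?thesis using cell by simp
qed

lemma is_cell_subspace:
  assumes "is_cell (subtopology X A) n c B" shows "is_cell X n c B"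
proof -
  have "c \<subseteq> topspace (subtopology X A)" using assms by (simp add: is_cell_def)
  then have "c \<subseteq> A" "c \<subseteq> topspace X" by auto
  then show ?thesis using assms by (simp add: is_cell_def subtopology_subtopology inf.absorb2)
qed

abbreviation boundary_ridges :: "nat \<Rightarrow> 'p cell_complex \<Rightarrow> 'p set set" where
  "boundary_ridges d T \<equiv> {\<rho> \<in> n_cells T (d - 1). card {D \<in> n_cells T d. \<rho> \<subseteq> D} = 1}"

text \<open>The link of a codimension two cell in \<open>T\<close> is a disjoint union of cycles and at most one path.\<close>

definition thin_boundary :: "nat \<Rightarrow> 'p cell_complex \<Rightarrow> bool" where
  "thin_boundary d T \<longleftrightarrow> (\<forall>F\<in>n_cells T (d - 2). card {\<rho> \<in> boundary_ridges d T. F \<subseteq> \<rho>} \<le> 2)"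

locale pm = simplicial_cw X K for X :: "'p topology" and K +
  fixes d :: nat
  assumes d2: "d \<ge> 2" and pm: "pseudomanifold d (X, K)"
begin

lemma pure: "c \<in> K \<Longrightarrow> \<exists>D\<in>n_cells (X, K) d. c \<subseteq> D"
  using pm by (simp add: pseudomanifold_def)

lemma ridge_le_two: "\<rho> \<in> n_cells (X, K) (d - 1) \<Longrightarrow> card {D \<in> n_cells (X, K) d. \<rho> \<subseteq> D} \<le> 2"
  using pm by (simp add: pseudomanifold_def)

lemma finite_n_cells: "finite (n_cells (X, K) n)"
  using finite_cells by (simp add: n_cells_def)

lemma n_cells_subset: "n_cells (X, K) n \<subseteq> K"
  by (auto simp: n_cells_def)

lemma n_cells_eq: "\<lbrakk>c \<in> n_cells (X, K) n; e \<in> n_cells (X, K) n; c \<subseteq> e\<rbrakk> \<Longrightarrow> c = e"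
  using cdim_eq by (simp add: n_cells_iff)

lemma ridge_card_pos: "\<rho> \<in> n_cells (X, K) (d - 1) \<Longrightarrow> card {D \<in> n_cells (X, K) d. \<rho> \<subseteq> D} \<ge> 1"
proof -
  assume "\<rho> \<in> n_cells (X, K) (d - 1)"
  then obtain D where "D \<in> n_cells (X, K) d" "\<rho> \<subseteq> D" using pure n_cells_subset by blast
  then have "{D \<in> n_cells (X, K) d. \<rho> \<subseteq> D} \<noteq> {}" by blast
  then show ?thesis using finite_n_cells[of d] by (simp add: Suc_le_eq card_gt_0_iff)
qed

lemma boundary_ridge_iff:
  "\<rho> \<in> n_cells (X, K) (d - 1) \<inter> pm_boundary d (X, K) \<longleftrightarrow> \<rho> \<in> boundary_ridges d (X, K)"
proof
  assume a: "\<rho> \<in> n_cells (X, K) (d - 1) \<inter> pm_boundary d (X, K)"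
  then obtain \<sigma> where s: "\<sigma> \<in> n_cells (X, K) (d - 1)" "card {D \<in> n_cells (X, K) d. \<sigma> \<subseteq> D} = 1" "\<rho> \<subseteq> \<sigma>"
    by (auto simp: pm_boundary_def)
  have "\<rho> = \<sigma>" by (rule n_cells_eq[OF _ s(1,3)]) (use a in blast)
  then show "\<rho> \<in> boundary_ridges d (X, K)" using s by simp
next
  assume "\<rho> \<in> boundary_ridges d (X, K)"
  then show "\<rho> \<in> n_cells (X, K) (d - 1) \<inter> pm_boundary d (X, K)"
    using n_cells_subset[of "d - 1"] by (auto simp: pm_boundary_def)
qed

lemma boundary_ridge_unique:
  assumes "\<rho> \<in> boundary_ridges d (X, K)"
  obtains E where "E \<in> n_cells (X, K) d" "\<rho> \<subseteq> E" "\<And>D. \<lbrakk>D \<in> n_cells (X, K) d; \<rho> \<subseteq> D\<rbrakk> \<Longrightarrow> D = E"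
proof -
  have "card {D \<in> n_cells (X, K) d. \<rho> \<subseteq> D} = 1" using assms by simp
  then obtain E where E: "{D \<in> n_cells (X, K) d. \<rho> \<subseteq> D} = {E}" by (rule card_1_singletonE)
  have "E \<in> {D \<in> n_cells (X, K) d. \<rho> \<subseteq> D}" unfolding E by simp
  then have "E \<in> n_cells (X, K) d" "\<rho> \<subseteq> E" by simp_all
  moreover have "D = E" if "D \<in> n_cells (X, K) d" "\<rho> \<subseteq> D" for D
  proof -
    have "D \<in> {D \<in> n_cells (X, K) d. \<rho> \<subseteq> D}" using that by simp
    then show ?thesis unfolding E by simp
  qed
  ultimately show thesis by (rule that)
qed

lemma ridges_between:
  assumes "F \<in> n_cells (X, K) (d - 2)" "D \<in> n_cells (X, K) d" "F \<subseteq> D"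
  shows "card {\<rho> \<in> n_cells (X, K) (d - 1). F \<subseteq> \<rho> \<and> \<rho> \<subseteq> D} = 2"
proof -
  have "{\<rho> \<in> n_cells (X, K) (d - 1). F \<subseteq> \<rho> \<and> \<rho> \<subseteq> D} = {G \<in> K. F \<subseteq> G \<and> G \<subseteq> D \<and> cdim G = cdim F + 1}"
    using assms(1) d2 unfolding n_cells_iff by auto
  then show ?thesis using cell_diamond[of F D] assms d2 unfolding n_cells_iff by simp
qed

end

lemma pmI: "\<lbrakk>d \<ge> 2; pseudomanifold d (X, K)\<rbrakk> \<Longrightarrow> pm X K d"
  by (simp add: pm_def pm_axioms_def simplicial_cw_def pseudomanifold_def)

lemma single_simplex_thin:
  assumes "d \<ge> 2" "pseudomanifold d T" "is_single_simplex d T"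
  shows "thin_boundary d T" "\<exists>D. n_cells T d = {D}"
proof -
  obtain X K where T: "T = (X, K)" by (cases T)
  interpret pm X K d by (rule pmI) (use assms T in auto)
  obtain D where D: "D \<in> n_cells (X, K) d" "\<And>c. c \<in> K \<Longrightarrow> c \<subseteq> D"
    using assms(3) T by (auto simp: is_single_simplex_def)
  show "thin_boundary d T" unfolding thin_boundary_def T
  proof
    fix F assume F: "F \<in> n_cells (X, K) (d - 2)"
    have "{\<rho> \<in> boundary_ridges d (X, K). F \<subseteq> \<rho>} \<subseteq> {\<rho> \<in> n_cells (X, K) (d - 1). F \<subseteq> \<rho> \<and> \<rho> \<subseteq> D}"
      using D(2) n_cells_subset[of "d - 1"] by blast
    then have "card {\<rho> \<in> boundary_ridges d (X, K). F \<subseteq> \<rho>} \<le> card {\<rho> \<in> n_cells (X, K) (d - 1). F \<subseteq> \<rho> \<and> \<rho> \<subseteq> D}"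
      using finite_n_cells by (intro card_mono) auto
    also have "\<dots> = 2" by (rule ridges_between[OF F D(1) D(2)]) (use F n_cells_subset in blast)
    finally show "card {\<rho> \<in> boundary_ridges d (X, K). F \<subseteq> \<rho>} \<le> 2" .
  qed
  have "E = D" if "E \<in> n_cells (X, K) d" for E
    using n_cells_eq[OF that D(1) D(2)] that n_cells_subset by blast
  then have "n_cells (X, K) d = {D}" using D(1) by blast
  then show "\<exists>D. n_cells T d = {D}" unfolding T by blast
qed

locale pm_gluing = X: pm X K d + Y: pm Y L d
  for X :: "'p topology" and K and Y :: "'p topology" and L and d +
  fixes \<sigma> D :: "'p set"
  assumes KL: "K \<subseteq> L" and XY: "X = subtopology Y (topspace X)"
    and \<sigma>: "\<sigma> \<in> boundary_ridges d (X, K)" and D: "D \<in> n_cells (Y, L) d" "D \<notin> K"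
    and L: "L = K \<union> {c \<in> L. c \<subseteq> D}" and meet: "D \<inter> topspace X = \<sigma>"
begin

lemma sub_cell: assumes "c \<in> K" shows "is_cell Y (X.cdim c) c (X.bd c)"
proof -
  have "is_cell (subtopology Y (topspace X)) (X.cdim c) c (X.bd c)" using X.is_cell[OF assms] XY by simp
  then show ?thesis by (rule is_cell_subspace)
qed

lemma sub_dim: "c \<in> K \<Longrightarrow> Y.cdim c = X.cdim c"
  using cell_dim_unique[OF sub_cell Y.is_cell, of c] KL by (simp add: subsetD)

lemma sub_bd: assumes "c \<in> K" shows "Y.bd c = X.bd c"
proof -
  have "is_cell Y (X.cdim c) c (Y.bd c)" using Y.is_cell[of c] KL assms sub_dim[OF assms] by (simp add: subsetD)
  then show ?thesis by (rule cell_boundary_unique[OF _ sub_cell[OF assms]])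
qed

text \<open>Open cells partition the space, so a cell of \<open>L\<close> with an interior point in
  the old space is the old cell around that point.\<close>

lemma in_sub: assumes "e \<in> L" "e \<subseteq> topspace X" shows "e \<in> K"
proof -
  obtain x where x: "x \<in> Y.inner_part e" using Y.inner_part_nonempty[OF assms(1)] by blast
  then have "x \<in> topspace X" using assms(2) by blast
  then obtain k where k: "k \<in> K" "x \<in> X.inner_part k" using X.covered by blast
  then have "x \<in> Y.inner_part k" using sub_bd by simp
  then have "e = k" using Y.disjoint_cells[OF assms(1) _ x] k(1) KL by blast
  then show ?thesis using k(1) by simp
qed

lemma sub_n_cells: "n_cells (X, K) n = n_cells (Y, L) n \<inter> K"
  using KL by (auto simp: X.n_cells_iff Y.n_cells_iff sub_dim)

lemma facets_eq: "n_cells (Y, L) d = insert D (n_cells (X, K) d)"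
proof (intro equalityI subsetI)
  fix E assume E: "E \<in> n_cells (Y, L) d"
  then have "E \<in> L" using Y.n_cells_subset by blast
  then consider "E \<in> K" | "E \<subseteq> D" using L by blast
  then show "E \<in> insert D (n_cells (X, K) d)"
  proof cases
    case 1
    then show ?thesis using E sub_n_cells by blast
  next
    case 2
    then show ?thesis using Y.n_cells_eq[OF E D(1)] by simp
  qed
qed (use D(1) sub_n_cells in blast)

lemma \<sigma>_face: "\<sigma> \<subseteq> D" "\<sigma> \<in> n_cells (X, K) (d - 1)" "\<sigma> \<in> K" "\<sigma> \<in> n_cells (Y, L) (d - 1)"
  using meet \<sigma> X.n_cells_subset sub_n_cells by blast+

lemma common_face:
  assumes "e \<in> L" "e \<subseteq> D" "c \<in> K" "e \<subseteq> c" shows "e \<subseteq> \<sigma>"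
  using assms X.cell_subset[OF assms(3)] meet by blast

lemma old_boundary_ridge:
  assumes "\<rho> \<in> boundary_ridges d (Y, L)" "\<rho> \<in> K"
  shows "\<rho> \<in> boundary_ridges d (X, K)" "\<rho> \<noteq> \<sigma>"
proof -
  have \<rho>: "\<rho> \<in> n_cells (X, K) (d - 1)" using assms sub_n_cells by blast
  have "{E \<in> n_cells (X, K) d. \<rho> \<subseteq> E} \<subseteq> {E \<in> n_cells (Y, L) d. \<rho> \<subseteq> E}" using facets_eq by blast
  then have "card {E \<in> n_cells (X, K) d. \<rho> \<subseteq> E} \<le> card {E \<in> n_cells (Y, L) d. \<rho> \<subseteq> E}"
    using Y.finite_n_cells by (intro card_mono) auto
  then show "\<rho> \<in> boundary_ridges d (X, K)" using X.ridge_card_pos[OF \<rho>] \<rho> assms(1) by simp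
  show "\<rho> \<noteq> \<sigma>"
  proof
    assume "\<rho> = \<sigma>"
    obtain E where E: "E \<in> n_cells (X, K) d" "\<sigma> \<subseteq> E" by (rule X.boundary_ridge_unique[OF \<sigma>])
    obtain E' where E': "\<And>D. \<lbrakk>D \<in> n_cells (Y, L) d; \<rho> \<subseteq> D\<rbrakk> \<Longrightarrow> D = E'"
      by (rule Y.boundary_ridge_unique[OF assms(1)]) (rule that)
    have "E = E'" using E'[of E] E facets_eq \<open>\<rho> = \<sigma>\<close> by simp
    moreover have "D = E'" using E'[of D] D \<sigma>_face(1) \<open>\<rho> = \<sigma>\<close> by simp
    ultimately show False using E(1) D(2) X.n_cells_subset by blast
  qed
qed

text \<open>At a face of \<open>\<sigma>\<close> the boundary ridge \<open>\<sigma>\<close> is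
  traded for the other ridge of \<open>D\<close>. At any other face, either all boundary ridges are
  old or all are ridges of \<open>D\<close>.\<close>

lemma thin:
  assumes thin: "thin_boundary d (X, K)" shows "thin_boundary d (Y, L)"
  unfolding thin_boundary_def
proof
  fix F assume F: "F \<in> n_cells (Y, L) (d - 2)"
  let ?B = "{\<rho> \<in> boundary_ridges d (Y, L). F \<subseteq> \<rho>}"
  let ?N = "{\<rho> \<in> n_cells (Y, L) (d - 1). F \<subseteq> \<rho> \<and> \<rho> \<subseteq> D}"
  have finN: "finite ?N" using Y.finite_n_cells[of "d - 1"] by simp
  have new: "\<rho> \<subseteq> D" if "\<rho> \<in> boundary_ridges d (Y, L)" "\<rho> \<notin> K" for \<rho>
  proof -
    have "\<rho> \<in> L" using that(1) Y.n_cells_subset by blast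
    then show ?thesis using that(2) L by blast
  qed
  show "card ?B \<le> 2"
  proof (cases "F \<in> K")
    case False
    have "?B \<subseteq> ?N"
    proof
      fix \<rho> assume \<rho>: "\<rho> \<in> ?B"
      have "\<rho> \<notin> K"
      proof
        assume "\<rho> \<in> K"
        then have "F \<subseteq> topspace X" using \<rho> X.cell_subset by blast
        then show False using in_sub[of F] F Y.n_cells_subset False by blast
      qed
      then show "\<rho> \<in> ?N" using new \<rho> by blast
    qed
    then have le: "card ?B \<le> card ?N" by (rule card_mono[OF finN])
    show ?thesis
    proof (cases "?B = {}")
      case False
      then obtain \<rho> where "\<rho> \<in> ?N" using \<open>?B \<subseteq> ?N\<close> by blast
      then have "F \<subseteq> D" by blast
      then show ?thesis using le Y.ridges_between[OF F D(1)] by simp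
    next
      case True
      show ?thesis unfolding True by simp
    qed
  next
    case True
    have FX: "F \<in> n_cells (X, K) (d - 2)" using F True sub_n_cells by blast
    let ?O = "{\<rho> \<in> boundary_ridges d (X, K). F \<subseteq> \<rho>}"
    have finO: "finite ?O" using X.finite_n_cells[of "d - 1"] by simp
    have O2: "card ?O \<le> 2" using thin FX unfolding thin_boundary_def by blast
    show ?thesis
    proof (cases "F \<subseteq> \<sigma>")
      case False
      have "?B \<subseteq> ?O"
      proof
        fix \<rho> assume \<rho>: "\<rho> \<in> ?B"
        have "\<rho> \<in> K"
        proof (rule ccontr)
          assume "\<rho> \<notin> K"
          then have "F \<subseteq> D" using new[of \<rho>] \<rho> by blast
          then have "F \<subseteq> \<sigma>" using common_face[OF _ _ True order_refl] F Y.n_cells_subset by blast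
          then show False using False by simp
        qed
        then show "\<rho> \<in> ?O" using old_boundary_ridge(1)[of \<rho>] \<rho> by blast
      qed
      then have "card ?B \<le> card ?O" by (rule card_mono[OF finO])
      then show ?thesis using O2 by simp
    next
      case F\<sigma>: True
      have "?B \<subseteq> (?O - {\<sigma>}) \<union> (?N - {\<sigma>})"
      proof
        fix \<rho> assume \<rho>: "\<rho> \<in> ?B"
        show "\<rho> \<in> (?O - {\<sigma>}) \<union> (?N - {\<sigma>})"
        proof (cases "\<rho> \<in> K")
          case True
          then show ?thesis using old_boundary_ridge[of \<rho>] \<rho> by blast
        next
          case False
          then have "\<rho> \<subseteq> D" "\<rho> \<noteq> \<sigma>" using new[of \<rho>] \<rho> \<sigma>_face(3) by blast+
          then show ?thesis using \<rho> by blast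
        qed
      qed
      then have "card ?B \<le> card ((?O - {\<sigma>}) \<union> (?N - {\<sigma>}))" using finO finN by (intro card_mono) auto
      also have "\<dots> \<le> card (?O - {\<sigma>}) + card (?N - {\<sigma>})" by (rule card_Un_le)
      also have "card (?O - {\<sigma>}) = card ?O - 1" using \<sigma> F\<sigma> finO by (intro card_Diff_singleton) simp
      also have "card (?N - {\<sigma>}) = card ?N - 1" using \<sigma>_face F\<sigma> by (intro card_Diff_singleton) simp
      also have "card ?N = 2" by (rule Y.ridges_between[OF F D(1) subset_trans[OF F\<sigma> \<sigma>_face(1)]])
      finally show ?thesis using O2 by simp
    qed
  qed
qed

end

lemma glue_simplexE:
  assumes "d \<ge> 2" "pseudomanifold d (X, K)" "pseudomanifold d (Y, L)" "glue_simplex d (X, K) (Y, L)"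
  obtains \<sigma> D where "pm_gluing X K Y L d \<sigma> D"
proof -
  interpret X: pm X K d by (rule pmI[OF assms(1,2)])
  interpret Y: pm Y L d by (rule pmI[OF assms(1,3)])
  have KL: "K \<subseteq> L" and XY: "X = subtopology Y (topspace X)"
    and ex: "\<exists>\<sigma>\<in>n_cells (X, K) (d - 1) \<inter> pm_boundary d (X, K). \<exists>D\<in>n_cells (Y, L) d.
        D \<notin> K \<and> L = K \<union> {c \<in> L. c \<subseteq> D} \<and> D \<inter> topspace X = \<sigma>"
    using assms(4) unfolding glue_simplex_def prod.case by (iprover elim: conjE)+
  from ex obtain \<sigma> D where e: "\<sigma> \<in> n_cells (X, K) (d - 1) \<inter> pm_boundary d (X, K)" "D \<in> n_cells (Y, L) d"
    "D \<notin> K" "L = K \<union> {c \<in> L. c \<subseteq> D}" "D \<inter> topspace X = \<sigma>"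
    by (elim bexE conjE)
  have \<sigma>: "\<sigma> \<in> boundary_ridges d (X, K)" using e(1) unfolding X.boundary_ridge_iff .
  have "pm_gluing X K Y L d \<sigma> D"
    by unfold_locales (rule KL XY \<sigma> e)+
  then show thesis by (rule that)
qed

locale pm_identification = X: pm X K d + Y: pm Y L d + cw_identification X K Y L \<sigma> \<tau> h q
  for X :: "'p topology" and K and Y :: "'q topology" and L and d \<sigma> \<tau> h q +
  fixes F :: "'p set"
  assumes \<sigma>b: "\<sigma> \<in> boundary_ridges d (X, K)" and \<tau>b: "\<tau> \<in> boundary_ridges d (X, K)"
    and F: "F \<in> n_cells (X, K) (d - 2)" "F \<subseteq> \<sigma>" "F \<subseteq> \<tau>"
begin

abbreviation Q :: "'p set \<Rightarrow> 'q set" where "Q \<equiv> \<lambda>c. q ` c"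

lemma Q_n_cells: "c \<in> K \<Longrightarrow> Q c \<in> n_cells (Y, L) n \<longleftrightarrow> c \<in> n_cells (X, K) n"
  using q_dim q_in_L by (simp add: X.n_cells_iff Y.n_cells_iff)

lemma fiber:
  assumes "c \<in> K" "e \<in> K" "Q c = Q e"
  shows "c = e \<or> (c \<subseteq> \<sigma> \<and> e \<subseteq> \<tau>) \<or> (c \<subseteq> \<tau> \<and> e \<subseteq> \<sigma>)"
  using image_eq_glued[OF assms] h_face assms(1,2) unfolding glued_def by metis

lemma Q\<sigma>\<tau>: "Q \<sigma> = Q \<tau>"
  by (rule glued_image) (simp add: glued_def h_im)

lemma fiber_\<sigma>: "\<lbrakk>c \<in> K; e \<in> K; Q c = Q e; c \<subseteq> \<sigma>; e \<subseteq> \<sigma>\<rbrakk> \<Longrightarrow> c = e"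
  using cell_mapD(5)[OF cell_map \<sigma>] .

lemma fiber_\<tau>: "\<lbrakk>c \<in> K; e \<in> K; Q c = Q e; c \<subseteq> \<tau>; e \<subseteq> \<tau>\<rbrakk> \<Longrightarrow> c = e"
  using cell_mapD(5)[OF cell_map \<tau>] .

text \<open>A cell identified with \<open>F\<close> would lie in \<open>\<sigma>\<close> or
  \<open>\<tau>\<close> together with \<open>F\<close>, and the quotient map is injective on the
  faces of either.\<close>

lemma fiber_F: "\<lbrakk>c \<in> K; Q c = Q F\<rbrakk> \<Longrightarrow> c = F"
  using fiber[of c F] fiber_\<sigma>[of c F] fiber_\<tau>[of c F] F X.n_cells_subset by blast

lemma facet_fiber:
  assumes "c \<in> n_cells (X, K) d" "e \<in> K" "Q c = Q e" shows "c = e"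
proof -
  have c: "c \<in> K" "X.cdim c = d" using assms(1) by (simp_all add: X.n_cells_iff)
  have "\<not> c \<subseteq> \<rho>" if "\<rho> \<in> boundary_ridges d (X, K)" for \<rho>
  proof
    assume sub: "c \<subseteq> \<rho>"
    have \<rho>: "\<rho> \<in> K" "X.cdim \<rho> = d - 1" using that by (simp_all add: X.n_cells_iff)
    have "X.cdim c \<le> X.cdim \<rho>" using X.cdim_less[OF c(1) \<rho>(1) sub] by (cases "c = \<rho>") auto
    then show False using c(2) \<rho>(2) X.d2 by simp
  qed
  then show ?thesis using fiber[OF c(1) assms(2,3)] \<sigma>b \<tau>b by blast
qed

lemma ridge_fiber:
  assumes "c \<in> n_cells (X, K) (d - 1)" "e \<in> K" "Q c = Q e" "c \<noteq> \<sigma>" "c \<noteq> \<tau>" shows "c = e"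
proof -
  have c: "c \<in> K" using assms(1) X.n_cells_subset by blast
  have "\<not> c \<subseteq> \<sigma>" "\<not> c \<subseteq> \<tau>" using X.n_cells_eq[OF assms(1)] \<sigma>b \<tau>b assms(4,5) by blast+
  then show ?thesis using fiber[OF c assms(2,3)] by blast
qed

lemma facets_above:
  assumes \<rho>: "\<rho> \<in> n_cells (X, K) (d - 1)"
  shows "{E \<in> n_cells (Y, L) d. Q \<rho> \<subseteq> E} = Q ` {E \<in> n_cells (X, K) d. \<exists>\<rho>'\<in>K. \<rho>' \<subseteq> E \<and> Q \<rho>' = Q \<rho>}"
proof (intro equalityI subsetI)
  have \<rho>K: "\<rho> \<in> K" using \<rho> X.n_cells_subset by blast
  fix E assume "E \<in> {E \<in> n_cells (Y, L) d. Q \<rho> \<subseteq> E}"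
  then have E: "E \<in> n_cells (Y, L) d" "Q \<rho> \<subseteq> E" by simp_all
  then have "E \<in> L" using Y.n_cells_subset by blast
  then obtain D where D: "D \<in> K" "E = Q D" using cell_mapD(3)[OF cell_map] by blast
  have "D \<in> n_cells (X, K) d" using E(1) Q_n_cells[OF D(1)] D(2) by simp
  moreover obtain \<rho>' where "\<rho>' \<in> K" "\<rho>' \<subseteq> D" "Q \<rho>' = Q \<rho>"
    using cell_mapD(4)[OF cell_map D(1) q_in_L[OF \<rho>K]] E(2) D(2) by blast
  ultimately show "E \<in> Q ` {E \<in> n_cells (X, K) d. \<exists>\<rho>'\<in>K. \<rho>' \<subseteq> E \<and> Q \<rho>' = Q \<rho>}" using D(2) by blast
next
  fix E assume "E \<in> Q ` {E \<in> n_cells (X, K) d. \<exists>\<rho>'\<in>K. \<rho>' \<subseteq> E \<and> Q \<rho>' = Q \<rho>}"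
  then obtain D \<rho>' where D: "E = Q D" "D \<in> n_cells (X, K) d" "\<rho>' \<in> K" "\<rho>' \<subseteq> D" "Q \<rho>' = Q \<rho>" by blast
  have "D \<in> K" using D(2) X.n_cells_subset by blast
  then have "E \<in> n_cells (Y, L) d" using Q_n_cells D(1,2) by simp
  moreover have "Q \<rho> \<subseteq> E" using image_mono[OF D(4), of q] D(1,5) by simp
  ultimately show "E \<in> {E \<in> n_cells (Y, L) d. Q \<rho> \<subseteq> E}" by simp
qed

text \<open>No two facets are identified, and no ridges but \<open>\<sigma>\<close> and
  \<open>\<tau>\<close>, so the count of facets changes only there. The facets of
  \<open>\<sigma>\<close> and \<open>\<tau>\<close> differ, because the quotient map is injective on
  the faces of a single facet; the merged ridge is therefore interior.\<close>

lemma boundary_ridges_eq: "boundary_ridges d (Y, L) = Q ` (boundary_ridges d (X, K) - {\<sigma>, \<tau>})"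
proof -
  have injF: "inj_on Q (n_cells (X, K) d)"
    by (rule inj_onI) (use facet_fiber X.n_cells_subset in blast)
  have other: "card {E \<in> n_cells (Y, L) d. Q \<rho> \<subseteq> E} = card {E \<in> n_cells (X, K) d. \<rho> \<subseteq> E}"
    if \<rho>: "\<rho> \<in> n_cells (X, K) (d - 1)" "\<rho> \<noteq> \<sigma>" "\<rho> \<noteq> \<tau>" for \<rho>
  proof -
    have "\<rho> \<in> K" using \<rho> X.n_cells_subset by blast
    then have "(\<exists>\<rho>'\<in>K. \<rho>' \<subseteq> E \<and> Q \<rho>' = Q \<rho>) \<longleftrightarrow> \<rho> \<subseteq> E" for E
      using ridge_fiber[OF \<rho>(1) _ _ \<rho>(2,3)] by metis
    then have "{E \<in> n_cells (Y, L) d. Q \<rho> \<subseteq> E} = Q ` {E \<in> n_cells (X, K) d. \<rho> \<subseteq> E}"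
      using facets_above[OF \<rho>(1)] by simp
    moreover have "inj_on Q {E \<in> n_cells (X, K) d. \<rho> \<subseteq> E}" by (rule inj_on_subset[OF injF]) blast
    ultimately show ?thesis by (simp add: card_image)
  qed
  have glued2: "card {E \<in> n_cells (Y, L) d. Q \<sigma> \<subseteq> E} \<noteq> 1"
  proof -
    obtain A where A: "A \<in> n_cells (X, K) d" "\<sigma> \<subseteq> A" by (rule X.boundary_ridge_unique[OF \<sigma>b])
    obtain B where B: "B \<in> n_cells (X, K) d" "\<tau> \<subseteq> B" by (rule X.boundary_ridge_unique[OF \<tau>b])
    have AB: "A \<in> K" "B \<in> K" using A B X.n_cells_subset by blast+
    have "A \<noteq> B"
    proof
      assume "A = B"
      then have "\<sigma> = \<tau>" using cell_mapD(5)[OF cell_map AB(1) \<sigma> \<tau>] A(2) B(2) Q\<sigma>\<tau> by simp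
      then show False using ne by simp
    qed
    then have "Q A \<noteq> Q B" using facet_fiber[OF A(1) AB(2)] by blast
    moreover have "Q A \<in> {E \<in> n_cells (Y, L) d. Q \<sigma> \<subseteq> E}" "Q B \<in> {E \<in> n_cells (Y, L) d. Q \<sigma> \<subseteq> E}"
      using Q_n_cells[OF AB(1)] Q_n_cells[OF AB(2)] A B image_mono[OF A(2), of q] image_mono[OF B(2), of q] Q\<sigma>\<tau> by simp_all
    ultimately show ?thesis by (metis card_1_singletonE singletonD)
  qed
  show ?thesis
  proof (intro equalityI subsetI)
    fix r assume r: "r \<in> boundary_ridges d (Y, L)"
    then have "r \<in> L" using Y.n_cells_subset by blast
    then obtain \<rho> where \<rho>: "\<rho> \<in> K" "r = Q \<rho>" using cell_mapD(3)[OF cell_map] by blast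
    have n: "\<rho> \<in> n_cells (X, K) (d - 1)" using r Q_n_cells[OF \<rho>(1)] \<rho>(2) by simp
    have "\<rho> \<noteq> \<sigma>" "\<rho> \<noteq> \<tau>" using glued2 r \<rho>(2) Q\<sigma>\<tau> by auto
    then have "\<rho> \<in> boundary_ridges d (X, K) - {\<sigma>, \<tau>}" using other[OF n] n r \<rho>(2) by simp
    then show "r \<in> Q ` (boundary_ridges d (X, K) - {\<sigma>, \<tau>})" using \<rho>(2) by (rule image_eqI[rotated])
  next
    fix r assume "r \<in> Q ` (boundary_ridges d (X, K) - {\<sigma>, \<tau>})"
    then obtain \<rho> where \<rho>: "r = Q \<rho>" "\<rho> \<in> boundary_ridges d (X, K) - {\<sigma>, \<tau>}" by (rule imageE)
    then have n: "\<rho> \<in> n_cells (X, K) (d - 1)" "\<rho> \<in> K" using X.n_cells_subset by blast+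
    then have "r \<in> n_cells (Y, L) (d - 1)" using Q_n_cells \<rho>(1) by simp
    then show "r \<in> boundary_ridges d (Y, L)" using other[OF n(1)] \<rho> by simp
  qed
qed

lemma boundary_above:
  assumes e: "e \<in> K" and r: "r \<in> boundary_ridges d (Y, L)" "Q e \<subseteq> r"
  obtains \<rho> e' where "\<rho> \<in> boundary_ridges d (X, K)" "\<rho> \<noteq> \<sigma>" "\<rho> \<noteq> \<tau>" "r = Q \<rho>" "e' \<in> K" "e' \<subseteq> \<rho>" "Q e' = Q e"
proof -
  obtain \<rho> where \<rho>: "r = Q \<rho>" "\<rho> \<in> boundary_ridges d (X, K) - {\<sigma>, \<tau>}"
    using r(1) unfolding boundary_ridges_eq by (rule imageE)
  have "\<rho> \<in> K" using \<rho>(2) X.n_cells_subset by blast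
  then obtain e' where e': "e' \<in> K" "e' \<subseteq> \<rho>" "Q e' = Q e"
    using cell_mapD(4)[OF cell_map \<open>\<rho> \<in> K\<close> q_in_L[OF e] r(2)[unfolded \<rho>(1)]] by (elim bexE conjE)
  show thesis by (rule that[OF _ _ _ \<rho>(1) e']) (use \<rho>(2) in simp_all)
qed

text \<open>At most two cells \<open>e\<close> and \<open>f\<close> of codimension two become equal.
  If they do, each lies in \<open>\<sigma>\<close> or \<open>\<tau>\<close>, which stops being a
  boundary ridge, so each contributes at most one boundary ridge.\<close>

lemma thin:
  assumes thin: "thin_boundary d (X, K)" shows "thin_boundary d (Y, L)"
  unfolding thin_boundary_def
proof
  fix G assume G: "G \<in> n_cells (Y, L) (d - 2)"
  then have "G \<in> L" using Y.n_cells_subset by blast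
  then obtain e where e: "e \<in> K" "G = Q e" using cell_mapD(3)[OF cell_map] by blast
  let ?B = "boundary_ridges d (X, K)"
  let ?A = "\<lambda>f. {\<rho> \<in> ?B. f \<subseteq> \<rho>}"
  have fin: "finite (?A f)" for f using X.finite_n_cells[of "d - 1"] by simp
  have dimf: "f \<in> n_cells (X, K) (d - 2)" if "f \<in> K" "Q f = Q e" for f
    using G Q_n_cells[OF that(1)] that(2) e(2) by simp
  have A2: "card (?A f) \<le> 2" if "f \<in> K" "Q f = Q e" for f
    using thin dimf[OF that] unfolding thin_boundary_def by blast
  have sub: "{r \<in> boundary_ridges d (Y, L). G \<subseteq> r} \<subseteq> Q ` (\<Union>f\<in>{f \<in> K. Q f = Q e}. ?A f - {\<sigma>, \<tau>})"
  proof
    fix r assume r: "r \<in> {r \<in> boundary_ridges d (Y, L). G \<subseteq> r}"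
    then have r': "r \<in> boundary_ridges d (Y, L)" "Q e \<subseteq> r" using e(2) by simp_all
    obtain \<rho> e' where "\<rho> \<in> ?B" "\<rho> \<noteq> \<sigma>" "\<rho> \<noteq> \<tau>" "r = Q \<rho>" "e' \<in> K" "e' \<subseteq> \<rho>" "Q e' = Q e"
      by (rule boundary_above[OF e(1) r'])
    then show "r \<in> Q ` (\<Union>f\<in>{f \<in> K. Q f = Q e}. ?A f - {\<sigma>, \<tau>})" by blast
  qed
  show "card {r \<in> boundary_ridges d (Y, L). G \<subseteq> r} \<le> 2"
  proof (cases "\<exists>f\<in>K. Q f = Q e \<and> f \<noteq> e")
    case False
    then have "{f \<in> K. Q f = Q e} = {e}" using e(1) by blast
    then have "{r \<in> boundary_ridges d (Y, L). G \<subseteq> r} \<subseteq> Q ` ?A e" using sub by auto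
    then have "card {r \<in> boundary_ridges d (Y, L). G \<subseteq> r} \<le> card (?A e)"
      using fin by (metis (no_types, lifting) card_image_le card_mono finite_imageI order_trans)
    then show ?thesis using A2[OF e(1)] by simp
  next
    case True
    then obtain f where f: "f \<in> K" "Q f = Q e" "f \<noteq> e" by blast
    have two: "{f \<in> K. Q f = Q e} = {e, f}" and ef: "\<exists>\<mu>\<in>{\<sigma>, \<tau>}. e \<subseteq> \<mu>" "\<exists>\<mu>\<in>{\<sigma>, \<tau>}. f \<subseteq> \<mu>"
    proof -
      have fe: "(e \<subseteq> \<sigma> \<and> f \<subseteq> \<tau>) \<or> (e \<subseteq> \<tau> \<and> f \<subseteq> \<sigma>)" using fiber[OF e(1) f(1)] f(2,3) by simp
      then show "\<exists>\<mu>\<in>{\<sigma>, \<tau>}. e \<subseteq> \<mu>" "\<exists>\<mu>\<in>{\<sigma>, \<tau>}. f \<subseteq> \<mu>" by auto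
      have "g = e \<or> g = f" if g: "g \<in> K" "Q g = Q e" for g
      proof (rule ccontr)
        assume gn: "\<not> (g = e \<or> g = f)"
        then have ge: "(g \<subseteq> \<sigma> \<and> e \<subseteq> \<tau>) \<or> (g \<subseteq> \<tau> \<and> e \<subseteq> \<sigma>)" using fiber[OF g(1) e(1) g(2)] by simp
        from fe ge consider "e \<subseteq> \<sigma>" "e \<subseteq> \<tau>" | "f \<subseteq> \<tau>" "g \<subseteq> \<tau>" | "f \<subseteq> \<sigma>" "g \<subseteq> \<sigma>" by blast
        then show False
        proof cases
          case 1
          then have "f = e" using fe fiber_\<sigma>[OF f(1) e(1) f(2)] fiber_\<tau>[OF f(1) e(1) f(2)] by blast
          then show False using f(3) by simp
        next
          case 2
          then show False using fiber_\<tau>[OF g(1) f(1)] g(2) f(2) gn by simp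
        next
          case 3
          then show False using fiber_\<sigma>[OF g(1) f(1)] g(2) f(2) gn by simp
        qed
      qed
      then show "{f \<in> K. Q f = Q e} = {e, f}" using e(1) f(1,2) by blast
    qed
    have one: "card (?A g - {\<sigma>, \<tau>}) \<le> 1" if "g \<in> K" "Q g = Q e" "\<exists>\<mu>\<in>{\<sigma>, \<tau>}. g \<subseteq> \<mu>" for g
    proof -
      obtain \<mu> where \<mu>: "\<mu> \<in> {\<sigma>, \<tau>}" "g \<subseteq> \<mu>" using \<open>\<exists>\<mu>\<in>{\<sigma>, \<tau>}. g \<subseteq> \<mu>\<close> by (rule bexE)
      have "\<mu> \<in> ?A g" using \<mu> \<sigma>b \<tau>b by auto
      have "?A g - {\<sigma>, \<tau>} \<subseteq> ?A g - {\<mu>}" using \<mu>(1) by blast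
      then have "card (?A g - {\<sigma>, \<tau>}) \<le> card (?A g - {\<mu>})" using fin[of g] by (intro card_mono finite_Diff)
      also have "\<dots> = card (?A g) - 1" by (rule card_Diff_singleton[OF \<open>\<mu> \<in> ?A g\<close>])
      finally show ?thesis using A2[OF that(1,2)] by simp
    qed
    have "card {r \<in> boundary_ridges d (Y, L). G \<subseteq> r} \<le> card (Q ` ((?A e - {\<sigma>, \<tau>}) \<union> (?A f - {\<sigma>, \<tau>})))"
    proof (rule card_mono)
      show "finite (Q ` ((?A e - {\<sigma>, \<tau>}) \<union> (?A f - {\<sigma>, \<tau>})))" using fin by (intro finite_imageI finite_UnI finite_Diff)
      show "{r \<in> boundary_ridges d (Y, L). G \<subseteq> r} \<subseteq> Q ` ((?A e - {\<sigma>, \<tau>}) \<union> (?A f - {\<sigma>, \<tau>}))"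
        using sub unfolding two by simp
    qed
    also have "\<dots> \<le> card ((?A e - {\<sigma>, \<tau>}) \<union> (?A f - {\<sigma>, \<tau>}))"
      using fin by (intro card_image_le finite_UnI finite_Diff)
    also have "\<dots> \<le> card (?A e - {\<sigma>, \<tau>}) + card (?A f - {\<sigma>, \<tau>})" by (rule card_Un_le)
    also have "\<dots> \<le> 2" using one[OF e(1) refl ef(1)] one[OF f(1,2) ef(2)] by simp
    finally show ?thesis .
  qed
qed

text \<open>A boundary ridge above the image of \<open>F\<close> would come from a third boundary
  ridge above \<open>F\<close>, next to \<open>\<sigma>\<close> and \<open>\<tau>\<close>.\<close>

lemma shared_face_interior:
  assumes thin: "thin_boundary d (X, K)" and r: "r \<in> boundary_ridges d (Y, L)"
  shows "\<not> Q F \<subseteq> r"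
proof
  assume sub: "Q F \<subseteq> r"
  have FK: "F \<in> K" using F(1) X.n_cells_subset by blast
  obtain \<rho> e' where e: "\<rho> \<in> boundary_ridges d (X, K)" "\<rho> \<noteq> \<sigma>" "\<rho> \<noteq> \<tau>" "r = Q \<rho>" "e' \<in> K" "e' \<subseteq> \<rho>" "Q e' = Q F"
    by (rule boundary_above[OF FK r sub])
  have "F \<subseteq> \<rho>" using fiber_F[OF e(5,7)] e(6) by simp
  then have "{\<rho>, \<sigma>, \<tau>} \<subseteq> {\<rho> \<in> boundary_ridges d (X, K). F \<subseteq> \<rho>}" using e(1) \<sigma>b \<tau>b F(2,3) by simp
  then have "card {\<rho>, \<sigma>, \<tau>} \<le> card {\<rho> \<in> boundary_ridges d (X, K). F \<subseteq> \<rho>}"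
    using X.finite_n_cells[of "d - 1"] by (intro card_mono) simp
  moreover have "card {\<rho>, \<sigma>, \<tau>} = 3" using e(2,3) ne by simp
  ultimately show False using thin F(1) unfolding thin_boundary_def by (metis (no_types, lifting) Suc_n_not_le_n le_trans numeral_2_eq_2 numeral_3_eq_3)
qed

end

lemma identify_facetsE:
  assumes "d \<ge> 2" "pseudomanifold d (X, K)" "pseudomanifold d (Y, L)" "identify_facets d (X, K) (Y, L)"
  obtains \<sigma> \<tau> h q F where "pm_identification X K Y L d \<sigma> \<tau> h q F"
proof -
  interpret X: pm X K d by (rule pmI[OF assms(1,2)])
  interpret Y: pm Y L d by (rule pmI[OF assms(1,3)])
  from assms(4) obtain \<sigma> \<tau> F h q where e: "\<sigma> \<in> n_cells (X, K) (d - 1) \<inter> pm_boundary d (X, K)"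
      "\<tau> \<in> n_cells (X, K) (d - 1) \<inter> pm_boundary d (X, K)" "F \<in> n_cells (X, K) (d - 2)"
      "\<sigma> \<noteq> \<tau>" "F \<subseteq> \<sigma> \<inter> \<tau>"
      "homeomorphic_map (subtopology X \<sigma>) (subtopology X \<tau>) h"
      "(\<lambda>c. h ` c) ` {c \<in> K. c \<subseteq> \<sigma>} = {c \<in> K. c \<subseteq> \<tau>}"
      "\<forall>x\<in>\<sigma> \<inter> \<tau>. h x = x" "quotient_map X Y q"
      "\<forall>x\<in>topspace X. \<forall>y\<in>topspace X.
           q x = q y \<longleftrightarrow> x = y \<or> (x \<in> \<sigma> \<and> y = h x) \<or> (y \<in> \<sigma> \<and> x = h y)"
      "L = (\<lambda>c. q ` c) ` K"
    unfolding identify_facets_def prod.case by (elim bexE exE conjE)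
  have b: "\<sigma> \<in> boundary_ridges d (X, K)" "\<tau> \<in> boundary_ridges d (X, K)"
    using e(1,2) unfolding X.boundary_ridge_iff .
  have "pm_identification X K Y L d \<sigma> \<tau> h q F"
  proof (unfold_locales)
    show "\<sigma> \<in> K" "\<tau> \<in> K" using b X.n_cells_subset by blast+
    show "F \<subseteq> \<sigma>" "F \<subseteq> \<tau>" using e(5) by simp_all
    show "h x = x" if "x \<in> \<sigma> \<inter> \<tau>" for x using e(8) that by (rule bspec)
    show "q x = q y \<longleftrightarrow> x = y \<or> (x \<in> \<sigma> \<and> y = h x) \<or> (y \<in> \<sigma> \<and> x = h y)"
      if "x \<in> topspace X" "y \<in> topspace X" for x y using e(10) that by simp
  qed (rule e b)+
  then show thesis by (rule that)
qed

section \<open>From local constructions to collapses\<close>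

lemma aff_dim_nonneg: "(F :: 'a::euclidean_space set) \<noteq> {} \<Longrightarrow> 0 \<le> aff_dim F"
  using aff_dim_geq[of F] aff_dim_empty[of F] by linarith

context simpl_complex
begin

text \<open>If \<open>F\<close> were the only face of \<open>D\<close> in its dimension, every
  extreme point of \<open>D\<close> would lie in \<open>F\<close>, hence all of \<open>D\<close>. It
  is used to show that collapsing the ridges does not destroy every face of dimension
  \<open>d - 2\<close>.\<close>

lemma other_facet_of_face:
  assumes "F \<in> S" "D \<in> S" "F \<noteq> {}" "F \<subseteq> D" "aff_dim D = aff_dim F + 1"
  obtains G where "G \<in> S" "G \<subseteq> D" "G \<noteq> F" "aff_dim G = aff_dim F"
proof (rule ccontr)
  assume "\<not> thesis"
  then have all: "G = F" if "G \<in> S" "G \<subseteq> D" "aff_dim G = aff_dim F" for G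
    using that \<open>\<And>G. \<lbrakk>G \<in> S; G \<subseteq> D; G \<noteq> F; aff_dim G = aff_dim F\<rbrakk> \<Longrightarrow> thesis\<close> by blast
  have "{x. x extreme_point_of D} \<subseteq> F"
  proof
    fix x assume "x \<in> {x. x extreme_point_of D}"
    then have x: "{x} face_of D" by (simp add: face_of_singleton)
    have "aff_dim D \<ge> 1" using aff_dim_nonneg[OF assms(3)] assms(5) by simp
    then have "{x} \<subset> D" using face_of_imp_subset[OF x] by (metis aff_dim_sing not_one_le_zero psubsetI)
    then obtain G where "G \<in> S" "{x} \<subseteq> G" "G \<subseteq> D" "aff_dim G = aff_dim D - 1"
      by (rule face_below[OF face_in[OF assms(2) x] assms(2)])
    then show "x \<in> F" using all[of G] assms(5) by simp
  qed
  then have "convex hull {x. x extreme_point_of D} \<subseteq> F" using convexS[OF assms(1)] by (rule hull_minimal)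
  then have "D \<subseteq> F" using Krein_Milman_Minkowski[OF compactS[OF assms(2)] convexS[OF assms(2)]] by simp
  then show False using assms(4,5) by (simp add: subset_antisym)
qed

lemma n_cells_complex: "n_cells (top_of_set (\<Union>S), S - {{}}) n = faces_of_dim S (int n)"
proof (intro equalityI subsetI)
  have cell: "is_cell (top_of_set (\<Union>S)) (nat (aff_dim F)) F (rel_frontier F)" if "F \<in> S" "F \<noteq> {}" for F
  proof -
    have "is_cell (top_of_set F) (nat (aff_dim F)) F (rel_frontier F)"
      using that aff_dim_nonneg[of F] by (intro convex_is_cell convexS compactS) auto
    then have "is_cell (subtopology (top_of_set (\<Union>S)) F) (nat (aff_dim F)) F (rel_frontier F)"
      using that by (simp add: subtopology_subtopology Sup_upper inf.absorb2)
    then show ?thesis by (rule is_cell_subspace)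
  qed
  show "c \<in> faces_of_dim S (int n)" if "c \<in> n_cells (top_of_set (\<Union>S), S - {{}}) n" for c
  proof -
    have c: "c \<in> S" "c \<noteq> {}" and "\<exists>B. is_cell (top_of_set (\<Union>S)) n c B" using that by (simp_all add: n_cells_def)
    then obtain B where B: "is_cell (top_of_set (\<Union>S)) n c B" by (elim exE)
    have "n = nat (aff_dim c)" by (rule cell_dim_unique[OF B cell[OF c]])
    then show ?thesis using c aff_dim_nonneg[of c] by (simp add: faces_of_dim_def)
  qed
  show "c \<in> n_cells (top_of_set (\<Union>S), S - {{}}) n" if "c \<in> faces_of_dim S (int n)" for c
  proof -
    have c: "c \<in> S" "aff_dim c = int n" using that by (simp_all add: faces_of_dim_def)
    then have "c \<noteq> {}" by auto
    then show ?thesis using cell[OF c(1)] c by (auto simp: n_cells_def)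
  qed
qed

end

context pm_complex
begin

text \<open>\<open>Q\<close> is the composite of the identifications that lead from \<open>T\<close> to the sphere. By the last
  condition, codimension two cells that get identified later lie on the boundary of \<open>T\<close>; so the face
  \<open>F\<close> shared by two identified ridges, which is interior afterwards, is not touched again.\<close>

definition unfolding_map :: "'p cell_complex \<Rightarrow> ('p set \<Rightarrow> 'a set) \<Rightarrow> bool" where
  "unfolding_map T Q \<longleftrightarrow> cell_map Q (snd T) (S - {{}}) \<and>
     (\<forall>c\<in>snd T. \<forall>n. c \<in> n_cells T n \<longleftrightarrow> Q c \<in> faces_of_dim S (int n)) \<and>
     inj_on Q (n_cells T d) \<and>
     (\<forall>F\<in>n_cells T (d - 2). \<forall>F'\<in>n_cells T (d - 2). Q F = Q F' \<and> F \<noteq> F' \<longrightarrow>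
        (\<exists>\<rho>\<in>boundary_ridges d T. F \<subseteq> \<rho>))"

definition subcomplex :: "'a set set \<Rightarrow> bool" where
  "subcomplex C \<longleftrightarrow> C \<subseteq> S \<and> (\<forall>F\<in>C. \<forall>G\<in>S. G \<subseteq> F \<longrightarrow> G \<in> C)"

text \<open>Quantified over all complexes with the ridges \<open>E\<close>, because only these
  ridges matter for the collapse. The last clause keeps the dimension from dropping below
  \<open>d - 2\<close>.\<close>

definition collapsible_ridges :: "'a set set \<Rightarrow> bool" where
  "collapsible_ridges E \<longleftrightarrow>
     (\<forall>C. subcomplex C \<and> (\<forall>F\<in>C. aff_dim F \<le> int d - 1) \<and> faces_of_dim C (int d - 1) = E \<longrightarrow>
        (\<exists>C'. collapses_onto C C' \<and> (\<forall>F\<in>C'. aff_dim F \<le> int d - 2) \<and>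
           (faces_of_dim C (int d - 2) \<noteq> {} \<longrightarrow> faces_of_dim C' (int d - 2) \<noteq> {})))"

lemma subcomplexD: "\<lbrakk>subcomplex C; F \<in> C; G \<in> S; G \<subseteq> F\<rbrakk> \<Longrightarrow> G \<in> C" "subcomplex C \<Longrightarrow> C \<subseteq> S"
  by (auto simp: subcomplex_def)

lemma collapse_subcomplex:
  assumes "collapse_dim k C D" "subcomplex C"
  shows "subcomplex D" "collapses_onto C D"
proof -
  have CS: "C \<subseteq> S" using assms(2) by (rule subcomplexD)
  have "G \<in> D" if "F \<in> D" "G \<in> S" "G \<subseteq> F" for F G
    by (rule collapse_dim_faces[OF assms(1) CS subcomplexD(1)[OF assms(2)] that])
  then show "subcomplex D" using collapse_dim_subset[OF assms(1)] CS by (auto simp: subcomplex_def)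
  show "collapses_onto C D" using assms(1) CS by (intro collapse_dim_star_onto r_into_rtranclp)
qed

lemma unfolding_mapD:
  assumes "unfolding_map (X, K) Q"
  shows "cell_map Q K (S - {{}})"
    "c \<in> K \<Longrightarrow> c \<in> n_cells (X, K) n \<longleftrightarrow> Q c \<in> faces_of_dim S (int n)"
    "inj_on Q (n_cells (X, K) d)"
    "\<lbrakk>F \<in> n_cells (X, K) (d - 2); F' \<in> n_cells (X, K) (d - 2); Q F = Q F'; F \<noteq> F'\<rbrakk> \<Longrightarrow>
        \<exists>\<rho>\<in>boundary_ridges d (X, K). F \<subseteq> \<rho>"
proof -
  from assms have 1: "cell_map Q K (S - {{}})" and 2: "\<forall>c\<in>K. \<forall>n. c \<in> n_cells (X, K) n \<longleftrightarrow> Q c \<in> faces_of_dim S (int n)"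
    and 3: "inj_on Q (n_cells (X, K) d)" and 4: "\<forall>F\<in>n_cells (X, K) (d - 2). \<forall>F'\<in>n_cells (X, K) (d - 2). Q F = Q F' \<and> F \<noteq> F' \<longrightarrow>
        (\<exists>\<rho>\<in>boundary_ridges d (X, K). F \<subseteq> \<rho>)"
    unfolding unfolding_map_def snd_conv by (iprover elim: conjE)+
  show "cell_map Q K (S - {{}})" by (rule 1)
  show "c \<in> K \<Longrightarrow> c \<in> n_cells (X, K) n \<longleftrightarrow> Q c \<in> faces_of_dim S (int n)" using 2 by simp
  show "inj_on Q (n_cells (X, K) d)" by (rule 3)
  show "\<exists>\<rho>\<in>boundary_ridges d (X, K). F \<subseteq> \<rho>"
    if "F \<in> n_cells (X, K) (d - 2)" "F' \<in> n_cells (X, K) (d - 2)" "Q F = Q F'" "F \<noteq> F'"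
    by (rule 4[rule_format, OF that(1,2)]) (use that(3,4) in simp)
qed

lemma unfolding_map_id:
  assumes "T = (top_of_set (\<Union>S), S - {{}})"
  shows "unfolding_map T (\<lambda>c. c)" "collapsible_ridges ((\<lambda>c. c) ` boundary_ridges d T)"
proof -
  have n: "n_cells T n = faces_of_dim S (int n)" for n unfolding assms by (rule n_cells_complex)
  show "unfolding_map T (\<lambda>c. c)"
    unfolding unfolding_map_def n by (auto simp: assms cell_map_id)
  have "int (d - 1) = int d - 1" using d2 by simp
  then have "boundary_ridges d T = {}" unfolding n using two by simp
  then show "collapsible_ridges ((\<lambda>c. c) ` boundary_ridges d T)"
  proof -
    have "\<exists>C'. collapses_onto C C' \<and> (\<forall>F\<in>C'. aff_dim F \<le> int d - 2) \<and>
           (faces_of_dim C (int d - 2) \<noteq> {} \<longrightarrow> faces_of_dim C' (int d - 2) \<noteq> {})"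
      if "\<forall>F\<in>C. aff_dim F \<le> int d - 1" "faces_of_dim C (int d - 1) = {}" for C
    proof (intro exI[of _ C] conjI ballI impI)
      show "collapses_onto C C" by (simp add: collapses_onto_def)
      show "aff_dim F \<le> int d - 2" if "F \<in> C" for F
        using that \<open>\<forall>F\<in>C. aff_dim F \<le> int d - 1\<close> \<open>faces_of_dim C (int d - 1) = {}\<close>
        by (fastforce simp: faces_of_dim_def)
    qed
    then show ?thesis unfolding collapsible_ridges_def \<open>boundary_ridges d T = {}\<close> image_empty
      by (intro allI impI) (elim conjE, assumption)
  qed
qed

lemma unfolding_map_step:
  assumes pi: "pm_identification X K Y L d \<sigma> \<tau> h q F0" and thin: "thin_boundary d (X, K)"
    and U: "unfolding_map (Y, L) Q" and col: "collapsible_ridges (Q ` boundary_ridges d (Y, L))"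
  shows "unfolding_map (X, K) (Q \<circ> (`) q)" "collapsible_ridges ((Q \<circ> (`) q) ` boundary_ridges d (X, K))"
proof -
  interpret I: pm_identification X K Y L d \<sigma> \<tau> h q F0 by (rule pi)
  let ?Q = "Q \<circ> (`) q"
  note Q = unfolding_mapD[OF U]
  have cm: "cell_map ?Q K (S - {{}})" by (rule cell_map_compose[OF I.cell_map Q(1)])
  have dim: "c \<in> n_cells (X, K) n \<longleftrightarrow> ?Q c \<in> faces_of_dim S (int n)" if "c \<in> K" for c n
    using Q(2)[OF I.q_in_L[OF that], of n] I.Q_n_cells[OF that, of n] by simp
  \<comment> \<open>If this identification merges \<open>F\<close> with another cell, then
    \<open>F\<close> lies in \<open>\<sigma>\<close> or \<open>\<tau>\<close>. If a later one does,
    a boundary ridge above the image of \<open>F\<close> exists in the quotient and is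
    lifted.\<close>
  have above: "\<exists>\<rho>\<in>boundary_ridges d (X, K). F \<subseteq> \<rho>"
    if F: "F \<in> n_cells (X, K) (d - 2)" and F': "F' \<in> n_cells (X, K) (d - 2)" and eq: "?Q F = ?Q F'" and ne: "F \<noteq> F'" for F F'
  proof -
    have FK: "F \<in> K" "F' \<in> K" using F F' I.X.n_cells_subset by blast+
    have glued: ?thesis if "q ` F = q ` e" "e \<in> K" "e \<noteq> F" for e
    proof -
      have "F \<subseteq> \<sigma> \<or> F \<subseteq> \<tau>" using I.fiber[OF FK(1) that(2,1)] that(3) by metis
      then show ?thesis
      proof
        assume "F \<subseteq> \<sigma>" then show ?thesis by (rule bexI[where x = \<sigma>, OF _ I.\<sigma>b])
      next
        assume "F \<subseteq> \<tau>" then show ?thesis by (rule bexI[where x = \<tau>, OF _ I.\<tau>b])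
      qed
    qed
    show ?thesis
    proof (cases "q ` F = q ` F'")
      case True
      then show ?thesis by (rule glued[OF _ FK(2) ne[symmetric]])
    next
      case False
      have "q ` F \<in> n_cells (Y, L) (d - 2)" "q ` F' \<in> n_cells (Y, L) (d - 2)"
        using I.Q_n_cells F F' FK by simp_all
      from Q(4)[OF this _ False] eq obtain r where r: "r \<in> boundary_ridges d (Y, L)" "q ` F \<subseteq> r"
        unfolding comp_apply by (elim meta_impE bexE) assumption+
      obtain \<rho> e' where e: "\<rho> \<in> boundary_ridges d (X, K)" "e' \<in> K" "e' \<subseteq> \<rho>" "q ` e' = q ` F"
        by (rule I.boundary_above[OF FK(1) r])
      show ?thesis
      proof (cases "e' = F")
        case True
        then have "F \<subseteq> \<rho>" using e(3) by simp
        then show ?thesis by (rule bexI[OF _ e(1)])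
      next
        case False
        then show ?thesis by (rule glued[OF e(4)[symmetric] e(2)])
      qed
    qed
  qed
  have inj: "inj_on ?Q (n_cells (X, K) d)"
  proof (rule comp_inj_on)
    show "inj_on ((`) q) (n_cells (X, K) d)"
      by (rule inj_onI) (use I.facet_fiber I.X.n_cells_subset in blast)
    have "(`) q ` n_cells (X, K) d \<subseteq> n_cells (Y, L) d"
      using I.Q_n_cells I.X.n_cells_subset by blast
    then show "inj_on Q ((`) q ` n_cells (X, K) d)" by (rule inj_on_subset[OF Q(3)])
  qed
  show "unfolding_map (X, K) ?Q"
    unfolding unfolding_map_def snd_conv
  proof (intro conjI cm inj)
    show "\<forall>c\<in>K. \<forall>n. c \<in> n_cells (X, K) n \<longleftrightarrow> ?Q c \<in> faces_of_dim S (int n)"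
      using dim by (intro ballI allI)
    show "\<forall>F\<in>n_cells (X, K) (d - 2). \<forall>F'\<in>n_cells (X, K) (d - 2). ?Q F = ?Q F' \<and> F \<noteq> F' \<longrightarrow>
        (\<exists>\<rho>\<in>boundary_ridges d (X, K). F \<subseteq> \<rho>)"
      by (intro ballI impI, elim conjE) (rule above)
  qed
  have F0: "F0 \<in> K" "F0 \<in> n_cells (X, K) (d - 2)" using I.F(1) I.X.n_cells_subset by blast+
  \<comment> \<open>A later ridge above the image of \<open>F0\<close> would contain a cell
    \<open>b\<close> with the same final image. It is not the image of \<open>F0\<close> itself,
    which is interior; but cells that are still to be merged lie on the boundary.\<close>
  have free: "\<not> ?Q F0 \<subseteq> Q r" if r: "r \<in> boundary_ridges d (Y, L)" for r
  proof
    assume sub: "?Q F0 \<subseteq> Q r"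
    have rL: "r \<in> L" using r I.Y.n_cells_subset by blast
    obtain b where b: "b \<in> L" "b \<subseteq> r" "Q b = ?Q F0"
      using cell_mapD(4)[OF Q(1) rL cell_mapD(1)[OF cm F0(1)] sub] by (elim bexE conjE)
    have not: "\<not> q ` F0 \<subseteq> r'" if "r' \<in> boundary_ridges d (Y, L)" for r'
      by (rule I.shared_face_interior[OF thin that])
    have "q ` F0 \<noteq> b" using not[OF r] b(2) by metis
    moreover have "q ` F0 \<in> n_cells (Y, L) (d - 2)" using I.Q_n_cells[OF F0(1)] F0(2) by simp
    moreover have "b \<in> n_cells (Y, L) (d - 2)" using Q(2)[OF b(1)] b(3) dim[OF F0(1)] F0(2) by simp
    ultimately have "\<exists>\<rho>\<in>boundary_ridges d (Y, L). q ` F0 \<subseteq> \<rho>" using Q(4)[of "q ` F0" b] b(3) by simp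
    then show False by (rule bexE) (rule notE[OF not])
  qed
  have E: "?Q ` boundary_ridges d (X, K) = insert (?Q \<sigma>) (Q ` boundary_ridges d (Y, L))"
  proof -
    have "boundary_ridges d (X, K) = insert \<sigma> (insert \<tau> (boundary_ridges d (X, K) - {\<sigma>, \<tau>}))"
      using I.\<sigma>b I.\<tau>b by blast
    then have "?Q ` boundary_ridges d (X, K) = insert (?Q \<sigma>) (insert (?Q \<tau>) (?Q ` (boundary_ridges d (X, K) - {\<sigma>, \<tau>})))"
      by (metis (no_types, lifting) image_insert)
    then show ?thesis using I.Q\<sigma>\<tau> unfolding I.boundary_ridges_eq by (simp add: image_comp)
  qed
  have s: "?Q \<sigma> \<in> ridges" using dim[OF I.\<sigma>, of "d - 1"] I.\<sigma>b d2 by (simp add: of_nat_diff)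
  have f: "?Q F0 \<in> faces_of_dim S (int d - 2)" using dim[OF F0(1), of "d - 2"] F0(2) d2 by (simp add: of_nat_diff)
  have fs: "?Q F0 \<subseteq> ?Q \<sigma>" by (rule cell_mapD(2)[OF cm I.\<sigma> F0(1) I.F(2)])
  have f': "?Q F0 \<in> S" "?Q F0 \<noteq> {}" "aff_dim (?Q F0) = int d - 2"
    using f cell_mapD(1)[OF cm F0(1)] by (simp_all add: faces_of_dim_def)
  have s': "?Q \<sigma> \<in> S" "aff_dim (?Q \<sigma>) = int d - 1" using s by (simp_all add: faces_of_dim_def)
  show "collapsible_ridges (?Q ` boundary_ridges d (X, K))"
    unfolding collapsible_ridges_def E
  proof (intro allI impI, elim conjE)
    fix C assume C: "subcomplex C" "\<forall>F\<in>C. aff_dim F \<le> int d - 1"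
      and CE: "faces_of_dim C (int d - 1) = insert (?Q \<sigma>) (Q ` boundary_ridges d (Y, L))"
    have CS: "C \<subseteq> S" by (rule subcomplexD(2)[OF C(1)])
    have sC: "?Q \<sigma> \<in> C" using CE by (auto simp: faces_of_dim_def)
    have fC: "?Q F0 \<in> C" by (rule subcomplexD(1)[OF C(1) sC f'(1) fs])
    let ?D = "C - {?Q F0, ?Q \<sigma>}"
    have cd: "collapse_dim (int d - 1) C ?D"
    proof (rule collapse_dimI[OF fC sC f'(2) s'(2) _ fs _ refl])
      show "aff_dim (?Q F0) = int d - 1 - 1" using f'(3) by simp
      fix G assume G: "G \<in> C" "?Q F0 \<subseteq> G"
      have GS: "G \<in> S" using G(1) CS by blast
      show "G = ?Q F0 \<or> G = ?Q \<sigma>"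
      proof (cases "aff_dim G = int d - 1")
        case True
        then have "G \<in> insert (?Q \<sigma>) (Q ` boundary_ridges d (Y, L))" unfolding CE[symmetric] using G(1) by (simp add: faces_of_dim_def)
        then show ?thesis
        proof (rule insertE)
          assume "G \<in> Q ` boundary_ridges d (Y, L)"
          then obtain r where "G = Q r" "r \<in> boundary_ridges d (Y, L)" by (rule imageE)
          then show ?thesis using free[of r] G(2) by simp
        qed (rule disjI2)
      next
        case False
        have "aff_dim (?Q F0) \<le> aff_dim G" using G(2) by (rule dim_mono)
        then have "aff_dim (?Q F0) = aff_dim G" using False f'(3) C(2)[rule_format, OF G(1)] by simp
        then have "?Q F0 = G" using dim_eq[OF f'(1) GS G(2)] by simp
        then show ?thesis by (intro disjI1) (rule sym)
      qed
    qed
    note D = collapse_subcomplex[OF cd C(1)]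
    have nots: "?Q \<sigma> \<notin> Q ` boundary_ridges d (Y, L)"
      using free fs by (metis (no_types, lifting) imageE)
    have "faces_of_dim ?D (int d - 1) = faces_of_dim C (int d - 1) - {?Q \<sigma>}"
      using f'(3) by (auto simp: faces_of_dim_def)
    also have "\<dots> = Q ` boundary_ridges d (Y, L)" unfolding CE using nots by simp
    finally have DE: "faces_of_dim ?D (int d - 1) = Q ` boundary_ridges d (Y, L)" .
    have Ddim: "\<forall>F\<in>?D. aff_dim F \<le> int d - 1" using C(2) by simp
    obtain C' where C': "collapses_onto ?D C'" "\<forall>F\<in>C'. aff_dim F \<le> int d - 2"
      "faces_of_dim ?D (int d - 2) \<noteq> {} \<longrightarrow> faces_of_dim C' (int d - 2) \<noteq> {}"
      using col[unfolded collapsible_ridges_def, THEN spec, of ?D, THEN mp, OF conjI[OF D(1) conjI[OF Ddim DE]]]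
      by (elim exE conjE)
    \<comment> \<open>Another face of dimension \<open>d - 2\<close> of the removed ridge survives
      this collapse.\<close>
    have "aff_dim (?Q \<sigma>) = aff_dim (?Q F0) + 1" using s'(2) f'(3) by simp
    then obtain G where G: "G \<in> S" "G \<subseteq> ?Q \<sigma>" "G \<noteq> ?Q F0" "aff_dim G = aff_dim (?Q F0)"
      by (rule other_facet_of_face[OF f'(1) s'(1) f'(2) fs])
    have "G \<in> C" by (rule subcomplexD(1)[OF C(1) sC G(1,2)])
    moreover have "G \<noteq> ?Q \<sigma>" using G(4) f'(3) s'(2) by auto
    ultimately have "G \<in> faces_of_dim ?D (int d - 2)" using G(3,4) f'(3) by (simp add: faces_of_dim_def)
    then have "faces_of_dim C' (int d - 2) \<noteq> {}" using C'(3) by blast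
    moreover have "collapses_onto C C'" by (rule collapses_onto_trans[OF D(2) C'(1)])
    ultimately show "\<exists>C'. collapses_onto C C' \<and> (\<forall>F\<in>C'. aff_dim F \<le> int d - 2) \<and>
           (faces_of_dim C (int d - 2) \<noteq> {} \<longrightarrow> faces_of_dim C' (int d - 2) \<noteq> {})"
      using C'(2) by (intro exI[of _ C'] conjI impI)
  qed
qed

abbreviation inner_ridges :: "'p cell_complex \<Rightarrow> 'p set set" where
  "inner_ridges T \<equiv> n_cells T (d - 1) - boundary_ridges d T"

text \<open>A gluing is a collapse of the complement: the old facet on the other side of
  \<open>\<sigma>\<close> has left \<open>C\<close> already, so above \<open>Q \<sigma>\<close> only
  \<open>Q D\<close> remains.\<close>

lemma glue_collapse:
  fixes X :: "'p topology" and Y :: "'p topology"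
  assumes pg: "pm_gluing X K Y L d \<sigma> D"
    and Q: "\<And>c n. c \<in> n_cells (Y, L) n \<Longrightarrow> Q c \<in> faces_of_dim S (int n)" "inj_on Q (n_cells (Y, L) d)"
      "\<And>c e. \<lbrakk>c \<in> L; e \<in> L; c \<subseteq> e\<rbrakk> \<Longrightarrow> Q c \<subseteq> Q e"
    and C: "subcomplex C" "faces_of_dim C (int d) = facets d S - Q ` n_cells (X, K) d"
      "faces_of_dim C (int d - 1) = ridges - Q ` inner_ridges (X, K)"
  obtains C' where "subcomplex C'" "collapse_dim (int d) C C'"
    "faces_of_dim C' (int d) = facets d S - Q ` n_cells (Y, L) d"
    "faces_of_dim C' (int d - 1) = ridges - Q ` inner_ridges (Y, L)"
proof -
  interpret G: pm_gluing X K Y L d \<sigma> D by (rule pg)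
  let ?C' = "C - {Q \<sigma>, Q D}"
  have DX: "D \<notin> n_cells (X, K) d" using G.D(2) G.X.n_cells_subset by blast
  have XY: "n_cells (X, K) d \<subseteq> n_cells (Y, L) d" using G.facets_eq by blast
  have QD: "Q D \<in> facets d S" by (rule Q(1)[OF G.D(1)])
  have Qs: "Q \<sigma> \<in> ridges" using Q(1)[OF G.\<sigma>_face(4)] d2 by (simp add: of_nat_diff)
  have DL: "D \<in> L" "\<sigma> \<in> L" using G.D(1) G.\<sigma>_face(4) G.Y.n_cells_subset by blast+
  have sD: "Q \<sigma> \<subseteq> Q D" by (rule Q(3)[OF DL(2,1) G.\<sigma>_face(1)])
  have "Q D \<notin> Q ` n_cells (X, K) d"
    using inj_on_image_mem_iff[OF Q(2) G.D(1) XY] DX by simp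
  then have "Q D \<in> faces_of_dim C (int d)" unfolding C(2) using QD by simp
  then have DC: "Q D \<in> C" by (simp add: faces_of_dim_def)
  have sC: "Q \<sigma> \<in> C" by (rule subcomplexD(1)[OF C(1) DC ridgeD(1)[OF Qs] sD])
  have CS: "C \<subseteq> S" by (rule subcomplexD(2)[OF C(1)])
  obtain E where E: "E \<in> n_cells (X, K) d" "\<sigma> \<subseteq> E" by (rule G.X.boundary_ridge_unique[OF G.\<sigma>])
  have EY: "E \<in> n_cells (Y, L) d" using E(1) XY by blast
  have EL: "E \<in> L" using EY G.Y.n_cells_subset by blast
  have "E \<noteq> D" using E(1) DX by blast
  then have QE: "Q E \<in> facets d S" "Q E \<noteq> Q D" "Q \<sigma> \<subseteq> Q E"
    using Q(1)[OF EY] inj_onD[OF Q(2) _ EY G.D(1)] Q(3)[OF DL(2) EL E(2)] by auto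
  have QEC: "Q E \<notin> C"
  proof
    assume "Q E \<in> C"
    then have "Q E \<in> faces_of_dim C (int d)" using QE(1) by (simp add: faces_of_dim_def)
    then show False unfolding C(2) using E(1) by blast
  qed
  have cd: "collapse_dim (int d) C ?C'"
  proof (rule collapse_dimI[OF sC DC _ _ _ sD _ refl])
    show "Q \<sigma> \<noteq> {}" using ridgeD(2)[OF Qs] d2 by auto
    show "aff_dim (Q D) = int d" "aff_dim (Q \<sigma>) = int d - 1" by (rule facetD(2)[OF QD] ridgeD(2)[OF Qs])+
    fix G assume G: "G \<in> C" "Q \<sigma> \<subseteq> G"
    have GS: "G \<in> S" using G(1) CS by blast
    show "G = Q \<sigma> \<or> G = Q D"
    proof (cases "aff_dim G = int d")
      case True
      then have "G \<in> facets d S" using GS by (simp add: faces_of_dim_def)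
      then have "G = Q D \<or> G = Q E"
        using two_facets_of_ridge[OF Qs QD QE(1) _ sD QE(3) G(2)] QE(2) by metis
      then show ?thesis using G(1) QEC by metis
    next
      case False
      have "aff_dim (Q \<sigma>) \<le> aff_dim G" using G(2) by (rule dim_mono)
      then have "aff_dim (Q \<sigma>) = aff_dim G" using False dim_le[OF GS] ridgeD(2)[OF Qs] by simp
      then show ?thesis using dim_eq[OF ridgeD(1)[OF Qs] GS G(2)] by simp
    qed
  qed
  \<comment> \<open>Among the interior ridges only \<open>\<sigma>\<close> is new: no other old
    ridge lies in the new facet, and no other new ridge in an old facet.\<close>
  have inner: "inner_ridges (Y, L) = insert \<sigma> (inner_ridges (X, K))"
  proof -
    have oldcard: "{E \<in> n_cells (Y, L) d. \<rho> \<subseteq> E} = {E \<in> n_cells (X, K) d. \<rho> \<subseteq> E}"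
      if \<rho>: "\<rho> \<in> n_cells (X, K) (d - 1)" "\<rho> \<noteq> \<sigma>" for \<rho>
    proof -
      have \<rho>K: "\<rho> \<in> K" using \<rho>(1) G.X.n_cells_subset by blast
      then have \<rho>L: "\<rho> \<in> L" using G.KL by blast
      have "\<not> \<rho> \<subseteq> D"
      proof
        assume "\<rho> \<subseteq> D"
        then have "\<rho> \<subseteq> \<sigma>" by (rule G.common_face[OF \<rho>L _ \<rho>K order_refl])
        then show False using G.X.n_cells_eq[OF \<rho>(1) G.\<sigma>_face(2)] \<rho>(2) by simp
      qed
      then show ?thesis unfolding G.facets_eq by blast
    qed
    have new: "{E \<in> n_cells (Y, L) d. \<rho> \<subseteq> E} = {D}" if \<rho>: "\<rho> \<in> n_cells (Y, L) (d - 1)" "\<rho> \<notin> K" for \<rho>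
    proof -
      have \<rho>L: "\<rho> \<in> L" using \<rho>(1) G.Y.n_cells_subset by blast
      then have "\<rho> \<subseteq> D" using \<rho>(2) G.L by blast
      moreover have "\<not> \<rho> \<subseteq> E" if "E \<in> n_cells (X, K) d" for E
      proof
        assume "\<rho> \<subseteq> E"
        moreover have "E \<in> K" using that G.X.n_cells_subset by blast
        ultimately have "\<rho> \<subseteq> topspace X" using G.X.cell_subset by blast
        then show False using G.in_sub[OF \<rho>L] \<rho>(2) by simp
      qed
      ultimately show ?thesis unfolding G.facets_eq by blast
    qed
    have \<sigma>2: "card {E \<in> n_cells (Y, L) d. \<sigma> \<subseteq> E} \<noteq> 1"
    proof
      assume "card {E \<in> n_cells (Y, L) d. \<sigma> \<subseteq> E} = 1"
      then have "\<sigma> \<in> boundary_ridges d (Y, L)" using G.\<sigma>_face(4) by simp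
      then show False using G.old_boundary_ridge(2)[of \<sigma>] G.\<sigma>_face(3) by simp
    qed
    show ?thesis
    proof (intro equalityI subsetI)
      fix \<rho> assume \<rho>: "\<rho> \<in> inner_ridges (Y, L)"
      then have n: "\<rho> \<in> n_cells (Y, L) (d - 1)" and c1: "card {E \<in> n_cells (Y, L) d. \<rho> \<subseteq> E} \<noteq> 1" by simp_all
      have "\<rho> \<in> K" using new[OF n] c1 by (rule_tac ccontr) simp
      then have nX: "\<rho> \<in> n_cells (X, K) (d - 1)" using n G.sub_n_cells by blast
      show "\<rho> \<in> insert \<sigma> (inner_ridges (X, K))"
        using oldcard[OF nX] c1 nX by (cases "\<rho> = \<sigma>") simp_all
    next
      fix \<rho> assume "\<rho> \<in> insert \<sigma> (inner_ridges (X, K))"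
      then show "\<rho> \<in> inner_ridges (Y, L)"
      proof (rule insertE)
        assume "\<rho> = \<sigma>" then show ?thesis using \<sigma>2 G.\<sigma>_face(4) by simp
      next
        assume a: "\<rho> \<in> inner_ridges (X, K)"
        then have nX: "\<rho> \<in> n_cells (X, K) (d - 1)" and c: "card {E \<in> n_cells (X, K) d. \<rho> \<subseteq> E} \<noteq> 1" by simp_all
        have "\<rho> \<noteq> \<sigma>" using a G.\<sigma> by blast
        moreover have "\<rho> \<in> n_cells (Y, L) (d - 1)" using nX G.sub_n_cells by blast
        ultimately show ?thesis using oldcard[OF nX] c by simp
      qed
    qed
  qed
  show thesis
  proof (rule that[OF collapse_subcomplex(1)[OF cd C(1)] cd])
    have "faces_of_dim ?C' (int d) = faces_of_dim C (int d) - {Q D}"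
      using ridgeD(2)[OF Qs] by (auto simp: faces_of_dim_def)
    then show "faces_of_dim ?C' (int d) = facets d S - Q ` n_cells (Y, L) d"
      unfolding C(2) G.facets_eq by blast
    have "faces_of_dim ?C' (int d - 1) = faces_of_dim C (int d - 1) - {Q \<sigma>}"
      using facetD(2)[OF QD] by (auto simp: faces_of_dim_def)
    then show "faces_of_dim ?C' (int d - 1) = ridges - Q ` inner_ridges (Y, L)"
      unfolding C(3) inner by blast
  qed
qed

lemma subcomplex_remove_facet: assumes "\<Delta> \<in> facets d S" shows "subcomplex (S - {\<Delta>})"
  unfolding subcomplex_def using facet_max[OF assms] by blast

theorem LC_imp_collapse:
  assumes "LC d S"
  shows "\<exists>\<Delta>\<in>facets d S. \<exists>C. has_dim C (int d - 2) \<and> collapses_onto (S - {\<Delta>}) C"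
proof -
  obtain T :: "nat \<Rightarrow> 'a cell_complex" and k N where N: "1 \<le> N" "N \<le> k"
    and pmT: "\<And>i. i \<in> {1..k} \<Longrightarrow> pseudomanifold d (T i)"
    and T1: "is_single_simplex d (T 1)"
    and glue: "\<And>i. i \<in> {1..<N} \<Longrightarrow> glue_simplex d (T i) (T (Suc i))"
    and ident: "\<And>i. i \<in> {N..<k} \<Longrightarrow> identify_facets d (T i) (T (Suc i))"
    and Tk: "T k = (top_of_set (\<Union>S), S - {{}})"
    using assms unfolding LC_def Let_def by (elim exE conjE) (metis (no_types, lifting))
  have gluing: "\<exists>\<sigma> D. pm_gluing (fst (T i)) (snd (T i)) (fst (T (Suc i))) (snd (T (Suc i))) d \<sigma> D" if "i \<in> {1..<N}" for i
    by (rule glue_simplexE[of d "fst (T i)" "snd (T i)" "fst (T (Suc i))" "snd (T (Suc i))"])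
      (use d2 pmT[of i] pmT[of "Suc i"] glue[OF that] that N in auto)
  have identif: "\<exists>\<sigma> \<tau> h q F. pm_identification (fst (T i)) (snd (T i)) (fst (T (Suc i))) (snd (T (Suc i))) d \<sigma> \<tau> h q F"
    if "i \<in> {N..<k}" for i
    by (rule identify_facetsE[of d "fst (T i)" "snd (T i)" "fst (T (Suc i))" "snd (T (Suc i))"])
      (use d2 pmT[of i] pmT[of "Suc i"] ident[OF that] that N in \<open>simp_all, blast\<close>)

  \<comment> \<open>The boundary stays thin along the construction\<close>
  have thin: "thin_boundary d (T i)" if "i \<in> {1..k}" for i
    using that
  proof (induction i)
    case (Suc i)
    show ?case
    proof (cases "i = 0")
      case True
      then show ?thesis using single_simplex_thin(1)[OF d2 pmT[of 1] T1] Suc.prems by simp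
    next
      case False
      then have IH: "thin_boundary d (fst (T i), snd (T i))" using Suc by simp
      consider "i \<in> {1..<N}" | "i \<in> {N..<k}" using False Suc.prems by fastforce
      then have "thin_boundary d (fst (T (Suc i)), snd (T (Suc i)))"
      proof cases
        case 1
        from gluing[OF 1] show ?thesis by (elim exE) (rule pm_gluing.thin[OF _ IH])
      next
        case 2
        from identif[OF 2] show ?thesis by (elim exE) (rule pm_identification.thin[OF _ IH])
      qed
      then show ?thesis by simp
    qed
  qed simp

  \<comment> \<open>The identifications, from the last to the first\<close>
  have "\<exists>Q. unfolding_map (T N) Q \<and> collapsible_ridges (Q ` boundary_ridges d (T N))"
    using N(2)
  proof (induction rule: inc_induct)
    case base
    show ?case using unfolding_map_id[OF Tk] by (intro exI[of _ "\<lambda>c. c"] conjI)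
  next
    case (step i)
    then have i: "i \<in> {N..<k}" by simp
    from step.IH obtain Q where Q: "unfolding_map (fst (T (Suc i)), snd (T (Suc i))) Q"
      "collapsible_ridges (Q ` boundary_ridges d (fst (T (Suc i)), snd (T (Suc i))))" by (simp only: prod.collapse) (elim exE conjE)
    have th: "thin_boundary d (fst (T i), snd (T i))" using thin[of i] i N(1) by simp
    from identif[OF i] obtain \<sigma> \<tau> h q F
      where I: "pm_identification (fst (T i)) (snd (T i)) (fst (T (Suc i))) (snd (T (Suc i))) d \<sigma> \<tau> h q F" by (elim exE)
    show ?case using unfolding_map_step[OF I th Q] unfolding prod.collapse by (intro exI conjI)
  qed
  then obtain Q where U: "unfolding_map (T N) Q" and col: "collapsible_ridges (Q ` boundary_ridges d (T N))"
    by (elim exE conjE)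
  define X K where "X = fst (T N)" and "K = snd (T N)"
  have TN: "T N = (X, K)" by (simp add: X_def K_def)
  interpret N: pm X K d by (rule pmI[OF d2]) (use pmT[of N] N TN in simp)
  note Q = unfolding_mapD[OF U[unfolded TN]]
  have sub: "snd (T i) \<subseteq> K \<and> (\<forall>n. n_cells (T i) n \<subseteq> n_cells (X, K) n)" if "i \<in> {1..N}" for i
  proof -
    have "i \<le> N" using that by simp
    then show ?thesis
    proof (induction rule: inc_induct)
      case base
      show ?case by (simp add: TN)
    next
      case (step j)
      then have "j \<in> {1..<N}" using that by simp
      from gluing[OF this] obtain \<sigma> D where g: "pm_gluing (fst (T j)) (snd (T j)) (fst (T (Suc j))) (snd (T (Suc j))) d \<sigma> D" by (elim exE)
      have "snd (T j) \<subseteq> snd (T (Suc j))" "n_cells (T j) n \<subseteq> n_cells (T (Suc j)) n" for n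
        using pm_gluing.KL[OF g] pm_gluing.sub_n_cells[OF g, of n] by simp_all
      then show ?case using step.IH by (meson order_trans)
    qed
  qed
  obtain D1 where D1: "n_cells (T 1) d = {D1}" using single_simplex_thin(2)[OF d2 pmT[of 1] T1] N by auto
  have Qdim: "Q c \<in> faces_of_dim S (int n)" if "c \<in> n_cells (X, K) n" for c n
    using Q(2)[of c n] that N.n_cells_subset by blast
  have D1N: "D1 \<in> n_cells (X, K) d" using sub[of 1, THEN conjunct2, rule_format, of d] D1 N by simp
  have \<Delta>: "Q D1 \<in> facets d S" by (rule Qdim[OF D1N])

  \<comment> \<open>The gluings as collapses of facets\<close>
  have phase1: "\<exists>C. collapses_onto (S - {Q D1}) C \<and> subcomplex C \<and>
      faces_of_dim C (int d) = facets d S - Q ` n_cells (T i) d \<and>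
      faces_of_dim C (int d - 1) = ridges - Q ` inner_ridges (T i) \<and>
      faces_of_dim S (int d - 2) \<subseteq> C" if "i \<in> {1..N}" for i
  proof -
    have "1 \<le> i" using that by simp
    then show ?thesis using that
    proof (induction rule: dec_induct)
      case base
      show ?case
      proof (intro exI[of _ "S - {Q D1}"] conjI)
        show "collapses_onto (S - {Q D1}) (S - {Q D1})" by (simp add: collapses_onto_def)
        show "subcomplex (S - {Q D1})" by (rule subcomplex_remove_facet[OF \<Delta>])
        show "faces_of_dim (S - {Q D1}) (int d) = facets d S - Q ` n_cells (T 1) d"
          unfolding D1 by (auto simp: faces_of_dim_def)
        interpret O: pm "fst (T 1)" "snd (T 1)" d by (rule pmI[OF d2]) (use pmT[of 1] N in simp)
        have inner: "inner_ridges (T 1) = {}"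
        proof (rule equals0I)
          fix \<rho> assume a: "\<rho> \<in> inner_ridges (T 1)"
          then have "card {D \<in> n_cells (T 1) d. \<rho> \<subseteq> D} \<ge> 1" "card {D \<in> n_cells (T 1) d. \<rho> \<subseteq> D} \<noteq> 1"
            using O.ridge_card_pos[of \<rho>] by simp_all
          moreover have "card {D \<in> n_cells (T 1) d. \<rho> \<subseteq> D} \<le> card {D1}"
            unfolding D1 by (rule card_mono) auto
          ultimately show False by simp
        qed
        show "faces_of_dim (S - {Q D1}) (int d - 1) = ridges - Q ` inner_ridges (T 1)"
          unfolding inner using facetD(2)[OF \<Delta>] unfolding image_empty by (simp only: image_empty Diff_empty) (auto simp: faces_of_dim_def)
        show "faces_of_dim S (int d - 2) \<subseteq> S - {Q D1}" using facetD(2)[OF \<Delta>] by (auto simp: faces_of_dim_def)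
      qed
    next
      case (step j)
      then have j: "j \<in> {1..<N}" "j \<in> {1..N}" "Suc j \<in> {1..N}" by simp_all
      from step.IH[OF j(2)] obtain C where C: "collapses_onto (S - {Q D1}) C" "subcomplex C"
        "faces_of_dim C (int d) = facets d S - Q ` n_cells (T j) d"
        "faces_of_dim C (int d - 1) = ridges - Q ` inner_ridges (T j)"
        "faces_of_dim S (int d - 2) \<subseteq> C" by (elim exE conjE)
      from gluing[OF j(1)] obtain \<sigma> D where g: "pm_gluing (fst (T j)) (snd (T j)) (fst (T (Suc j))) (snd (T (Suc j))) d \<sigma> D" by (elim exE)
      note sj = sub[OF j(3)]
      have q1: "Q c \<in> faces_of_dim S (int n)" if "c \<in> n_cells (fst (T (Suc j)), snd (T (Suc j))) n" for c n
        using Qdim[of c n] that sj by (simp only: prod.collapse) blast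
      have q2: "inj_on Q (n_cells (fst (T (Suc j)), snd (T (Suc j))) d)"
        by (rule inj_on_subset[OF Q(3)]) (use sj in simp)
      have q3: "Q c \<subseteq> Q e" if "c \<in> snd (T (Suc j))" "e \<in> snd (T (Suc j))" "c \<subseteq> e" for c e
        by (rule cell_mapD(2)[OF Q(1) _ _ that(3)]) (use sj that in blast)+
      have c: "faces_of_dim C (int d) = facets d S - Q ` n_cells (fst (T j), snd (T j)) d"
        "faces_of_dim C (int d - 1) = ridges - Q ` inner_ridges (fst (T j), snd (T j))"
        using C(3,4) by simp_all
      obtain C' where C': "subcomplex C'" "collapse_dim (int d) C C'"
        "faces_of_dim C' (int d) = facets d S - Q ` n_cells (fst (T (Suc j)), snd (T (Suc j))) d"
        "faces_of_dim C' (int d - 1) = ridges - Q ` inner_ridges (fst (T (Suc j)), snd (T (Suc j)))"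
        by (rule glue_collapse[OF g q1 q2 q3 C(2) c])
      have "faces_of_dim S (int d - 2) \<subseteq> C'"
      proof
        fix F assume F: "F \<in> faces_of_dim S (int d - 2)"
        from C'(2) obtain s t where "C' = C - {s, t}" "aff_dim t = int d" "aff_dim s = int d - 1"
          unfolding collapse_dim_def by (elim bexE conjE)
        then show "F \<in> C'" using C(5) F by (auto simp: faces_of_dim_def)
      qed
      moreover have "collapses_onto (S - {Q D1}) C'"
        by (rule collapses_onto_trans[OF C(1) collapse_subcomplex(2)[OF C'(2) C(2)]])
      ultimately show ?case using C'(1,3,4) unfolding prod.collapse by (intro exI[of _ C'] conjI)
    qed
  qed

  \<comment> \<open>Both phases combined\<close>
  have "N \<in> {1..N}" using N by simp
  from phase1[OF this] obtain C where C: "collapses_onto (S - {Q D1}) C" "subcomplex C"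
      "faces_of_dim C (int d) = facets d S - Q ` n_cells (X, K) d"
      "faces_of_dim C (int d - 1) = ridges - Q ` inner_ridges (X, K)"
      "faces_of_dim S (int d - 2) \<subseteq> C" unfolding TN by (elim exE conjE)
  have lift: "\<exists>c\<in>n_cells (X, K) n. F = Q c" if "F \<in> faces_of_dim S (int n)" for F n
  proof -
    have "F \<in> S - {{}}" using that by (auto simp: faces_of_dim_def)
    from cell_mapD(3)[OF Q(1) this] obtain c where "c \<in> K" "F = Q c" by (elim bexE)
    then show ?thesis using Q(2)[of c n] that by blast
  qed
  have "faces_of_dim C (int d) = {}" unfolding C(3) using lift[of _ d] by blast
  then have Cdim: "\<forall>F\<in>C. aff_dim F \<le> int d - 1"
  proof -
    have "aff_dim F \<le> int d - 1" if "F \<in> C" for F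
    proof -
      have "aff_dim F \<noteq> int d" using that \<open>faces_of_dim C (int d) = {}\<close> by (auto simp: faces_of_dim_def)
      moreover have "aff_dim F \<le> int d" using dim_le that subcomplexD(2)[OF C(2)] by blast
      ultimately show ?thesis by simp
    qed
    then show ?thesis by blast
  qed
  have d1: "int (d - 1) = int d - 1" using d2 by simp
  \<comment> \<open>The gluings have removed the ridges of the tree; those left are the images of
    the boundary ridges of \<open>T N\<close>.\<close>
  have "faces_of_dim C (int d - 1) = Q ` boundary_ridges d (X, K)"
  proof (intro equalityI subsetI)
    fix r assume r: "r \<in> faces_of_dim C (int d - 1)"
    then have "r \<in> ridges" "r \<notin> Q ` inner_ridges (X, K)" unfolding C(4) by simp_all
    moreover obtain \<rho> where "\<rho> \<in> n_cells (X, K) (d - 1)" "r = Q \<rho>"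
      using lift[of r "d - 1"] \<open>r \<in> ridges\<close> unfolding d1 by (elim meta_impE bexE) assumption+
    ultimately show "r \<in> Q ` boundary_ridges d (X, K)" by blast
  next
    fix r assume "r \<in> Q ` boundary_ridges d (X, K)"
    then obtain \<rho> where \<rho>: "r = Q \<rho>" "\<rho> \<in> boundary_ridges d (X, K)" by (rule imageE)
    have \<rho>n: "\<rho> \<in> n_cells (X, K) (d - 1)" "\<rho> \<in> K" using \<rho>(2) N.n_cells_subset by blast+
    have r: "r \<in> ridges" using Qdim[OF \<rho>n(1)] \<rho>(1) d1 by simp
    have "r \<notin> Q ` inner_ridges (X, K)"
    proof
      assume "r \<in> Q ` inner_ridges (X, K)"
      \<comment> \<open>Suppose an inner ridge \<open>\<mu>\<close> and a boundary ridge
        \<open>\<rho>\<close> both lie over \<open>r\<close>. The two facets at \<open>\<mu>\<close>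
        map to the two facets of \<open>S\<close> at \<open>r\<close>, so the facet at
        \<open>\<rho>\<close> is one of them. It contains both ridges, which are then equal as faces
        with the same image.\<close>
      then obtain \<mu> where \<mu>: "r = Q \<mu>" "\<mu> \<in> inner_ridges (X, K)" by (rule imageE)
      have \<mu>n: "\<mu> \<in> n_cells (X, K) (d - 1)" "\<mu> \<in> K" using \<mu>(2) N.n_cells_subset by blast+
      obtain E where E: "E \<in> n_cells (X, K) d" "\<rho> \<subseteq> E" by (rule N.boundary_ridge_unique[OF \<rho>(2)])
      have "card {D \<in> n_cells (X, K) d. \<mu> \<subseteq> D} \<noteq> 1" using \<mu>(2) by simp
      then have "card {D \<in> n_cells (X, K) d. \<mu> \<subseteq> D} = 2"
        using N.ridge_card_pos[OF \<mu>n(1)] N.ridge_le_two[OF \<mu>n(1)] by linarith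
      then obtain A B where AB: "{D \<in> n_cells (X, K) d. \<mu> \<subseteq> D} = {A, B}" "A \<noteq> B" by (meson card_2_iff)
      have "A \<in> {D \<in> n_cells (X, K) d. \<mu> \<subseteq> D}" "B \<in> {D \<in> n_cells (X, K) d. \<mu> \<subseteq> D}" unfolding AB(1) by simp_all
      then have A: "A \<in> n_cells (X, K) d" "\<mu> \<subseteq> A" and B: "B \<in> n_cells (X, K) d" "\<mu> \<subseteq> B" by simp_all
      have K3: "A \<in> K" "B \<in> K" "E \<in> K" using A B E N.n_cells_subset by blast+
      have sub3: "r \<subseteq> Q A" "r \<subseteq> Q B" "r \<subseteq> Q E"
        using cell_mapD(2)[OF Q(1) K3(1) \<mu>n(2) A(2)] cell_mapD(2)[OF Q(1) K3(2) \<mu>n(2) B(2)]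
          cell_mapD(2)[OF Q(1) K3(3) \<rho>n(2) E(2)] \<mu>(1) \<rho>(1) by simp_all
      have "Q A \<noteq> Q B" using inj_onD[OF Q(3) _ A(1) B(1)] AB(2) by blast
      then have "Q E = Q A \<or> Q E = Q B"
        by (rule two_facets_of_ridge[OF r Qdim[OF A(1)] Qdim[OF B(1)] Qdim[OF E(1)] sub3])
      then have "E = A \<or> E = B" using inj_onD[OF Q(3) _ E(1) A(1)] inj_onD[OF Q(3) _ E(1) B(1)] by blast
      then have "\<mu> \<subseteq> E" using A(2) B(2) by blast
      then have "\<rho> = \<mu>" using cell_mapD(5)[OF Q(1) K3(3) \<rho>n(2) \<mu>n(2) E(2)] \<rho>(1) \<mu>(1) by simp
      then show False using \<rho>(2) \<mu>(2) by blast
    qed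
    then show "r \<in> faces_of_dim C (int d - 1)" unfolding C(4) using r by blast
  qed
  from col[unfolded collapsible_ridges_def TN, THEN spec, of C, THEN mp, OF conjI[OF C(2) conjI[OF Cdim this]]]
  obtain C' where C': "collapses_onto C C'" "\<forall>F\<in>C'. aff_dim F \<le> int d - 2"
      "faces_of_dim C (int d - 2) \<noteq> {} \<longrightarrow> faces_of_dim C' (int d - 2) \<noteq> {}"
    by (elim exE conjE)
  have "faces_of_dim S (int d - 2) \<noteq> {}"
  proof -
    have "{} \<in> S" using face_in[OF facetD(1)[OF \<Delta>]] by simp
    then obtain F where "F \<in> S" "aff_dim F = int d - 2" by (rule codim2_above[of "{}"]) (use d2 in auto)
    then show ?thesis by (auto simp: faces_of_dim_def)
  qed
  then have "faces_of_dim C (int d - 2) \<noteq> {}" using C(5) by (fastforce simp: faces_of_dim_def)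
  then have "has_dim C' (int d - 2)" unfolding has_dim_def using C'(2,3) by (auto simp: faces_of_dim_def)
  moreover have "collapses_onto (S - {Q D1}) C'" by (rule collapses_onto_trans[OF C(1) C'(1)])
  ultimately show ?thesis using \<Delta> by blast
qed

end

section \<open>Complexes glued from facets\<close>

text \<open>The final topology for the maps \<open>i D\<close>, that is, the quotient of the
  disjoint union of the facets. \<open>i D x\<close> is the name that the point \<open>x\<close> of
  the facet \<open>D\<close> gets in the quotient.\<close>

definition glue_space :: "'a::euclidean_space set set \<Rightarrow> ('a set \<Rightarrow> 'a \<Rightarrow> 'p) \<Rightarrow> 'p topology" where
  "glue_space V i = topology (\<lambda>U. U \<subseteq> (\<Union>D\<in>V. i D ` D) \<and> (\<forall>D\<in>V. openin (top_of_set D) {x \<in> D. i D x \<in> U}))"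

definition glue_cells :: "'a::euclidean_space set set \<Rightarrow> 'a set set \<Rightarrow> ('a set \<Rightarrow> 'a \<Rightarrow> 'p) \<Rightarrow> 'p set set" where
  "glue_cells S V i = {i D ` F |D F. D \<in> V \<and> F \<in> S \<and> F \<subseteq> D \<and> F \<noteq> {}}"

lemma openin_glue_space:
  "openin (glue_space V i) U \<longleftrightarrow>
     U \<subseteq> (\<Union>D\<in>V. i D ` D) \<and> (\<forall>D\<in>V. openin (top_of_set D) {x \<in> D. i D x \<in> U})"
proof -
  let ?O = "\<lambda>U. U \<subseteq> (\<Union>D\<in>V. i D ` D) \<and> (\<forall>D\<in>V. openin (top_of_set D) {x \<in> D. i D x \<in> U})"
  have "istopology ?O"
    unfolding istopology_def
  proof (intro conjI allI impI ballI)
    fix U W assume U: "?O U" and W: "?O W"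
    show "U \<inter> W \<subseteq> (\<Union>D\<in>V. i D ` D)" using U by (rule_tac subset_trans[OF Int_lower1]) (erule conjunct1)
    fix D assume D: "D \<in> V"
    have "{x \<in> D. i D x \<in> U \<inter> W} = {x \<in> D. i D x \<in> U} \<inter> {x \<in> D. i D x \<in> W}" by blast
    then show "openin (top_of_set D) {x \<in> D. i D x \<in> U \<inter> W}"
      using openin_Int[OF conjunct2[OF U, rule_format, OF D] conjunct2[OF W, rule_format, OF D]] by simp
  next
    fix \<U> assume \<U>: "\<forall>U\<in>\<U>. ?O U"
    show "\<Union>\<U> \<subseteq> (\<Union>D\<in>V. i D ` D)" by (rule Union_least) (rule conjunct1[OF \<U>[rule_format]])
    fix D assume D: "D \<in> V"
    have "{x \<in> D. i D x \<in> \<Union>\<U>} = \<Union>((\<lambda>U. {x \<in> D. i D x \<in> U}) ` \<U>)" by blast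
    moreover have "openin (top_of_set D) (\<Union>((\<lambda>U. {x \<in> D. i D x \<in> U}) ` \<U>))"
      by (rule openin_Union) (use \<U> D in auto)
    ultimately show "openin (top_of_set D) {x \<in> D. i D x \<in> \<Union>\<U>}" by simp
  qed
  then show ?thesis unfolding glue_space_def by (simp only: topology_inverse')
qed

lemma topspace_glue_space: "topspace (glue_space V i) = (\<Union>D\<in>V. i D ` D)"
proof (rule antisym)
  show "topspace (glue_space V i) \<subseteq> (\<Union>D\<in>V. i D ` D)"
    using openin_topspace[of "glue_space V i"] unfolding openin_glue_space by (rule conjunct1)
  have "{x \<in> D. i D x \<in> (\<Union>D\<in>V. i D ` D)} = D" if "D \<in> V" for D using that by blast
  then have "openin (glue_space V i) (\<Union>D\<in>V. i D ` D)" unfolding openin_glue_space by simp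
  then show "(\<Union>D\<in>V. i D ` D) \<subseteq> topspace (glue_space V i)" by (rule openin_subset)
qed

lemma continuous_map_glue_inclusion:
  assumes "D \<in> V" shows "continuous_map (top_of_set D) (glue_space V i) (i D)"
  unfolding continuous_map topspace_glue_space using assms by (auto simp: openin_glue_space)

lemma continuous_map_from_glue_space:
  assumes "\<And>D. D \<in> V \<Longrightarrow> continuous_map (top_of_set D) Y (f \<circ> i D)"
  shows "continuous_map (glue_space V i) Y f"
  unfolding continuous_map
proof (intro conjI allI impI)
  show "f ` topspace (glue_space V i) \<subseteq> topspace Y"
    using assms unfolding topspace_glue_space continuous_map by fastforce
  fix U assume U: "openin Y U"
  show "openin (glue_space V i) {x \<in> topspace (glue_space V i). f x \<in> U}"
    unfolding openin_glue_space topspace_glue_space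
  proof (intro conjI ballI)
    fix D assume D: "D \<in> V"
    then have "{x \<in> D. i D x \<in> {x \<in> \<Union>D\<in>V. i D ` D. f x \<in> U}} = {x \<in> topspace (top_of_set D). (f \<circ> i D) x \<in> U}"
      by auto
    then show "openin (top_of_set D) {x \<in> D. i D x \<in> {x \<in> \<Union>D\<in>V. i D ` D. f x \<in> U}}"
      using openin_continuous_map_preimage[OF assms[OF D] U] by simp
  qed blast
qed

lemma compact_glue_space:
  assumes "finite V" "\<And>D. D \<in> V \<Longrightarrow> compact D" shows "compact_space (glue_space V i)"
proof -
  have "compactin (glue_space V i) (i D ` D)" if D: "D \<in> V" for D
    using image_compactin[OF _ continuous_map_glue_inclusion[OF D, of i], of D] assms(2)[OF D]
    by (simp add: compactin_subtopology)
  then have "compactin (glue_space V i) (\<Union>((\<lambda>D. i D ` D) ` V))"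
    using assms(1) by (intro compactin_Union) auto
  then show ?thesis by (simp add: compact_space_def topspace_glue_space)
qed

lemma same_topology_compact_Hausdorff:
  assumes "compact_space X" "Hausdorff_space Y" "continuous_map X Y (\<lambda>x. x)" "topspace X = topspace Y"
  shows "X = Y"
proof -
  have "homeomorphic_map X Y (\<lambda>x. x)"
    by (rule continuous_imp_homeomorphic_map) (use assms in auto)
  from homeomorphic_map_openness_eq[OF this] have "openin X U \<longleftrightarrow> openin Y U" for U
    using openin_subset[of Y U] assms(4) by auto
  then show ?thesis unfolding topology_eq by blast
qed

lemma is_cell_image:
  assumes c: "is_cell (top_of_set F) n F B" and g: "homeomorphic_map (top_of_set F) (subtopology X (g ` F)) g"
    and "g ` F \<subseteq> topspace X"
  shows "is_cell X n (g ` F) (g ` B)"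
proof -
  obtain f where f: "homeomorphic_map (disk n) (subtopology (top_of_set F) F) f"
      "B = f ` {x \<in> topspace (disk n). (\<Sum>i<n. x i ^ 2) = 1}"
    using c unfolding is_cell_def by (elim conjE exE)
  then have "homeomorphic_map (disk n) (subtopology X (g ` F)) (g \<circ> f)"
    using homeomorphic_map_compose[of "disk n" "top_of_set F" f "subtopology X (g ` F)" g] g
    by (simp add: subtopology_subtopology)
  then show ?thesis unfolding is_cell_def using assms(3) f(2) by (auto simp: image_comp)
qed

text \<open>\<open>i_inj\<close> says that points at different places of \<open>S\<close> are never
  identified, so the glued complex projects to \<open>S\<close>. \<open>i_faces\<close> says that
  facets identified at one relative interior point of a face are identified along the whole
  face.\<close>

locale facet_gluing = pm_complex S d for S :: "'a::euclidean_space set set" and d +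
  fixes V :: "'a set set" and i :: "'a set \<Rightarrow> 'a \<Rightarrow> 'p"
  assumes V: "V \<subseteq> facets d S" "V \<noteq> {}"
    and i_inj: "\<And>D D' x y. \<lbrakk>D \<in> V; D' \<in> V; x \<in> D; y \<in> D'; i D x = i D' y\<rbrakk> \<Longrightarrow> x = y"
    and i_faces: "\<And>D D' F x y. \<lbrakk>D \<in> V; D' \<in> V; F \<in> S; F \<subseteq> D; F \<subseteq> D'; y \<in> rel_interior F; i D y = i D' y; x \<in> F\<rbrakk>
        \<Longrightarrow> i D x = i D' x"
begin

abbreviation "X \<equiv> glue_space V i"
abbreviation "K \<equiv> glue_cells S V i"

lemma VS: "D \<in> V \<Longrightarrow> D \<in> S" and V_dim: "D \<in> V \<Longrightarrow> aff_dim D = int d"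
  using V(1) facetD by blast+

lemma finite_V: "finite V" using finite_subset[OF V(1) fin_facets] .

lemma cellI: "\<lbrakk>D \<in> V; F \<in> S; F \<subseteq> D; F \<noteq> {}\<rbrakk> \<Longrightarrow> i D ` F \<in> K"
  by (auto simp: glue_cells_def)

lemma cellE:
  assumes "c \<in> K" obtains D F where "D \<in> V" "F \<in> S" "F \<subseteq> D" "F \<noteq> {}" "c = i D ` F"
  using assms by (auto simp: glue_cells_def)

lemma finite_K: "finite K"
proof -
  have "K \<subseteq> (\<lambda>(D, F). i D ` F) ` (V \<times> S)" by (auto simp: glue_cells_def)
  then show ?thesis using finite_V fin by (meson finite_SigmaI finite_imageI finite_subset)
qed

definition proj :: "'p \<Rightarrow> 'a" where "proj z = (SOME x. \<exists>D\<in>V. x \<in> D \<and> z = i D x)"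

lemma proj [simp]: assumes "D \<in> V" "x \<in> D" shows "proj (i D x) = x"
proof -
  have "\<exists>D'\<in>V. proj (i D x) \<in> D' \<and> i D x = i D' (proj (i D x))"
    unfolding proj_def by (rule someI[of "\<lambda>y. \<exists>D'\<in>V. y \<in> D' \<and> i D x = i D' y" x]) (use assms in blast)
  then show ?thesis using i_inj[OF assms(1) _ assms(2)] by metis
qed

lemma proj_image: "\<lbrakk>D \<in> V; F \<subseteq> D\<rbrakk> \<Longrightarrow> proj ` i D ` F = F"
  using proj by (force simp: image_image subset_iff)

lemma inj_i: "D \<in> V \<Longrightarrow> inj_on (i D) D"
  using i_inj by (blast intro: inj_onI)

lemma proj_point: assumes "z \<in> topspace X" obtains D where "D \<in> V" "proj z \<in> D" "z = i D (proj z)"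
proof -
  obtain D x where "D \<in> V" "x \<in> D" "z = i D x" using assms unfolding topspace_glue_space by blast
  then show thesis using that[of D] by simp
qed

lemma continuous_proj: "continuous_map X euclidean proj"
proof (rule continuous_map_from_glue_space)
  fix D assume D: "D \<in> V"
  show "continuous_map (top_of_set D) euclidean (proj \<circ> i D)"
    by (rule continuous_map_eq[of _ _ "\<lambda>x. x"]) (use D in auto)
qed

lemma compact_X: "compact_space X"
  using finite_V compactS VS by (blast intro: compact_glue_space)

text \<open>Two points over the same \<open>x\<close> are separated by the open star of \<open>x\<close>, cut up into the sheets
  that come together at either point.\<close>

lemma Hausdorff_X: "Hausdorff_space X"
  unfolding Hausdorff_space_def
proof (intro allI impI, elim conjE)
  fix z w assume z: "z \<in> topspace X" and w: "w \<in> topspace X" and ne: "z \<noteq> w"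
  show "\<exists>U W. openin X U \<and> openin X W \<and> z \<in> U \<and> w \<in> W \<and> disjnt U W"
  proof (cases "proj z = proj w")
    case False
    then obtain O1 O2 where O: "open O1" "open O2" "proj z \<in> O1" "proj w \<in> O2" "O1 \<inter> O2 = {}"
      by (rule hausdorff[elim_format]) blast
    show ?thesis
    proof (intro exI conjI)
      show "openin X {u \<in> topspace X. proj u \<in> O1}" "openin X {u \<in> topspace X. proj u \<in> O2}"
        using openin_continuous_map_preimage[OF continuous_proj] O(1,2) by auto
      show "disjnt {u \<in> topspace X. proj u \<in> O1} {u \<in> topspace X. proj u \<in> O2}"
        using O(5) by (auto simp: disjnt_def)
    qed (use z w O in auto)
  next
    case True
    define x where "x = proj z"
    define star where "star = - \<Union>{F \<in> S. x \<notin> F}"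
    have open_star: "open star"
      unfolding star_def using closed_Union[of "{F \<in> S. x \<notin> F}"] by (intro open_Compl) auto
    define sheet where "sheet u = {u' \<in> topspace X. \<exists>D\<in>V. x \<in> D \<and> i D x = u \<and> proj u' \<in> D \<inter> star \<and> u' = i D (proj u')}" for u
    have sheetI: "i D y \<in> sheet u" if "D \<in> V" "x \<in> D" "i D x = u" "y \<in> D" "y \<in> star" for D y u
      using that unfolding sheet_def topspace_glue_space by auto
    have sheetD: "x \<in> D \<and> i D x = u \<and> y \<in> star" if "i D y \<in> sheet u" "D \<in> V" "y \<in> D" for D y u
    proof -
      obtain D' where D': "D' \<in> V" "x \<in> D'" "i D' x = u" "y \<in> D'" "y \<in> star" "i D y = i D' y"
        using \<open>i D y \<in> sheet u\<close> proj[OF \<open>D \<in> V\<close> \<open>y \<in> D\<close>] unfolding sheet_def by auto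
      have "y \<in> \<Union>S" using VS[OF that(2)] that(3) by blast
      \<comment> \<open>The carrier of \<open>y\<close> contains \<open>x\<close>, because
        \<open>y\<close> is in the star of \<open>x\<close>; agreement of two facets at
        \<open>y\<close> therefore spreads to \<open>x\<close>.\<close>
      then obtain F where F: "F \<in> S" "y \<in> rel_interior F" by (rule carrier_exists)
      have FD: "F \<subseteq> D" "F \<subseteq> D'" using rel_interior_meets[OF F(1) VS F(2)] that(2,3) D'(1,4) by blast+
      have "y \<in> F" using F(2) rel_interior_subset by blast
      then have "x \<in> F" using D'(5) F(1) unfolding star_def by blast
      then have "i D x = i D' x" by (rule i_faces[OF that(2) D'(1) F(1) FD F(2) D'(6)])
      then show ?thesis using \<open>x \<in> F\<close> FD D' by auto
    qed
    have open_sheet: "openin X (sheet u)" for u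
      unfolding openin_glue_space
    proof (intro conjI ballI)
      show "sheet u \<subseteq> (\<Union>D\<in>V. i D ` D)" unfolding sheet_def topspace_glue_space by blast
      fix D assume D: "D \<in> V"
      show "openin (top_of_set D) {y \<in> D. i D y \<in> sheet u}"
      proof (cases "x \<in> D \<and> i D x = u")
        case True
        then have "{y \<in> D. i D y \<in> sheet u} = D \<inter> star" using sheetI[OF D] sheetD[OF _ D] by blast
        then show ?thesis using open_star by (simp add: openin_open_Int)
      next
        case False
        then have none: "{y \<in> D. i D y \<in> sheet u} = {}" using sheetD[OF _ D] by blast
        show ?thesis unfolding none by (rule openin_empty)
      qed
    qed
    have xs: "x \<in> star" by (simp add: star_def)
    have "z \<in> sheet z"
    proof (rule proj_point[OF z])
      fix D assume D: "D \<in> V" "proj z \<in> D" "z = i D (proj z)"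
      have "i D x \<in> sheet z" by (rule sheetI) (use D xs in \<open>simp_all add: x_def\<close>)
      then show ?thesis using D(3) by (simp add: x_def)
    qed
    moreover have "w \<in> sheet w"
    proof (rule proj_point[OF w])
      fix D assume D: "D \<in> V" "proj w \<in> D" "w = i D (proj w)"
      have "i D x \<in> sheet w" by (rule sheetI) (use D xs True in \<open>simp_all add: x_def\<close>)
      then show ?thesis using D(3) True by (simp add: x_def)
    qed
    moreover have "disjnt (sheet z) (sheet w)"
      unfolding disjnt_iff
    proof (intro allI notI, elim conjE)
      fix u assume u: "u \<in> sheet z" "u \<in> sheet w"
      then obtain D where D: "D \<in> V" "proj u \<in> D" "u = i D (proj u)" unfolding sheet_def by blast
      have "i D (proj u) \<in> sheet z" "i D (proj u) \<in> sheet w" using u D(3) by simp_all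
      then have "i D x = z" "i D x = w" using sheetD[OF _ D(1,2)] by blast+
      then show False using ne by simp
    qed
    ultimately show ?thesis using open_sheet by blast
  qed
qed

lemma cell_homeomorphic:
  assumes "D \<in> V" "F \<in> S" "F \<subseteq> D"
  shows "homeomorphic_map (top_of_set F) (subtopology X (i D ` F)) (i D)"
proof -
  have sub: "i D ` F \<subseteq> topspace X" using assms unfolding topspace_glue_space by blast
  show ?thesis
  proof (rule continuous_imp_homeomorphic_map)
    show "compact_space (top_of_set F)" using compactS[OF assms(2)] by (simp add: compact_space_subtopology)
    show "Hausdorff_space (subtopology X (i D ` F))" by (rule Hausdorff_space_subtopology[OF Hausdorff_X])
    have "continuous_map (subtopology (top_of_set D) F) X (i D)"
      by (rule continuous_map_from_subtopology[OF continuous_map_glue_inclusion[OF assms(1)]])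
    then show "continuous_map (top_of_set F) (subtopology X (i D ` F)) (i D)"
      using assms(3) by (simp add: continuous_map_in_subtopology subtopology_subtopology inf.absorb2)
    show "i D ` topspace (top_of_set F) = topspace (subtopology X (i D ` F))" using sub by auto
    show "inj_on (i D) (topspace (top_of_set F))" using inj_on_subset[OF inj_i[OF assms(1)] assms(3)] by simp
  qed
qed

lemma cell:
  assumes "D \<in> V" "F \<in> S" "F \<subseteq> D" "aff_dim F = int n"
  shows "is_cell X n (i D ` F) (i D ` rel_frontier F)"
proof (rule is_cell_image[OF convex_is_cell cell_homeomorphic])
  show "i D ` F \<subseteq> topspace X" using assms(1,3) unfolding topspace_glue_space by blast
qed (use assms convexS compactS in auto)

lemma rel_interior_nonempty: "\<lbrakk>F \<in> S; F \<noteq> {}\<rbrakk> \<Longrightarrow> \<exists>x. x \<in> rel_interior F"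
  using rel_interior_eq_empty[OF convexS] by blast

text \<open>A common point lies at the same place of \<open>S\<close> for both cells by
  \<open>i_inj\<close>, which gives the inclusion of the faces; by \<open>i_faces\<close> the names
  then agree on all of \<open>F\<close>.\<close>

lemma meeting_cells:
  assumes "D \<in> V" "D' \<in> V" "F \<in> S" "F \<subseteq> D" "F' \<in> S" "F' \<subseteq> D'"
    and "x \<in> rel_interior F" "i D x \<in> i D' ` F'"
  shows "F \<subseteq> F' \<and> (\<forall>y\<in>F. i D y = i D' y)"
proof -
  obtain y where y: "i D x = i D' y" "y \<in> F'" using assms(8) by (rule imageE)
  have xF: "x \<in> F" using assms(7) rel_interior_subset by blast
  have "x = y" by (rule i_inj[OF assms(1,2) _ _ y(1)]) (use xF assms y(2) in blast)+
  then have FF': "F \<subseteq> F'" using rel_interior_meets[OF assms(3,5,7)] y(2) by blast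
  then show ?thesis using i_faces[OF assms(1,2,3,4) _ assms(7)] y(1) \<open>x = y\<close> assms(6) by blast
qed

lemma cell_subset_iff:
  assumes "D \<in> V" "D' \<in> V" "F \<in> S" "F \<subseteq> D" "F' \<in> S" "F' \<subseteq> D'" "F \<noteq> {}"
  shows "i D ` F \<subseteq> i D' ` F' \<longleftrightarrow> F \<subseteq> F' \<and> (\<forall>y\<in>F. i D y = i D' y)"
proof
  assume sub: "i D ` F \<subseteq> i D' ` F'"
  obtain x where x: "x \<in> rel_interior F" using rel_interior_nonempty[OF assms(3,7)] by blast
  then have "i D x \<in> i D' ` F'" using sub rel_interior_subset by blast
  then show "F \<subseteq> F' \<and> (\<forall>y\<in>F. i D y = i D' y)" by (rule meeting_cells[OF assms(1-6) x])
qed force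

lemma below:
  assumes "D \<in> V" "F \<in> S" "F \<subseteq> D" "c \<in> K" "c \<subseteq> i D ` F"
  obtains G where "G \<in> S" "G \<subseteq> F" "G \<noteq> {}" "c = i D ` G"
proof -
  obtain D' G where G: "D' \<in> V" "G \<in> S" "G \<subseteq> D'" "G \<noteq> {}" "c = i D' ` G" by (rule cellE[OF assms(4)])
  have "G \<subseteq> F" "\<forall>y\<in>G. i D' y = i D y"
    using cell_subset_iff[OF G(1) assms(1) G(2,3) assms(2,3) G(4)] assms(5) G(5) by blast+
  moreover have "c = i D ` G" using G(5) \<open>\<forall>y\<in>G. i D' y = i D y\<close> by (simp cong: image_cong)
  ultimately show thesis using that[of G] G by blast
qed

lemma n_cells_iff: "c \<in> n_cells (X, K) n \<longleftrightarrow> (\<exists>D\<in>V. \<exists>F\<in>S. F \<subseteq> D \<and> aff_dim F = int n \<and> c = i D ` F)"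
proof
  assume "c \<in> n_cells (X, K) n"
  then have c: "c \<in> K" "\<exists>B. is_cell X n c B" by (simp_all add: n_cells_def)
  obtain D F where F: "D \<in> V" "F \<in> S" "F \<subseteq> D" "F \<noteq> {}" "c = i D ` F" by (rule cellE[OF c(1)])
  have "aff_dim F = int (nat (aff_dim F))" using aff_dim_nonneg[OF F(4)] by simp
  moreover from c(2) obtain B where "is_cell X n c B" by (rule exE)
  ultimately have "nat (aff_dim F) = n" using cell[OF F(1-3)] cell_dim_unique F(5) by metis
  then show "\<exists>D\<in>V. \<exists>F\<in>S. F \<subseteq> D \<and> aff_dim F = int n \<and> c = i D ` F"
    using F aff_dim_nonneg[OF F(4)] by (intro bexI[of _ D] bexI[of _ F]) auto
next
  assume "\<exists>D\<in>V. \<exists>F\<in>S. F \<subseteq> D \<and> aff_dim F = int n \<and> c = i D ` F"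
  then obtain D F where F: "D \<in> V" "F \<in> S" "F \<subseteq> D" "aff_dim F = int n" "c = i D ` F" by (elim bexE conjE)
  then have "F \<noteq> {}" by auto
  then have "c \<in> K" using F cellI by simp
  then show "c \<in> n_cells (X, K) n" using cell[OF F(1-4)] F(5) unfolding n_cells_def by auto
qed

lemma facet_cells: "n_cells (X, K) d = (\<lambda>D. i D ` D) ` V"
proof (intro equalityI subsetI)
  fix c assume "c \<in> n_cells (X, K) d"
  then obtain D F where F: "D \<in> V" "F \<in> S" "F \<subseteq> D" "aff_dim F = int d" "c = i D ` F"
    unfolding n_cells_iff by (elim bexE conjE)
  have "F = D" by (rule dim_eq[OF F(2) VS F(3)]) (use F V_dim in auto)
  then show "c \<in> (\<lambda>D. i D ` D) ` V" using F by blast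
next
  fix c assume "c \<in> (\<lambda>D. i D ` D) ` V"
  then obtain D where "c = i D ` D" "D \<in> V" by (rule imageE)
  then show "c \<in> n_cells (X, K) d" unfolding n_cells_iff using VS V_dim by blast
qed

lemma facet_cell_inj: "\<lbrakk>D \<in> V; D' \<in> V; i D ` D = i D' ` D'\<rbrakk> \<Longrightarrow> D = D'"
  by (metis proj_image order_refl)

lemma facets_above_card:
  assumes "D \<in> V" "G \<in> S" "G \<subseteq> D" "G \<noteq> {}"
  shows "card {E \<in> n_cells (X, K) d. i D ` G \<subseteq> E} = card {D' \<in> V. G \<subseteq> D' \<and> (\<forall>y\<in>G. i D y = i D' y)}"
proof -
  have "i D ` G \<subseteq> i D' ` D' \<longleftrightarrow> G \<subseteq> D' \<and> (\<forall>y\<in>G. i D y = i D' y)" if "D' \<in> V" for D'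
    by (rule cell_subset_iff[OF assms(1) that assms(2,3) VS[OF that] order_refl assms(4)])
  then have "{E \<in> n_cells (X, K) d. i D ` G \<subseteq> E} = (\<lambda>D. i D ` D) ` {D' \<in> V. G \<subseteq> D' \<and> (\<forall>y\<in>G. i D y = i D' y)}"
    unfolding facet_cells by blast
  moreover have "inj_on (\<lambda>D. i D ` D) {D' \<in> V. G \<subseteq> D' \<and> (\<forall>y\<in>G. i D y = i D' y)}"
    by (rule inj_onI) (use facet_cell_inj in blast)
  ultimately show ?thesis by (simp add: card_image)
qed

lemma regular: "regular_CW_complex (X, K)"
proof -
  \<comment> \<open>A cell does not determine the facet it was named through, so its boundary is
    described by projecting to \<open>S\<close>.\<close>
  define bd where "bd c = {z \<in> c. proj z \<in> rel_frontier (proj ` c)}" for c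
  have bd: "bd (i D ` F) = i D ` rel_frontier F" "i D ` F - bd (i D ` F) = i D ` rel_interior F"
    if "D \<in> V" "F \<in> S" "F \<subseteq> D" for D F
  proof -
    have cl: "closed F" using compactS[OF that(2)] by (rule compact_imp_closed)
    have fr: "rel_frontier F = F - rel_interior F" using cl by (simp add: rel_frontier_def)
    have ri: "rel_interior F \<subseteq> F" by (rule rel_interior_subset)
    have px: "proj (i D x) = x" if "x \<in> F" for x using that \<open>D \<in> V\<close> \<open>F \<subseteq> D\<close> by auto
    have "bd (i D ` F) = {z \<in> i D ` F. proj z \<in> rel_frontier F}" unfolding bd_def proj_image[OF that(1,3)] ..
    then show 1: "bd (i D ` F) = i D ` rel_frontier F" using px fr by auto
    have "i D ` (F - rel_frontier F) = i D ` F - i D ` rel_frontier F"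
      using inj_on_subset[OF inj_i[OF that(1)] that(3)] fr by (intro inj_on_image_set_diff[of _ F]) auto
    moreover have "F - rel_frontier F = rel_interior F" using fr ri by blast
    ultimately show "i D ` F - bd (i D ` F) = i D ` rel_interior F" using 1 by simp
  qed
  show ?thesis
    unfolding regular_CW_complex_def prod.case
  proof (intro conjI exI[of _ bd] ballI impI)
    show "Hausdorff_space X" by (rule Hausdorff_X)
    show "finite K" by (rule finite_K)
  next
    fix c assume "c \<in> K"
    then obtain D F where F: "D \<in> V" "F \<in> S" "F \<subseteq> D" "F \<noteq> {}" "c = i D ` F" by (rule cellE)
    have "aff_dim F = int (nat (aff_dim F))" using aff_dim_nonneg[OF F(4)] by simp
    then show "\<exists>n. is_cell X n c (bd c)"
      using cell[OF F(1-3)] unfolding F(5) bd(1)[OF F(1-3)] by (rule_tac exI)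
    let ?L = "{i D ` G |G. G face_of F \<and> G \<noteq> F \<and> G \<noteq> {}}"
    have "?L \<subseteq> K"
    proof
      fix l assume "l \<in> ?L"
      then obtain G where G: "l = i D ` G" "G face_of F" "G \<noteq> {}" by blast
      then show "l \<in> K" using cellI[OF F(1) face_in[OF F(2) G(2)]] face_of_imp_subset[OF G(2)] F(3) by auto
    qed
    moreover have "rel_frontier F = \<Union>{G. G face_of F \<and> G \<noteq> F}"
      by (rule rel_frontier_of_polyhedron_alt[OF polytope_imp_polyhedron[OF polytopeS[OF F(2)]]])
    then have "bd c = \<Union>?L" unfolding F(5) bd(1)[OF F(1-3)] by auto
    ultimately show "\<exists>L\<subseteq>K. bd c = \<Union>L" by blast
  next
    show "(\<Union>c\<in>K. c - bd c) = topspace X"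
    proof (intro equalityI subsetI)
      fix z assume "z \<in> (\<Union>c\<in>K. c - bd c)"
      then obtain c where c: "c \<in> K" "z \<in> c" by blast
      obtain D F where F: "D \<in> V" "F \<in> S" "F \<subseteq> D" "F \<noteq> {}" "c = i D ` F" by (rule cellE[OF c(1)])
      then show "z \<in> topspace X" using c(2) unfolding topspace_glue_space by blast
    next
      fix z assume z: "z \<in> topspace X"
      obtain D where D: "D \<in> V" "proj z \<in> D" "z = i D (proj z)" by (rule proj_point[OF z])
      have "proj z \<in> \<Union>S" using VS[OF D(1)] D(2) by blast
      then obtain F where F: "F \<in> S" "proj z \<in> rel_interior F" by (rule carrier_exists)
      have FD: "F \<subseteq> D" by (rule rel_interior_meets[OF F(1) VS[OF D(1)] F(2) D(2)])
      have "F \<noteq> {}" using F(2) rel_interior_subset by blast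
      then have "i D ` F \<in> K" by (rule cellI[OF D(1) F(1) FD])
      moreover have "z \<in> i D ` F - bd (i D ` F)" unfolding bd(2)[OF D(1) F(1) FD] using D(3) F(2) by blast
      ultimately show "z \<in> (\<Union>c\<in>K. c - bd c)" by blast
    qed
  next
    fix c c' assume c: "c \<in> K" and c': "c' \<in> K" and ne: "c \<noteq> c'"
    obtain D F where F: "D \<in> V" "F \<in> S" "F \<subseteq> D" "F \<noteq> {}" "c = i D ` F" by (rule cellE[OF c])
    obtain D' F' where F': "D' \<in> V" "F' \<in> S" "F' \<subseteq> D'" "F' \<noteq> {}" "c' = i D' ` F'" by (rule cellE[OF c'])
    show "(c - bd c) \<inter> (c' - bd c') = {}"
    proof (rule equals0I)
      fix z assume "z \<in> (c - bd c) \<inter> (c' - bd c')"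
      then have z: "z \<in> i D ` rel_interior F" "z \<in> i D' ` rel_interior F'"
        using bd(2)[OF F(1-3)] bd(2)[OF F'(1-3)] F(5) F'(5) by auto
      obtain x where x: "z = i D x" "x \<in> rel_interior F" using z(1) by (rule imageE)
      obtain x' where x': "z = i D' x'" "x' \<in> rel_interior F'" using z(2) by (rule imageE)
      have "i D x \<in> i D' ` F'" using z(2) x(1) image_mono[OF rel_interior_subset[of F'], of "i D'"] by auto
      then have 1: "F \<subseteq> F' \<and> (\<forall>y\<in>F. i D y = i D' y)" by (rule meeting_cells[OF F(1) F'(1) F(2,3) F'(2,3) x(2)])
      have "i D' x' \<in> i D ` F" using z(1) x'(1) image_mono[OF rel_interior_subset[of F], of "i D"] by auto
      then have 2: "F' \<subseteq> F \<and> (\<forall>y\<in>F'. i D' y = i D y)" by (rule meeting_cells[OF F'(1) F(1) F'(2,3) F(2,3) x'(2)])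
      have "c = c'" unfolding F(5) F'(5) by (rule image_cong) (use 1 2 in auto)
      then show False using ne by simp
    qed
  qed
qed

lemma lower_interval_boolean:
  assumes "D \<in> V" "F \<in> S" "F \<subseteq> D"
  shows "boolean_poset {c \<in> insert {} K. c \<subseteq> i D ` F}"
proof -
  obtain n where "n simplex F" using simplexS[OF assms(2)] by blast
  then obtain C where C: "finite C" "bij_betw (\<lambda>A. convex hull A) (Pow C) {G. G face_of F}"
      "\<And>A B. \<lbrakk>A \<subseteq> C; B \<subseteq> C\<rbrakk> \<Longrightarrow> convex hull A \<subseteq> convex hull B \<longleftrightarrow> A \<subseteq> B"
    by (rule simplex_faces_boolean) (rule that)
  \<comment> \<open>\<open>boolean_poset\<close> asks for subsets of a set of numbers, so the
    vertices are enumerated.\<close>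
  obtain e where e: "bij_betw e {0..<card C} C" using ex_bij_betw_nat_finite[OF C(1)] by (rule exE)
  let ?A = "{0..<card C}"
  have inj: "inj_on e ?A" and im: "e ` ?A = C" using e by (simp_all add: bij_betw_def)
  have sub: "convex hull (e ` B) face_of F" if "B \<subseteq> ?A" for B
  proof -
    have "e ` B \<in> Pow C" using that im by blast
    then show ?thesis using bij_betwE[OF C(2)] by blast
  qed
  have ord: "i D ` G \<subseteq> i D ` G' \<longleftrightarrow> G \<subseteq> G'" if "G face_of F" "G' face_of F" for G G'
    using inj_on_subset[OF inj_i[OF assms(1)] assms(3)] face_of_imp_subset[OF that(1)] face_of_imp_subset[OF that(2)]
    by (rule inj_on_image_subset_iff)
  have hull_ord: "convex hull (e ` B) \<subseteq> convex hull (e ` B') \<longleftrightarrow> B \<subseteq> B'" if "B \<subseteq> ?A" "B' \<subseteq> ?A" for B B'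
    using C(3)[of "e ` B" "e ` B'"] that im inj_on_image_subset_iff[OF inj that] by blast
  let ?\<phi> = "\<lambda>B. i D ` (convex hull (e ` B))"
  have \<phi>_ord: "?\<phi> B \<subseteq> ?\<phi> B' \<longleftrightarrow> B \<subseteq> B'" if "B \<subseteq> ?A" "B' \<subseteq> ?A" for B B'
    using ord[OF sub[OF that(1)] sub[OF that(2)]] hull_ord[OF that] by simp
  have onto: "?\<phi> ` Pow ?A = {c \<in> insert {} K. c \<subseteq> i D ` F}"
  proof (intro equalityI subsetI)
    fix c assume "c \<in> ?\<phi> ` Pow ?A"
    then obtain B where B: "c = ?\<phi> B" "B \<in> Pow ?A" by (rule imageE)
    let ?G = "convex hull (e ` B)"
    have G: "?G face_of F" using sub B(2) by blast
    have GF: "?G \<subseteq> F" by (rule face_of_imp_subset[OF G])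
    show "c \<in> {c \<in> insert {} K. c \<subseteq> i D ` F}"
    proof (cases "?G = {}")
      case False
      have "i D ` ?G \<in> K" by (rule cellI[OF assms(1) face_in[OF assms(2) G] subset_trans[OF GF assms(3)] False])
      then show ?thesis using B(1) image_mono[OF GF, of "i D"] by simp
    next
      case True
      show ?thesis unfolding B(1) True by simp
    qed
  next
    fix c assume c: "c \<in> {c \<in> insert {} K. c \<subseteq> i D ` F}"
    have "\<exists>G. G face_of F \<and> c = i D ` G"
    proof (cases "c = {}")
      case True
      then show ?thesis by (intro exI[of _ "{}"]) simp
    next
      case False
      then have "c \<in> K" "c \<subseteq> i D ` F" using c by simp_all
      then obtain G where "G \<in> S" "G \<subseteq> F" "G \<noteq> {}" "c = i D ` G" by (rule below[OF assms])
      then show ?thesis using face_iff[of G F] assms(2) by auto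
    qed
    then obtain G where G: "G face_of F" "c = i D ` G" by (elim exE conjE)
    have "G \<in> (\<lambda>A. convex hull A) ` Pow C" using C(2) G(1) by (simp add: bij_betw_def)
    then obtain A where A: "G = convex hull A" "A \<in> Pow C" by (rule imageE)
    then have "A \<subseteq> e ` ?A" using im by simp
    then obtain B where B: "B \<subseteq> ?A" "A = e ` B" by (auto simp: subset_image_iff)
    show "c \<in> ?\<phi> ` Pow ?A" by (rule image_eqI[of _ _ B]) (use B A G in simp_all)
  qed
  have "inj_on ?\<phi> (Pow ?A)"
  proof (rule inj_onI)
    fix B B' assume B: "B \<in> Pow ?A" "B' \<in> Pow ?A" "?\<phi> B = ?\<phi> B'"
    then have "B \<subseteq> B'" "B' \<subseteq> B" using \<phi>_ord[of B B'] \<phi>_ord[of B' B] by auto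
    then show "B = B'" by (rule antisym)
  qed
  then have "bij_betw ?\<phi> (Pow ?A) {c \<in> insert {} K. c \<subseteq> i D ` F}" using onto by (simp add: bij_betw_def)
  moreover have "\<forall>B\<in>Pow ?A. \<forall>B'\<in>Pow ?A. ?\<phi> B \<subseteq> ?\<phi> B' \<longleftrightarrow> B \<subseteq> B'"
    using \<phi>_ord by (intro ballI) (simp only: Pow_iff)
  ultimately show ?thesis
    unfolding boolean_poset_def by (intro exI[of _ ?A] exI[of _ ?\<phi>] conjI) simp_all
qed

lemma pseudomanifold: "pseudomanifold d (X, K)"
  unfolding pseudomanifold_def simplicial_CW_complex_def prod.case
proof (intro conjI ballI regular)
  show "boolean_poset {c \<in> insert {} K. c \<subseteq> F}" if "F \<in> K" for F
  proof (rule cellE[OF that])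
    fix D G assume "D \<in> V" "G \<in> S" "G \<subseteq> D" "F = i D ` G"
    then show ?thesis using lower_interval_boolean by simp
  qed
  obtain D where D: "D \<in> V" using V(2) by blast
  then have "D \<noteq> {}" using V_dim[of D] by auto
  then show "K \<noteq> {}" using cellI[OF D VS[OF D] order_refl] by blast
  show "\<exists>D\<in>n_cells (X, K) d. c \<subseteq> D" if "c \<in> K" for c
  proof (rule cellE[OF that])
    fix D F assume "D \<in> V" "F \<subseteq> D" "c = i D ` F"
    then show ?thesis unfolding facet_cells by blast
  qed
  show "card {D \<in> n_cells (X, K) d. \<sigma> \<subseteq> D} \<le> 2" if "\<sigma> \<in> n_cells (X, K) (d - 1)" for \<sigma>
  proof -
    obtain D G where G: "D \<in> V" "G \<in> S" "G \<subseteq> D" "aff_dim G = int (d - 1)" "\<sigma> = i D ` G"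
      using \<open>\<sigma> \<in> n_cells (X, K) (d - 1)\<close> unfolding n_cells_iff by (elim bexE conjE)
    then have Gr: "G \<in> ridges" "G \<noteq> {}" using d2 by (auto simp: faces_of_dim_def of_nat_diff)
    have "card {D' \<in> V. G \<subseteq> D' \<and> (\<forall>y\<in>G. i D y = i D' y)} \<le> card {D \<in> facets d S. G \<subseteq> D}"
      using V(1) fin_facets by (intro card_mono) auto
    then show ?thesis unfolding G(5) facets_above_card[OF G(1-3) Gr(2)] two[OF Gr(1)] .
  qed
qed

lemma boundary_ridge:
  assumes "G \<in> ridges" "D \<in> V" "G \<subseteq> D" "\<And>D'. \<lbrakk>D' \<in> V; G \<subseteq> D'; D' \<noteq> D\<rbrakk> \<Longrightarrow> \<exists>y\<in>G. i D y \<noteq> i D' y"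
  shows "i D ` G \<in> n_cells (X, K) (d - 1) \<inter> pm_boundary d (X, K)"
proof -
  have G: "G \<in> S" "aff_dim G = int (d - 1)" using assms(1) d2 by (simp_all add: faces_of_dim_def of_nat_diff)
  then have "G \<noteq> {}" by auto
  have n: "i D ` G \<in> n_cells (X, K) (d - 1)" unfolding n_cells_iff using G assms(2,3) by blast
  have "{D' \<in> V. G \<subseteq> D' \<and> (\<forall>y\<in>G. i D y = i D' y)} = {D}"
  proof (intro equalityI subsetI)
    fix D' assume "D' \<in> {D' \<in> V. G \<subseteq> D' \<and> (\<forall>y\<in>G. i D y = i D' y)}"
    then show "D' \<in> {D}" using assms(4)[of D'] by (cases "D' = D") auto
  qed (use assms in simp)
  then have "card {E \<in> n_cells (X, K) d. i D ` G \<subseteq> E} = 1"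
    unfolding facets_above_card[OF assms(2) G(1) assms(3) \<open>G \<noteq> {}\<close>] by simp
  moreover have "i D ` G \<in> K" using n by (simp add: n_cells_def)
  ultimately show ?thesis using n unfolding pm_boundary_def by auto
qed

end

section \<open>From collapses to local constructions\<close>

abbreviation glue_complex ::
    "'a::euclidean_space set set \<Rightarrow> 'a set set \<Rightarrow> ('a set \<Rightarrow> 'a \<Rightarrow> 'p) \<Rightarrow> 'p cell_complex" where
  "glue_complex S V i \<equiv> (glue_space V i, glue_cells S V i)"

context pm_complex
begin

lemma single_facet_simplex:
  assumes "facet_gluing S d {D} i" shows "is_single_simplex d (glue_complex S {D} i)"
proof -
  interpret G: facet_gluing S d "{D}" i by (rule assms)
  have "c \<subseteq> i D ` D" if "c \<in> G.K" for c using that by (auto simp: glue_cells_def)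
  moreover have "i D ` D \<in> n_cells (G.X, G.K) d" unfolding G.facet_cells by simp
  moreover have "simplicial_CW_complex (G.X, G.K)"
    using G.pseudomanifold by (simp add: pseudomanifold_def)
  ultimately show ?thesis unfolding is_single_simplex_def by auto
qed

lemma glue_complex_glue:
  assumes gX: "facet_gluing S d V i" and gY: "facet_gluing S d (insert D V) i"
    and D: "D \<notin> V" and G: "G \<in> ridges" "G \<subseteq> D" and D0: "D0 \<in> V" "G \<subseteq> D0"
    and agree: "\<And>x. x \<in> G \<Longrightarrow> i D x = i D0 x"
    and meet: "\<And>D' x. \<lbrakk>D' \<in> V; x \<in> D; x \<in> D'; i D x = i D' x\<rbrakk> \<Longrightarrow> x \<in> G"
  shows "glue_simplex d (glue_complex S V i) (glue_complex S (insert D V) i)"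
proof -
  interpret X: facet_gluing S d V i by (rule gX)
  interpret Y: facet_gluing S d "insert D V" i by (rule gY)
  have DV: "D \<in> facets d S" "D0 \<in> facets d S" "D \<noteq> D0" using Y.V(1) D D0 by auto
  have sub: "topspace X.X \<subseteq> topspace Y.X" unfolding topspace_glue_space by blast
  \<comment> \<open>The glued topology is compact and at least as fine as the subspace topology,
    which is Hausdorff; so the two are equal.\<close>
  have "X.X = subtopology Y.X (topspace X.X)"
  proof (rule same_topology_compact_Hausdorff[OF X.compact_X Hausdorff_space_subtopology[OF Y.Hausdorff_X]])
    have "continuous_map X.X Y.X (\<lambda>x. x)"
      by (rule continuous_map_from_glue_space) (simp add: comp_def continuous_map_glue_inclusion)
    then show "continuous_map X.X (subtopology Y.X (topspace X.X)) (\<lambda>x. x)"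
      by (simp add: continuous_map_in_subtopology)
    show "topspace X.X = topspace (subtopology Y.X (topspace X.X))" using sub by auto
  qed
  moreover have KL: "X.K \<subseteq> Y.K" by (auto simp: glue_cells_def)
  moreover have "i D0 ` G \<in> n_cells (X.X, X.K) (d - 1) \<inter> pm_boundary d (X.X, X.K)"
  proof (rule X.boundary_ridge[OF G(1) D0])
    fix D' assume D': "D' \<in> V" "G \<subseteq> D'" "D' \<noteq> D0"
    have "D' = D \<or> D' = D0"
      by (rule two_facets_of_ridge[OF G(1) DV(1,2) _ G(2) D0(2) D'(2) DV(3)]) (use D'(1) X.V(1) in blast)
    then show "\<exists>y\<in>G. i D0 y \<noteq> i D' y" using D' D by auto
  qed
  moreover have "i D ` D \<in> n_cells (Y.X, Y.K) d" unfolding Y.facet_cells by simp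
  moreover have "i D ` D \<notin> X.K"
  proof
    assume "i D ` D \<in> X.K"
    then obtain D1 F where F: "D1 \<in> V" "F \<subseteq> D1" "i D ` D = i D1 ` F" by (rule X.cellE)
    have "Y.proj ` i D ` D = D" by (rule Y.proj_image) simp_all
    moreover have "Y.proj ` i D1 ` F = F" by (rule Y.proj_image) (use F in simp_all)
    ultimately have "D = F" using F(3) by simp
    then have "D1 = D" using facet_max[OF DV(1) X.VS[OF F(1)]] F(2) by simp
    then show False using F(1) D by simp
  qed
  moreover have "Y.K = X.K \<union> {c \<in> Y.K. c \<subseteq> i D ` D}"
  proof (intro equalityI subsetI)
    fix c assume c: "c \<in> Y.K"
    then obtain D1 F where F: "D1 \<in> insert D V" "F \<in> S" "F \<subseteq> D1" "F \<noteq> {}" "c = i D1 ` F" by (rule Y.cellE)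
    show "c \<in> X.K \<union> {c \<in> Y.K. c \<subseteq> i D ` D}"
    proof (cases "D1 = D")
      case True
      then show ?thesis using c F by blast
    next
      case False
      then show ?thesis using X.cellI[OF _ F(2,3,4)] F(1,5) by simp
    qed
  qed (use KL in blast)
  moreover have "i D ` D \<inter> topspace X.X = i D0 ` G"
  proof (intro equalityI subsetI)
    fix z assume "z \<in> i D ` D \<inter> topspace X.X"
    then obtain x D' y where z: "z = i D x" "x \<in> D" "D' \<in> V" "y \<in> D'" "z = i D' y"
      unfolding topspace_glue_space by blast
    have "x = y" by (rule Y.i_inj[of D D']) (use z in auto)
    then have "x \<in> G" using meet[OF z(3,2)] z by simp
    then show "z \<in> i D0 ` G" using agree z(1) by blast
  next
    fix z assume "z \<in> i D0 ` G"
    then obtain x where x: "z = i D0 x" "x \<in> G" by (rule imageE)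
    then have "z = i D x" using agree by simp
    then show "z \<in> i D ` D \<inter> topspace X.X" using x D0 G(2) unfolding topspace_glue_space by blast
  qed
  ultimately show ?thesis unfolding glue_simplex_def prod.case using sub
    by (intro conjI bexI[of _ "i D0 ` G"] bexI[of _ "i D ` D"])
qed

text \<open>\<open>j\<close> arises from \<open>i\<close> by merging the copies of
  \<open>\<rho>\<close> in \<open>A\<close> and \<open>B\<close>. The homeomorphism moves a point of
  one copy to the point of the other copy over the same place of \<open>S\<close>; a point common to
  both copies is therefore fixed.\<close>

lemma glue_complex_identify:
  assumes gX: "facet_gluing S d V i" and gY: "facet_gluing S d V j"
    and \<rho>: "\<rho> \<in> ridges" and A: "A \<in> V" "\<rho> \<subseteq> A" and B: "B \<in> V" "\<rho> \<subseteq> B"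
    and F: "F \<in> faces_of_dim S (int d - 2)" "F \<subseteq> \<rho>"
    and j: "\<And>D D' x. \<lbrakk>D \<in> V; D' \<in> V; x \<in> D; x \<in> D'\<rbrakk> \<Longrightarrow>
        j D x = j D' x \<longleftrightarrow> i D x = i D' x \<or> (x \<in> \<rho> \<and> i D x = i A x \<and> i D' x = i B x) \<or>
          (x \<in> \<rho> \<and> i D x = i B x \<and> i D' x = i A x)"
    and apart: "\<exists>x\<in>\<rho>. i A x \<noteq> i B x" and agree: "\<And>x. x \<in> F \<Longrightarrow> i A x = i B x"
  shows "identify_facets d (glue_complex S V i) (glue_complex S V j)"
proof -
  interpret X: facet_gluing S d V i by (rule gX)
  interpret Y: facet_gluing S d V j by (rule gY)
  have \<rho>S: "\<rho> \<in> S" by (rule ridgeD(1)[OF \<rho>])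
  have FS: "F \<in> S" "aff_dim F = int (d - 2)" using F(1) d2 by (simp_all add: faces_of_dim_def of_nat_diff)
  have AB: "A \<in> facets d S" "B \<in> facets d S" "A \<noteq> B" using A B X.V(1) apart by auto
  have bA: "i A ` \<rho> \<in> n_cells (X.X, X.K) (d - 1) \<inter> pm_boundary d (X.X, X.K)"
  proof (rule X.boundary_ridge[OF \<rho> A])
    fix D' assume D': "D' \<in> V" "\<rho> \<subseteq> D'" "D' \<noteq> A"
    have "D' = A \<or> D' = B"
      by (rule two_facets_of_ridge[OF \<rho> AB(1,2) _ A(2) B(2) D'(2) AB(3)]) (use D'(1) X.V(1) in blast)
    then show "\<exists>y\<in>\<rho>. i A y \<noteq> i D' y" using D' apart by auto
  qed
  have bB: "i B ` \<rho> \<in> n_cells (X.X, X.K) (d - 1) \<inter> pm_boundary d (X.X, X.K)"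
  proof (rule X.boundary_ridge[OF \<rho> B])
    fix D' assume D': "D' \<in> V" "\<rho> \<subseteq> D'" "D' \<noteq> B"
    have "D' = A \<or> D' = B"
      by (rule two_facets_of_ridge[OF \<rho> AB(1,2) _ A(2) B(2) D'(2) AB(3)]) (use D'(1) X.V(1) in blast)
    then show "\<exists>y\<in>\<rho>. i B y \<noteq> i D' y" using D' apart by (auto simp: eq_commute)
  qed
  have same: "i A x = i B x" if "x \<in> \<rho>" "y \<in> \<rho>" "i A x = i B y" for x y
    using X.i_inj[OF A(1) B(1) _ _ that(3)] that A(2) B(2) by blast
  have ne: "i A ` \<rho> \<noteq> i B ` \<rho>"
  proof
    assume eq: "i A ` \<rho> = i B ` \<rho>"
    obtain x where x: "x \<in> \<rho>" "i A x \<noteq> i B x" using apart by blast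
    then have "i A x \<in> i B ` \<rho>" using eq by blast
    then obtain y where "i A x = i B y" "y \<in> \<rho>" by (rule imageE)
    then show False using same x by blast
  qed
  have nF: "i A ` F \<in> n_cells (X.X, X.K) (d - 2)"
    unfolding X.n_cells_iff using A FS F(2) by blast
  have "i A ` F = i B ` F" by (rule image_cong) (use agree in auto)
  then have Fsub: "i A ` F \<subseteq> i A ` \<rho> \<inter> i B ` \<rho>" using F(2) by blast
  define h where "h z = i B (X.proj z)" for z
  have pA: "X.proj (i A x) = x" "h (i A x) = i B x" if "x \<in> \<rho>" for x using that A by (auto simp: h_def)
  have hom: "homeomorphic_map (subtopology X.X (i A ` \<rho>)) (subtopology X.X (i B ` \<rho>)) h"
  proof -
    obtain g where g: "homeomorphic_maps (top_of_set \<rho>) (subtopology X.X (i A ` \<rho>)) (i A) g"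
      using X.cell_homeomorphic[OF A(1) \<rho>S A(2)] unfolding homeomorphic_map_maps by (rule exE)
    have gm: "homeomorphic_map (subtopology X.X (i A ` \<rho>)) (top_of_set \<rho>) g" and gA: "\<And>x. x \<in> \<rho> \<Longrightarrow> g (i A x) = x"
      using g unfolding homeomorphic_maps_map by simp_all
    have "homeomorphic_map (subtopology X.X (i A ` \<rho>)) (subtopology X.X (i B ` \<rho>)) (i B \<circ> g)"
      by (rule homeomorphic_map_compose[OF gm X.cell_homeomorphic[OF B(1) \<rho>S B(2)]])
    then show ?thesis
      by (rule homeomorphic_map_eq) (use gA pA in auto)
  qed
  have h_cell: "h ` i A ` G = i B ` G" if "G \<subseteq> \<rho>" for G
    unfolding image_image by (rule image_cong) (use pA that in auto)
  have cells_below: "{c \<in> X.K. c \<subseteq> i D ` \<rho>} = {i D ` G |G. G \<in> S \<and> G \<subseteq> \<rho> \<and> G \<noteq> {}}" if "D \<in> V" "\<rho> \<subseteq> D" for D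
  proof (intro equalityI subsetI)
    fix c assume "c \<in> {c \<in> X.K. c \<subseteq> i D ` \<rho>}"
    then have "c \<in> X.K" "c \<subseteq> i D ` \<rho>" by simp_all
    then obtain G where "G \<in> S" "G \<subseteq> \<rho>" "G \<noteq> {}" "c = i D ` G" by (rule X.below[OF \<open>D \<in> V\<close> \<rho>S \<open>\<rho> \<subseteq> D\<close>])
    then show "c \<in> {i D ` G |G. G \<in> S \<and> G \<subseteq> \<rho> \<and> G \<noteq> {}}" by blast
  next
    fix c assume "c \<in> {i D ` G |G. G \<in> S \<and> G \<subseteq> \<rho> \<and> G \<noteq> {}}"
    then obtain G where G: "c = i D ` G" "G \<in> S" "G \<subseteq> \<rho>" "G \<noteq> {}" by blast
    have "i D ` G \<in> X.K" by (rule X.cellI[OF that(1) G(2) subset_trans[OF G(3) that(2)] G(4)])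
    then show "c \<in> {c \<in> X.K. c \<subseteq> i D ` \<rho>}" using G(1) image_mono[OF G(3), of "i D"] by simp
  qed
  have faces: "(\<lambda>c. h ` c) ` {c \<in> X.K. c \<subseteq> i A ` \<rho>} = {c \<in> X.K. c \<subseteq> i B ` \<rho>}"
  proof -
    have "(\<lambda>c. h ` c) ` {i A ` G |G. G \<in> S \<and> G \<subseteq> \<rho> \<and> G \<noteq> {}} = (\<lambda>G. h ` i A ` G) ` {G \<in> S. G \<subseteq> \<rho> \<and> G \<noteq> {}}"
      by blast
    also have "\<dots> = (\<lambda>G. i B ` G) ` {G \<in> S. G \<subseteq> \<rho> \<and> G \<noteq> {}}" by (rule image_cong) (use h_cell in auto)
    also have "\<dots> = {i B ` G |G. G \<in> S \<and> G \<subseteq> \<rho> \<and> G \<noteq> {}}" by blast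
    finally show ?thesis unfolding cells_below[OF A] cells_below[OF B] .
  qed
  have fix_h: "h z = z" if "z \<in> i A ` \<rho> \<inter> i B ` \<rho>" for z
  proof -
    have z: "z \<in> i A ` \<rho>" "z \<in> i B ` \<rho>" using that by simp_all
    obtain x where x: "z = i A x" "x \<in> \<rho>" using z(1) by (rule imageE)
    obtain y where "z = i B y" "y \<in> \<rho>" using z(2) by (rule imageE)
    then show ?thesis using same[OF x(2)] x pA(2)[OF x(2)] by simp
  qed
  \<comment> \<open>Any facet that carries the point may be chosen, since \<open>j\<close>
    identifies whatever \<open>i\<close> identifies.\<close>
  define q where "q z = j (SOME D. D \<in> V \<and> X.proj z \<in> D \<and> z = i D (X.proj z)) (X.proj z)" for z
  have q: "q (i D x) = j D x" if "D \<in> V" "x \<in> D" for D x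
  proof -
    let ?P = "\<lambda>D'. D' \<in> V \<and> x \<in> D' \<and> i D x = i D' x"
    have "?P (Eps ?P)" by (rule someI[of ?P D]) (use that in simp)
    then have "j D x = j (Eps ?P) x" using j[OF that(1) _ that(2)] by blast
    then show ?thesis unfolding q_def X.proj[OF that] by simp
  qed
  have qc: "continuous_map X.X Y.X q"
  proof (rule continuous_map_from_glue_space)
    fix D assume D: "D \<in> V"
    show "continuous_map (top_of_set D) Y.X (q \<circ> i D)"
      by (rule continuous_map_eq[OF continuous_map_glue_inclusion[OF D, of j]]) (use q[OF D] in auto)
  qed
  have "q ` topspace X.X = topspace Y.X" unfolding topspace_glue_space image_UN
  proof (rule SUP_cong[OF refl])
    fix D assume "D \<in> V"
    then show "q ` i D ` D = j D ` D" unfolding image_image by (intro image_cong) (use q in auto)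
  qed
  then have quot: "quotient_map X.X Y.X q"
    by (intro continuous_closed_imp_quotient_map qc continuous_imp_closed_map_gen X.compact_X
        Hausdorff_imp_kc_space Y.Hausdorff_X)
  have q_eq: "q z = q w \<longleftrightarrow> z = w \<or> (z \<in> i A ` \<rho> \<and> w = h z) \<or> (w \<in> i A ` \<rho> \<and> z = h w)"
    if z: "z \<in> topspace X.X" and w: "w \<in> topspace X.X" for z w
  proof -
    obtain D a where D: "D \<in> V" "a \<in> D" "z = i D a" using z unfolding topspace_glue_space by blast
    obtain D' b where D': "D' \<in> V" "b \<in> D'" "w = i D' b" using w unfolding topspace_glue_space by blast
    have qzw: "q z = j D a" "q w = j D' b" using q D D' by simp_all
    have inA: "x \<in> \<rho> \<and> i E x = i A x" if "i E x \<in> i A ` \<rho>" "E \<in> V" "x \<in> E" for E x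
    proof -
      obtain y where y: "i E x = i A y" "y \<in> \<rho>" using \<open>i E x \<in> i A ` \<rho>\<close> by (rule imageE)
      have "x = y" by (rule X.i_inj[OF \<open>E \<in> V\<close> A(1) \<open>x \<in> E\<close> _ y(1)]) (use y A in blast)
      then show ?thesis using y by simp
    qed
    have pE: "h (i E x) = i B x" if "E \<in> V" "x \<in> E" for E x using that by (simp add: h_def)
    show ?thesis
    \<comment> \<open>Over one place of \<open>S\<close> the claim is the assumption on
      \<open>j\<close>; over different places neither side can hold.\<close>
    proof (cases "a = b")
      case True
      have "z \<in> i A ` \<rho> \<longleftrightarrow> a \<in> \<rho> \<and> i D a = i A a" using inA[OF _ D(1,2)] D(3) by auto
      moreover have "w \<in> i A ` \<rho> \<longleftrightarrow> a \<in> \<rho> \<and> i D' a = i A a" using inA[OF _ D'(1,2)] D'(3) True by auto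
      moreover have "h z = i B a" "h w = i B a" using pE[OF D(1,2)] pE[OF D'(1,2)] D(3) D'(3) True by simp_all
      ultimately show ?thesis unfolding qzw using j[OF D(1) D'(1) D(2)] D(3) D'(2,3) True by metis
    next
      case False
      have "q z \<noteq> q w" unfolding qzw using Y.i_inj[OF D(1) D'(1) D(2) D'(2)] False by blast
      moreover have "z \<noteq> w" using X.i_inj[OF D(1) D'(1) D(2) D'(2)] False D(3) D'(3) by blast
      moreover have "w \<noteq> h z" if "z \<in> i A ` \<rho>"
      proof
        assume "w = h z"
        then have "i D' b = i B a" using pE[OF D(1,2)] D(3) D'(3) by simp
        moreover have "a \<in> B" using inA[OF _ D(1,2)] that D(3) B(2) by auto
        ultimately show False using X.i_inj[OF D'(1) B(1) D'(2)] False by blast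
      qed
      moreover have "z \<noteq> h w" if "w \<in> i A ` \<rho>"
      proof
        assume "z = h w"
        then have "i D a = i B b" using pE[OF D'(1,2)] D(3) D'(3) by simp
        moreover have "b \<in> B" using inA[OF _ D'(1,2)] that D'(3) B(2) by auto
        ultimately show False using X.i_inj[OF D(1) B(1) D(2)] False by blast
      qed
      ultimately show ?thesis by blast
    qed
  qed
  have "Y.K = (\<lambda>c. q ` c) ` X.K"
  proof -
    have img: "q ` i D ` G = j D ` G" if "D \<in> V" "G \<subseteq> D" for D G
      unfolding image_image by (rule image_cong) (use q that in auto)
    show ?thesis
    proof (intro equalityI subsetI)
      fix c assume "c \<in> Y.K"
      then obtain D G where G: "D \<in> V" "G \<in> S" "G \<subseteq> D" "G \<noteq> {}" "c = j D ` G" by (rule Y.cellE)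
      then show "c \<in> (\<lambda>c. q ` c) ` X.K" using img[OF G(1,3)] X.cellI[OF G(1-4)] by (intro image_eqI[of _ _ "i D ` G"]) simp_all
    next
      fix c assume "c \<in> (\<lambda>c. q ` c) ` X.K"
      then obtain e where e: "c = q ` e" "e \<in> X.K" by (rule imageE)
      obtain D G where G: "D \<in> V" "G \<in> S" "G \<subseteq> D" "G \<noteq> {}" "e = i D ` G" by (rule X.cellE[OF e(2)])
      then show "c \<in> Y.K" using img[OF G(1,3)] Y.cellI[OF G(1-4)] e(1) by simp
    qed
  qed
  then show ?thesis
    unfolding identify_facets_def prod.case
    by (intro bexI[OF _ bA] bexI[OF _ bB] bexI[OF _ nF] exI[of _ h] exI[of _ q] conjI ne Fsub hom faces quot ballI fix_h q_eq)
qed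

lemma glue_complex_all:
  assumes g: "facet_gluing S d (facets d S) i" and i: "\<And>D x. \<lbrakk>D \<in> facets d S; x \<in> D\<rbrakk> \<Longrightarrow> i D x = x"
  shows "glue_complex S (facets d S) i = (top_of_set (\<Union>S), S - {{}})"
proof -
  interpret G: facet_gluing S d "facets d S" i by (rule g)
  have im: "i D ` F = F" if "D \<in> facets d S" "F \<subseteq> D" for D F
    using i[OF that(1)] that(2) by (force simp: image_def)
  have U: "(\<Union>D\<in>facets d S. D) = \<Union>S" using pure facetD(1) by blast
  have "glue_space (facets d S) i = top_of_set (\<Union>S)"
  proof (rule same_topology_compact_Hausdorff[OF G.compact_X])
    show "continuous_map G.X (top_of_set (\<Union>S)) (\<lambda>x. x)"
    proof (rule continuous_map_from_glue_space)
      fix D assume D: "D \<in> facets d S"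
      then have "D \<subseteq> \<Union>S" using facetD(1) by blast
      then have "continuous_map (top_of_set D) (top_of_set (\<Union>S)) (\<lambda>x. x)" by (auto simp: continuous_map_in_subtopology)
      then show "continuous_map (top_of_set D) (top_of_set (\<Union>S)) ((\<lambda>x. x) \<circ> i D)"
        by (rule continuous_map_eq) (use i[OF D] in auto)
    qed
    show "topspace G.X = topspace (top_of_set (\<Union>S))" unfolding topspace_glue_space using im U by simp
  qed (simp add: Hausdorff_space_subtopology)
  moreover have "G.K = S - {{}}"
  proof (intro equalityI subsetI)
    fix c assume "c \<in> G.K"
    then obtain D F where "D \<in> facets d S" "F \<in> S" "F \<subseteq> D" "F \<noteq> {}" "c = i D ` F" by (rule G.cellE)
    then show "c \<in> S - {{}}" using im by simp
  next
    fix c assume c: "c \<in> S - {{}}"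
    then obtain D where "D \<in> facets d S" "c \<subseteq> D" using pure by blast
    then show "c \<in> G.K" using im[of D c] G.cellI[of D c] c by simp
  qed
  ultimately show ?thesis by simp
qed

text \<open>The graph of the facets at \<open>x\<close> that are glued along a ridge of
  \<open>E\<close> through \<open>x\<close>; its components are the points over \<open>x\<close> in
  the complex glued along \<open>E\<close>.\<close>

definition link :: "'a set set \<Rightarrow> 'a \<Rightarrow> ('a set \<times> 'a set) set" where
  "link E x = {(A, B). A \<in> facets d S \<and> B \<in> facets d S \<and> (\<exists>G\<in>E. x \<in> G \<and> G \<subseteq> A \<and> G \<subseteq> B)}"

lemma linkI: "\<lbrakk>A \<in> facets d S; B \<in> facets d S; G \<in> E; x \<in> G; G \<subseteq> A; G \<subseteq> B\<rbrakk> \<Longrightarrow> (A, B) \<in> link E x"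
  by (auto simp: link_def)

lemma linkE:
  assumes "(A, B) \<in> link E x"
  obtains G where "A \<in> facets d S" "B \<in> facets d S" "G \<in> E" "x \<in> G" "G \<subseteq> A" "G \<subseteq> B"
  using assms by (auto simp: link_def)

lemma link_sym: "(A, B) \<in> (link E x)\<^sup>* \<Longrightarrow> (B, A) \<in> (link E x)\<^sup>*"
  by (rule symD[OF sym_rtrancl]) (auto simp: sym_def link_def)

lemma link_trans: "\<lbrakk>(A, B) \<in> (link E x)\<^sup>*; (B, C) \<in> (link E x)\<^sup>*\<rbrakk> \<Longrightarrow> (A, C) \<in> (link E x)\<^sup>*"
  by (rule rtrancl_trans)

definition sheet_class :: "'a set set \<Rightarrow> 'a \<Rightarrow> 'a set \<Rightarrow> 'a set set" where
  "sheet_class E x D = (link E x)\<^sup>* `` {D}"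

lemma sheet_class_iff: "D' \<in> sheet_class E x D \<longleftrightarrow> (D, D') \<in> (link E x)\<^sup>*"
  by (simp add: sheet_class_def)

lemma sheet_class_eq_iff: "sheet_class E x D = sheet_class E x D' \<longleftrightarrow> (D, D') \<in> (link E x)\<^sup>*"
proof
  assume "sheet_class E x D = sheet_class E x D'"
  then have "D' \<in> sheet_class E x D" by (simp add: sheet_class_def)
  then show "(D, D') \<in> (link E x)\<^sup>*" by (simp add: sheet_class_iff)
next
  assume "(D, D') \<in> (link E x)\<^sup>*"
  then show "sheet_class E x D = sheet_class E x D'"
    using link_sym link_trans unfolding sheet_class_def by blast
qed

lemma sheet_class_subset:
  assumes "D \<in> facets d S" "x \<in> D" shows "sheet_class E x D \<subseteq> {D' \<in> facets d S. x \<in> D'}"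
proof
  fix D' assume "D' \<in> sheet_class E x D"
  then have "(D, D') \<in> (link E x)\<^sup>*" by (simp add: sheet_class_iff)
  then show "D' \<in> {D' \<in> facets d S. x \<in> D'}"
    by (cases rule: rtranclE) (use assms in \<open>auto simp: link_def\<close>)
qed

text \<open>The new ridge adds the single edge between \<open>A\<close> and \<open>B\<close>, so it
  can only merge their two components. The three cases match the identification of points by
  \<open>h\<close>.\<close>

lemma link_insert_iff:
  assumes \<rho>: "\<rho> \<in> ridges" and A: "A \<in> facets d S" "\<rho> \<subseteq> A" and B: "B \<in> facets d S" "\<rho> \<subseteq> B" and "A \<noteq> B"
  shows "(D, D') \<in> (link (insert \<rho> E) x)\<^sup>* \<longleftrightarrow> (D, D') \<in> (link E x)\<^sup>* \<or>
     (x \<in> \<rho> \<and> (D, A) \<in> (link E x)\<^sup>* \<and> (D', B) \<in> (link E x)\<^sup>*) \<or>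
     (x \<in> \<rho> \<and> (D, B) \<in> (link E x)\<^sup>* \<and> (D', A) \<in> (link E x)\<^sup>*)" (is "?l \<longleftrightarrow> ?r D'")
proof
  assume ?l
  then show "?r D'"
  proof (induction rule: rtrancl_induct)
    case (step Y Z)
    obtain G where G: "Y \<in> facets d S" "Z \<in> facets d S" "G \<in> insert \<rho> E" "x \<in> G" "G \<subseteq> Y" "G \<subseteq> Z"
      by (rule linkE[OF step.hyps(2)])
    show ?case
    proof (cases "G = \<rho>")
      case False
      then have YZ: "(Y, Z) \<in> (link E x)\<^sup>*" using G by (intro r_into_rtrancl linkI[of _ _ G]) auto
      have "(Z, C) \<in> (link E x)\<^sup>*" if "(Y, C) \<in> (link E x)\<^sup>*" for C
        by (rule link_trans[OF link_sym[OF YZ] that])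
      moreover have "(D, Z) \<in> (link E x)\<^sup>*" if "(D, Y) \<in> (link E x)\<^sup>*" by (rule link_trans[OF that YZ])
      ultimately show ?thesis using step.IH by blast
    next
      case True
      have "Y = A \<or> Y = B" "Z = A \<or> Z = B"
        using two_facets_of_ridge[OF \<rho> A(1) B(1) _ A(2) B(2) _ \<open>A \<noteq> B\<close>] G True by blast+
      moreover have "(D, Y) \<in> (link E x)\<^sup>* \<or> (D, A) \<in> (link E x)\<^sup>* \<or> (D, B) \<in> (link E x)\<^sup>*"
        using step.IH by blast
      ultimately have "(D, A) \<in> (link E x)\<^sup>* \<or> (D, B) \<in> (link E x)\<^sup>*" "Z = A \<or> Z = B" by metis+
      then show ?thesis using True G(4) by blast
    qed
  qed simp
next
  assume r: "?r D'"
  have mono: "(P, Q) \<in> (link (insert \<rho> E) x)\<^sup>*" if "(P, Q) \<in> (link E x)\<^sup>*" for P Q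
    by (rule set_mp[OF rtrancl_mono that]) (auto simp: link_def)
  have AB: "(A, B) \<in> (link (insert \<rho> E) x)\<^sup>*" if "x \<in> \<rho>"
    by (rule r_into_rtrancl[OF linkI[OF A(1) B(1) insertI1 that A(2) B(2)]])
  from r show ?l
  proof (elim disjE conjE)
    assume "(D, D') \<in> (link E x)\<^sup>*" then show ?thesis by (rule mono)
  next
    assume a: "x \<in> \<rho>" "(D, A) \<in> (link E x)\<^sup>*" "(D', B) \<in> (link E x)\<^sup>*"
    show ?thesis by (rule link_trans[OF mono[OF a(2)] link_trans[OF AB[OF a(1)] link_sym[OF mono[OF a(3)]]]])
  next
    assume a: "x \<in> \<rho>" "(D, B) \<in> (link E x)\<^sup>*" "(D', A) \<in> (link E x)\<^sup>*"
    show ?thesis by (rule link_trans[OF mono[OF a(2)] link_trans[OF link_sym[OF AB[OF a(1)]] link_sym[OF mono[OF a(3)]]]])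
  qed
qed

text \<open>The only ridge through a relative interior point of \<open>\<rho>\<close> is
  \<open>\<rho>\<close> itself.\<close>

lemma not_linked_across:
  assumes E: "E \<subseteq> ridges" and \<rho>: "\<rho> \<in> ridges" "\<rho> \<notin> E" and x: "x \<in> rel_interior \<rho>" and "A \<noteq> B"
  shows "(A, B) \<notin> (link E x)\<^sup>*"
proof
  assume "(A, B) \<in> (link E x)\<^sup>*"
  then obtain Z where "(A, Z) \<in> link E x" using \<open>A \<noteq> B\<close> by (metis converse_rtranclE)
  then obtain G where G: "G \<in> E" "x \<in> G" by (rule linkE)
  have Gr: "G \<in> ridges" using G(1) E by blast
  have "\<rho> \<subseteq> G" by (rule rel_interior_meets[OF ridgeD(1)[OF \<rho>(1)] ridgeD(1)[OF Gr] x G(2)])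
  then have "\<rho> = G" using dim_eq[OF ridgeD(1)[OF \<rho>(1)] ridgeD(1)[OF Gr]] ridgeD(2)[OF \<rho>(1)] ridgeD(2)[OF Gr] by simp
  then show False using G(1) \<rho>(2) by simp
qed

text \<open>The facets and ridges around a face of codimension two form cycles, so removing one edge
  \<open>\<rho>\<close> does not disconnect its endpoints: otherwise counting incidences in the component of \<open>A\<close>
  in two ways gives an even number on the facet side and an odd one on the ridge side.\<close>

lemma linked_around_codim2:
  assumes F: "F \<in> S" "aff_dim F = int d - 2" "F \<subseteq> \<rho>" and \<rho>: "\<rho> \<in> ridges"
    and A: "A \<in> facets d S" "\<rho> \<subseteq> A" and B: "B \<in> facets d S" "\<rho> \<subseteq> B" and "A \<noteq> B"
    and E: "\<And>G. \<lbrakk>G \<in> ridges; F \<subseteq> G; G \<noteq> \<rho>\<rbrakk> \<Longrightarrow> G \<in> E" and x: "x \<in> F"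
  shows "(A, B) \<in> (link E x)\<^sup>*"
proof (rule ccontr)
  assume not: "(A, B) \<notin> (link E x)\<^sup>*"
  define Z where "Z = {D \<in> facets d S. F \<subseteq> D \<and> (A, D) \<in> (link E x)\<^sup>*}"
  define R where "R = {G \<in> ridges. F \<subseteq> G}"
  have fZ: "finite Z" using fin_facets by (simp add: Z_def)
  have fR: "finite R" using fin by (simp add: R_def faces_of_dim_def)
  have AZ: "A \<in> Z" "B \<notin> Z" using A F(3) not by (auto simp: Z_def)
  \<comment> \<open>The two facets at such a ridge are linked to each other, so both or neither
    belong to \<open>Z\<close>.\<close>
  have even: "even (card {D \<in> Z. G \<subseteq> D})" if "G \<in> R - {\<rho>}" for G
  proof (cases "\<exists>D\<in>Z. G \<subseteq> D")
    case True
    then obtain D where D: "D \<in> Z" "G \<subseteq> D" by blast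
    have G: "G \<in> ridges" "F \<subseteq> G" "G \<in> E" using that E by (auto simp: R_def)
    have "D' \<in> Z" if D': "D' \<in> facets d S" "G \<subseteq> D'" for D'
    proof -
      have "(D, D') \<in> link E x" using D D' G x by (intro linkI[of _ _ G]) (auto simp: Z_def)
      then have "(A, D') \<in> (link E x)\<^sup>*" using D(1) by (auto simp: Z_def)
      then show ?thesis using D' G(2) by (auto simp: Z_def)
    qed
    then have "{D \<in> Z. G \<subseteq> D} = {D \<in> facets d S. G \<subseteq> D}" by (auto simp: Z_def)
    then show ?thesis using two[OF G(1)] by simp
  next
    case False
    then have "{D \<in> Z. G \<subseteq> D} = {}" by blast
    then show ?thesis by (metis card.empty even_zero)
  qed
  have one: "{D \<in> Z. \<rho> \<subseteq> D} = {A}"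
  proof (intro equalityI subsetI)
    fix D assume "D \<in> {D \<in> Z. \<rho> \<subseteq> D}"
    then have D: "D \<in> Z" "D \<in> facets d S" "\<rho> \<subseteq> D" by (simp_all add: Z_def)
    have "D = A \<or> D = B" by (rule two_facets_of_ridge[OF \<rho> A(1) B(1) D(2) A(2) B(2) D(3) \<open>A \<noteq> B\<close>])
    then show "D \<in> {A}" using D(1) AZ(2) by blast
  qed (use AZ A in blast)
  have "(\<Sum>G\<in>R. card {D \<in> Z. G \<subseteq> D}) = (\<Sum>D\<in>Z. card {G \<in> R. G \<subseteq> D})"
    by (rule sum_multicount_gen[OF fR fZ]) simp
  also have "\<dots> = (\<Sum>D\<in>Z. 2)"
  proof (rule sum.cong[OF refl])
    fix D assume "D \<in> Z"
    then have "D \<in> facets d S" "F \<subseteq> D" by (simp_all add: Z_def)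
    then have "card {G \<in> ridges. F \<subseteq> G \<and> G \<subseteq> D} = 2" by (rule facet_ridges[OF F(1,2)])
    moreover have "{G \<in> R. G \<subseteq> D} = {G \<in> ridges. F \<subseteq> G \<and> G \<subseteq> D}" by (auto simp: R_def)
    ultimately show "card {G \<in> R. G \<subseteq> D} = 2" by simp
  qed
  finally have total: "even (\<Sum>G\<in>R. card {D \<in> Z. G \<subseteq> D})" by simp
  have "\<rho> \<in> R" using \<rho> F(3) by (simp add: R_def)
  then have "(\<Sum>G\<in>R. card {D \<in> Z. G \<subseteq> D}) = card {D \<in> Z. \<rho> \<subseteq> D} + (\<Sum>G\<in>R - {\<rho>}. card {D \<in> Z. G \<subseteq> D})"
    by (rule sum.remove[OF fR])
  moreover have "even (\<Sum>G\<in>R - {\<rho>}. card {D \<in> Z. G \<subseteq> D})" by (rule dvd_sum[OF even])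
  ultimately show False using total unfolding one by simp
qed

context
  fixes num :: "'a set set \<Rightarrow> nat" and v :: 'a
  assumes num: "inj_on num (Pow (facets d S))"
    and v: "\<And>x y. \<lbrakk>x \<in> \<Union>S; y \<in> \<Union>S\<rbrakk> \<Longrightarrow> norm (x - y) < norm v"
begin

text \<open>The sheets over \<open>x\<close> are numbered by multiples of a vector longer than the diameter; a point with
  a single sheet keeps its own name, so that the last complex of the construction is literally \<open>S\<close>.\<close>

definition label :: "'a set set \<Rightarrow> 'a \<Rightarrow> 'a set \<Rightarrow> nat" where
  "label E x D = (if sheet_class E x D = {D' \<in> facets d S. x \<in> D'} then 0 else Suc (num (sheet_class E x D)))"

definition name :: "'a set set \<Rightarrow> 'a set \<Rightarrow> 'a \<Rightarrow> 'a" where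
  "name E D x = x + real (label E x D) *\<^sub>R v"

text \<open>Two names differ by the difference of the places and an integer multiple of
  \<open>v\<close>. The former is shorter than \<open>v\<close>, so equal names have equal labels
  and equal places, and equal labels over one place mean the same sheet.\<close>

lemma name_eq_iff:
  assumes D: "D \<in> facets d S" "x \<in> D" and D': "D' \<in> facets d S" "y \<in> D'"
  shows "name E D x = name E D' y \<longleftrightarrow> x = y \<and> (D, D') \<in> (link E x)\<^sup>*"
proof
  assume eq: "name E D x = name E D' y"
  let ?l = "label E x D" and ?l' = "label E y D'"
  have "x - y = (real ?l' - real ?l) *\<^sub>R v" using eq by (simp add: name_def algebra_simps)
  then have n: "norm (x - y) = \<bar>real ?l' - real ?l\<bar> * norm v" by simp
  have less: "norm (x - y) < norm v" using v D D' facetD(1) by blast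
  have ll: "?l = ?l'"
  proof (rule ccontr)
    assume "?l \<noteq> ?l'"
    then have "1 \<le> \<bar>real ?l' - real ?l\<bar>" by linarith
    then have "norm v \<le> norm (x - y)" unfolding n using mult_right_mono[of 1 _ "norm v"] by simp
    then show False using less by simp
  qed
  then have xy: "x = y" using n by simp
  have "sheet_class E x D = sheet_class E x D'"
  proof -
    have "sheet_class E x D \<in> Pow (facets d S)" "sheet_class E x D' \<in> Pow (facets d S)"
      using sheet_class_subset[OF D] sheet_class_subset[OF D'] xy by blast+
    then show ?thesis using ll inj_onD[OF num] unfolding xy label_def by (auto split: if_splits)
  qed
  then show "x = y \<and> (D, D') \<in> (link E x)\<^sup>*" using xy by (simp add: sheet_class_eq_iff)
next
  assume a: "x = y \<and> (D, D') \<in> (link E x)\<^sup>*"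
  have "x = y" "sheet_class E x D = sheet_class E x D'" unfolding sheet_class_eq_iff using a by blast+
  then show "name E D x = name E D' y" by (simp add: name_def label_def)
qed

text \<open>A ridge that contains a relative interior point of \<open>F\<close> contains
  \<open>F\<close>, so facets linked at that point are linked at every point of
  \<open>F\<close>.\<close>

lemma facet_gluing_name:
  assumes "V \<subseteq> facets d S" "V \<noteq> {}" "E \<subseteq> ridges"
  shows "facet_gluing S d V (name E)"
proof (unfold_locales, rule assms(1), rule assms(2))
  fix D D' x y assume "D \<in> V" "D' \<in> V" "x \<in> D" "y \<in> D'" "name E D x = name E D' y"
  then show "x = y" using name_eq_iff[of D x D' y E] assms(1) by blast
next
  fix D D' F x y assume D: "D \<in> V" "D' \<in> V" and F: "F \<in> S" "F \<subseteq> D" "F \<subseteq> D'" "y \<in> rel_interior F"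
    and eq: "name E D y = name E D' y" and x: "x \<in> F"
  have Df: "D \<in> facets d S" "D' \<in> facets d S" using D assms(1) by blast+
  have y: "y \<in> F" using F(4) rel_interior_subset by blast
  have "(D, D') \<in> (link E y)\<^sup>*" using name_eq_iff[of D y D' y E] Df F y eq by blast
  moreover have "link E y \<subseteq> link E x"
  proof
    fix p assume p: "p \<in> link E y"
    obtain P Q where PQ: "p = (P, Q)" by (cases p)
    then obtain G where G: "P \<in> facets d S" "Q \<in> facets d S" "G \<in> E" "y \<in> G" "G \<subseteq> P" "G \<subseteq> Q"
      using linkE[of P Q E y] p by metis
    have "G \<in> S" using G(3) assms(3) ridgeD(1) by blast
    then have "F \<subseteq> G" by (rule rel_interior_meets[OF F(1) _ F(4) G(4)])
    then show "p \<in> link E x" unfolding PQ using G x by (intro linkI[of _ _ G]) auto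
  qed
  ultimately have "(D, D') \<in> (link E x)\<^sup>*" using rtrancl_mono by blast
  then show "name E D x = name E D' x" using name_eq_iff[of D x D' x E] Df F x by blast
qed

text \<open>The copies of \<open>\<rho>\<close> in its two facets differ, because over its relative
  interior they are not linked. They agree along \<open>F\<close>, since all other ridges around
  \<open>F\<close> have been glued.\<close>

lemma identify_names:
  assumes E: "E \<subseteq> ridges" and \<rho>: "\<rho> \<in> ridges" "\<rho> \<notin> E" and F: "F \<in> S" "aff_dim F = int d - 2" "F \<subseteq> \<rho>"
    and free: "\<And>G. \<lbrakk>G \<in> ridges; F \<subseteq> G; G \<noteq> \<rho>\<rbrakk> \<Longrightarrow> G \<in> E"
  shows "identify_facets d (glue_complex S (facets d S) (name E)) (glue_complex S (facets d S) (name (insert \<rho> E)))"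
proof -
  have "card {D \<in> facets d S. \<rho> \<subseteq> D} = 2" by (rule two[OF \<rho>(1)])
  then obtain A B where AB: "{D \<in> facets d S. \<rho> \<subseteq> D} = {A, B}" "A \<noteq> B" by (meson card_2_iff)
  have "A \<in> {D \<in> facets d S. \<rho> \<subseteq> D}" "B \<in> {D \<in> facets d S. \<rho> \<subseteq> D}" unfolding AB(1) by simp_all
  then have A: "A \<in> facets d S" "\<rho> \<subseteq> A" and B: "B \<in> facets d S" "\<rho> \<subseteq> B" by simp_all
  show ?thesis
  proof (rule glue_complex_identify[OF _ _ \<rho>(1) A B _ F(3)])
    show "facet_gluing S d (facets d S) (name E)" "facet_gluing S d (facets d S) (name (insert \<rho> E))"
      using E \<rho> facets_ne by (intro facet_gluing_name order_refl; simp)+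
    show "F \<in> faces_of_dim S (int d - 2)" using F by (simp add: faces_of_dim_def)
    show "name (insert \<rho> E) D x = name (insert \<rho> E) D' x \<longleftrightarrow> name E D x = name E D' x \<or>
        (x \<in> \<rho> \<and> name E D x = name E A x \<and> name E D' x = name E B x) \<or>
        (x \<in> \<rho> \<and> name E D x = name E B x \<and> name E D' x = name E A x)"
      if D: "D \<in> facets d S" "D' \<in> facets d S" "x \<in> D" "x \<in> D'" for D D' x
    proof -
      have n: "name E' P x = name E' Q x \<longleftrightarrow> (P, Q) \<in> (link E' x)\<^sup>*"
        if "P \<in> facets d S" "x \<in> P" "Q \<in> facets d S" "x \<in> Q" for E' P Q
        using name_eq_iff[OF that] by simp
      show ?thesis
      proof (cases "x \<in> \<rho>")
        case True
        then have "x \<in> A" "x \<in> B" using A B by blast+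
        show ?thesis
          unfolding n[OF D(1,3,2,4)] n[OF D(1,3) A(1) \<open>x \<in> A\<close>] n[OF D(1,3) B(1) \<open>x \<in> B\<close>]
            n[OF D(2,4) A(1) \<open>x \<in> A\<close>] n[OF D(2,4) B(1) \<open>x \<in> B\<close>]
          by (rule link_insert_iff[OF \<rho>(1) A B AB(2)])
      next
        case False
        then show ?thesis unfolding n[OF D(1,3,2,4)] using link_insert_iff[OF \<rho>(1) A B AB(2), of D D' E x] by simp
      qed
    qed
    have "\<rho> \<noteq> {}" using ridgeD(2)[OF \<rho>(1)] d2 by auto
    then obtain x where x: "x \<in> rel_interior \<rho>" using rel_interior_eq_empty[OF convexS[OF ridgeD(1)[OF \<rho>(1)]]] by blast
    then have "x \<in> \<rho>" using rel_interior_subset by blast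
    moreover have "name E A x \<noteq> name E B x"
      using not_linked_across[OF E \<rho> x AB(2)] name_eq_iff[OF A(1) _ B(1), of x x E] A(2) B(2) \<open>x \<in> \<rho>\<close> by blast
    ultimately show "\<exists>x\<in>\<rho>. name E A x \<noteq> name E B x" by (rule bexI[rotated])
    show "name E A x = name E B x" if "x \<in> F" for x
    proof -
      have "(A, B) \<in> (link E x)\<^sup>*" by (rule linked_around_codim2[OF F \<rho>(1) A B AB(2) free that])
      then show ?thesis using name_eq_iff[OF A(1) _ B(1), of x x E] A(2) B(2) F(3) that by blast
    qed
  qed
qed

text \<open>The new facet must meet the earlier ones in the ridge to its parent only. Over a point
  outside this ridge it is linked to its descendants only, and these have larger rank than the
  facets present.\<close>

lemma glue_names:
  assumes fs: "facet_seq \<Delta> n \<sigma> \<Sigma>" and i: "i < n"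
  defines "V \<equiv> \<lambda>m. insert \<Delta> (\<Sigma> ` {..<m})" and "E \<equiv> \<sigma> ` {..<n}"
  shows "glue_simplex d (glue_complex S (V i) (name E)) (glue_complex S (V (Suc i)) (name E))"
proof -
  note fsD = facet_seqD[OF fs]
  have \<Delta>: "\<Delta> \<in> facets d S" using fs by (simp add: facet_seq_def)
  have E: "E \<subseteq> ridges" using fsD(1) by (auto simp: E_def)
  have Vf: "V m \<subseteq> facets d S" if "m \<le> n" for m using that \<Delta> fsD(2) by (auto simp: V_def)
  have Vs: "V (Suc i) = insert (\<Sigma> i) (V i)" by (auto simp: V_def lessThan_Suc)
  have new: "\<Sigma> i \<notin> V i" using fsD(3,6)[OF i] by (simp add: V_def)
  obtain D0 where D0: "D0 \<in> facets d S" "D0 \<noteq> \<Sigma> i" "\<sigma> i \<subseteq> D0"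
    by (rule ridge_other[OF fsD(1,2,4)[OF i]])
  have "D0 = \<Delta> \<or> D0 \<in> \<Sigma> ` {..i}" by (rule fsD(7)[OF i D0(1,3)])
  then have D0V: "D0 \<in> V i" using D0(2) by (auto simp: V_def lessThan_Suc_atMost[symmetric] lessThan_Suc)
  \<comment> \<open>Pairs of a child and its parent: \<open>B\<close> is the facet on the other side
    of \<open>\<sigma> j\<close>.\<close>
  define par where "par = {(\<Sigma> j, B) |j B. j < n \<and> \<sigma> j \<subseteq> B \<and> B \<in> facets d S \<and> B \<noteq> \<Sigma> j}"
  have rank: "facet_rank \<Delta> n \<Sigma> (\<Sigma> i) \<le> facet_rank \<Delta> n \<Sigma> Z" if "(Z, \<Sigma> i) \<in> par\<^sup>*" for Z
    using that
  proof (induction rule: converse_rtrancl_induct)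
    case (step Y Z)
    then obtain j where "j < n" "Y = \<Sigma> j" "\<sigma> j \<subseteq> Z" "Z \<in> facets d S" "Z \<noteq> \<Sigma> j" by (auto simp: par_def)
    then show ?case using facet_seq_above[OF fs, of j Z] step.IH by auto
  qed simp
  \<comment> \<open>Away from \<open>\<sigma> i\<close> no link leads from \<open>\<Sigma> i\<close>
    to its parent; so every facet reached is a descendant.\<close>
  have desc: "(Z, \<Sigma> i) \<in> par\<^sup>*" if "(\<Sigma> i, Z) \<in> (link E x)\<^sup>*" "x \<notin> \<sigma> i" for x Z
    using that(1)
  proof (induction rule: rtrancl_induct)
    case (step Y Z)
    obtain G where G: "Y \<in> facets d S" "Z \<in> facets d S" "G \<in> E" "x \<in> G" "G \<subseteq> Y" "G \<subseteq> Z" by (rule linkE[OF step.hyps(2)])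
    then obtain j where j: "j < n" "G = \<sigma> j" by (auto simp: E_def)
    have "j \<noteq> i" using j G(4) that(2) by blast
    then have ji: "\<Sigma> j \<noteq> \<Sigma> i" using inj_onD[OF facet_seq_inj(1)[OF fs], of j i] j(1) i by auto
    show ?case
    proof (cases "Y = Z")
      case False
      have two: "\<Sigma> j = Y \<or> \<Sigma> j = Z"
        by (rule two_facets_of_ridge[OF fsD(1)[OF j(1)] G(1,2) fsD(2)[OF j(1)] _ _ fsD(4)[OF j(1)] False]) (use G j in simp_all)
      show ?thesis
      proof (cases "\<Sigma> j = Z")
        case True
        then have "(Z, Y) \<in> par" using j G False unfolding par_def by blast
        then show ?thesis using step.IH by (rule converse_rtrancl_into_rtrancl)
      next
        case nZ: False
        \<comment> \<open>The link goes up from \<open>Y\<close> to its parent \<open>Z\<close>. The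
          chain of parents from \<open>Y\<close> to \<open>\<Sigma> i\<close> starts with the same
          \<open>Z\<close>; dropping its first pair gives the chain for \<open>Z\<close>.\<close>
        then have Y: "Y = \<Sigma> j" using two by simp
        from step.IH show ?thesis
        proof (cases rule: converse_rtranclE)
          case base
          then show ?thesis using ji Y by simp
        next
          case (step B)
          then obtain j' where j': "j' < n" "Y = \<Sigma> j'" "\<sigma> j' \<subseteq> B" "B \<in> facets d S" "B \<noteq> \<Sigma> j'" by (auto simp: par_def)
          have "j' = j" using inj_onD[OF facet_seq_inj(1)[OF fs], of j' j] j(1) j'(1,2) Y by auto
          then have "B = Y \<or> B = Z"
            using two_facets_of_ridge[OF fsD(1)[OF j(1)] G(1,2) j'(4) _ _ _ False] G(5,6) j(2) j'(3) by blast
          then have "B = Z" using j'(2,5) by simp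
          then show ?thesis using step(2) by simp
        qed
      qed
    qed (use step.IH in simp)
  qed simp
  have VfS: "\<Sigma> i \<in> facets d S" by (rule fsD(2)[OF i])
  show ?thesis
    unfolding Vs
  proof (rule glue_complex_glue[OF _ _ new fsD(1,4)[OF i] D0V D0(3)])
    show "facet_gluing S d (V i) (name E)" using Vf[of i] i E by (intro facet_gluing_name) (auto simp: V_def)
    show "facet_gluing S d (insert (\<Sigma> i) (V i)) (name E)"
      using Vf[of "Suc i"] i E unfolding Vs by (intro facet_gluing_name) auto
    show "name E (\<Sigma> i) x = name E D0 x" if "x \<in> \<sigma> i" for x
    proof -
      have "(\<Sigma> i, D0) \<in> link E x"
        by (rule linkI[OF VfS D0(1) _ that fsD(4)[OF i] D0(3)]) (use i in \<open>simp add: E_def\<close>)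
      then show ?thesis using name_eq_iff[OF VfS _ D0(1), of x x E] that fsD(4)[OF i] D0(3) by blast
    qed
    show "x \<in> \<sigma> i" if D': "D' \<in> V i" and x: "x \<in> \<Sigma> i" "x \<in> D'" and eq: "name E (\<Sigma> i) x = name E D' x" for D' x
    proof (rule ccontr)
      assume "x \<notin> \<sigma> i"
      have D'f: "D' \<in> facets d S" using D' Vf[of i] i by auto
      have "(\<Sigma> i, D') \<in> (link E x)\<^sup>*" using name_eq_iff[OF VfS x(1) D'f x(2), of E] eq by simp
      then have "facet_rank \<Delta> n \<Sigma> (\<Sigma> i) \<le> facet_rank \<Delta> n \<Sigma> D'" by (rule rank[OF desc[OF _ \<open>x \<notin> \<sigma> i\<close>]])
      moreover have "facet_rank \<Delta> n \<Sigma> D' \<le> i" using D' i facet_rank[OF fs] by (auto simp: V_def)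
      ultimately show False using facet_rank(2)[OF fs i] by simp
    qed
  qed
qed

text \<open>The arcs of the tree given by the first collapses are glued first, in the order of these
  collapses; then the remaining ridges are glued in the order in which they collapse.\<close>

lemma collapse_imp_LC:
  assumes fs: "facet_seq \<Delta> n \<sigma> \<Sigma>"
    and cs: "collapse_seq (int d - 1) (S - {\<Delta>} - \<sigma> ` {..<n} - \<Sigma> ` {..<n}) m \<phi> \<rho>"
    and all: "ridges \<subseteq> \<sigma> ` {..<n} \<union> \<rho> ` {..<m}"
    and linked: "\<And>x A. \<lbrakk>x \<in> \<Union>S; A \<subseteq> {D \<in> facets d S. x \<in> D}; A \<noteq> {}; A \<noteq> {D \<in> facets d S. x \<in> D}\<rbrakk> \<Longrightarrow>
        \<exists>D\<in>A. \<exists>E\<in>{D \<in> facets d S. x \<in> D} - A. \<exists>G\<in>ridges. x \<in> G \<and> G \<subseteq> D \<and> G \<subseteq> E"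
  shows "LC d S"
proof -
  note fsD = facet_seqD[OF fs]
  have \<Delta>: "\<Delta> \<in> facets d S" and \<Sigma>: "\<Sigma> ` {..<n} = facets d S - {\<Delta>}" using fs by (simp_all add: facet_seq_def)
  define C where "C = S - {\<Delta>} - \<sigma> ` {..<n} - \<Sigma> ` {..<n}"
  define V where "V k = insert \<Delta> (\<Sigma> ` {..<k})" for k
  define E where "E k = \<sigma> ` {..<n} \<union> \<rho> ` {..<k}" for k
  \<comment> \<open>\<open>T 1\<close> has the one facet \<open>\<Delta>\<close>, and
    \<open>T (Suc n)\<close> has all facets, where both descriptions agree. From there each step
    glues one more ridge, and \<open>E 0\<close> consists of the ridges of the tree.\<close>
  define T where "T k = (if k \<le> Suc n then glue_complex S (V (k - 1)) (name (E 0))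
      else glue_complex S (facets d S) (name (E (k - Suc n))))" for k
  have Vn: "V n = facets d S" using \<Delta> \<Sigma> by (auto simp: V_def)
  have Tlate: "T (Suc n + k) = glue_complex S (facets d S) (name (E k))" for k
    by (cases "k = 0") (simp_all add: T_def Vn)
  have csD: "\<phi> k \<in> C" "\<rho> k \<in> C" "aff_dim (\<rho> k) = int d - 1" "aff_dim (\<phi> k) = int d - 2" "\<phi> k \<subseteq> \<rho> k"
      "\<rho> k \<notin> \<rho> ` {..<k}" "\<forall>G\<in>C. \<phi> k \<subseteq> G \<longrightarrow> G = \<phi> k \<or> G \<in> \<rho> ` {..k}" if "k < m" for k
    using cs that unfolding collapse_seq_def C_def[symmetric] by auto
  have CS: "C \<subseteq> S" by (auto simp: C_def)
  have \<rho>r: "\<rho> k \<in> ridges" if "k < m" for k using csD(2,3)[OF that] CS by (auto simp: faces_of_dim_def)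
  have Er: "E k \<subseteq> ridges" if "k \<le> m" for k using that fsD(1) \<rho>r by (auto simp: E_def)
  have Vf: "V k \<subseteq> facets d S" "V k \<noteq> {}" if "k \<le> n" for k using that \<Delta> fsD(2) by (auto simp: V_def)
  have cardN: "card (facets d S) = Suc n"
  proof -
    have "card (\<Sigma> ` {..<n}) = n" using card_image[OF facet_seq_inj(1)[OF fs]] by simp
    moreover have "facets d S = insert \<Delta> (\<Sigma> ` {..<n})" using \<Delta> \<Sigma> by blast
    moreover have "\<Delta> \<notin> \<Sigma> ` {..<n}" using \<Sigma> by blast
    ultimately show ?thesis by simp
  qed
  have pmT: "pseudomanifold d (T k)" if k: "k \<in> {1..Suc n + m}" for k
  proof (cases "k \<le> Suc n")
    case True
    have "facet_gluing S d (V (k - 1)) (name (E 0))"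
      using True by (intro facet_gluing_name Vf Er) auto
    then show ?thesis using facet_gluing.pseudomanifold True by (simp add: T_def)
  next
    case False
    have "facet_gluing S d (facets d S) (name (E (k - Suc n)))"
      using k by (intro facet_gluing_name Er facets_ne order_refl) auto
    then show ?thesis using facet_gluing.pseudomanifold False by (simp add: T_def)
  qed
  have T1: "is_single_simplex d (T 1)"
  proof -
    have "facet_gluing S d {\<Delta>} (name (E 0))" using \<Delta> by (intro facet_gluing_name Er) auto
    then show ?thesis using single_facet_simplex by (simp add: T_def V_def)
  qed
  have glue: "glue_simplex d (T k) (T (Suc k))" if "k \<in> {1..<Suc n}" for k
  proof -
    define k' where "k' = k - 1"
    have k': "k = Suc k'" "k' < n" using that by (auto simp: k'_def)
    show ?thesis using glue_names[OF fs k'(2)] k' by (simp add: T_def V_def E_def)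
  qed
  have ident: "identify_facets d (T k) (T (Suc k))" if "k \<in> {Suc n..<Suc n + m}" for k
  proof -
    define k' where "k' = k - Suc n"
    have k': "k = Suc n + k'" "k' < m" using that by (auto simp: k'_def)
    have Es: "E (Suc k') = insert (\<rho> k') (E k')" by (auto simp: E_def lessThan_Suc)
    have "identify_facets d (glue_complex S (facets d S) (name (E k'))) (glue_complex S (facets d S) (name (E (Suc k'))))"
      unfolding Es
    proof (rule identify_names[OF _ \<rho>r[OF k'(2)]])
      show "E k' \<subseteq> ridges" using Er k'(2) by simp
      show "\<rho> k' \<notin> E k'" using csD(2,6)[OF k'(2)] by (auto simp: E_def C_def)
      show "\<phi> k' \<in> S" using csD(1)[OF k'(2)] CS by blast
      show "aff_dim (\<phi> k') = int d - 2" "\<phi> k' \<subseteq> \<rho> k'" by (rule csD(4,5)[OF k'(2)])+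
      fix G assume G: "G \<in> ridges" "\<phi> k' \<subseteq> G" "G \<noteq> \<rho> k'"
      show "G \<in> E k'"
      proof (cases "G \<in> \<sigma> ` {..<n}")
        case False
        have "G \<notin> facets d S" using ridgeD(2)[OF G(1)] facetD(2)[of G] by auto
        then have "G \<in> C" using False ridgeD(1)[OF G(1)] \<Delta> \<Sigma> unfolding C_def by blast
        then have "G = \<phi> k' \<or> G \<in> \<rho> ` {..k'}" using csD(7)[OF k'(2)] G(2) by blast
        moreover have "G \<noteq> \<phi> k'" using ridgeD(2)[OF G(1)] csD(4)[OF k'(2)] by auto
        ultimately obtain l where "G = \<rho> l" "l \<le> k'" by auto
        then show ?thesis using G(3) by (cases "l = k'") (auto simp: E_def)
      qed (simp add: E_def)
    qed
    then show ?thesis using Tlate[of k'] Tlate[of "Suc k'"] k'(1) by simp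
  qed
  have Em: "E m = ridges" using all Er[of m] by (auto simp: E_def)
  \<comment> \<open>By \<open>linked\<close> the facets at \<open>x\<close> form a single sheet, so
    its label is 0 and the name of \<open>x\<close> is \<open>x\<close>.\<close>
  have end_name: "name ridges D x = x" if D: "D \<in> facets d S" "x \<in> D" for D x
  proof -
    have xS: "x \<in> \<Union>S" using D facetD(1) by blast
    have "sheet_class ridges x D = {D' \<in> facets d S. x \<in> D'}"
    proof (rule ccontr)
      assume ne: "sheet_class ridges x D \<noteq> {D' \<in> facets d S. x \<in> D'}"
      have "sheet_class ridges x D \<noteq> {}" using sheet_class_iff[of D ridges x D] by auto
      from linked[OF xS sheet_class_subset[OF D] this ne] obtain A B G where
        AB: "A \<in> sheet_class ridges x D" "B \<in> {D \<in> facets d S. x \<in> D} - sheet_class ridges x D" "G \<in> ridges" "x \<in> G" "G \<subseteq> A" "G \<subseteq> B"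
        by (elim bexE conjE)
      have "A \<in> facets d S" "B \<in> facets d S" using AB(1,2) sheet_class_subset[OF D] by blast+
      then have "(A, B) \<in> link ridges x" by (rule linkI[OF _ _ AB(3-6)])
      then have "B \<in> sheet_class ridges x D" using AB(1) by (auto simp: sheet_class_iff)
      then show False using AB(2) by simp
    qed
    then show ?thesis by (simp add: name_def label_def)
  qed
  have "T (Suc n + m) = (top_of_set (\<Union>S), S - {{}})"
    unfolding Tlate Em by (rule glue_complex_all[OF facet_gluing_name[OF order_refl facets_ne order_refl] end_name])
  then show ?thesis
    unfolding LC_def Let_def cardN using pmT T1 glue ident
    by (intro exI[of _ T] exI[of _ "Suc n + m"] conjI ballI) auto
qed

end

end

sublocale sphere_complex \<subseteq> pm_complex S d
proof
  show "2 \<le> d" by (rule d2)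
  show "card {D \<in> facets d S. G \<subseteq> D} = 2" if "G \<in> faces_of_dim S (int d - 1)" for G
    by (rule ridge_two_facets[OF that])
  show "\<exists>D\<in>facets d S. F \<subseteq> D" if "F \<in> S" for F by (rule face_in_facet[OF that])
  show "facets d S \<noteq> {}" using S_nonempty face_in_facet by blast
qed

context sphere_complex
begin

lemma collapse_contractible:
  assumes "\<Delta> \<in> facets d S" "collapses_onto (S - {\<Delta>}) C"
  shows "contractible (\<Union>C)"
proof (rule collapses_onto_contractible[OF assms(2) _ _ remove_facet_contractible[OF assms(1)]])
  show "G \<in> S - {\<Delta>}" if "F \<in> S - {\<Delta>}" "G \<in> S" "G \<subseteq> F" for F G
    using subcomplexD(1)[OF subcomplex_remove_facet[OF assms(1)] that] .
qed blast

lemma cotree_collapse: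
  assumes "spanning_tree (facets d S) (dual_arcs d S) T" "\<Delta> \<in> facets d S"
    "collapses_onto (cotree_complex d S T) C"
  shows "collapses_onto (S - {\<Delta>}) C"
  by (rule collapses_onto_trans[OF collapses_onto_cotree[OF assms(1,2)] assms(3)])

text \<open>The collapse is sorted twice: the pairs of dimension \<open>d\<close> give the tree, and
  those of dimension \<open>d - 1\<close> give the order of the identifications. They reach every
  ridge because \<open>C\<close> contains none.\<close>

lemma LC_if_collapse:
  assumes \<Delta>: "\<Delta> \<in> facets d S" and C: "collapses_onto (S - {\<Delta>}) C" "has_dim C (int d - 2)"
  shows "LC d S"
proof -
  obtain n \<sigma> \<Sigma> where fs: "facet_seq \<Delta> n \<sigma> \<Sigma>" and col: "collapses_onto (S - {\<Delta>} - \<sigma> ` {..<n} - \<Sigma> ` {..<n}) C"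
    by (rule collapse_facet_seq[OF assms])
  let ?C = "S - {\<Delta>} - \<sigma> ` {..<n} - \<Sigma> ` {..<n}"
  have \<Sigma>: "\<Sigma> ` {..<n} = facets d S - {\<Delta>}" using fs by (simp add: facet_seq_def)
  have dimC: "aff_dim F \<le> int d - 1" if F: "F \<in> ?C" for F
  proof -
    have "F \<in> S" "F \<notin> facets d S" using F \<Sigma> by auto
    then show ?thesis using dim_le[of F] by (simp add: faces_of_dim_def)
  qed
  obtain C' where C': "(collapse_dim (int d - 1))\<^sup>*\<^sup>* ?C C'" "\<And>F. F \<in> C' \<Longrightarrow> aff_dim F < int d - 1"
  proof (rule collapse_sort[OF col _ dimC])
    show "aff_dim F < int d - 1" if "F \<in> C" for F using that C(2) unfolding has_dim_def by force
  qed (blast, assumption, rule that)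
  obtain m \<phi> \<rho> where cs: "collapse_seq (int d - 1) ?C m \<phi> \<rho>" "C' = ?C - \<phi> ` {..<m} - \<rho> ` {..<m}"
    by (rule collapse_dim_collapse_seq[OF C'(1)]) blast
  have all: "ridges \<subseteq> \<sigma> ` {..<n} \<union> \<rho> ` {..<m}"
  proof
    fix G assume G: "G \<in> ridges"
    show "G \<in> \<sigma> ` {..<n} \<union> \<rho> ` {..<m}"
    proof (rule ccontr)
      assume not: "G \<notin> \<sigma> ` {..<n} \<union> \<rho> ` {..<m}"
      have "G \<notin> facets d S" using ridgeD(2)[OF G] facetD(2)[of G] by auto
      then have "G \<in> ?C" using not ridgeD(1)[OF G] \<Delta> \<Sigma> by blast
      moreover have "aff_dim (\<phi> k) \<noteq> aff_dim G" if "k < m" for k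
        using that cs(1) ridgeD(2)[OF G] unfolding collapse_seq_def by simp
      then have "G \<notin> \<phi> ` {..<m}" by auto
      ultimately have "G \<in> C'" using not cs(2) by blast
      then show False using C'(2)[of G] ridgeD(2)[OF G] by simp
    qed
  qed
  obtain num :: "'a set set \<Rightarrow> nat" where num: "inj_on num (Pow (facets d S))"
    using finite_imp_inj_to_nat_seg[of "Pow (facets d S)"] fin_facets by (metis finite_Pow_iff)
  \<comment> \<open>The translates used as names need a vector longer than the diameter of the
    sphere; adding 1 makes the inequality strict.\<close>
  obtain e where "0 < e" "\<And>x y. \<lbrakk>x \<in> \<Union>S; y \<in> \<Union>S\<rbrakk> \<Longrightarrow> dist x y < e"
  proof -
    have "bounded (\<Union>S)" using compact_U by (rule compact_imp_bounded)
    then obtain c where c: "\<And>x y. \<lbrakk>x \<in> \<Union>S; y \<in> \<Union>S\<rbrakk> \<Longrightarrow> dist x y \<le> c"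
      unfolding bounded_two_points by blast
    show thesis
    proof (rule that[of "max c 0 + 1"])
      show "dist x y < max c 0 + 1" if "x \<in> \<Union>S" "y \<in> \<Union>S" for x y using c[OF that] by simp
    qed simp
  qed
  moreover obtain v :: 'a where "norm v = e" using vector_choose_size[of e] \<open>0 < e\<close> by auto
  ultimately have v: "norm (x - y) < norm v" if "x \<in> \<Union>S" "y \<in> \<Union>S" for x y
    using that by (simp add: dist_norm)
  show ?thesis by (rule collapse_imp_LC[OF num v fs cs(1) all facets_linked])
qed

end

theorem theorem2p10:
  fixes S :: "'a::euclidean_space set set" and d :: nat
  assumes "d \<ge> 3" and "simplicial_sphere d S"
  shows
   "(LC d S \<longleftrightarrow>
       (\<exists>T C. spanning_tree (facets d S) (dual_arcs d S) T \<and>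
          has_dim C (int d - 2) \<and> contractible (\<Union>C) \<and>
          collapses_onto (cotree_complex d S T) C)) \<and>
    (LC d S \<longleftrightarrow>
       (\<exists>C. has_dim C (int d - 2) \<and> contractible (\<Union>C) \<and>
          (\<forall>\<Delta>\<in>facets d S. collapses_onto (S - {\<Delta>}) C))) \<and>
    (LC d S \<longleftrightarrow>
       (\<exists>\<Delta>\<in>facets d S. \<exists>C. has_dim C (int d - 2) \<and> contractible (\<Union>C) \<and>
          collapses_onto (S - {\<Delta>}) C)) \<and>
    \<comment> \<open>contractibility of \<open>C\<close> is automatic in the second and third condition\<close>
    (\<forall>T C. spanning_tree (facets d S) (dual_arcs d S) T \<and> has_dim C (int d - 2) \<and>
        collapses_onto (cotree_complex d S T) C \<longrightarrow> contractible (\<Union>C)) \<and>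
    (\<forall>\<Delta>\<in>facets d S. \<forall>C. has_dim C (int d - 2) \<and>
        collapses_onto (S - {\<Delta>}) C \<longrightarrow> contractible (\<Union>C))"
proof -
  interpret sphere_complex S d
    using assms by unfold_locales (simp_all add: simplicial_sphere_def)
  obtain \<Delta>0 where \<Delta>0: "\<Delta>0 \<in> facets d S" using facets_ne by blast
  let ?tree = "\<lambda>T. spanning_tree (facets d S) (dual_arcs d S) T"
  have cotree_contractible: "contractible (\<Union>C)"
    if "?tree T" "collapses_onto (cotree_complex d S T) C" for T C
    by (rule collapse_contractible[OF \<Delta>0 cotree_collapse[OF that(1) \<Delta>0 that(2)]])
  have P2_P3: "\<exists>C. has_dim C (int d - 2) \<and> contractible (\<Union>C) \<and> (\<forall>\<Delta>\<in>facets d S. collapses_onto (S - {\<Delta>}) C)"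
    if "\<exists>T C. ?tree T \<and> has_dim C (int d - 2) \<and> contractible (\<Union>C) \<and> collapses_onto (cotree_complex d S T) C"
    using that cotree_collapse by meson
  have P3_P4: "\<exists>\<Delta>\<in>facets d S. \<exists>C. has_dim C (int d - 2) \<and> contractible (\<Union>C) \<and> collapses_onto (S - {\<Delta>}) C"
    if "\<exists>C. has_dim C (int d - 2) \<and> contractible (\<Union>C) \<and> (\<forall>\<Delta>\<in>facets d S. collapses_onto (S - {\<Delta>}) C)"
    using that \<Delta>0 by meson
  have P4_P2: "\<exists>T C. ?tree T \<and> has_dim C (int d - 2) \<and> contractible (\<Union>C) \<and> collapses_onto (cotree_complex d S T) C"
    if "\<exists>\<Delta>\<in>facets d S. \<exists>C. has_dim C (int d - 2) \<and> contractible (\<Union>C) \<and> collapses_onto (S - {\<Delta>}) C"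
  proof -
    from that obtain \<Delta> C where C: "\<Delta> \<in> facets d S" "has_dim C (int d - 2)" "contractible (\<Union>C)"
      "collapses_onto (S - {\<Delta>}) C" by (elim bexE exE conjE)
    obtain T where "?tree T" "collapses_onto (cotree_complex d S T) C"
      by (rule collapse_spanning_tree[OF C(1,4,2)])
    then show ?thesis using C(2,3) by (intro exI conjI)
  qed
  have P4_LC: "LC d S"
    if "\<exists>\<Delta>\<in>facets d S. \<exists>C. has_dim C (int d - 2) \<and> contractible (\<Union>C) \<and> collapses_onto (S - {\<Delta>}) C"
    using that LC_if_collapse by meson
  have LC_P4: "\<exists>\<Delta>\<in>facets d S. \<exists>C. has_dim C (int d - 2) \<and> contractible (\<Union>C) \<and> collapses_onto (S - {\<Delta>}) C"
    if "LC d S"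
    using LC_imp_collapse[OF that] collapse_contractible by meson
  show ?thesis
  proof (intro conjI)
    show "\<forall>T C. ?tree T \<and> has_dim C (int d - 2) \<and> collapses_onto (cotree_complex d S T) C \<longrightarrow> contractible (\<Union>C)"
      using cotree_contractible by meson
    show "\<forall>\<Delta>\<in>facets d S. \<forall>C. has_dim C (int d - 2) \<and> collapses_onto (S - {\<Delta>}) C \<longrightarrow> contractible (\<Union>C)"
      using collapse_contractible by meson
  qed (iprover intro: P2_P3 P3_P4 P4_P2 P4_LC LC_P4)+
qed

end
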